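(* Let $k$ be a field, let $q\in k^\times$ be not a root of unity, and let $d$ be a positive integer. Then the category $\widetilde{\mathcal P^d_q}$ is not finitely generated. In particular, $\widetilde{\mathcal P^d_q}$ is not equivalent to $\mathcal P^d_{q,e}$ for any $e$.
   Context: $\mathcal B_d$ is the Artin braid group with generators $T_1,\dots,T_{d-1}$ (trivial for $d\le 1$). $\mathcal V$ is the category of finite dimensional $k$-vector spaces. $V_n$ is the $n$-dimensional space with basis $v_1,\dots,v_n$, and $R_n\in\mathrm{End}(V_n\otimes V_n)$ is given by $R_n(v_i\otimes v_j)=v_j\otimes v_i$ if $i<j$, $=q\,v_i\otimes v_i$ if $i=j$, $=(q-q^{-1})v_i\otimes v_j+v_j\otimes v_i$ if $i>j$. Write $R_n(v_i\otimes v_j)=\sum_{s,t}(R_n)^{st}_{ij}v_s\otimes v_t$. $A_q(n,n)$ is the algebra generated by $x_{ij}$ ($1\le i,j\le n$) with relations $\sum_{s,t}(R_n)^{ab}_{st}x_{si}x_{tj}=\sum_{s,t}(R_n)^{st}_{ij}x_{as}x_{bt}$; it is a bialgebra graded by $\deg x_{ij}=1$, with $\Delta(x_{ij})=\sum_s x_{is}\otimes x_{sj}$, $\epsilon(x_{ij})=\delta_{ij}$, and $V_n$ is a right comodule via $v_i\mapsto\sum_j v_j\otimes x_{ji}$. $A_q(n,n)_e$ denotes its degree $e$ part. The category of finite dimensional right $A_q(n,n)$-comodules is braided monoidal; its braiding $R_{V,W}:V\otimes W\to W\otimes V$ is natural in comodule maps, satisfies $R_{V\otimes W,U}=(R_{V,U}\otimes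 1)(1\otimes R_{W,U})$ and $R_{V,W\otimes U}=(1\otimes R_{V,U})(R_{V,W}\otimes 1)$, and $R_{V_n,V_n}=R_n$. Put $R_V:=R_{V,V}$. $T_i\in\mathcal B_d$ acts on $V^{\otimes d}$ by $R_V$ in tensor positions $i,i+1$. An $e$-Hecke pair ($e\ge 0$) is a finite dimensional right $A_q(n,n)$-comodule $V$, for some $n\ge1$, whose coaction has image in $V\otimes A_q(n,n)_e$. $\Gamma^d_{q,e}\mathcal V$ is the category whose objects are all $e$-Hecke pairs (all $n\ge 1$), with $\mathrm{Hom}(V,W)=\mathrm{Hom}_{\mathcal B_d}(V^{\otimes d},W^{\otimes d})$; $\mathcal P^d_{q,e}$ is the category of $k$-linear functors $\Gamma^d_{q,e}\mathcal V\to\mathcal V$, with natural transformations as morphisms. $\Gamma^d_q\mathcal V$ is the category whose objects are formal finite direct sums $\bigoplus_i V_i$, where each $V_i$ is an $e_i$-Hecke pair for some $e_i$, with $\mathrm{Hom}(V_i,W_j)=\mathrm{Hom}_{\mathcal B_d}(V_i^{\otimes d},W_j^{\otimes d})$ for homogeneous objects and $\mathrm{Hom}(\bigoplus_iV_i,\bigoplus_jW_j)=\bigoplus_{i,j}\mathrm{Hom}(V_i,W_j)$. $\widetilde{\mathcal P^d_q}$ is the category of $k$-linear functors $\Gamma^d_q\mathcal V\to\Gamma^1_q\mathcal V$ with natural transformations as morphisms; here $\Gamma^1_q\mathcal V$ is equivalent to $\mathcal V$. Such a functor category is finitely generated if there is an object $W$ of the domain category such that for every functor $F$ in it and every object $U$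 of the domain, the map $\mathrm{Hom}(W,U)\otimes F(W)\to F(U)$, $f\otimes v\mapsto F(f)(v)$, is surjective.
   Formalization: The formal theorem assumes d ≥ 2 instead of d ≥ 1: for d = 1 the braid group is trivial, all linear maps are morphisms, any one-dimensional object generates, and both functor categories are equivalent to the category of finite dimensional vector spaces, so both claims fail. *)

theory Defs
  imports
    "HOL-Library.Poly_Mapping"
    "HOL-Library.Product_Plus"
    "HOL-Library.FuncSet"
    "Jordan_Normal_Form.Matrix"
    "HOL-Algebra.QuotRing"
begin

section \<open>Categories, linear categories, functor categories\<close>

text \<open>Morphisms carry no source and target (a matrix, say, is a morphism between many pairs of
  objects), so identities, composition and the action of functors take the objects as arguments:
  \<open>Cmp C X Y Z g f\<close> is the composite of \<open>f : X \<rightarrow> Y\<close> and \<open>g : Y \<rightarrow> Z\<close>.\<close>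

record ('o, 'm) cat =
  Ob :: "'o set"
  Mor :: "'o \<Rightarrow> 'o \<Rightarrow> 'm set"
  Idm :: "'o \<Rightarrow> 'm"
  Cmp :: "'o \<Rightarrow> 'o \<Rightarrow> 'o \<Rightarrow> 'm \<Rightarrow> 'm \<Rightarrow> 'm"

record ('o, 'm, 'k) lin_cat = "('o, 'm) cat" +
  Add :: "'m \<Rightarrow> 'm \<Rightarrow> 'm"
  Smul :: "'k \<Rightarrow> 'm \<Rightarrow> 'm"

record ('o, 'm, 'p, 'n) fctr =
  FOb :: "'o \<Rightarrow> 'p"
  FMor :: "'o \<Rightarrow> 'o \<Rightarrow> 'm \<Rightarrow> 'n"

definition is_functor ::
  "('o, 'm, 'x) cat_scheme \<Rightarrow> ('p, 'n, 'y) cat_scheme \<Rightarrow> ('o, 'm, 'p, 'n) fctr \<Rightarrow> bool" where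
  "is_functor C D F \<longleftrightarrow>
     (\<forall>X\<in>Ob C. FOb F X \<in> Ob D) \<and>
     (\<forall>X\<in>Ob C. \<forall>Y\<in>Ob C. \<forall>f\<in>Mor C X Y. FMor F X Y f \<in> Mor D (FOb F X) (FOb F Y)) \<and>
     (\<forall>X\<in>Ob C. FMor F X X (Idm C X) = Idm D (FOb F X)) \<and>
     (\<forall>X\<in>Ob C. \<forall>Y\<in>Ob C. \<forall>Z\<in>Ob C. \<forall>f\<in>Mor C X Y. \<forall>g\<in>Mor C Y Z.
        FMor F X Z (Cmp C X Y Z g f)
        = Cmp D (FOb F X) (FOb F Y) (FOb F Z) (FMor F Y Z g) (FMor F X Y f))"

definition is_linear_functor ::
  "('o, 'm, 'k, 'x) lin_cat_scheme \<Rightarrow> ('p, 'n, 'k, 'y) lin_cat_scheme \<Rightarrow>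
   ('o, 'm, 'p, 'n) fctr \<Rightarrow> bool" where
  "is_linear_functor C D F \<longleftrightarrow> is_functor C D F \<and>
     (\<forall>X\<in>Ob C. \<forall>Y\<in>Ob C. \<forall>f\<in>Mor C X Y. \<forall>g\<in>Mor C X Y.
        FMor F X Y (Add C f g) = Add D (FMor F X Y f) (FMor F X Y g)) \<and>
     (\<forall>X\<in>Ob C. \<forall>Y\<in>Ob C. \<forall>f\<in>Mor C X Y. \<forall>a.
        FMor F X Y (Smul C a f) = Smul D a (FMor F X Y f))"

text \<open>Functors and transformations that are objects and morphisms of a functor category take the
  value \<^term>\<open>undefined\<close> outside their domain, so that equality of these HOL functions is
  equality of functors and of transformations.\<close>

definition extensional_functor :: "('o, 'm, 'x) cat_scheme \<Rightarrow> ('o, 'm, 'p, 'n) fctr \<Rightarrow> bool" where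
  "extensional_functor C F \<longleftrightarrow> FOb F \<in> extensional (Ob C) \<and>
     (\<forall>X Y f. \<not> (X \<in> Ob C \<and> Y \<in> Ob C \<and> f \<in> Mor C X Y) \<longrightarrow> FMor F X Y f = undefined)"

definition nat_trans ::
  "('o, 'm, 'x) cat_scheme \<Rightarrow> ('p, 'n, 'y) cat_scheme \<Rightarrow>
   ('o, 'm, 'p, 'n) fctr \<Rightarrow> ('o, 'm, 'p, 'n) fctr \<Rightarrow> ('o \<Rightarrow> 'n) \<Rightarrow> bool" where
  "nat_trans C D F G \<eta> \<longleftrightarrow>
     (\<forall>X\<in>Ob C. \<eta> X \<in> Mor D (FOb F X) (FOb G X)) \<and>
     (\<forall>X\<in>Ob C. \<forall>Y\<in>Ob C. \<forall>f\<in>Mor C X Y.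
        Cmp D (FOb F X) (FOb F Y) (FOb G Y) (\<eta> Y) (FMor F X Y f)
        = Cmp D (FOb F X) (FOb G X) (FOb G Y) (FMor G X Y f) (\<eta> X))"

definition linear_functor_cat ::
  "('o, 'm, 'k, 'x) lin_cat_scheme \<Rightarrow> ('p, 'n, 'k, 'y) lin_cat_scheme \<Rightarrow>
   (('o, 'm, 'p, 'n) fctr, 'o \<Rightarrow> 'n) cat" where
  "linear_functor_cat C D =
    \<lparr>Ob = {F. is_linear_functor C D F \<and> extensional_functor C F},
     Mor = (\<lambda>F G. {\<eta> \<in> extensional (Ob C). nat_trans C D F G \<eta>}),
     Idm = (\<lambda>F. \<lambda>X\<in>Ob C. Idm D (FOb F X)),
     Cmp = (\<lambda>F G H \<theta> \<eta>. \<lambda>X\<in>Ob C. Cmp D (FOb F X) (FOb G X) (FOb H X) (\<theta> X) (\<eta> X))\<rparr>"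

definition iso_in :: "('o, 'm, 'x) cat_scheme \<Rightarrow> 'o \<Rightarrow> 'o \<Rightarrow> 'm \<Rightarrow> bool" where
  "iso_in C X Y f \<longleftrightarrow> f \<in> Mor C X Y \<and>
     (\<exists>g\<in>Mor C Y X. Cmp C X Y X g f = Idm C X \<and> Cmp C Y X Y f g = Idm C Y)"

definition nat_iso ::
  "('o, 'm, 'x) cat_scheme \<Rightarrow> ('p, 'n, 'y) cat_scheme \<Rightarrow>
   ('o, 'm, 'p, 'n) fctr \<Rightarrow> ('o, 'm, 'p, 'n) fctr \<Rightarrow> ('o \<Rightarrow> 'n) \<Rightarrow> bool" where
  "nat_iso C D F G \<eta> \<longleftrightarrow>
     nat_trans C D F G \<eta> \<and> (\<forall>X\<in>Ob C. iso_in D (FOb F X) (FOb G X) (\<eta> X))"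

definition id_functor :: "('o, 'm, 'o, 'm) fctr" where
  "id_functor = \<lparr>FOb = (\<lambda>X. X), FMor = (\<lambda>X Y f. f)\<rparr>"

definition comp_functor ::
  "('p, 'n, 'r, 'l) fctr \<Rightarrow> ('o, 'm, 'p, 'n) fctr \<Rightarrow> ('o, 'm, 'r, 'l) fctr" where
  "comp_functor G F =
    \<lparr>FOb = (\<lambda>X. FOb G (FOb F X)),
     FMor = (\<lambda>X Y f. FMor G (FOb F X) (FOb F Y) (FMor F X Y f))\<rparr>"

definition equivalent_cats :: "('o, 'm, 'x) cat_scheme \<Rightarrow> ('p, 'n, 'y) cat_scheme \<Rightarrow> bool" where
  "equivalent_cats C D \<longleftrightarrow>
     (\<exists>F G \<eta> \<theta>. is_functor C D F \<and> is_functor D C G \<and>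
        nat_iso C C (comp_functor G F) id_functor \<eta> \<and>
        nat_iso D D (comp_functor F G) id_functor \<theta>)"

section \<open>The bialgebra of quantum matrices\<close>

text \<open>Lists under concatenation are the free monoid. Hence \<open>(nat \<times> nat) list \<Rightarrow>\<^sub>0 'k\<close>, with the
  convolution product of \<^theory>\<open>HOL-Library.Poly_Mapping\<close>, is the free algebra in variables
  \<open>x\<^bsub>ij\<^esub>\<close>; the word \<open>[(i, j), \<dots>]\<close> stands for \<open>x\<^bsub>ij\<^esub> \<dots>\<close>. Its tensor square is the monoid algebra
  of pairs of words. All indices run over \<open>0, \<dots>, n - 1\<close>.\<close>

instantiation list :: (type) monoid_add
begin
definition zero_list_def: "0 = ([] :: 'a list)"
definition plus_list_def: "xs + ys = (xs @ ys :: 'a list)"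
instance by standard (simp_all add: zero_list_def plus_list_def)
end

type_synonym word = "(nat \<times> nat) list"
type_synonym 'k falg = "word \<Rightarrow>\<^sub>0 'k"
type_synonym 'k falg2 = "(word \<times> word) \<Rightarrow>\<^sub>0 'k"

definition words :: "nat \<Rightarrow> word set" where
  "words n = lists ({..<n} \<times> {..<n})"

definition Free :: "nat \<Rightarrow> ('k::field) falg ring" where
  "Free n = \<lparr>carrier = {f. Poly_Mapping.keys f \<subseteq> words n},
     monoid.mult = (*), one = 1, zero = 0, add = (+)\<rparr>"

definition Free2 :: "nat \<Rightarrow> ('k::field) falg2 ring" where
  "Free2 n = \<lparr>carrier = {f. Poly_Mapping.keys f \<subseteq> words n \<times> words n},
     monoid.mult = (*), one = 1, zero = 0, add = (+)\<rparr>"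

definition var :: "nat \<Rightarrow> nat \<Rightarrow> ('k::field) falg" where
  "var i j = Poly_Mapping.single [(i, j)] 1"

definition const :: "'k::field \<Rightarrow> 'k falg" where
  "const a = Poly_Mapping.single [] a"

text \<open>\<open>Rcoef q s t i j\<close> is the coefficient of \<open>v\<^sub>s \<otimes> v\<^sub>t\<close> in \<open>R\<^sub>n (v\<^sub>i \<otimes> v\<^sub>j)\<close>.\<close>

definition Rcoef :: "'k::field \<Rightarrow> nat \<Rightarrow> nat \<Rightarrow> nat \<Rightarrow> nat \<Rightarrow> 'k" where
  "Rcoef q s t i j =
     (if i < j then (if (s, t) = (j, i) then 1 else 0)
      else if i = j then (if (s, t) = (i, i) then q else 0)
      else if (s, t) = (i, j) then q - inverse q
      else if (s, t) = (j, i) then 1 else 0)"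

definition relator :: "nat \<Rightarrow> 'k::field \<Rightarrow> nat \<Rightarrow> nat \<Rightarrow> nat \<Rightarrow> nat \<Rightarrow> 'k falg" where
  "relator n q a b i j =
     (\<Sum>s<n. \<Sum>t<n. const (Rcoef q a b s t) * var s i * var t j)
     - (\<Sum>s<n. \<Sum>t<n. const (Rcoef q s t i j) * var a s * var b t)"

definition relators :: "nat \<Rightarrow> 'k::field \<Rightarrow> 'k falg set" where
  "relators n q = {relator n q a b i j | a b i j. a < n \<and> b < n \<and> i < n \<and> j < n}"

definition rel_ideal :: "nat \<Rightarrow> 'k::field \<Rightarrow> 'k falg set" where
  "rel_ideal n q = genideal (Free n) (relators n q)"

text \<open>The algebra \<open>A\<^sub>q(n, n)\<close>. Its elements are cosets.\<close>

definition Aq :: "nat \<Rightarrow> 'k::field \<Rightarrow> 'k falg set ring" where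
  "Aq n q = Free n Quot rel_ideal n q"

definition cls :: "nat \<Rightarrow> 'k::field \<Rightarrow> 'k falg \<Rightarrow> 'k falg set" where
  "cls n q f = rel_ideal n q +>\<^bsub>Free n\<^esub> f"

definition Aq_deg :: "nat \<Rightarrow> 'k::field \<Rightarrow> nat \<Rightarrow> 'k falg set set" where
  "Aq_deg n q e = cls n q ` {f \<in> carrier (Free n). \<forall>w\<in>Poly_Mapping.keys f. length w = e}"

definition ftens :: "'k::field falg \<Rightarrow> 'k falg \<Rightarrow> 'k falg2" where
  "ftens f g = (\<Sum>u\<in>Poly_Mapping.keys f. \<Sum>v\<in>Poly_Mapping.keys g.
     Poly_Mapping.single (u, v) (Poly_Mapping.lookup f u * Poly_Mapping.lookup g v))"

text \<open>Comultiplication and counit of the free algebra: the algebra homomorphisms with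
  \<open>x\<^bsub>ij\<^esub> \<mapsto> \<Sum>\<^sub>s x\<^bsub>is\<^esub> \<otimes> x\<^bsub>sj\<^esub>\<close> and \<open>x\<^bsub>ij\<^esub> \<mapsto> \<delta>\<^bsub>ij\<^esub>\<close>.\<close>

definition free_comult :: "nat \<Rightarrow> 'k::field falg \<Rightarrow> 'k falg2" where
  "free_comult n f = (\<Sum>w\<in>Poly_Mapping.keys f. Poly_Mapping.single ([], []) (Poly_Mapping.lookup f w)
     * prod_list (map (\<lambda>(i, j). \<Sum>s<n. ftens (var i s) (var s j)) w))"

definition free_counit :: "'k::field falg \<Rightarrow> 'k" where
  "free_counit f = (\<Sum>w\<in>Poly_Mapping.keys f. Poly_Mapping.lookup f w
     * prod_list (map (\<lambda>(i, j). if i = j then 1 else 0) w))"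

text \<open>If \<open>A = F / I\<close> then \<open>A \<otimes> A = (F \<otimes> F) / (I \<otimes> F + F \<otimes> I)\<close>, and \<open>I \<otimes> F + F \<otimes> I\<close> is the ideal
  generated by all \<open>f \<otimes> 1\<close> and \<open>1 \<otimes> f\<close> with \<open>f \<in> I\<close>.\<close>

definition rel_ideal2 :: "nat \<Rightarrow> 'k::field \<Rightarrow> 'k falg2 set" where
  "rel_ideal2 n q =
     genideal (Free2 n) ((\<lambda>f. ftens f 1) ` rel_ideal n q \<union> (\<lambda>f. ftens 1 f) ` rel_ideal n q)"

definition Aq2 :: "nat \<Rightarrow> 'k::field \<Rightarrow> 'k falg2 set ring" where
  "Aq2 n q = Free2 n Quot rel_ideal2 n q"

definition Atens :: "nat \<Rightarrow> 'k::field \<Rightarrow> 'k falg set \<Rightarrow> 'k falg set \<Rightarrow> 'k falg2 set" where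
  "Atens n q a b = (\<Union>f\<in>a. \<Union>g\<in>b. rel_ideal2 n q +>\<^bsub>Free2 n\<^esub> ftens f g)"

definition comult :: "nat \<Rightarrow> 'k::field \<Rightarrow> 'k falg set \<Rightarrow> 'k falg2 set" where
  "comult n q a = (\<Union>f\<in>a. rel_ideal2 n q +>\<^bsub>Free2 n\<^esub> free_comult n f)"

definition counit :: "'k::field falg set \<Rightarrow> 'k" where
  "counit a = the_elem (free_counit ` a)"

section \<open>Comodules and their braiding\<close>

text \<open>Finite dimensional vector spaces are coordinate spaces \<open>k\<^sup>m\<close>, and linear maps are matrices.
  A right \<open>A\<^sub>q(n, n)\<close>-comodule is given by the square matrix \<open>c\<close> of its coaction
  \<open>e\<^sub>i \<mapsto> \<Sum>\<^sub>j e\<^sub>j \<otimes> c\<^bsub>ji\<^esub>\<close>.\<close>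

type_synonym 'k coact = "'k falg set mat"

definition is_comodule :: "nat \<Rightarrow> 'k::field \<Rightarrow> 'k coact \<Rightarrow> bool" where
  "is_comodule n q c \<longleftrightarrow> square_mat c \<and> elements_mat c \<subseteq> carrier (Aq n q) \<and>
     (\<forall>i<dim_row c. \<forall>j<dim_row c.
        comult n q (c $$ (i, j))
          = finsum (Aq2 n q) (\<lambda>s. Atens n q (c $$ (i, s)) (c $$ (s, j))) {..<dim_row c} \<and>
        counit (c $$ (i, j)) = (if i = j then 1 else 0))"

definition comodule_maps :: "nat \<Rightarrow> 'k::field \<Rightarrow> 'k coact \<Rightarrow> 'k coact \<Rightarrow> 'k mat set" where
  "comodule_maps n q c c' = {f \<in> carrier_mat (dim_row c') (dim_row c).
     \<forall>k<dim_row c'. \<forall>i<dim_row c.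
       finsum (Aq n q) (\<lambda>j. cls n q (const (f $$ (k, j))) \<otimes>\<^bsub>Aq n q\<^esub> c $$ (j, i)) {..<dim_row c}
       = finsum (Aq n q) (\<lambda>l. c' $$ (k, l) \<otimes>\<^bsub>Aq n q\<^esub> cls n q (const (f $$ (l, i)))) {..<dim_row c'}}"

definition std_comodule :: "nat \<Rightarrow> 'k::field \<Rightarrow> 'k coact" where
  "std_comodule n q = mat n n (\<lambda>(i, j). cls n q (var i j))"

text \<open>\<open>k\<^sup>m \<otimes> k\<^sup>p\<close> is identified with \<open>k\<^bsup>mp\<^esup>\<close>, the vector \<open>e\<^sub>i \<otimes> e\<^sub>j\<close> becoming \<open>e\<^bsub>ip+j\<^esub>\<close>.
  This makes the tensor product strictly associative.\<close>

definition kron :: "'k::semiring_1 mat \<Rightarrow> 'k mat \<Rightarrow> 'k mat" where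
  "kron A B = mat (dim_row A * dim_row B) (dim_col A * dim_col B)
     (\<lambda>(i, j). A $$ (i div dim_row B, j div dim_col B) * B $$ (i mod dim_row B, j mod dim_col B))"

definition tens_comodule :: "nat \<Rightarrow> 'k::field \<Rightarrow> 'k coact \<Rightarrow> 'k coact \<Rightarrow> 'k coact" where
  "tens_comodule n q c c' = mat (dim_row c * dim_row c') (dim_col c * dim_col c')
     (\<lambda>(i, j). c $$ (i div dim_row c', j div dim_col c')
                 \<otimes>\<^bsub>Aq n q\<^esub> c' $$ (i mod dim_row c', j mod dim_col c'))"

definition Rmat :: "nat \<Rightarrow> 'k::field \<Rightarrow> 'k mat" where
  "Rmat n q = mat (n * n) (n * n) (\<lambda>(k, l). Rcoef q (k div n) (k mod n) (l div n) (l mod n))"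

definition is_braiding :: "nat \<Rightarrow> 'k::field \<Rightarrow> ('k coact \<Rightarrow> 'k coact \<Rightarrow> 'k mat) \<Rightarrow> bool" where
  "is_braiding n q R \<longleftrightarrow>
     (\<forall>V W. is_comodule n q V \<and> is_comodule n q W \<longrightarrow>
        R V W \<in> comodule_maps n q (tens_comodule n q V W) (tens_comodule n q W V) \<and>
        invertible_mat (R V W)) \<and>
     (\<forall>V V' W W' f g. is_comodule n q V \<and> is_comodule n q V' \<and>
        is_comodule n q W \<and> is_comodule n q W' \<and>
        f \<in> comodule_maps n q V V' \<and> g \<in> comodule_maps n q W W' \<longrightarrow>
        R V' W' * kron f g = kron g f * R V W) \<and>
     (\<forall>V W U. is_comodule n q V \<and> is_comodule n q W \<and> is_comodule n q U \<longrightarrow>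
        R (tens_comodule n q V W) U
          = kron (R V U) (1\<^sub>m (dim_row W)) * kron (1\<^sub>m (dim_row V)) (R W U) \<and>
        R V (tens_comodule n q W U)
          = kron (1\<^sub>m (dim_row W)) (R V U) * kron (R V W) (1\<^sub>m (dim_row U))) \<and>
     R (std_comodule n q) (std_comodule n q) = Rmat n q"

text \<open>The properties in \<^const>\<open>is_braiding\<close> determine the braiding on comodules: it is known on
  tensor powers of \<open>V\<^sub>n\<close>, on the trivial comodule, and every comodule is a direct sum of homogeneous
  ones, which are subquotients of multiples of tensor powers of \<open>V\<^sub>n\<close>. It exists because
  \<open>A\<^sub>q(n, n)\<close> is coquasitriangular for \<open>q \<noteq> 0\<close>.\<close>

definition braiding :: "nat \<Rightarrow> 'k::field \<Rightarrow> 'k coact \<Rightarrow> 'k coact \<Rightarrow> 'k mat" where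
  "braiding n q = (SOME R. is_braiding n q R)"

section \<open>Hecke pairs and quantum polynomial functors\<close>

text \<open>A pair \<open>(n, c)\<close> is the comodule \<open>c\<close> over \<open>A\<^sub>q(n, n)\<close>.\<close>

type_synonym 'k hpair = "nat \<times> 'k coact"

definition hecke_pairs :: "'k::field \<Rightarrow> nat \<Rightarrow> 'k hpair set" where
  "hecke_pairs q e = {(n, c). n \<ge> 1 \<and> is_comodule n q c \<and> elements_mat c \<subseteq> Aq_deg n q e}"

definition vdim :: "'k hpair \<Rightarrow> nat" where
  "vdim V = dim_row (snd V)"

definition RV :: "'k::field \<Rightarrow> 'k hpair \<Rightarrow> 'k mat" where
  "RV q V = braiding (fst V) q (snd V) (snd V)"

text \<open>For \<open>i + 1 < d\<close>, \<open>Tact q d V i\<close> is the action of the Artin generator \<open>T\<^bsub>i+1\<^esub>\<close> on \<open>V\<^bsup>\<otimes>d\<^esup>\<close>.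
  As the \<open>T\<^sub>i\<close> generate the braid group, a linear map is equivariant iff it commutes with them.\<close>

definition Tact :: "'k::field \<Rightarrow> nat \<Rightarrow> 'k hpair \<Rightarrow> nat \<Rightarrow> 'k mat" where
  "Tact q d V i = kron (1\<^sub>m (vdim V ^ i)) (kron (RV q V) (1\<^sub>m (vdim V ^ (d - 2 - i))))"

definition braid_hom :: "'k::field \<Rightarrow> nat \<Rightarrow> 'k hpair \<Rightarrow> 'k hpair \<Rightarrow> 'k mat set" where
  "braid_hom q d V W = {f \<in> carrier_mat (vdim W ^ d) (vdim V ^ d).
     \<forall>i. i + 1 < d \<longrightarrow> f * Tact q d V i = Tact q d W i * f}"

definition Vect :: "(nat, 'k::field mat, 'k) lin_cat" where
  "Vect = \<lparr>Ob = UNIV, Mor = (\<lambda>m p. carrier_mat p m), Idm = (\<lambda>m. 1\<^sub>m m),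
     Cmp = (\<lambda>_ _ _ g f. g * f), Add = (+), Smul = (\<cdot>\<^sub>m)\<rparr>"

definition Gamma_hom :: "'k::field \<Rightarrow> nat \<Rightarrow> nat \<Rightarrow> ('k hpair, 'k mat, 'k) lin_cat" where
  "Gamma_hom q d e = \<lparr>Ob = hecke_pairs q e, Mor = braid_hom q d, Idm = (\<lambda>V. 1\<^sub>m (vdim V ^ d)),
     Cmp = (\<lambda>_ _ _ g f. g * f), Add = (+), Smul = (\<cdot>\<^sub>m)\<rparr>"

definition P_hom ::
  "'k::field \<Rightarrow> nat \<Rightarrow> nat \<Rightarrow> (('k hpair, 'k mat, nat, 'k mat) fctr, 'k hpair \<Rightarrow> 'k mat) cat" where
  "P_hom q d e = linear_functor_cat (Gamma_hom q d e) Vect"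

text \<open>A formal direct sum is a list of Hecke pairs, possibly of different degrees. A morphism is a
  matrix whose \<open>(j, i)\<close> entry is the component from the \<open>i\<close>-th summand of the source to the
  \<open>j\<close>-th summand of the target.\<close>

definition block_comp ::
  "nat \<Rightarrow> 'k::field hpair list \<Rightarrow> 'k hpair list \<Rightarrow> 'k hpair list \<Rightarrow>
   'k mat mat \<Rightarrow> 'k mat mat \<Rightarrow> 'k mat mat" where
  "block_comp d X Y Z g f = mat (length Z) (length X) (\<lambda>(k, i).
     mat (vdim (Z ! k) ^ d) (vdim (X ! i) ^ d) (\<lambda>ab.
       \<Sum>j<length Y. (g $$ (k, j) * f $$ (j, i)) $$ ab))"

definition Gamma :: "'k::field \<Rightarrow> nat \<Rightarrow> ('k hpair list, 'k mat mat, 'k) lin_cat" where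
  "Gamma q d =
    \<lparr>Ob = lists (\<Union>e. hecke_pairs q e),
     Mor = (\<lambda>X Y. {f \<in> carrier_mat (length Y) (length X).
              \<forall>j<length Y. \<forall>i<length X. f $$ (j, i) \<in> braid_hom q d (X ! i) (Y ! j)}),
     Idm = (\<lambda>X. mat (length X) (length X) (\<lambda>(j, i).
              if i = j then 1\<^sub>m (vdim (X ! i) ^ d) else 0\<^sub>m (vdim (X ! j) ^ d) (vdim (X ! i) ^ d))),
     Cmp = block_comp d,
     Add = (\<lambda>f g. mat (dim_row f) (dim_col f) (\<lambda>p. f $$ p + g $$ p)),
     Smul = (\<lambda>a f. map_mat ((\<cdot>\<^sub>m) a) f)\<rparr>"

definition P_tilde ::
  "'k::field \<Rightarrow> nat \<Rightarrow>
   (('k hpair list, 'k mat mat, 'k hpair list, 'k mat mat) fctr, 'k hpair list \<Rightarrow> 'k mat mat) cat"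
  where "P_tilde q d = linear_functor_cat (Gamma q d) (Gamma q 1)"

text \<open>The vectors of the space underlying an object \<open>\<Oplus>\<^sub>i X\<^sub>i\<close> of \<open>\<Gamma>\<^sup>1\<^sub>q\<V>\<close>, with the action of
  morphisms on them.\<close>

definition vectors :: "'k hpair list \<Rightarrow> 'k vec vec set" where
  "vectors X = {v \<in> carrier_vec (length X). \<forall>i<length X. v $ i \<in> carrier_vec (vdim (X ! i))}"

definition apply_blocks ::
  "'k::field hpair list \<Rightarrow> 'k hpair list \<Rightarrow> 'k mat mat \<Rightarrow> 'k vec vec \<Rightarrow> 'k vec vec" where
  "apply_blocks X Y f v = vec (length Y) (\<lambda>j. vec (vdim (Y ! j)) (\<lambda>a.
     \<Sum>i<length X. (f $$ (j, i) *\<^sub>v v $ i) $ a))"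

definition sum_vectors :: "'k::field hpair list \<Rightarrow> (nat \<Rightarrow> 'k vec vec) \<Rightarrow> nat \<Rightarrow> 'k vec vec" where
  "sum_vectors X v N = vec (length X) (\<lambda>i. vec (vdim (X ! i)) (\<lambda>a. \<Sum>r<N. v r $ i $ a))"

text \<open>The elements of \<open>Hom(W, U) \<otimes> F(W)\<close> are the finite sums of pure tensors \<open>f \<otimes> v\<close>, so the
  evaluation map is surjective iff every element of \<open>F(U)\<close> is a finite sum of elements \<open>F(f)(v)\<close>.

  For \<open>d = 1\<close> the braid group is trivial, and any one-dimensional \<open>W\<close> is a generator because
  identities are sums of maps that factor through \<open>W\<close>. Failure of finite generation is
  therefore a matter of \<open>d \<ge> 2\<close>.\<close>

definition finitely_generated_P_tilde :: "'k::field \<Rightarrow> nat \<Rightarrow> bool" where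
  "finitely_generated_P_tilde q d \<longleftrightarrow>
     (\<exists>W\<in>Ob (Gamma q d). \<forall>F\<in>Ob (P_tilde q d). \<forall>U\<in>Ob (Gamma q d). \<forall>u\<in>vectors (FOb F U).
        \<exists>N f v. (\<forall>r<N. f r \<in> Mor (Gamma q d) W U \<and> v r \<in> vectors (FOb F W)) \<and>
          u = sum_vectors (FOb F U)
                (\<lambda>r. apply_blocks (FOb F W) (FOb F U) (FMor F W U (f r)) (v r)) N)"

end

theory Submission
  imports Defs "HOL-Computational_Algebra.Polynomial" "Jordan_Normal_Form.Char_Poly"
begin

text \<open>
  The two kinds of functor categories are told apart by the endomorphisms of one functor. Let
  \<open>F\<close> be the functor \<open>V \<mapsto> V\<^bsup>\<otimes>d\<^esup>\<close> on \<open>\<Gamma>\<^sup>d\<^sub>q\<V>\<close>, which forgets that a morphism is equivariant. The one-dimensional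
  Hecke pair \<open>L\<^sub>j\<close> over \<open>A\<^sub>q(1, 1)\<close> with coaction \<open>x\<^sub>1\<^sub>1\<^sup>j\<close> has the braiding \<open>q\<^bsup>j\<^sup>2\<^esup>\<close>, and these numbers
  are pairwise distinct since \<open>q\<close> is not a root of unity. As \<open>d \<ge> 2\<close>, the generator \<open>T\<^sub>1\<close> exists; an
  equivariant map from \<open>V\<close> to \<open>L\<^sub>j\<close> is a left eigenvector of \<open>T\<^sub>1\<close> on \<open>V\<^bsup>\<otimes>d\<^esup>\<close> for the eigenvalue \<open>q\<^bsup>j\<^sup>2\<^esup>\<close>.

  A fixed object \<open>W\<close> involves finitely many eigenvalues, so \<open>Hom(W, L\<^sub>j) = 0\<close> for some \<open>j\<close>, whereas
  \<open>F(L\<^sub>j) \<noteq> 0\<close>. This is \<open>not_finitely_generated\<close>.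

  For the second claim, let \<open>u\<^sub>j\<close> be the Fitting projection of \<open>T\<^sub>1 - q\<^bsup>j\<^sup>2\<^esup>\<close>, onto the part of \<open>V\<^bsup>\<otimes>d\<^esup>\<close> on which
  this operator is invertible. It is natural in \<open>V\<close>, and the products \<open>u\<^sub>0 \<cdots> u\<^bsub>k-1\<^esub>\<close> form a descending chain
  of idempotent endomorphisms of \<open>F\<close>, strictly descending because \<open>L\<^sub>k\<close> separates two successive
  members. An equivalence of categories would carry it to a strictly descending chain of idempotent
  endomorphisms of some functor \<open>H\<close> in \<open>\<P>\<^sup>d\<^bsub>q,e\<^esub>\<close>. There it cannot exist: the object
  \<open>W = (V\<^bsub>n\<^esub>\<^bsup>\<otimes>e\<^esup>)\<^bsup>\<oplus>d\<^esup>\<close> with \<open>n = max 1 (d e)\<close> generates \<open>\<Gamma>\<^sup>d\<^bsub>q,e\<^esub>\<V>\<close>, in the sense that every identity is a sum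
  of maps through \<open>W\<close> (\<open>generated_hecke\<close>), so that an endomorphism of \<open>H\<close> is determined by its value on
  \<open>W\<close> (\<open>endomorphism_determined\<close>), and a chain of idempotent matrices of fixed size becomes stationary
  (\<open>no_idempotent_chain\<close>).

  The generation theorem carries the quantum group theory. Comodules are studied through the linear
  functionals on words that are invariant under the relations of \<open>A\<^sub>q(n, n)\<close>; by duality they detect
  everything (\<open>mem_rel_ideal\<close>). Matrix coefficients of positive cabled braids are such functionals and
  yield the braiding (\<open>braiding_exists\<close>), which pins down the choice in the definition of the braiding
  up to the properties used here. For generic \<open>q\<close> there is an averaging operator from all operators on
  \<open>V\<^sub>n\<^bsup>\<otimes>e\<^esup>\<close> onto those commuting with the Hecke algebra (\<open>averaging\<close>); with it every comodule of degree \<open>e\<close>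
  is a retract of a multiple of \<open>V\<^sub>n\<^bsup>\<otimes>e\<^esup>\<close> (\<open>retract\<close>). Order preserving relabellings of the basis of \<open>V\<^sub>n\<close> are
  compatible with all braidings (\<open>relabel_Rmor\<close>), even though \<open>n\<close> changes. A basis vector of
  \<open>((V\<^sub>n\<^bsup>\<otimes>e\<^esup>)\<^bsup>\<oplus>m\<^esup>)\<^bsup>\<otimes>d\<^esup>\<close> involves at most \<open>d e\<close> letters and \<open>d\<close> copies, so for larger \<open>n\<close> or \<open>m\<close> one of them is missing
  and the vector comes from a smaller \<open>n\<close> or \<open>m\<close> (\<open>generated_MM\<close>).
\<close>

section \<open>Averaging over the Hecke algebra\<close>

text \<open>Rings of operators are not commutative, so commutation and invertibility are relations between elements.\<close>
definition cmt :: "'a::ring_1 \<Rightarrow> 'a \<Rightarrow> bool" where "cmt x y \<longleftrightarrow> x * y = y * x"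

lemma cmt_sym: "cmt x y \<Longrightarrow> cmt y x" by (simp add: cmt_def)
lemma cmt_refl [simp]: "cmt x x" by (simp add: cmt_def)
lemma cmt_one [simp]: "cmt x 1" "cmt 1 x" by (simp_all add: cmt_def)
lemma cmt_zero [simp]: "cmt x 0" "cmt 0 x" by (simp_all add: cmt_def)
lemma cmt_mult: "cmt x y \<Longrightarrow> cmt x z \<Longrightarrow> cmt x (y * z)"
  unfolding cmt_def by (metis mult.assoc)
lemma cmt_add: "cmt x y \<Longrightarrow> cmt x z \<Longrightarrow> cmt x (y + z)"
  by (simp add: cmt_def algebra_simps)
lemma cmt_diff: "cmt x y \<Longrightarrow> cmt x z \<Longrightarrow> cmt x (y - z)"
  by (simp add: cmt_def algebra_simps)
lemma cmt_uminus: "cmt x y \<Longrightarrow> cmt x (- y)"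
  by (simp add: cmt_def)
lemma cmt_prod_list: "(\<And>y. y \<in> set ys \<Longrightarrow> cmt x y) \<Longrightarrow> cmt x (prod_list ys)"
  by (induction ys) (auto intro: cmt_mult)
lemma cmt_left_mult: "cmt y x \<Longrightarrow> cmt z x \<Longrightarrow> cmt (y * z) x"
  by (meson cmt_mult cmt_sym)
lemma cmt_left_diff: "cmt y x \<Longrightarrow> cmt z x \<Longrightarrow> cmt (y - z) x"
  by (meson cmt_diff cmt_sym)
lemma cmt_left_add: "cmt y x \<Longrightarrow> cmt z x \<Longrightarrow> cmt (y + z) x"
  by (meson cmt_add cmt_sym)

lemmas cmt_intros = cmt_mult cmt_add cmt_diff cmt_uminus cmt_left_mult cmt_left_diff cmt_left_add

text \<open>Units, with an inverse that is arbitrary for elements that are not units.\<close>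
definition uni :: "'a::ring_1 \<Rightarrow> bool" where "uni x \<longleftrightarrow> (\<exists>y. x * y = 1 \<and> y * x = 1)"
definition rinv :: "'a::ring_1 \<Rightarrow> 'a" where "rinv x = (SOME y. x * y = 1 \<and> y * x = 1)"

lemma rinv: assumes "uni x" shows "x * rinv x = 1" "rinv x * x = 1"
  using assms unfolding uni_def rinv_def by (metis (mono_tags, lifting) someI_ex)+

lemma uni_mult: "uni x \<Longrightarrow> uni y \<Longrightarrow> uni (x * y)"
proof -
  assume x: "uni x" and y: "uni y"
  have "x * y * (rinv y * rinv x) = x * (y * rinv y) * rinv x" by (simp only: mult.assoc)
  moreover have "rinv y * rinv x * (x * y) = rinv y * (rinv x * x) * y" by (simp only: mult.assoc)
  ultimately show "uni (x * y)"
    unfolding uni_def using rinv[OF x] rinv[OF y] by (intro exI[of _ "rinv y * rinv x"]) simp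
qed

lemma cmt_rinv: assumes "uni x" "cmt a x" shows "cmt a (rinv x)"
proof -
  have "rinv x * a = rinv x * a * (x * rinv x)" by (simp add: rinv assms)
  also have "\<dots> = rinv x * (a * x) * rinv x" by (simp add: mult.assoc)
  also have "\<dots> = rinv x * (x * a) * rinv x" using assms(2) by (simp add: cmt_def)
  also have "\<dots> = (rinv x * x) * a * rinv x" by (simp add: mult.assoc)
  also have "\<dots> = a * rinv x" by (simp add: rinv assms)
  finally show ?thesis by (simp add: cmt_def)
qed

text \<open>A divisor of a unit is a unit, provided that it commutes with its cofactor.\<close>
lemma uni_factor:
  assumes "uni z" "y * m = z" "cmt y m"
  shows "uni y"
proof -
  have "m * y = z" using assms by (simp add: cmt_def)
  have "y * (m * rinv z) = 1" using rinv[OF assms(1)] assms(2) by (simp add: mult.assoc[symmetric])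
  moreover have "(rinv z * m) * y = 1" using rinv[OF assms(1)] \<open>m * y = z\<close> by (simp add: mult.assoc)
  ultimately have "rinv z * m = m * rinv z" by (metis mult.assoc mult.left_neutral mult.right_neutral)
  with \<open>y * (m * rinv z) = 1\<close> \<open>(rinv z * m) * y = 1\<close> show ?thesis unfolding uni_def by metis
qed

text \<open>The factor \<open>x\<close> kills the product of all \<open>x - r\<close>, hence any product of multiples of them.\<close>
lemma prod_list_mult_cmt:
  assumes "\<And>r r'. r \<in> set rs \<Longrightarrow> r' \<in> set rs \<Longrightarrow> cmt (f r) (g r')"
  shows "prod_list (map (\<lambda>r. f r * g r) rs) = prod_list (map f rs) * prod_list (map g rs)"
  using assms
proof (induction rs)
  case (Cons r rs)
  have c: "cmt (g r) (prod_list (map f rs))"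
    by (rule cmt_prod_list) (use Cons.prems in \<open>auto intro: cmt_sym\<close>)
  have "prod_list (map (\<lambda>r. f r * g r) (r # rs))
      = f r * (g r * prod_list (map f rs)) * prod_list (map g rs)"
    using Cons by (simp add: mult.assoc)
  also have "\<dots> = f r * (prod_list (map f rs) * g r) * prod_list (map g rs)"
    using c by (simp add: cmt_def)
  finally show ?case by (simp add: mult.assoc)
qed simp

text \<open>If \<open>y \<equiv> z\<^sub>r\<close> modulo \<open>x - r\<close> for every root \<open>r\<close>, then \<open>y\<close> divides the product of the \<open>z\<^sub>r\<close>.\<close>
lemma uni_if_uni_mod_roots:
  fixes y :: "'a::ring_1"
  assumes zero: "prod_list (map (\<lambda>r. x - f r) rs) = 0"
    and dec: "\<And>r. r \<in> set rs \<Longrightarrow> y - z r = (x - f r) * s r"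
    and cs: "\<And>r r'. r \<in> set rs \<Longrightarrow> r' \<in> set rs \<Longrightarrow> cmt (x - f r) (s r')"
    and cz: "\<And>r. r \<in> set rs \<Longrightarrow> cmt y (z r)"
    and uz: "\<And>r. r \<in> set rs \<Longrightarrow> uni (z r)"
  shows "uni y"
proof -
  have "\<exists>m. prod_list (map (\<lambda>r. z r - y) rs) = prod_list (map z rs) - y * m \<and> cmt y m"
    using cz
  proof (induction rs)
    case Nil then show ?case by (auto intro!: exI[of _ 0])
  next
    case (Cons r rs)
    then obtain m where m: "prod_list (map (\<lambda>r. z r - y) rs) = prod_list (map z rs) - y * m" "cmt y m"
      by auto
    have "z r * y = y * z r" using Cons.prems by (simp add: cmt_def)
    then have zy: "z r * (y * w) = y * (z r * w)" for w by (metis mult.assoc)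
    have "(z r - y) * (prod_list (map z rs) - y * m)
       = z r * prod_list (map z rs) - y * (prod_list (map z rs) + z r * m - y * m)"
      using zy by (simp add: algebra_simps)
    moreover have "cmt y (prod_list (map z rs) + z r * m - y * m)"
      using Cons.prems m(2) by (auto intro!: cmt_intros cmt_prod_list)
    ultimately show ?case using m by auto
  qed
  then obtain m where m: "prod_list (map (\<lambda>r. z r - y) rs) = prod_list (map z rs) - y * m" "cmt y m"
    by blast
  have "map (\<lambda>r. z r - y) rs = map (\<lambda>r. (x - f r) * (- s r)) rs"
    using dec by (intro map_cong) (simp_all add: algebra_simps)
  then have "prod_list (map (\<lambda>r. z r - y) rs) = prod_list (map (\<lambda>r. x - f r) rs) * prod_list (map (\<lambda>r. - s r) rs)"
    using cs by (simp only:) (rule prod_list_mult_cmt, auto intro: cmt_uminus)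
  then have "y * m = prod_list (map z rs)" using m zero by simp
  moreover have "uni (prod_list (map z rs))"
    using uz by (induction rs) (auto intro: uni_mult simp: uni_def[of 1])
  ultimately show ?thesis using m(2) by (metis uni_factor)
qed


text \<open>The relations between \<open>X = L\<^sub>k\<close>, \<open>Y = L\<^bsub>k+1\<^esub>\<close> and \<open>t = T\<^sub>k\<close> are those of the affine Hecke algebra. The element
  \<open>\<phi>\<close> below intertwines \<open>X\<close> and \<open>Y\<close>; its square is a polynomial in \<open>X\<close> and \<open>Y\<close> that vanishes only if
  their eigenvalues differ by a factor \<open>q\<^sup>2\<close> or \<open>q\<^sup>-\<^sup>2\<close>.\<close>
lemma affine_intertwiner:
  fixes X Y t h :: "'a::ring_1"
  assumes tX: "t * X = Y * t - h * Y" and tY: "t * Y = X * t + h * Y" and tt: "t * t = 1 + h * t"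
    and XY: "Y * X = X * Y" and hX: "X * h = h * X" and hY: "Y * h = h * Y" and ht: "t * h = h * t"
  defines "\<phi> \<equiv> t * (X - Y) + h * Y"
  shows "\<phi> * X = Y * \<phi>" "\<phi> * \<phi> = h * h * X * Y - (X - Y) * (X - Y)"
proof -
  have a: "t * (X * z) = Y * (t * z) - h * (Y * z)" "t * (Y * z) = X * (t * z) + h * (Y * z)"
    "t * (t * z) = z + h * (t * z)" "Y * (X * z) = X * (Y * z)" "X * (h * z) = h * (X * z)"
    "Y * (h * z) = h * (Y * z)" "t * (h * z) = h * (t * z)" for z
    using assms(1-7) by (metis (no_types, opaque_lifting) mult.assoc left_diff_distrib distrib_right mult_1)+
  show "\<phi> * X = Y * \<phi>" "\<phi> * \<phi> = h * h * X * Y - (X - Y) * (X - Y)"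
    unfolding \<phi>_def by (simp_all add: algebra_simps tX tY tt XY hX hY ht a)
qed

lemma prod_list_map_concat:
  "prod_list (map f (concat xss)) = prod_list (map (\<lambda>xs. prod_list (map f xs)) xss)"
  for f :: "'b \<Rightarrow> 'a::monoid_mult"
  by (induction xss) auto

locale hecke =
  fixes T :: "nat \<Rightarrow> 'a::ring_1" and \<kappa> :: "'k::field \<Rightarrow> 'a" and q :: 'k and e :: nat
  assumes \<kappa>_add: "\<kappa> (a + b) = \<kappa> a + \<kappa> b" and \<kappa>_mult: "\<kappa> (a * b) = \<kappa> a * \<kappa> b"
    and \<kappa>_one: "\<kappa> 1 = 1" and \<kappa>_central: "\<kappa> a * x = x * \<kappa> a"
    and quad: "Suc i < e \<Longrightarrow> T i * T i = 1 + \<kappa> (q - inverse q) * T i"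
    and braid: "Suc (Suc i) < e \<Longrightarrow> T i * T (Suc i) * T i = T (Suc i) * T i * T (Suc i)"
    and far: "Suc i < j \<Longrightarrow> Suc j < e \<Longrightarrow> T i * T j = T j * T i"
    and q0: "q \<noteq> 0" and q_nru: "\<And>m::nat. m > 0 \<Longrightarrow> q ^ m \<noteq> 1"
begin

abbreviation "h \<equiv> \<kappa> (q - inverse q)"

lemma \<kappa>_zero: "\<kappa> 0 = 0" using \<kappa>_add[of 0 0] by simp
lemma \<kappa>_diff: "\<kappa> (a - b) = \<kappa> a - \<kappa> b" using \<kappa>_add[of "a - b" b] by simp
lemma cmt_\<kappa>: "cmt (\<kappa> a) x" "cmt x (\<kappa> a)" by (simp_all add: cmt_def \<kappa>_central)
lemma uni_\<kappa>: "a \<noteq> 0 \<Longrightarrow> uni (\<kappa> a)"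
  unfolding uni_def by (intro exI[of _ "\<kappa> (inverse a)"]) (simp flip: \<kappa>_mult add: \<kappa>_one)

lemma far': "Suc i < j \<or> Suc j < i \<Longrightarrow> Suc i < e \<Longrightarrow> Suc j < e \<Longrightarrow> cmt (T i) (T j)"
  using far by (metis cmt_def)

text \<open>\<open>Tr k\<close> sums over the coset representatives \<open>T\<^sub>i \<cdots> T\<^bsub>k-1\<^esub>\<close>: it averages from the commutant of \<open>T\<^sub>0, \<dots>, T\<^bsub>k-2\<^esub>\<close>
  to that of \<open>T\<^sub>0, \<dots>, T\<^bsub>k-1\<^esub>\<close>.\<close>
fun Tr :: "nat \<Rightarrow> 'a \<Rightarrow> 'a" where
  "Tr 0 z = z"
| "Tr (Suc k) z = z + Tr k (T k * z * T k)"

text \<open>The multiplicative Jucys--Murphy elements.\<close>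
fun L :: "nat \<Rightarrow> 'a" where
  "L 0 = 1"
| "L (Suc k) = T k * L k * T k"

lemma Tr_mult:
  assumes "\<And>i. i < k \<Longrightarrow> cmt a (T i)"
  shows "a * Tr k z = Tr k (a * z)" "Tr k z * a = Tr k (z * a)"
proof -
  have "a * Tr k z = Tr k (a * z) \<and> Tr k z * a = Tr k (z * a)" using assms
  proof (induction k arbitrary: z)
    case (Suc k)
    have c: "a * T k = T k * a" using Suc.prems[of k] by (simp add: cmt_def)
    have c': "a * (T k * x) = T k * (a * x)" for x using c by (metis mult.assoc)
    have "a * Tr k (T k * z * T k) = Tr k (a * (T k * z * T k))"
         "Tr k (T k * z * T k) * a = Tr k (T k * z * T k * a)" using Suc by auto
    then show ?case using c c' by (simp add: distrib_left distrib_right mult.assoc)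
  qed simp
  then show "a * Tr k z = Tr k (a * z)" "Tr k z * a = Tr k (z * a)" by auto
qed

lemma Tr_add: "Tr k (y + z) = Tr k y + Tr k z"
  by (induction k arbitrary: y z) (simp_all add: algebra_simps)
lemma Tr_diff: "Tr k (y - z) = Tr k y - Tr k z"
  using Tr_add[of k "y - z" z] by simp

lemma Tr_cmt:
  assumes "k < e" and "\<And>i. Suc i < k \<Longrightarrow> cmt (T i) z" and "i < k"
  shows "cmt (T i) (Tr k z)"
  using assms
proof (induction k arbitrary: z i)
  case (Suc k)
  note z = Suc.prems(2)
  have zi: "cmt (T i) (T k * z * T k)" if "Suc i < k" for i
    using that Suc.prems z far' by (intro cmt_mult) auto
  show ?case
  proof (cases "i < k")
    case True
    have "cmt (T i) (Tr k (T k * z * T k))"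
      using True Suc.prems by (intro Suc.IH) (auto intro: zi)
    then show ?thesis using True z[of i] by (auto intro: cmt_add)
  next
    case False
    then have i: "i = k" using Suc.prems by simp
    have Q: "T k * T k = 1 + h * T k" using Suc.prems quad by simp
    have "cmt (T k) (z + T k * z * T k)"
    proof -
      have "T k * (z + T k * z * T k) = T k * z + (T k * T k) * z * T k" by (simp add: algebra_simps)
      also have "\<dots> = T k * z + z * T k + (h * (T k * z)) * T k"
        by (simp add: Q algebra_simps)
      also have "h * (T k * z) = T k * z * h" by (rule \<kappa>_central)
      also have "T k * z + z * T k + T k * z * h * T k = z * T k + T k * z * (T k * T k)"
        by (simp add: Q algebra_simps)
      also have "\<dots> = (z + T k * z * T k) * T k" by (simp add: algebra_simps)
      finally show ?thesis by (simp add: cmt_def)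
    qed
    moreover have "cmt (T k) (Tr j (T j * (T k * z * T k) * T j))" if k: "k = Suc j" for j
    proof -
      let ?y = "T j * (T k * z * T k) * T j"
      have B: "T j * T k * T j = T k * T j * T k" using braid[of j] k Suc.prems by simp
      have zj: "T j * z = z * T j" using z[of j] k by (simp add: cmt_def)
      have "T k * ?y = (T k * T j * T k) * z * T k * T j" by (simp add: mult.assoc)
      also have "\<dots> = T j * T k * (T j * z) * T k * T j" by (simp add: B[symmetric]) (simp add: mult.assoc)
      also have "\<dots> = T j * T k * z * (T j * T k * T j)" by (simp add: zj mult.assoc)
      also have "\<dots> = ?y * T k" by (simp add: B) (simp add: mult.assoc)
      finally have y: "T k * ?y = ?y * T k" .
      have "cmt (T k) (T i)" if "i < j" for i using that k Suc.prems far' by auto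
      from Tr_mult[of j "T k", OF this] show ?thesis using y by (simp add: cmt_def)
    qed
    ultimately show ?thesis unfolding i
      by (cases k) (simp_all add: cmt_add add.assoc[symmetric])
  qed
qed simp

lemma L_Tr: "k < e \<Longrightarrow> Suc k < e \<Longrightarrow> L (Suc k) = 1 + h * Tr k (T k)"
proof (induction k)
  case 0 then show ?case by (simp add: quad)
next
  case (Suc k)
  have B: "T k * T (Suc k) * T k = T (Suc k) * T k * T (Suc k)" using braid Suc.prems by simp
  have c: "cmt (T (Suc k)) (T i)" if "i < k" for i using far' that Suc.prems by auto
  have "L (Suc (Suc k)) = T (Suc k) * (1 + h * Tr k (T k)) * T (Suc k)"
    using Suc by (simp del: L.simps(2) add: L.simps(2)[of "Suc k"])
  also have "\<dots> = T (Suc k) * T (Suc k) + (T (Suc k) * h) * (Tr k (T k) * T (Suc k))"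
    by (simp add: algebra_simps)
  also have "T (Suc k) * h = h * T (Suc k)" by (rule \<kappa>_central[symmetric])
  also have "h * T (Suc k) * (Tr k (T k) * T (Suc k)) = h * (T (Suc k) * Tr k (T k) * T (Suc k))"
    by (simp add: mult.assoc)
  also have "T (Suc k) * Tr k (T k) * T (Suc k) = Tr k (T k * T (Suc k) * T k)"
    using c by (simp add: Tr_mult B)
  finally show ?case using quad[of "Suc k"] Suc.prems by (simp add: algebra_simps)
qed

lemma L_cmt_T: "k < e \<Longrightarrow> Suc i < k \<Longrightarrow> cmt (T i) (L k)"
proof (cases k)
  case (Suc j)
  assume a: "k < e" "Suc i < k"
  have "cmt (T i) (Tr j (T j))" using a Suc far' by (intro Tr_cmt) auto
  then show ?thesis using a Suc L_Tr[of j] by (auto intro!: cmt_intros cmt_\<kappa> simp del: L.simps)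
qed simp

lemma L_cmt_L: "k < e \<Longrightarrow> j \<le> k \<Longrightarrow> cmt (L j) (L k)"
proof (induction j)
  case (Suc j)
  show ?case
  proof (cases "Suc j = k")
    case False
    then show ?thesis using Suc L_cmt_T[of k j] by (auto intro!: cmt_left_mult)
  qed simp
qed simp

lemma L_cmt: "k < e \<Longrightarrow> j < e \<Longrightarrow> cmt (L j) (L k)"
  using L_cmt_L by (metis cmt_sym nat_le_linear)

lemma TX: assumes "Suc k < e"
  shows "T k * L (Suc k) = L k * T k + h * L (Suc k)" "L (Suc k) * T k = T k * L k + h * L (Suc k)"
proof -
  have Q: "T k * T k = 1 + h * T k" using assms quad by simp
  have "T k * L (Suc k) = (T k * T k) * L k * T k" by (simp add: mult.assoc)
  then show "T k * L (Suc k) = L k * T k + h * L (Suc k)" by (simp add: Q algebra_simps)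
  have "L (Suc k) * T k = T k * L k * (T k * T k)" by (simp add: mult.assoc)
  also have "\<dots> = T k * L k + (T k * L k) * h * T k" by (simp add: Q algebra_simps)
  also have "(T k * L k) * h = h * (T k * L k)" by (rule \<kappa>_central[symmetric])
  finally show "L (Suc k) * T k = T k * L k + h * L (Suc k)" by (simp add: mult.assoc)
qed

declare L.simps(2) [simp del]

definition qpow :: "'k set" where "qpow = {q powi (2 * j) | j. True}"

lemma hh: "h * h + 1 + 1 = \<kappa> (q^2) + \<kappa> (inverse (q^2))"
proof -
  have "(q - inverse q) * (q - inverse q) + 1 + 1 = q^2 + inverse (q^2)"
    using q0 by (simp add: power2_eq_square field_simps)
  then have "\<kappa> ((q - inverse q) * (q - inverse q) + 1 + 1) = \<kappa> (q^2 + inverse (q^2))" by simp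
  then show ?thesis by (simp only: \<kappa>_add \<kappa>_mult \<kappa>_one)
qed

text \<open>The eigenvalues of all \<open>L\<^sub>k\<close> are even powers of \<open>q\<close>. If \<open>p\<close> annihilates \<open>X = L\<^sub>k\<close>, conjugation
  by the intertwiner gives \<open>p(Y) (X - q\<^sup>2 Y) (X - q\<^sup>-\<^sup>2 Y) = 0\<close> for \<open>Y = L\<^bsub>k+1\<^esub>\<close>; replacing \<open>X\<close> by
  each root of \<open>p\<close> in turn gives a polynomial that annihilates \<open>Y\<close>.\<close>
lemma L_roots:
  "k < e \<Longrightarrow> \<exists>rs. prod_list (map (\<lambda>r. L k - \<kappa> r) rs) = 0 \<and> set rs \<subseteq> qpow"
proof (induction k)
  case 0
  have "1 \<in> qpow" unfolding qpow_def by (auto intro!: exI[of _ 0])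
  then show ?case by (intro exI[of _ "[1]"]) (simp add: \<kappa>_one)
next
  case (Suc k)
  then obtain rs where rs: "prod_list (map (\<lambda>r. L k - \<kappa> r) rs) = 0" "set rs \<subseteq> qpow" by auto
  define X Y t where "X = L k" and "Y = L (Suc k)" and "t = T k"
  have XY: "cmt X Y" unfolding X_def Y_def using Suc.prems by (intro L_cmt) auto
  define \<phi> where "\<phi> = t * (X - Y) + h * Y"
  have "t * X = Y * t - h * Y" "t * Y = X * t + h * Y" "t * t = 1 + h * t"
    using TX[of k] quad[of k] Suc.prems by (simp_all add: X_def Y_def t_def algebra_simps del: L.simps)
  note \<phi> = affine_intertwiner[OF this XY[unfolded cmt_def, symmetric] \<kappa>_central[symmetric]
      \<kappa>_central[symmetric] \<kappa>_central[symmetric], folded \<phi>_def]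
  have \<phi>X: "\<phi> * X = Y * \<phi>" and \<phi>\<phi>: "\<phi> * \<phi> = h * h * X * Y - (X - Y) * (X - Y)"
    using \<phi> by simp_all
  define a b where "a = q^2" and "b = inverse (q^2)"
  have ab: "a * b = 1" using q0 by (simp add: a_def b_def)
  define s where "s = h * h + 1 + 1"
  have s: "s = \<kappa> a + \<kappa> b" using hh by (simp add: s_def a_def b_def)
  have sc: "s * x = x * s" for x using \<kappa>_central by (simp add: s algebra_simps)
  define g where "g x = x * x - s * (x * Y) + Y * Y" for x
  have gX: "\<phi> * \<phi> = - g X"
    using XY unfolding \<phi>\<phi> g_def s_def by (simp add: algebra_simps cmt_def)
  define p where "p y = prod_list (map (\<lambda>r. y - \<kappa> r) rs)" for y
  have step: "\<phi> * (X - \<kappa> r) = (Y - \<kappa> r) * \<phi>" for r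
    using \<phi>X \<kappa>_central[of r \<phi>] by (simp add: algebra_simps)
  have "\<phi> * prod_list (map (\<lambda>r. X - \<kappa> r) rs') = prod_list (map (\<lambda>r. Y - \<kappa> r) rs') * \<phi>" for rs'
  proof (induction rs')
    case (Cons r rs')
    have "\<phi> * ((X - \<kappa> r) * prod_list (map (\<lambda>r. X - \<kappa> r) rs'))
        = (Y - \<kappa> r) * (\<phi> * prod_list (map (\<lambda>r. X - \<kappa> r) rs'))"
      by (metis step mult.assoc)
    then show ?case by (simp add: Cons mult.assoc)
  qed simp
  from this[of rs] have "p Y * \<phi> = 0" using rs(1) by (simp add: p_def X_def)
  then have "p Y * (\<phi> * \<phi>) = 0" by (metis mult.assoc mult_zero_left)
  then have pg: "p Y * g X = 0" by (simp add: gX)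
  have pY: "cmt x (p Y)" if "cmt x Y" for x
    unfolding p_def by (rule cmt_prod_list) (auto intro!: cmt_diff that cmt_\<kappa>)
  define z where "z r = p Y * ((Y - \<kappa> (a * r)) * (Y - \<kappa> (b * r)))" for r
  define s' where "s' r = p Y * (s * Y - X - \<kappa> r)" for r
  have z: "z r = (X - \<kappa> r) * s' r" for r
  proof -
    have kr: "x * \<kappa> r = \<kappa> r * x" for x by (rule \<kappa>_central[symmetric])
    have kr2: "x * (\<kappa> r * y) = \<kappa> r * (x * y)" for x y by (metis kr mult.assoc)
    have "(Y - \<kappa> (a * r)) * (Y - \<kappa> (b * r)) = Y * Y - (\<kappa> a + \<kappa> b) * (\<kappa> r * Y) + \<kappa> (a * b) * (\<kappa> r * \<kappa> r)"
    proof -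
      have "\<kappa> (a * r) * \<kappa> (b * r) = \<kappa> (a * b) * (\<kappa> r * \<kappa> r)" by (simp flip: \<kappa>_mult add: ac_simps)
      moreover have "Y * \<kappa> (b * r) = \<kappa> b * (\<kappa> r * Y)" by (metis \<kappa>_central \<kappa>_mult mult.assoc)
      moreover have "\<kappa> (a * r) * Y = \<kappa> a * (\<kappa> r * Y)" by (simp add: \<kappa>_mult mult.assoc)
      ultimately show ?thesis by (simp add: algebra_simps)
    qed
    then have "(Y - \<kappa> (a * r)) * (Y - \<kappa> (b * r)) = g (\<kappa> r)"
      by (simp add: ab \<kappa>_one g_def s algebra_simps)
    then have "z r = p Y * (g (\<kappa> r) - g X)" using pg by (simp add: z_def right_diff_distrib)
    also have "g (\<kappa> r) - g X = (X - \<kappa> r) * (s * Y - X - \<kappa> r)"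
    proof -
      have sX: "X * (s * Y) = s * (X * Y)" by (metis sc mult.assoc)
      have sk: "\<kappa> r * (s * Y) = s * (\<kappa> r * Y)" by (metis sc mult.assoc)
      have "X * \<kappa> r = \<kappa> r * X" by (rule kr)
      then show ?thesis using sX sk unfolding g_def by (simp add: algebra_simps)
    qed
    also have "p Y * ((X - \<kappa> r) * (s * Y - X - \<kappa> r)) = (X - \<kappa> r) * s' r"
    proof -
      have "cmt (X - \<kappa> r) (p Y)" by (intro pY cmt_left_diff XY cmt_\<kappa>)
      then show ?thesis unfolding s'_def cmt_def by (metis mult.assoc)
    qed
    finally show ?thesis .
  qed
  have "prod_list (map z rs) = prod_list (map (\<lambda>r. X - \<kappa> r) rs) * prod_list (map s' rs)"
    unfolding z
  proof (rule prod_list_mult_cmt)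
    fix r r'
    have "cmt X s" using sc by (simp add: cmt_def)
    then show "cmt (X - \<kappa> r) (s' r')" unfolding s'_def
      by (intro cmt_left_diff cmt_mult pY cmt_diff cmt_\<kappa> XY) auto
  qed
  then have "prod_list (map z rs) = 0" using rs(1) by (simp add: X_def)
  moreover have "z = (\<lambda>r. prod_list (map (\<lambda>r'. Y - \<kappa> r') (rs @ [a * r, b * r])))"
    by (rule ext) (simp add: z_def p_def)
  ultimately have "prod_list (map (\<lambda>r'. Y - \<kappa> r') (concat (map (\<lambda>r. rs @ [a * r, b * r]) rs))) = 0"
    unfolding prod_list_map_concat map_map comp_def by simp
  moreover have "set (concat (map (\<lambda>r. rs @ [a * r, b * r]) rs)) \<subseteq> qpow"
  proof -
    have "a * r \<in> qpow \<and> b * r \<in> qpow" if "r \<in> qpow" for r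
    proof -
      obtain j where j: "r = q powi (2 * j)" using \<open>r \<in> qpow\<close> qpow_def by auto
      have "a * r = q powi (2 * (j + 1))" "b * r = q powi (2 * (j - 1))"
        using q0 by (simp_all add: a_def b_def j algebra_simps power_int_add power_int_diff
            power2_eq_square field_simps)
      then show ?thesis unfolding qpow_def by blast
    qed
    then show ?thesis using rs(2) by auto
  qed
  ultimately show ?case unfolding Y_def by blast
qed

lemma uni_shift:
  assumes "prod_list (map (\<lambda>r. L k - \<kappa> r) rs) = 0" "u \<notin> set rs"
  shows "uni (\<kappa> u - L k)"
proof (rule uni_if_uni_mod_roots[OF assms(1), where z = "\<lambda>r. \<kappa> (u - r)" and s = "\<lambda>r. - 1"])
  fix r assume "r \<in> set rs"
  then show "uni (\<kappa> (u - r))" using assms(2) by (intro uni_\<kappa>) auto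
qed (auto simp: \<kappa>_diff intro!: cmt_uminus cmt_\<kappa> cmt_diff)

lemma infinite_field: "infinite (UNIV :: 'k set)"
proof -
  have "inj (\<lambda>m::nat. q ^ m)"
  proof (rule linorder_injI)
    fix m n :: nat assume "m < n"
    then have "q ^ n = q ^ m * q ^ (n - m)" by (simp flip: power_add)
    then show "q ^ m \<noteq> q ^ n" using q_nru[of "n - m"] q0 \<open>m < n\<close> by auto
  qed
  then show ?thesis by (meson infinite_super range_inj_infinite subset_UNIV)
qed

text \<open>The polynomials \<open>\<Prod> (u - r)\<^sup>2\<close> and \<open>\<Prod> (u - q\<^sup>2 r) (u - q\<^sup>-\<^sup>2 r)\<close> differ: if \<open>r\<close> is the root with the
  largest exponent then \<open>q\<^sup>2 r\<close> is a zero of the second one only.\<close>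
lemma square_prod_neq:
  assumes "rs \<noteq> []" "set rs \<subseteq> qpow"
  shows "prod_list (map (\<lambda>r. [:- r, 1:] * [:- r, 1:]) rs)
       \<noteq> prod_list (map (\<lambda>r. [:- (q^2 * r), 1:] * [:- (inverse (q^2) * r), 1:]) rs)"
    (is "?F \<noteq> ?G")
proof
  assume eq: "?F = ?G"
  define J where "J = {j. q powi (2 * j) \<in> set rs}"
  have inj: "j = k" if "q powi (2 * j) = q powi (2 * k)" for j k :: int
  proof (rule ccontr)
    have main: False if "j < k" "q powi (2 * j) = q powi (2 * k)" for j k :: int
    proof -
      have "q powi (2 * k) = q powi (2 * j + 2 * (k - j))" by simp
      also have "\<dots> = q powi (2 * j) * q powi (2 * (k - j))" by (rule power_int_add) (use q0 in simp)
      also have "q powi (2 * (k - j)) = q ^ nat (2 * (k - j))" using that by (simp add: power_int_def)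
      finally have "q ^ nat (2 * (k - j)) = 1" using that(2) q0 by simp
      then show False using q_nru[of "nat (2 * (k - j))"] that by simp
    qed
    assume "j \<noteq> k"
    then show False using main[of j k] main[of k j] that by (cases "j < k") auto
  qed
  have "finite J" unfolding J_def
    by (rule finite_vimageI[of "set rs" "\<lambda>j::int. q powi (2 * j)", unfolded vimage_def])
       (auto intro: injI inj)
  moreover have "J \<noteq> {}"
  proof -
    obtain r where "r \<in> set rs" using assms(1) by (cases rs) auto
    then show ?thesis using assms(2) unfolding J_def qpow_def by auto
  qed
  ultimately have M: "Max J \<in> J" "\<And>j. j \<in> J \<Longrightarrow> j \<le> Max J" by auto
  define u where "u = q^2 * q powi (2 * Max J)"
  have u: "u = q powi (2 * (Max J + 1))"
    using q0 by (simp add: u_def power_int_add algebra_simps power2_eq_square)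
  have pp: "poly (prod_list (map f rs)) u = prod_list (map (\<lambda>r. poly (f r) u) rs)" for f :: "'k \<Rightarrow> 'k poly"
    by (induction rs) auto
  let ?g = "\<lambda>r. [:- (q^2 * r), 1:] * [:- (inverse (q^2) * r), 1:]"
  have "poly (?g (q powi (2 * Max J))) u = 0" unfolding poly_mult by (simp add: u_def)
  then have "0 \<in> set (map (\<lambda>r. poly (?g r) u) rs)"
    using M(1) unfolding J_def set_map by (intro image_eqI[of _ _ "q powi (2 * Max J)"]) (simp_all only: mem_Collect_eq J_def)
  then have "poly ?G u = 0" unfolding pp prod_list_zero_iff .
  then have "0 \<in> set (map (\<lambda>r. poly ([:- r, 1:] * [:- r, 1:]) u) rs)"
    unfolding eq[symmetric] pp prod_list_zero_iff .
  then obtain r where r: "r \<in> set rs" "u = r" unfolding poly_mult by auto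
  then have "q powi (2 * (Max J + 1)) \<in> set rs" using u by metis
  then have "Max J + 1 \<in> J" by (subst J_def) simp
  then show False using M(2)[of "Max J + 1"] by simp
qed

lemma generic_point:
  assumes R: "finite R" "R \<subseteq> qpow"
  obtains u where "u \<notin> R" "u \<noteq> 0" "u \<noteq> 1"
    "\<And>rs. rs \<noteq> [] \<Longrightarrow> length rs \<le> e \<Longrightarrow> set rs \<subseteq> R \<Longrightarrow>
      prod_list (map (\<lambda>r. (u - r) * (u - r)) rs)
      \<noteq> prod_list (map (\<lambda>r. (u - r) * (u - r) - (q - inverse q) * (q - inverse q) * (u * r)) rs)"
proof -
  define F G :: "'k list \<Rightarrow> 'k poly" where "F = (\<lambda>rs. prod_list (map (\<lambda>r. [:- r, 1:] * [:- r, 1:]) rs))"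
    and "G = (\<lambda>rs. prod_list (map (\<lambda>r. [:- (q^2 * r), 1:] * [:- (inverse (q^2) * r), 1:]) rs))"
  define RS where "RS = {rs. set rs \<subseteq> R \<and> length rs \<le> e} - {[]}"
  have "finite RS" unfolding RS_def using finite_lists_length_le[OF R(1)] by simp
  then have "finite (R \<union> {0, 1} \<union> (\<Union>rs\<in>RS. {u. poly (F rs - G rs) u = 0}))"
    using R square_prod_neq unfolding F_def G_def RS_def
    by (intro finite_UnI finite_UN_I poly_roots_finite) auto
  from ex_new_if_finite[OF infinite_field this]
  obtain u where u: "u \<notin> R \<union> {0, 1} \<union> (\<Union>rs\<in>RS. {u. poly (F rs - G rs) u = 0})" ..
  have pp: "poly (prod_list (map f rs)) u = prod_list (map (\<lambda>r. poly (f r) u) rs)"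
    for f :: "'k \<Rightarrow> 'k poly" and rs by (induction rs) auto
  have g: "poly ([:- (q^2 * r), 1:] * [:- (inverse (q^2) * r), 1:]) u
    = (u - r) * (u - r) - (q - inverse q) * (q - inverse q) * (u * r)" for r
    using q0 by (simp add: field_simps power2_eq_square)
  show ?thesis
  proof (rule that[of u])
    fix rs :: "'k list" assume "rs \<noteq> []" "length rs \<le> e" "set rs \<subseteq> R"
    then have "poly (F rs) u \<noteq> poly (G rs) u" using u unfolding RS_def by auto
    moreover have "poly (F rs) u = prod_list (map (\<lambda>r. (u - r) * (u - r)) rs)"
      unfolding F_def pp by (simp add: algebra_simps)
    moreover have "poly (G rs) u = prod_list (map (\<lambda>r. (u - r) * (u - r) - (q - inverse q) * (q - inverse q) * (u * r)) rs)"
      unfolding G_def pp g ..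
    ultimately show "prod_list (map (\<lambda>r. (u - r) * (u - r)) rs)
      \<noteq> prod_list (map (\<lambda>r. (u - r) * (u - r) - (q - inverse q) * (q - inverse q) * (u * r)) rs)"
      by simp
  qed (use u in auto)
qed

context
  fixes u :: 'k and R :: "'k set"
  assumes roots: "\<And>k. k < e \<Longrightarrow> \<exists>rs. prod_list (map (\<lambda>r. L k - \<kappa> r) rs) = 0 \<and> set rs \<subseteq> R"
    and uR: "u \<notin> R" and u0: "u \<noteq> 0" and u1: "u \<noteq> 1"
    and generic: "\<And>rs. rs \<noteq> [] \<Longrightarrow> length rs \<le> e \<Longrightarrow> set rs \<subseteq> R \<Longrightarrow>
      prod_list (map (\<lambda>r. (u - r) * (u - r)) rs)
      \<noteq> prod_list (map (\<lambda>r. (u - r) * (u - r) - (q - inverse q) * (q - inverse q) * (u * r)) rs)"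
begin

abbreviation "ff x \<equiv> (\<kappa> u - x) * (\<kappa> u - x)"
abbreviation "gg x \<equiv> ff x - h * h * (\<kappa> u * x)"

lemma uni_prod_diff:
  assumes "set ks \<subseteq> {..<e}"
    and "\<And>rs. length rs = length ks \<Longrightarrow> set rs \<subseteq> R \<Longrightarrow> \<alpha> * prod_list (map (\<lambda>r. (u - r) * (u - r)) rs)
      \<noteq> \<beta> * prod_list (map (\<lambda>r. (u - r) * (u - r) - (q - inverse q) * (q - inverse q) * (u * r)) rs)"
  shows "uni (\<kappa> \<alpha> * prod_list (map (\<lambda>k. ff (L k)) ks) - \<kappa> \<beta> * prod_list (map (\<lambda>k. gg (L k)) ks))"
  using assms
proof (induction ks arbitrary: \<alpha> \<beta>)
  case Nil
  then have "\<alpha> \<noteq> \<beta>" using Nil.prems(2)[of "[]"] by auto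
  then have "uni (\<kappa> (\<alpha> - \<beta>))" by (intro uni_\<kappa>) simp
  then show ?case by (simp add: \<kappa>_diff)
next
  case (Cons k ks)
  define f g where "f = (\<lambda>r. (u - r) * (u - r))"
    and "g = (\<lambda>r. (u - r) * (u - r) - (q - inverse q) * (q - inverse q) * (u * r))"
  define F G where "F = prod_list (map (\<lambda>k. ff (L k)) ks)" and "G = prod_list (map (\<lambda>k. gg (L k)) ks)"
  define X where "X = L k"
  obtain rs where rs: "prod_list (map (\<lambda>r. X - \<kappa> r) rs) = 0" "set rs \<subseteq> R"
    using roots Cons.prems(1) X_def by force
  have cL: "cmt (L k) (L j)" if "j \<in> set ks" for j using that Cons.prems(1) L_cmt by auto
  have XF: "cmt X F" "cmt X G" unfolding X_def F_def G_def
    by (auto intro!: cmt_prod_list cmt_intros cmt_\<kappa> cL)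
  have FG: "cmt F G"
  proof -
    have "cmt F (L j)" if "j \<in> set ks" for j
    proof (rule cmt_sym, unfold F_def, rule cmt_prod_list)
      fix y assume "y \<in> set (map (\<lambda>k. ff (L k)) ks)"
      then obtain k' where k': "k' \<in> set ks" "y = ff (L k')" by auto
      have "cmt (L j) (L k')" using that k' Cons.prems(1) by (intro L_cmt) auto
      then show "cmt (L j) y" using k' by (auto intro!: cmt_intros cmt_\<kappa>)
    qed
    then show ?thesis unfolding G_def by (auto intro!: cmt_prod_list cmt_intros cmt_\<kappa>)
  qed
  have kx: "x * \<kappa> r = \<kappa> r * x" "x * (\<kappa> r * y) = \<kappa> r * (x * y)" for x y r
    by (metis \<kappa>_central mult.assoc)+
  let ?y = "\<kappa> \<alpha> * (ff X * F) - \<kappa> \<beta> * (gg X * G)"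
  define s where "s r = \<kappa> \<alpha> * ((X + \<kappa> r - \<kappa> u - \<kappa> u) * F) - \<kappa> \<beta> * ((X + \<kappa> r - \<kappa> u - \<kappa> u - h * h * \<kappa> u) * G)" for r
  define z where "z r = \<kappa> (\<alpha> * f r) * F - \<kappa> (\<beta> * g r) * G" for r
  have kf: "\<kappa> (f r) = ff (\<kappa> r)" "\<kappa> (g r) = gg (\<kappa> r)" for r
    by (simp_all add: f_def g_def \<kappa>_diff \<kappa>_mult)
  have dec: "?y - z r = (X - \<kappa> r) * s r" for r
  proof -
    have 1: "ff X - ff (\<kappa> r) = (X - \<kappa> r) * (X + \<kappa> r - \<kappa> u - \<kappa> u)"
      using kx(1)[of X] kx(1)[of "\<kappa> r" u] by (simp add: algebra_simps)
    have 2: "gg X - gg (\<kappa> r) = (X - \<kappa> r) * (X + \<kappa> r - \<kappa> u - \<kappa> u - h * h * \<kappa> u)"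
    proof -
      have "h * h * (\<kappa> u * X) - h * h * (\<kappa> u * \<kappa> r) = (X - \<kappa> r) * (h * h * \<kappa> u)"
      proof -
        have "h * h * \<kappa> u = \<kappa> ((q - inverse q) * (q - inverse q) * u)" by (simp add: \<kappa>_mult)
        then have "(X - \<kappa> r) * (h * h * \<kappa> u) = (h * h * \<kappa> u) * (X - \<kappa> r)" by (metis \<kappa>_central)
        then show ?thesis by (simp add: right_diff_distrib mult.assoc)
      qed
      then show ?thesis using 1 by (simp add: algebra_simps)
    qed
    have "?y - z r = \<kappa> \<alpha> * ((ff X - ff (\<kappa> r)) * F) - \<kappa> \<beta> * ((gg X - gg (\<kappa> r)) * G)"
      by (simp add: z_def \<kappa>_mult kf left_diff_distrib right_diff_distrib mult.assoc)
    also have "\<dots> = (X - \<kappa> r) * s r"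
    proof -
      have "\<kappa> \<alpha> * (((X - \<kappa> r) * a) * F) - \<kappa> \<beta> * (((X - \<kappa> r) * b) * G)
        = (X - \<kappa> r) * (\<kappa> \<alpha> * (a * F) - \<kappa> \<beta> * (b * G))" for a b
        by (simp only: mult.assoc right_diff_distrib[of "X - \<kappa> r"] kx(2)[of "X - \<kappa> r"])
      then show ?thesis unfolding 1 2 s_def .
    qed
    finally show ?thesis .
  qed
  have "uni ?y"
  proof (rule uni_if_uni_mod_roots[OF rs(1), where z = z and s = s])
    show "cmt (X - \<kappa> r) (s r')" for r r'
      unfolding s_def by (intro cmt_left_diff cmt_diff cmt_mult cmt_add cmt_\<kappa> XF cmt_refl)
    show "cmt ?y (z r)" for r
      unfolding z_def using XF FG
      by (intro cmt_left_diff cmt_diff cmt_mult cmt_left_mult cmt_\<kappa> cmt_refl) (auto intro: cmt_sym)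
    show "uni (z r)" if "r \<in> set rs" for r unfolding z_def F_def G_def
    proof (rule Cons.IH)
      fix rs' :: "'k list" assume "length rs' = length ks" "set rs' \<subseteq> R"
      then show "\<alpha> * f r * prod_list (map (\<lambda>r. (u - r) * (u - r)) rs') \<noteq> \<beta> * g r *
          prod_list (map (\<lambda>r. (u - r) * (u - r) - (q - inverse q) * (q - inverse q) * (u * r)) rs')"
        using Cons.prems(2)[of "r # rs'"] that rs(2) by (auto simp: f_def g_def mult.assoc)
    qed (use Cons.prems in auto)
  qed (rule dec)
  then show ?case by (simp add: X_def F_def G_def)
qed

definition w where "w k = rinv (\<kappa> u - L k)"

lemma uni_w: "k < e \<Longrightarrow> uni (\<kappa> u - L k)"
  using uni_shift roots uR by (metis subsetD)
lemma w_inv: assumes "k < e" shows "(\<kappa> u - L k) * w k = 1" "w k * (\<kappa> u - L k) = 1"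
  using rinv[OF uni_w[OF assms]] by (simp_all add: w_def)
lemma uni_w': "k < e \<Longrightarrow> uni (w k)" using w_inv unfolding uni_def by blast
lemma cmt_w: "k < e \<Longrightarrow> cmt a (L k) \<Longrightarrow> cmt a (w k)"
  unfolding w_def by (intro cmt_rinv uni_w cmt_diff cmt_\<kappa>)

definition Q where "Q k = Tr k (w k)"

lemma Q_cmt: assumes "k < e" "i < k" shows "cmt (T i) (Q k)"
  unfolding Q_def using assms by (intro Tr_cmt cmt_w L_cmt_T) auto

lemma cmt_Tr: "(\<And>i. i < k \<Longrightarrow> cmt a (T i)) \<Longrightarrow> cmt a z \<Longrightarrow> cmt a (Tr k z)"
  unfolding cmt_def using Tr_mult[of k a z] by (simp add: cmt_def)

text \<open>The recursion for \<open>Q\<^sub>k = Tr\<^sub>k ((u - L\<^sub>k)\<^sup>-\<^sup>1)\<close> in the form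
  \<open>Z\<^bsub>k+1\<^esub> = Z\<^sub>k (1 - h\<^sup>2 u Y w\<^sup>2)\<close>, where \<open>Z\<^sub>k = (u - 1) - h\<^sup>2 u Q\<^sub>k\<close>, \<open>Y = L\<^bsub>k+1\<^esub>\<close> and \<open>w = (u - Y)\<^sup>-\<^sup>1\<close>.
  It combines \<open>T w T = v + h u v w T\<close> with the expansion of \<open>Y\<close> as a trace.\<close>
lemma Q_step:
  assumes k: "Suc k < e"
  defines "Z \<equiv> \<lambda>k. \<kappa> (u - 1) - h * h * (\<kappa> u * Q k)"
  shows "Z (Suc k) = Z k * (1 - h * h * (\<kappa> u * (L (Suc k) * (w (Suc k) * w (Suc k)))))"
proof -
  define X Y t v z where "X = L k" and "Y = L (Suc k)" and "t = T k" and "v = w k" and "z = w (Suc k)"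
  have XY: "cmt X Y" unfolding X_def Y_def using k by (intro L_cmt) auto
  have inv: "(\<kappa> u - X) * v = 1" "v * (\<kappa> u - X) = 1" "(\<kappa> u - Y) * z = 1" "z * (\<kappa> u - Y) = 1"
    using w_inv[of k] w_inv[of "Suc k"] k by (simp_all add: X_def Y_def v_def z_def del: L.simps)
  have kx: "x * \<kappa> r = \<kappa> r * x" "x * (\<kappa> r * y) = \<kappa> r * (x * y)" for x y r
    by (metis \<kappa>_central mult.assoc)+
  have vz: "cmt v Y" "cmt v z" "cmt z Y"
  proof -
    show "cmt v Y" unfolding v_def using XY k cmt_w[of k Y] by (auto simp: X_def intro: cmt_sym)
    then show "cmt v z" unfolding z_def using k Y_def by (intro cmt_w) auto
    show "cmt z Y" unfolding z_def Y_def using k by (intro cmt_sym[OF cmt_w]) auto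
  qed
  have tY: "t * Y = X * t + h * Y" using TX(1)[of k] k by (simp add: t_def Y_def X_def del: L.simps)
  have tt: "t * t = 1 + h * t" using quad k t_def by simp
  have Yz: "Y * z = \<kappa> u * z - 1" using inv(3) by (simp add: algebra_simps)
  have "t * (\<kappa> u - Y) = (\<kappa> u - X) * t - h * Y"
    using tY by (simp add: right_diff_distrib left_diff_distrib kx)
  then have "v * (t * (\<kappa> u - Y)) * z = v * ((\<kappa> u - X) * t - h * Y) * z" by simp
  then have tz: "v * t = t * z - h * (v * (Y * z))"
  proof -
    assume a: "v * (t * (\<kappa> u - Y)) * z = v * ((\<kappa> u - X) * t - h * Y) * z"
    have "v * (t * (\<kappa> u - Y)) * z = v * t * ((\<kappa> u - Y) * z)" by (simp only: mult.assoc)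
    moreover have "v * ((\<kappa> u - X) * t - h * Y) * z = (v * (\<kappa> u - X)) * (t * z) - v * h * (Y * z)"
      by (simp only: mult.assoc right_diff_distrib left_diff_distrib)
    ultimately show ?thesis using a by (simp add: inv kx mult.assoc)
  qed
  have tzt: "t * z * t = v + h * (\<kappa> u * (z * (v * t)))"
  proof -
    have "t * z = v * t + h * (v * (Y * z))" using tz by simp
    then have "t * z * t = v * (t * t) + h * (v * (Y * z) * t)"
      by (simp add: distrib_right mult.assoc)
    also have "\<dots> = v + h * (v * (t + Y * z * t))"
      by (simp add: tt distrib_left kx(2)[of v] mult.assoc)
    also have "t + Y * z * t = \<kappa> u * (z * t)" by (simp add: Yz left_diff_distrib mult.assoc)
    finally have "t * z * t = v + h * (\<kappa> u * ((v * z) * t))" by (simp add: kx(2)[of v] mult.assoc)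
    also have "(v * z) * t = z * (v * t)" using vz(2) by (simp add: cmt_def mult.assoc[symmetric])
    finally show ?thesis .
  qed
  have cT: "cmt z (T i)" "cmt Y (T i)" if "i < k" for i
  proof -
    have "cmt (T i) (L (Suc k))" using that k by (intro L_cmt_T) auto
    then show "cmt Y (T i)" "cmt z (T i)" unfolding z_def Y_def using k by (auto intro: cmt_sym cmt_w)
  qed
  have Trk: "Tr k (z * y) = z * Tr k y" "Tr k (Y * y) = Y * Tr k y" "Tr k (\<kappa> r * y) = \<kappa> r * Tr k y" for y r
    using Tr_mult(1)[of k _ y] cT cmt_\<kappa> by metis+
  have Trk': "Tr k (y * z) = Tr k y * z" for y using Tr_mult(2)[of k z y] cT by simp
  have QY: "cmt Y (Q k)" "cmt z (Q k)"
    unfolding Q_def using cT vz by (auto intro!: cmt_Tr simp: v_def[symmetric] cmt_sym)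
  have "Tr k (v * t) = Tr k t * z - h * ((Y * Q k) * z)"
  proof -
    have "v * (Y * z) = Y * (v * z)" using vz(1) by (simp add: cmt_def mult.assoc[symmetric])
    then have "v * t = t * z - h * (Y * (v * z))" using tz by simp
    then have "Tr k (v * t) = Tr k t * z - Tr k (h * (Y * (v * z)))" by (simp add: Tr_diff Trk')
    also have "Tr k (h * (Y * (v * z))) = h * (Y * (Tr k v * z))" by (simp add: Trk Trk')
    finally show ?thesis by (simp add: Q_def v_def mult.assoc)
  qed
  moreover have "h * Tr k t = Y - 1" using L_Tr[of k] k by (simp add: Y_def t_def del: L.simps)
  ultimately have trv: "h * Tr k (v * t) = (Y - 1 - h * h * (Y * Q k)) * z"
    by (simp add: right_diff_distrib left_diff_distrib flip: mult.assoc)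
  have "Q (Suc k) = z + Tr k (t * z * t)" by (simp add: Q_def z_def t_def)
  also have "\<dots> = z + Q k + \<kappa> u * (z * (h * Tr k (v * t)))"
  proof -
    have "Tr k (h * (\<kappa> u * (z * (v * t)))) = h * (\<kappa> u * (z * Tr k (v * t)))" by (simp add: Trk)
    also have "\<dots> = \<kappa> u * (h * (z * Tr k (v * t)))" by (rule kx(2))
    also have "h * (z * Tr k (v * t)) = z * (h * Tr k (v * t))" by (rule kx(2)[symmetric])
    finally show ?thesis by (simp add: tzt Tr_add Q_def v_def add.assoc)
  qed
  also have "\<dots> = z + Q k + \<kappa> u * (z * ((Y - 1 - h * h * (Y * Q k)) * z))" by (simp only: trv)
  finally have Qs: "Q (Suc k) = z + Q k + \<kappa> u * (z * ((Y - 1 - h * h * (Y * Q k)) * z))" .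
  have c: "z * Y = Y * z" "Q k * Y = Y * Q k" "Q k * z = z * Q k"
    using vz QY by (simp_all add: cmt_def)
  have c2: "z * (Y * x) = Y * (z * x)" "Q k * (Y * x) = Y * (Q k * x)" "Q k * (z * x) = z * (Q k * x)" for x
    using c by (metis mult.assoc)+
  have zz: "z = \<kappa> u * (z * z) - Y * (z * z)" using inv(3) by (metis left_diff_distrib mult.assoc mult_1)
  have "z + \<kappa> u * (z * ((Y - 1) * z)) = \<kappa> (u - 1) * (Y * (z * z))"
  proof -
    have "z * ((Y - 1) * z) = Y * (z * z) - z * z" by (simp add: algebra_simps c c2)
    then show ?thesis by (subst (1) zz) (simp add: \<kappa>_diff \<kappa>_one algebra_simps)
  qed
  note C = this
  define \<beta> where "\<beta> = (q - inverse q) * (q - inverse q) * u"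
  have hk: "h * h * (\<kappa> u * x) = \<kappa> \<beta> * x" for x
    by (simp add: \<beta>_def \<kappa>_mult mult.assoc)
  have kh: "\<kappa> u * (h * (h * x)) = \<kappa> \<beta> * x" for x
  proof -
    have "\<kappa> u * h * h = \<kappa> \<beta>" by (simp add: \<beta>_def ac_simps flip: \<kappa>_mult)
    then show ?thesis by (metis mult.assoc)
  qed
  have "\<kappa> u * (z * ((Y - 1 - h * h * (Y * Q k)) * z))
      = \<kappa> u * (z * ((Y - 1) * z)) - \<kappa> u * (h * (h * (Y * (z * (z * Q k)))))"
    by (simp add: left_diff_distrib right_diff_distrib mult.assoc c c2 kx(2)[of z])
  then have "Q (Suc k) = Q k + (z + \<kappa> u * (z * ((Y - 1) * z))) - \<kappa> u * (h * (h * (Y * (z * (z * Q k)))))"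
    unfolding Qs by simp
  then have Qs': "Q (Suc k) = Q k + \<kappa> (u - 1) * (Y * (z * z)) - \<kappa> \<beta> * (Y * (z * (z * Q k)))"
    by (simp only: C kh)
  have "\<kappa> \<beta> * (\<kappa> (u - 1) * x) = \<kappa> (u - 1) * (\<kappa> \<beta> * x)" for x by (rule kx(2))
  then show ?thesis unfolding Z_def Qs' Y_def[symmetric] z_def[symmetric] hk
    by (simp add: right_diff_distrib left_diff_distrib distrib_left mult.assoc c c2 kx(2)[of "Q k"])
qed

lemma Q_formula:
  "k < e \<Longrightarrow> \<kappa> (u - 1) - h * h * (\<kappa> u * Q k)
     = \<kappa> (u - 1) * prod_list (map (\<lambda>j. 1 - h * h * (\<kappa> u * (L j * (w j * w j)))) [0..<Suc k])"
proof (induction k)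
  case 0
  then have e: "0 < e" by simp
  have u1': "\<kappa> (u - 1) * w 0 = 1" using w_inv(1)[OF e] by (simp add: \<kappa>_diff \<kappa>_one)
  have kx: "\<kappa> (u - 1) * (\<kappa> a * x) = \<kappa> a * (\<kappa> (u - 1) * x)" for a x by (metis \<kappa>_central mult.assoc)
  have "\<kappa> (u - 1) * (w 0 * w 0) = w 0" using u1' by (simp flip: mult.assoc)
  then show ?case by (simp add: Q_def right_diff_distrib mult.assoc kx)
next
  case (Suc k)
  then show ?case using Q_step[of k] by (simp add: mult.assoc)
qed

lemma uni_Q: assumes k: "k < e" shows "uni (Q k)"
proof -
  define ks where "ks = [0..<Suc k]"
  have ks: "set ks \<subseteq> {..<e}" "ks \<noteq> []" "length ks \<le> e" using k by (auto simp: ks_def)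
  define F G W where "F = prod_list (map (\<lambda>k. ff (L k)) ks)" and "G = prod_list (map (\<lambda>k. gg (L k)) ks)"
    and "W = prod_list (map (\<lambda>k. w k * w k) ks)"
  have kx: "x * \<kappa> r = \<kappa> r * x" "x * (\<kappa> r * y) = \<kappa> r * (x * y)" for x y r
    by (metis \<kappa>_central mult.assoc)+
  have cw: "cmt (w i) (L j)" if "i < e" "j < e" for i j
    using that by (intro cmt_sym[OF cmt_w] L_cmt)
  have wwF: "w j * w j * ff (L j) = 1" if "j < e" for j
  proof -
    have "w j * w j * ff (L j) = w j * (w j * (\<kappa> u - L j)) * (\<kappa> u - L j)" by (simp only: mult.assoc)
    then show ?thesis by (simp add: w_inv that)
  qed
  have wwG: "w j * w j * gg (L j) = 1 - h * h * (\<kappa> u * (L j * (w j * w j)))" if "j < e" for j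
  proof -
    have "w j * L j = L j * w j" using cw[OF that that] by (simp add: cmt_def)
    then have "w j * (w j * L j) = L j * (w j * w j)" by (metis mult.assoc)
    moreover have "w j * w j * gg (L j) = w j * w j * ff (L j) - w j * w j * (h * h * (\<kappa> u * L j))"
      by (simp only: right_diff_distrib)
    moreover have "w j * w j * (h * h * (\<kappa> u * L j)) = h * h * (\<kappa> u * (w j * (w j * L j)))"
      by (simp only: mult.assoc kx(2)[of "w j"])
    ultimately show ?thesis using wwF[OF that] by simp
  qed
  have "W * F = prod_list (map (\<lambda>j. w j * w j * ff (L j)) ks)"
    unfolding W_def F_def using ks(1)
    by (intro prod_list_mult_cmt[symmetric]) (auto intro!: cmt_intros cmt_\<kappa> cw)
  also have "\<dots> = prod_list (map (\<lambda>_. 1) ks)" using wwF ks(1) by (intro arg_cong[of _ _ prod_list] map_cong) auto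
  also have "\<dots> = 1" by (induction ks) auto
  finally have WF: "W * F = 1" .
  have "W * G = prod_list (map (\<lambda>j. w j * w j * gg (L j)) ks)"
    unfolding W_def G_def using ks(1)
    by (intro prod_list_mult_cmt[symmetric]) (auto intro!: cmt_intros cmt_\<kappa> cw)
  also have "\<dots> = prod_list (map (\<lambda>j. 1 - h * h * (\<kappa> u * (L j * (w j * w j)))) ks)"
    using wwG ks(1) by (intro arg_cong[of _ _ prod_list] map_cong) auto
  finally have "\<kappa> (u - 1) - h * h * (\<kappa> u * Q k) = \<kappa> (u - 1) * (W * G)"
    using Q_formula[OF k] by (simp add: ks_def)
  then have "h * h * (\<kappa> u * Q k) = \<kappa> (u - 1) * (W * F) - \<kappa> (u - 1) * (W * G)"
    by (simp add: WF algebra_simps)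
  then have eq: "Q k * (h * h * \<kappa> u) = \<kappa> (u - 1) * (W * (F - G))"
    by (simp add: right_diff_distrib kx(1)[of "Q k"] kx(2)[of "Q k"] mult.assoc)
  have "uni (\<kappa> 1 * F - \<kappa> 1 * G)" unfolding F_def G_def
  proof (rule uni_prod_diff[OF ks(1)])
    fix rs :: "'k list" assume rs: "length rs = length ks" "set rs \<subseteq> R"
    then have "rs \<noteq> []" "length rs \<le> e" using ks by auto
    from generic[OF this rs(2)] show "1 * prod_list (map (\<lambda>r. (u - r) * (u - r)) rs)
      \<noteq> 1 * prod_list (map (\<lambda>r. (u - r) * (u - r) - (q - inverse q) * (q - inverse q) * (u * r)) rs)"
      by (simp only: mult_1_left not_False_eq_True)
  qed
  then have "uni (F - G)" by (simp add: \<kappa>_one)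
  moreover have "uni W" unfolding W_def using ks(1)
  proof (induction ks)
    case Nil then show ?case by (simp add: uni_def)
  qed (auto intro!: uni_mult uni_w')
  ultimately have "uni (\<kappa> (u - 1) * (W * (F - G)))" using u1 by (intro uni_mult uni_\<kappa>) auto
  then show ?thesis using eq by (rule uni_factor) (intro cmt_mult cmt_\<kappa>)
qed

definition cc where "cc k = w k * rinv (Q k)"

lemma cc_cmt: "k < e \<Longrightarrow> Suc i < k \<Longrightarrow> cmt (T i) (cc k)"
  unfolding cc_def by (intro cmt_mult cmt_w L_cmt_T cmt_rinv uni_Q Q_cmt) auto

lemma Tr_cc: assumes "k < e" shows "Tr k (cc k) = 1"
proof -
  have "cmt (rinv (Q k)) (T i)" if "i < k" for i
    using that assms by (intro cmt_sym[OF cmt_rinv] uni_Q Q_cmt)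
  then have "Tr k (w k * rinv (Q k)) = Tr k (w k) * rinv (Q k)" using Tr_mult(2)[of k "rinv (Q k)"] by simp
  then show ?thesis unfolding cc_def using rinv(1)[OF uni_Q[OF assms]] by (simp add: Q_def)
qed

fun av :: "nat \<Rightarrow> 'a \<Rightarrow> 'a" where
  "av 0 f = f"
| "av (Suc k) f = Tr (Suc k) (av k f * cc (Suc k))"

lemma av_cmt: "k < e \<Longrightarrow> i < k \<Longrightarrow> cmt (T i) (av k f)"
proof (induction k arbitrary: i)
  case (Suc k)
  show ?case unfolding av.simps using Suc cc_cmt[of "Suc k"]
    by (intro Tr_cmt cmt_mult) auto
qed simp

lemma av_bimodule:
  "(\<And>i. i < k \<Longrightarrow> cmt s (T i)) \<Longrightarrow> k < e \<Longrightarrow> av k (s * f) = s * av k f \<and> av k (f * s) = av k f * s"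
proof (induction k)
  case (Suc k)
  have "cmt s (L i)" if "i \<le> Suc k" for i using that Suc.prems
    by (induction i) (auto intro!: cmt_mult simp: L.simps(2))
  then have "cmt s (cc (Suc k))" unfolding cc_def Q_def using Suc.prems
    by (intro cmt_mult cmt_w cmt_rinv uni_Q[unfolded Q_def] cmt_Tr) auto
  then have "av k f * s * cc (Suc k) = av k f * cc (Suc k) * s" by (simp add: cmt_def mult.assoc)
  then show ?case using Suc Tr_mult[of "Suc k" s "av k f * cc (Suc k)"] by (simp add: mult.assoc del: Tr.simps)
qed simp

lemma av_one: "k < e \<Longrightarrow> av k 1 = 1"
  by (induction k) (simp_all del: Tr.simps add: Tr_cc)

lemma av_add: "av k (f + g) = av k f + av k g"
  by (induction k) (simp_all add: Tr_add distrib_right del: Tr.simps)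

end

text \<open>A conditional expectation onto the commutant of the Hecke algebra. Its existence is equivalent
  to semisimplicity; here \<open>av = Tr\<^bsub>e-1\<^esub> (\<dots> Tr\<^sub>1 (f c\<^sub>1) \<dots> c\<^bsub>e-1\<^esub>)\<close> with \<open>c\<^sub>k = (u - L\<^sub>k)\<^sup>-\<^sup>1 Q\<^sub>k\<^sup>-\<^sup>1\<close>
  chosen such that \<open>Tr\<^sub>k c\<^sub>k = 1\<close>.\<close>
theorem averaging:
  obtains av :: "'a \<Rightarrow> 'a" where
    "\<And>f i. Suc i < e \<Longrightarrow> T i * av f = av f * T i"
    "\<And>s f. (\<And>i. Suc i < e \<Longrightarrow> s * T i = T i * s) \<Longrightarrow> av (s * f) = s * av f"
    "\<And>s f. (\<And>i. Suc i < e \<Longrightarrow> s * T i = T i * s) \<Longrightarrow> av (f * s) = av f * s"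
    "\<And>f g. av (f + g) = av f + av g" "av 1 = 1"
proof (cases "e = 0")
  case True then show ?thesis by (intro that[of "\<lambda>f. f"]) auto
next
  case False
  have "\<exists>rs. \<forall>k<e. prod_list (map (\<lambda>r. L k - \<kappa> r) (rs k)) = 0 \<and> set (rs k) \<subseteq> qpow"
    using L_roots by metis
  then obtain rs where rs: "\<And>k. k < e \<Longrightarrow> prod_list (map (\<lambda>r. L k - \<kappa> r) (rs k)) = 0 \<and> set (rs k) \<subseteq> qpow"
    by blast
  define R where "R = (\<Union>k<e. set (rs k))"
  have R: "\<exists>rs. prod_list (map (\<lambda>r. L k - \<kappa> r) rs) = 0 \<and> set rs \<subseteq> R" if "k < e" for k
    using rs[OF that] that by (intro exI[of _ "rs k"]) (auto simp: R_def)
  have "finite R" "R \<subseteq> qpow" using rs by (auto simp: R_def)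
  then show ?thesis
  proof (rule generic_point)
    fix u
    assume u: "u \<notin> R" "u \<noteq> 0" "u \<noteq> 1"
      "\<And>rs. rs \<noteq> [] \<Longrightarrow> length rs \<le> e \<Longrightarrow> set rs \<subseteq> R \<Longrightarrow>
        prod_list (map (\<lambda>r. (u - r) * (u - r)) rs)
        \<noteq> prod_list (map (\<lambda>r. (u - r) * (u - r) - (q - inverse q) * (q - inverse q) * (u * r)) rs)"
    note ctx = R u
    show ?thesis
      by (rule that[of "av u (e - 1)"])
        (use False av_cmt[OF ctx, of "e - 1"] av_bimodule[OF ctx, of "e - 1"] av_one[OF ctx, of "e - 1"]
          av_add[OF ctx, of "e - 1"] in \<open>auto simp: cmt_def\<close>)
  qed
qed

end

section \<open>Linear functionals on monoid algebras\<close>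

text \<open>The linear extension of \<open>\<phi>\<close> from words to the monoid algebra.\<close>
definition lf :: "('w \<Rightarrow> 'k::field) \<Rightarrow> ('w \<Rightarrow>\<^sub>0 'k) \<Rightarrow> 'k" where
  "lf \<phi> f = (\<Sum>w\<in>Poly_Mapping.keys f. Poly_Mapping.lookup f w * \<phi> w)"

lemma lf_superset:
  assumes "finite A" "Poly_Mapping.keys f \<subseteq> A"
  shows "lf \<phi> f = (\<Sum>w\<in>A. Poly_Mapping.lookup f w * \<phi> w)"
  unfolding lf_def by (rule sum.mono_neutral_left) (use assms in \<open>auto simp: in_keys_iff\<close>)

lemma lf_add: "lf \<phi> (f + g) = lf \<phi> f + lf \<phi> g"
proof -
  let ?A = "Poly_Mapping.keys f \<union> Poly_Mapping.keys g"
  have "finite ?A" by simp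
  then show ?thesis
    using lf_superset[of ?A "f + g" \<phi>] lf_superset[of ?A f \<phi>] lf_superset[of ?A g \<phi>] keys_add[of f g]
    by (simp add: lookup_add distrib_right sum.distrib)
qed

lemma lf_zero [simp]: "lf \<phi> 0 = 0" by (simp add: lf_def)
lemma lf_sum: "lf \<phi> (\<Sum>i\<in>A. f i) = (\<Sum>i\<in>A. lf \<phi> (f i))"
  by (induction A rule: infinite_finite_induct) (auto simp: lf_add)
lemma lf_uminus: "lf \<phi> (- f) = - lf \<phi> f" using lf_add[of \<phi> f "- f"] by (simp add: eq_neg_iff_add_eq_0 add.commute)
lemma lf_diff: "lf \<phi> (f - g) = lf \<phi> f - lf \<phi> g" using lf_add[of \<phi> "f - g" g] by simp
lemma lf_single [simp]: "lf \<phi> (Poly_Mapping.single w a) = a * \<phi> w" by (simp add: lf_def)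

lemma pm_expand: "f = (\<Sum>w\<in>Poly_Mapping.keys f. Poly_Mapping.single w (Poly_Mapping.lookup f w))"
  by (rule poly_mapping_eqI) (auto simp: lookup_sum lookup_single when_def in_keys_iff)

lemma lf_cong: "(\<And>w. w \<in> Poly_Mapping.keys f \<Longrightarrow> \<phi> w = \<psi> w) \<Longrightarrow> lf \<phi> f = lf \<psi> f"
  by (simp add: lf_def)

lemma lf_lin: "lf (\<lambda>w. a * \<phi> w + b * \<psi> w) f = a * lf \<phi> f + b * lf \<psi> f"
  by (simp add: lf_def sum_distrib_left algebra_simps sum.distrib)

lemma lf_sum_fun: "lf (\<lambda>w. \<Sum>i\<in>A. \<phi> i w) f = (\<Sum>i\<in>A. lf (\<phi> i) f)"
  unfolding lf_def sum_distrib_left by (rule sum.swap)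

lemma lf_scale: "lf (\<lambda>w. a * \<phi> w) f = a * lf \<phi> f"
  using lf_lin[of a \<phi> 0 \<phi>] by simp

lemma lf_swap: "lf (\<lambda>w. lf (\<lambda>v. \<chi> w v) g) f = lf (\<lambda>v. lf (\<lambda>w. \<chi> w v) f) g"
  unfolding lf_def sum_distrib_left by (subst sum.swap) (simp add: ac_simps)

lemma lf_mult:
  fixes f g :: "('w::monoid_add) \<Rightarrow>\<^sub>0 'k::field"
  shows "lf \<phi> (f * g) = lf (\<lambda>u. lf (\<lambda>v. \<phi> (u + v)) g) f"
proof -
  have "f * g = (\<Sum>u\<in>Poly_Mapping.keys f. \<Sum>v\<in>Poly_Mapping.keys g.
      Poly_Mapping.single (u + v) (Poly_Mapping.lookup f u * Poly_Mapping.lookup g v))"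
    by (subst (1) pm_expand[of f], subst (1) pm_expand[of g])
       (simp add: sum_product mult_single)
  then show ?thesis by (simp add: lf_sum) (simp add: lf_def sum_distrib_left ac_simps)
qed

lemma lf_ftens: "lf \<phi> (ftens f g) = lf (\<lambda>u. lf (\<lambda>v. \<phi> (u, v)) g) f"
  unfolding ftens_def by (simp add: lf_sum) (simp add: lf_def sum_distrib_left ac_simps)

text \<open>A Hamel basis gives enough functionals to separate points from subspaces.\<close>
lemma separating_functional:
  fixes I :: "(('w::monoid_add) \<Rightarrow>\<^sub>0 'k::field) set"
  assumes "0 \<in> I" "\<And>f g. f \<in> I \<Longrightarrow> g \<in> I \<Longrightarrow> f + g \<in> I"
    and "\<And>a f. f \<in> I \<Longrightarrow> Poly_Mapping.single 0 a * f \<in> I" and x: "x \<notin> I"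
  obtains \<phi> where "lf \<phi> x \<noteq> 0" "\<And>f. f \<in> I \<Longrightarrow> lf \<phi> f = 0"
proof -
  define sc :: "'k \<Rightarrow> ('w \<Rightarrow>\<^sub>0 'k) \<Rightarrow> ('w \<Rightarrow>\<^sub>0 'k)" where "sc = (\<lambda>a f. Poly_Mapping.single 0 a * f)"
  interpret V: vector_space sc
    by unfold_locales (simp_all add: sc_def algebra_simps single_add mult.assoc[symmetric] mult_single)
  interpret K: vector_space "(*) :: 'k \<Rightarrow> 'k \<Rightarrow> 'k"
    by unfold_locales (simp_all add: algebra_simps)
  interpret P: vector_space_pair sc "(*) :: 'k \<Rightarrow> 'k \<Rightarrow> 'k" ..
  have sub: "V.subspace I" unfolding V.subspace_def using assms by (auto simp: sc_def)
  obtain B where B: "B \<subseteq> I" "V.independent B" "I \<subseteq> V.span B"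
    using V.maximal_independent_subset[of I] by auto
  have "V.span B = I" using B sub by (intro subset_antisym V.span_minimal) auto
  then have "V.independent (insert x B)" using x B(2) by (intro V.independent_insertI) auto
  from P.linear_independent_extend[OF this, of "\<lambda>y. if y = x then 1 else 0"]
  obtain ll where ll0: "Vector_Spaces.linear sc (*) ll" "\<forall>y\<in>insert x B. ll y = (if y = x then 1 else 0)"
    by blast
  then have ll: "Vector_Spaces.linear sc (*) ll" "\<And>y. y \<in> insert x B \<Longrightarrow> ll y = (if y = x then 1 else 0)"
    by auto
  interpret ll: Vector_Spaces.linear sc "(*) :: 'k \<Rightarrow> 'k \<Rightarrow> 'k" ll by fact
  have llB: "ll y = 0" if "y \<in> I" for y
  proof -
    have b: "ll b = 0" if "b \<in> B" for b using ll(2)[of b] that B(1) x by auto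
    have "y \<in> V.span B" using that B by auto
    then show ?thesis
      by (induction rule: V.span_induct_alt) (simp_all add: b ll.add ll.scale)
  qed
  define \<phi> where "\<phi> w = ll (Poly_Mapping.single w 1)" for w
  have \<phi>: "lf \<phi> f = ll f" for f
  proof -
    have "f = (\<Sum>w\<in>Poly_Mapping.keys f. sc (Poly_Mapping.lookup f w) (Poly_Mapping.single w 1))"
      by (subst (1) pm_expand[of f]) (simp add: sc_def mult_single)
    then have "ll f = (\<Sum>w\<in>Poly_Mapping.keys f. ll (sc (Poly_Mapping.lookup f w) (Poly_Mapping.single w 1)))"
      by (metis (no_types, lifting) ll.sum sum.cong)
    then show ?thesis by (simp add: ll.scale lf_def \<phi>_def)
  qed
  show ?thesis by (rule that[of \<phi>]) (simp_all add: \<phi> ll(2) llB)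
qed

definition submon :: "('w::monoid_add) set \<Rightarrow> bool" where
  "submon W \<longleftrightarrow> 0 \<in> W \<and> (\<forall>u\<in>W. \<forall>v\<in>W. u + v \<in> W)"

text \<open>The monoid algebra of the submonoid \<open>W\<close>. Both free algebras of the definition of \<open>A\<^sub>q(n, n)\<close> are
  instances.\<close>
definition MA :: "('w::monoid_add) set \<Rightarrow> ('w \<Rightarrow>\<^sub>0 'k::field) ring" where
  "MA W = \<lparr>carrier = {f. Poly_Mapping.keys f \<subseteq> W}, monoid.mult = (*), one = 1, zero = 0, add = (+)\<rparr>"

lemma MA_simps [simp]:
  "carrier (MA W) = {f. Poly_Mapping.keys f \<subseteq> W}" "monoid.mult (MA W) = (*)" "one (MA W) = 1"
  "zero (MA W) = 0" "add (MA W) = (+)"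
  by (simp_all add: MA_def)

lemma submon_words: "submon (words n)"
  by (auto simp: submon_def words_def zero_list_def plus_list_def)
lemma submon_words2: "submon (words n \<times> words n)"
  using submon_words[of n] by (auto simp: submon_def zero_prod_def)

lemma Free_MA: "Free n = MA (words n)" by (simp add: Free_def MA_def)
lemma Free2_MA: "Free2 n = MA (words n \<times> words n)" by (simp add: Free2_def MA_def)

lemma keys_mult_sub: "submon W \<Longrightarrow> Poly_Mapping.keys f \<subseteq> W \<Longrightarrow> Poly_Mapping.keys g \<subseteq> W \<Longrightarrow> Poly_Mapping.keys (f * g) \<subseteq> W"
  unfolding submon_def
  by (rule order_trans[OF keys_mult]) (clarify, meson subsetD)
lemma keys_add_sub: "Poly_Mapping.keys f \<subseteq> W \<Longrightarrow> Poly_Mapping.keys g \<subseteq> W \<Longrightarrow> Poly_Mapping.keys (f + g) \<subseteq> W"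
  using keys_add[of f g] by blast
lemma keys_diff_sub: "Poly_Mapping.keys f \<subseteq> W \<Longrightarrow> Poly_Mapping.keys g \<subseteq> W \<Longrightarrow> Poly_Mapping.keys (f - g) \<subseteq> W"
  using keys_diff[of f g] by blast
lemma keys_sum_sub: "(\<And>i. i \<in> A \<Longrightarrow> Poly_Mapping.keys (f i) \<subseteq> W) \<Longrightarrow> Poly_Mapping.keys (\<Sum>i\<in>A. f i) \<subseteq> W"
  using keys_sum[of f A] by blast

lemma keys_one_sub: "submon W \<Longrightarrow> Poly_Mapping.keys (1 :: 'w::monoid_add \<Rightarrow>\<^sub>0 'k::field) \<subseteq> W"
  by (simp flip: single_one add: submon_def)

lemma ring_MA:
  fixes W :: "'w::monoid_add set"
  assumes "submon W" shows "ring (MA W :: ('w \<Rightarrow>\<^sub>0 'k::field) ring)"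
proof (rule ringI)
  show "abelian_group (MA W)"
  proof (rule abelian_groupI)
    fix x assume "x \<in> carrier (MA W)"
    then show "\<exists>y\<in>carrier (MA W). y \<oplus>\<^bsub>MA W\<^esub> x = \<zero>\<^bsub>MA W\<^esub>" by (intro bexI[of _ "- x"]) auto
  qed (auto simp: keys_add_sub add.assoc add.commute)
  show "Group.monoid (MA W)"
    by (rule monoidI) (use keys_mult_sub[OF assms] keys_one_sub[OF assms] in \<open>simp_all add: mult.assoc\<close>)
qed (simp_all add: distrib_left distrib_right)

locale quotient_algebra =
  fixes W :: "('w::monoid_add) set" and I :: "('w \<Rightarrow>\<^sub>0 'k::field) set"
  assumes W: "submon W" and I: "ideal I (MA W)"
begin

interpretation ideal I "MA W" by (rule I)

lemma I_keys: "f \<in> I \<Longrightarrow> Poly_Mapping.keys f \<subseteq> W" using a_subset by auto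
lemma I_zero: "0 \<in> I" using additive_subgroup.zero_closed[OF additive_subgroup_axioms] by simp
lemma I_add: "f \<in> I \<Longrightarrow> g \<in> I \<Longrightarrow> f + g \<in> I" using additive_subgroup.a_closed[OF additive_subgroup_axioms, of f g] by simp
lemma I_mult: "f \<in> I \<Longrightarrow> Poly_Mapping.keys g \<subseteq> W \<Longrightarrow> g * f \<in> I" "f \<in> I \<Longrightarrow> Poly_Mapping.keys g \<subseteq> W \<Longrightarrow> f * g \<in> I"
  using I_l_closed I_r_closed by auto
lemma I_sc: "f \<in> I \<Longrightarrow> Poly_Mapping.single 0 a * f \<in> I"
  using I_mult(1)[of f "Poly_Mapping.single 0 a"] W by (auto simp: submon_def)
lemma I_uminus: "f \<in> I \<Longrightarrow> - f \<in> I" using I_sc[of f "- 1"] by (simp add: single_uminus)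
lemma coset: "I +>\<^bsub>MA W\<^esub> f = {i + f | i. i \<in> I}" by (auto simp: a_r_coset_def')
lemma coset_self: "f \<in> I +>\<^bsub>MA W\<^esub> f" unfolding coset using I_zero by force
lemma coset_eq: "I +>\<^bsub>MA W\<^esub> f = I +>\<^bsub>MA W\<^esub> g \<longleftrightarrow> f - g \<in> I"
proof
  assume "I +>\<^bsub>MA W\<^esub> f = I +>\<^bsub>MA W\<^esub> g"
  then obtain i where "i \<in> I" "f = i + g" using coset_self[of f] coset by auto
  then show "f - g \<in> I" by simp
next
  have sub: "I +>\<^bsub>MA W\<^esub> f \<subseteq> I +>\<^bsub>MA W\<^esub> g" if "f - g \<in> I" for f g
  proof
    fix x assume "x \<in> I +>\<^bsub>MA W\<^esub> f"
    then obtain i where "i \<in> I" "x = i + f" using coset by auto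
    then have "i + (f - g) \<in> I" "x = (i + (f - g)) + g" using I_add[of i "f - g"] that by simp_all
    then show "x \<in> I +>\<^bsub>MA W\<^esub> g" unfolding coset by blast
  qed
  assume a: "f - g \<in> I"
  then have "g - f \<in> I" using I_uminus by fastforce
  then show "I +>\<^bsub>MA W\<^esub> f = I +>\<^bsub>MA W\<^esub> g" using sub a by blast
qed
lemma coset_mem: "f \<in> I +>\<^bsub>MA W\<^esub> g \<longleftrightarrow> f - g \<in> I"
proof
  assume "f - g \<in> I"
  then show "f \<in> I +>\<^bsub>MA W\<^esub> g" unfolding coset by (intro CollectI exI[of _ "f - g"]) simp
qed (auto simp: coset)

lemma ring_quot: "ring (MA W Quot I)" by (rule quotient_is_ring)
lemma quot_carrier_eq: "carrier (MA W Quot I) = {I +>\<^bsub>MA W\<^esub> f | f. Poly_Mapping.keys f \<subseteq> W}"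
  by (auto simp: FactRing_def A_RCOSETS_def')
lemma quot_carrier: "Poly_Mapping.keys f \<subseteq> W \<Longrightarrow> I +>\<^bsub>MA W\<^esub> f \<in> carrier (MA W Quot I)"
  by (auto simp: quot_carrier_eq)
lemma quot_carrierE:
  assumes "a \<in> carrier (MA W Quot I)" obtains f where "Poly_Mapping.keys f \<subseteq> W" "a = I +>\<^bsub>MA W\<^esub> f"
  using assms by (auto simp: quot_carrier_eq)
lemma quot_mult: "Poly_Mapping.keys f \<subseteq> W \<Longrightarrow> Poly_Mapping.keys g \<subseteq> W \<Longrightarrow>
    (I +>\<^bsub>MA W\<^esub> f) \<otimes>\<^bsub>MA W Quot I\<^esub> (I +>\<^bsub>MA W\<^esub> g) = I +>\<^bsub>MA W\<^esub> (f * g)"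
  using rcoset_mult_add[of f g] by (simp add: FactRing_def)
lemma quot_add: "Poly_Mapping.keys f \<subseteq> W \<Longrightarrow> Poly_Mapping.keys g \<subseteq> W \<Longrightarrow>
    (I +>\<^bsub>MA W\<^esub> f) \<oplus>\<^bsub>MA W Quot I\<^esub> (I +>\<^bsub>MA W\<^esub> g) = I +>\<^bsub>MA W\<^esub> (f + g)"
  using a_rcos_sum[of f g] by (simp add: FactRing_def)
lemma quot_finsum: "finite A \<Longrightarrow> (\<And>i. i \<in> A \<Longrightarrow> Poly_Mapping.keys (f i) \<subseteq> W) \<Longrightarrow>
    finsum (MA W Quot I) (\<lambda>i. I +>\<^bsub>MA W\<^esub> f i) A = I +>\<^bsub>MA W\<^esub> (\<Sum>i\<in>A. f i)"
proof (induction A rule: finite_induct)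
  case empty
  interpret Q: ring "MA W Quot I" by (rule ring_quot)
  have "I +>\<^bsub>MA W\<^esub> 0 = I" by (auto simp: coset)
  moreover have "zero (MA W Quot I) = I" by (simp add: FactRing_def)
  ultimately show ?case by simp
next
  case (insert x A)
  interpret Q: ring "MA W Quot I" by (rule ring_quot)
  have "finsum (MA W Quot I) (\<lambda>i. I +>\<^bsub>MA W\<^esub> f i) (insert x A)
    = (I +>\<^bsub>MA W\<^esub> f x) \<oplus>\<^bsub>MA W Quot I\<^esub> finsum (MA W Quot I) (\<lambda>i. I +>\<^bsub>MA W\<^esub> f i) A"
    using insert by (intro Q.finsum_insert) (auto intro: quot_carrier)
  then show ?case using insert by (simp add: quot_add keys_sum_sub)
qed

end

section \<open>The relations in terms of functionals\<close>

text \<open>The action of \<open>R\<^sub>n\<close> on coordinates: if \<open>x\<close> and \<open>y\<close> are the coordinates of a vector at \<open>v\<^sub>a \<otimes> v\<^sub>b\<close> and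
  \<open>v\<^sub>b \<otimes> v\<^sub>a\<close> then \<open>hk q a b x y\<close> is that of its image at \<open>v\<^sub>a \<otimes> v\<^sub>b\<close>.\<close>
definition hk :: "'k::field \<Rightarrow> nat \<Rightarrow> nat \<Rightarrow> 'k \<Rightarrow> 'k \<Rightarrow> 'k" where
  "hk q a b x y = (if a = b then q * x else if a < b then y else (q - inverse q) * x + y)"

lemma hk_coeff: "hk q a b x y
  = (if a = b then q else if a < b then 0 else q - inverse q) * x + (if a = b then 0 else 1) * y"
  by (simp add: hk_def)

lemma Rcoef_alt: "Rcoef q a b s t =
   (if a = b then (if s = a \<and> t = a then q else 0)
    else (if s = a \<and> t = b \<and> b < a then q - inverse q else 0) + (if s = b \<and> t = a then 1 else 0))"
  by (auto simp: Rcoef_def)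

lemma sum_delta2:
  assumes "a < n" "b < (n::nat)"
  shows "(\<Sum>s<n. \<Sum>t<n. (if s = a \<and> t = b \<and> P then c else 0) * X s t) = (if P then c * X a b else (0::'k::field))"
proof -
  have 1: "(if s = a \<and> t = b \<and> P then c else 0) * X s t
    = (if s = a then (if t = b then (if P then c * X a b else 0) else 0) else 0)" for s t
    by auto
  have 2: "(\<Sum>t<n. if s = a then (if t = b then K else 0) else 0) = (if s = a then K else (0::'k))" for s K
    using assms by (cases "s = a") simp_all
  show ?thesis unfolding 1 2 using assms by simp
qed

lemma sum_Rcoef_left:
  assumes "a < n" "b < n"
  shows "(\<Sum>s<n. \<Sum>t<n. Rcoef q a b s t * X s t) = hk q a b (X a b) (X b a)"
  using sum_delta2[OF assms, of "b < a" "q - inverse q" X] sum_delta2[OF assms(2,1), of True 1 X]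
    sum_delta2[OF assms(1,1), of True q X]
  by (auto simp: Rcoef_alt hk_def distrib_right sum.distrib)

lemma Rcoef_sym: "Rcoef q s t i j = Rcoef q i j s t"
  by (auto simp: Rcoef_def)

lemma sum_Rcoef_right:
  assumes "i < n" "j < n"
  shows "(\<Sum>s<n. \<Sum>t<n. Rcoef q s t i j * X s t) = hk q i j (X i j) (X j i)"
  using sum_Rcoef_left[OF assms] by (simp add: Rcoef_sym[of q _ _ i j])

text \<open>The functionals on words that descend to \<open>A\<^sub>q(n, n)\<close>. Read as a matrix indexed by row words and
  column words, the restriction of such a functional to words of a fixed length commutes with the
  action of the Hecke algebra.\<close>
definition Rinv :: "nat \<Rightarrow> 'k::field \<Rightarrow> (word \<Rightarrow> 'k) \<Rightarrow> bool" where
  "Rinv n q \<phi> \<longleftrightarrow> (\<forall>u\<in>words n. \<forall>v\<in>words n. \<forall>a<n. \<forall>b<n. \<forall>i<n. \<forall>j<n.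
     hk q a b (\<phi> (u @ [(a, i), (b, j)] @ v)) (\<phi> (u @ [(b, i), (a, j)] @ v))
     = hk q i j (\<phi> (u @ [(a, i), (b, j)] @ v)) (\<phi> (u @ [(a, j), (b, i)] @ v)))"

lemma lf_relator:
  assumes "a < n" "b < n" "i < n" "j < n"
  shows "lf \<phi> (relator n q a b i j) = hk q a b (\<phi> [(a, i), (b, j)]) (\<phi> [(b, i), (a, j)])
     - hk q i j (\<phi> [(a, i), (b, j)]) (\<phi> [(a, j), (b, i)])"
proof -
  have m: "const c * var s i * var t j = Poly_Mapping.single [(s, i), (t, j)] (c::'k::field)" for c s i t j
    by (simp add: const_def var_def mult_single plus_list_def)
  show ?thesis unfolding relator_def m
    by (simp add: lf_diff lf_sum sum_Rcoef_left[OF assms(1,2)] sum_Rcoef_right[OF assms(3,4)])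
qed

lemma words_append: "u @ v \<in> words n \<longleftrightarrow> u \<in> words n \<and> v \<in> words n" by (auto simp: words_def)
lemma words_Cons: "(a, i) # v \<in> words n \<longleftrightarrow> a < n \<and> i < n \<and> v \<in> words n" by (auto simp: words_def)
lemma words_Nil [simp]: "[] \<in> words n" by (auto simp: words_def)

lemma keys_relator:
  assumes "a < n" "b < n" "i < n" "j < n"
  shows "Poly_Mapping.keys (relator n q a b i j :: 'k::field falg) \<subseteq> words n"
proof -
  have m: "const c * var s i * var t j = Poly_Mapping.single [(s, i), (t, j)] (c::'k::field)" for c s i t j
    by (simp add: const_def var_def mult_single plus_list_def)
  show ?thesis unfolding relator_def m
    by (intro keys_diff_sub keys_sum_sub) (use assms in \<open>auto simp: words_Cons split: if_splits\<close>)
qed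

lemma relators_sub: "relators n q \<subseteq> carrier (MA (words n))"
  using keys_relator by (fastforce simp: relators_def)

lemma quotient_Aq: "quotient_algebra (words n) (rel_ideal n q)"
proof (rule quotient_algebra.intro)
  show "submon (words n)" by (rule submon_words)
  show "ideal (rel_ideal n q) (MA (words n))" unfolding rel_ideal_def Free_MA
    by (rule ring.genideal_ideal[OF ring_MA[OF submon_words] relators_sub])
qed

lemma Rinv_context:
  assumes "Rinv n q \<phi>" "u \<in> words n" "v \<in> words n"
  shows "Rinv n q (\<lambda>w. \<phi> (u @ w @ v))"
  unfolding Rinv_def
proof (intro ballI allI impI)
  fix u' v' :: word and a b i j assume *: "u' \<in> words n" "v' \<in> words n" "a < n" "b < n" "i < n" "j < n"
  have "u @ u' \<in> words n" "v' @ v \<in> words n" using * assms by (auto simp: words_append)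
  with assms(1)[unfolded Rinv_def] * show
    "hk q a b (\<phi> (u @ (u' @ [(a, i), (b, j)] @ v') @ v)) (\<phi> (u @ (u' @ [(b, i), (a, j)] @ v') @ v)) =
     hk q i j (\<phi> (u @ (u' @ [(a, i), (b, j)] @ v') @ v)) (\<phi> (u @ (u' @ [(a, j), (b, i)] @ v') @ v))"
    by (metis append.assoc)
qed

lemma ideal_annihilator:
  fixes \<Phi> :: "('w::monoid_add \<Rightarrow> 'k::field) set"
  assumes W: "submon W"
    and left: "\<And>\<phi> u. \<phi> \<in> \<Phi> \<Longrightarrow> u \<in> W \<Longrightarrow> (\<lambda>w. \<phi> (u + w)) \<in> \<Phi>"
    and right: "\<And>\<phi> u. \<phi> \<in> \<Phi> \<Longrightarrow> u \<in> W \<Longrightarrow> (\<lambda>w. \<phi> (w + u)) \<in> \<Phi>"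
  shows "ideal {f. Poly_Mapping.keys f \<subseteq> W \<and> (\<forall>\<phi>\<in>\<Phi>. lf \<phi> f = 0)} (MA W)"
    (is "ideal ?J _")
proof -
  interpret ring "MA W :: ('w \<Rightarrow>\<^sub>0 'k) ring" by (rule ring_MA[OF W])
  have ml: "lf \<phi> (g * f) = 0" if "f \<in> ?J" "Poly_Mapping.keys g \<subseteq> W" "\<phi> \<in> \<Phi>" for f g \<phi>
  proof -
    have "lf (\<lambda>v. \<phi> (u + v)) f = 0" if "u \<in> Poly_Mapping.keys g" for u
      using that \<open>f \<in> ?J\<close> \<open>Poly_Mapping.keys g \<subseteq> W\<close> left[OF \<open>\<phi> \<in> \<Phi>\<close>, of u] by auto
    then show ?thesis unfolding lf_mult by (simp add: lf_def[of _ g])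
  qed
  have mr: "lf \<phi> (f * g) = 0" if "f \<in> ?J" "Poly_Mapping.keys g \<subseteq> W" "\<phi> \<in> \<Phi>" for f g \<phi>
  proof -
    have "lf (\<lambda>v. \<phi> (v + u)) f = 0" if "u \<in> Poly_Mapping.keys g" for u
      using that \<open>f \<in> ?J\<close> \<open>Poly_Mapping.keys g \<subseteq> W\<close> right[OF \<open>\<phi> \<in> \<Phi>\<close>, of u] by auto
    then show ?thesis unfolding lf_mult lf_swap[of _ g] by (simp add: lf_def[of _ g])
  qed
  show ?thesis
  proof (rule idealI[OF ring_MA[OF W]])
    show "subgroup ?J (add_monoid (MA W))"
    proof (rule group.subgroupI[OF add.is_group])
      show "?J \<noteq> {}" by (auto intro!: exI[of _ 0])
      fix a b assume a: "a \<in> ?J"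
      then have "- a \<in> ?J" "- a \<oplus>\<^bsub>MA W\<^esub> a = \<zero>\<^bsub>MA W\<^esub>" by (simp_all add: lf_uminus)
      moreover have "\<ominus>\<^bsub>MA W\<^esub> a = - a"
        by (rule minus_equality) (use a in simp_all)
      ultimately show "inv\<^bsub>add_monoid (MA W)\<^esub> a \<in> ?J" by (simp add: a_inv_def)
      assume "b \<in> ?J"
      then show "a \<otimes>\<^bsub>add_monoid (MA W)\<^esub> b \<in> ?J" using a keys_add_sub[of a W b] by (simp add: lf_add)
    qed auto
  next
    fix a x :: "'w \<Rightarrow>\<^sub>0 'k" assume *: "a \<in> ?J" "x \<in> carrier (MA W)"
    then show "x \<otimes>\<^bsub>MA W\<^esub> a \<in> ?J" "a \<otimes>\<^bsub>MA W\<^esub> x \<in> ?J"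
      using ml mr keys_mult_sub[OF W, of x a] keys_mult_sub[OF W, of a x] by simp_all
  qed
qed

lemma Rinv_kills:
  assumes "Rinv n q \<phi>" "f \<in> rel_ideal n q"
  shows "lf \<phi> f = 0"
proof -
  let ?J = "{f. Poly_Mapping.keys f \<subseteq> words n \<and> (\<forall>\<phi>\<in>Collect (Rinv n q). lf \<phi> f = 0)}"
  have "ideal ?J (MA (words n))"
    by (rule ideal_annihilator[OF submon_words])
      (use Rinv_context[of n q _ _ "[]"] Rinv_context[of n q _ "[]"] in \<open>auto simp: plus_list_def\<close>)
  moreover have "relators n q \<subseteq> ?J"
  proof
    fix r assume "r \<in> relators n q"
    then obtain a b i j where r: "r = relator n q a b i j" "a < n" "b < n" "i < n" "j < n"
      by (auto simp: relators_def)
    have "lf \<phi> r = 0" if "Rinv n q \<phi>" for \<phi>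
      using that[unfolded Rinv_def, rule_format, of "[]" "[]" a b i j] r by (simp add: lf_relator)
    then show "r \<in> ?J" using keys_relator[of a n b i j q] r by auto
  qed
  ultimately have "rel_ideal n q \<subseteq> ?J" unfolding rel_ideal_def Free_MA
    by (rule ring.genideal_minimal[OF ring_MA[OF submon_words]])
  then show ?thesis using assms by auto
qed


lemma lf_context:
  fixes f :: "('w::monoid_add) \<Rightarrow>\<^sub>0 'k::field"
  shows "lf \<phi> (Poly_Mapping.single u 1 * f * Poly_Mapping.single v 1) = lf (\<lambda>w. \<phi> (u + w + v)) f"
  by (simp add: lf_mult)

text \<open>Duality. Invariance of a functional means that it kills the relators multiplied by words on both sides,
  and these span the ideal; a Hamel basis provides enough functionals that kill the ideal.\<close>
lemma mem_rel_ideal: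
  assumes "Poly_Mapping.keys f \<subseteq> words n"
  shows "f \<in> rel_ideal n q \<longleftrightarrow> (\<forall>\<phi>. Rinv n q \<phi> \<longrightarrow> lf \<phi> f = 0)"
proof
  assume *: "\<forall>\<phi>. Rinv n q \<phi> \<longrightarrow> lf \<phi> f = 0"
  interpret quotient_algebra "words n" "rel_ideal n q" by (rule quotient_Aq)
  show "f \<in> rel_ideal n q"
  proof (rule ccontr)
    assume "f \<notin> rel_ideal n q"
    then obtain \<phi> where \<phi>: "lf \<phi> f \<noteq> 0" "\<And>g. g \<in> rel_ideal n q \<Longrightarrow> lf \<phi> g = 0"
      using separating_functional[OF I_zero I_add I_sc] by metis
    have "Rinv n q \<phi>" unfolding Rinv_def
    proof (intro ballI allI impI)
      fix u v :: word and a b i j assume *: "u \<in> words n" "v \<in> words n" "a < n" "b < n" "i < n" "j < n"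
      have "relator n q a b i j \<in> relators n q" using * by (auto simp: relators_def)
      then have "relator n q a b i j \<in> rel_ideal n q"
        using ring.genideal_self[OF ring_MA[OF submon_words] relators_sub, of n q]
        unfolding rel_ideal_def Free_MA by blast
      then have "Poly_Mapping.single u 1 * relator n q a b i j * Poly_Mapping.single v 1 \<in> rel_ideal n q"
        using * by (intro I_mult) auto
      then have "lf (\<lambda>w. \<phi> (u + w + v)) (relator n q a b i j) = 0" using \<phi>(2) lf_context by metis
      then show "hk q a b (\<phi> (u @ [(a, i), (b, j)] @ v)) (\<phi> (u @ [(b, i), (a, j)] @ v)) =
        hk q i j (\<phi> (u @ [(a, i), (b, j)] @ v)) (\<phi> (u @ [(a, j), (b, i)] @ v))"
        using * by (simp add: lf_relator plus_list_def)
    qed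
    then show False using * \<phi>(1) by blast
  qed
qed (simp add: Rinv_kills)

section \<open>The tensor square\<close>

text \<open>The analogue of \<open>Rinv\<close> for functionals on pairs of words, which descend to the tensor square.\<close>
definition R2inv :: "nat \<Rightarrow> 'k::field \<Rightarrow> (word \<Rightarrow> word \<Rightarrow> 'k) \<Rightarrow> bool" where
  "R2inv n q \<chi> \<longleftrightarrow> (\<forall>v\<in>words n. Rinv n q (\<lambda>u. \<chi> u v)) \<and> (\<forall>u\<in>words n. Rinv n q (\<chi> u))"

abbreviation lf2 :: "(word \<Rightarrow> word \<Rightarrow> 'k::field) \<Rightarrow> 'k falg2 \<Rightarrow> 'k" where
  "lf2 \<chi> \<equiv> lf (\<lambda>(u, v). \<chi> u v)"

lemma keys_ftens: "Poly_Mapping.keys f \<subseteq> A \<Longrightarrow> Poly_Mapping.keys g \<subseteq> B \<Longrightarrow> Poly_Mapping.keys (ftens f g) \<subseteq> A \<times> B"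
  unfolding ftens_def by (intro keys_sum_sub) (auto split: if_splits)

lemma keys_one [simp]: "Poly_Mapping.keys (1 :: 'w::monoid_add \<Rightarrow>\<^sub>0 'k::field) = {0}"
  by (simp flip: single_one)

lemma rel_ideal_sub: "f \<in> rel_ideal n q \<Longrightarrow> Poly_Mapping.keys f \<subseteq> words n"
  using quotient_algebra.I_keys[OF quotient_Aq] .

definition gens2 :: "nat \<Rightarrow> 'k::field \<Rightarrow> 'k falg2 set" where
  "gens2 n q = (\<lambda>f. ftens f 1) ` rel_ideal n q \<union> (\<lambda>f. ftens 1 f) ` rel_ideal n q"

lemma gens2_sub: "gens2 n q \<subseteq> carrier (MA (words n \<times> words n))"
proof -
  have "Poly_Mapping.keys (1 :: 'a falg) \<subseteq> words n" by (simp add: zero_list_def)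
  then show ?thesis unfolding gens2_def using rel_ideal_sub keys_ftens by (auto; blast)
qed

lemma rel_ideal2_MA: "rel_ideal2 n q = genideal (MA (words n \<times> words n)) (gens2 n q)"
  by (simp add: rel_ideal2_def Free2_MA gens2_def)

lemma quotient_Aq2: "quotient_algebra (words n \<times> words n) (rel_ideal2 n q)"
proof (rule quotient_algebra.intro)
  show "submon (words n \<times> words n)" by (rule submon_words2)
  show "ideal (rel_ideal2 n q) (MA (words n \<times> words n))" unfolding rel_ideal2_MA
    by (rule ring.genideal_ideal[OF ring_MA[OF submon_words2] gens2_sub])
qed

lemma R2inv_context:
  assumes "R2inv n q \<chi>" "u \<in> words n" "v \<in> words n" "u' \<in> words n" "v' \<in> words n"
  shows "R2inv n q (\<lambda>x y. \<chi> (u @ x @ v) (u' @ y @ v'))"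
  using assms unfolding R2inv_def by (auto simp: words_append intro: Rinv_context)

lemma R2inv_kills:
  assumes "R2inv n q \<chi>" "h \<in> rel_ideal2 n q"
  shows "lf2 \<chi> h = 0"
proof -
  let ?W = "words n \<times> words n"
  let ?\<Phi> = "{\<phi>. R2inv n q (\<lambda>u v. \<phi> (u, v))}"
  let ?J = "{f. Poly_Mapping.keys f \<subseteq> ?W \<and> (\<forall>\<phi>\<in>?\<Phi>. lf \<phi> f = 0)}"
  have "ideal ?J (MA ?W)"
  proof (rule ideal_annihilator[OF submon_words2])
    fix \<phi> :: "word \<times> word \<Rightarrow> 'a" and p assume "\<phi> \<in> ?\<Phi>" "p \<in> ?W"
    moreover obtain u u' where "p = (u, u')" by force
    ultimately show "(\<lambda>w. \<phi> (p + w)) \<in> ?\<Phi>" "(\<lambda>w. \<phi> (w + p)) \<in> ?\<Phi>"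
      using R2inv_context[of n q "\<lambda>u v. \<phi> (u, v)" u "[]" u' "[]"]
        R2inv_context[of n q "\<lambda>u v. \<phi> (u, v)" "[]" u "[]" u'] by (simp_all add: plus_list_def)
  qed
  moreover have "gens2 n q \<subseteq> ?J"
  proof
    fix r assume r: "r \<in> gens2 n q"
    then have "Poly_Mapping.keys r \<subseteq> ?W" using gens2_sub by auto
    moreover have "lf \<phi> r = 0" if "\<phi> \<in> ?\<Phi>" for \<phi>
    proof -
      from r obtain f where f: "f \<in> rel_ideal n q" "r = ftens f 1 \<or> r = ftens 1 f" by (auto simp: gens2_def)
      have "Rinv n q (\<lambda>u. \<phi> (u, []))" "Rinv n q (\<lambda>u. \<phi> ([], u))" using that by (auto simp: R2inv_def)
      then have "lf (\<lambda>u. \<phi> (u, [])) f = 0" "lf (\<lambda>u. \<phi> ([], u)) f = 0" using f Rinv_kills by blast+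
      then show ?thesis using f(2) by (auto simp: lf_ftens zero_list_def simp flip: single_one)
    qed
    ultimately show "r \<in> ?J" by simp
  qed
  ultimately have "rel_ideal2 n q \<subseteq> ?J" unfolding rel_ideal2_MA
    by (rule ring.genideal_minimal[OF ring_MA[OF submon_words2]])
  then have "h \<in> ?J" using assms(2) by blast
  moreover have "(\<lambda>(u, v). \<chi> u v) \<in> ?\<Phi>" using assms(1) by simp
  ultimately show ?thesis by blast
qed

lemma mem_rel_ideal2:
  assumes "Poly_Mapping.keys h \<subseteq> words n \<times> words n"
  shows "h \<in> rel_ideal2 n q \<longleftrightarrow> (\<forall>\<chi>. R2inv n q \<chi> \<longrightarrow> lf2 \<chi> h = 0)"
proof
  assume *: "\<forall>\<chi>. R2inv n q \<chi> \<longrightarrow> lf2 \<chi> h = 0"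
  interpret quotient_algebra "words n \<times> words n" "rel_ideal2 n q" by (rule quotient_Aq2)
  show "h \<in> rel_ideal2 n q"
  proof (rule ccontr)
    assume "h \<notin> rel_ideal2 n q"
    then obtain \<phi> where \<phi>: "lf \<phi> h \<noteq> 0" "\<And>g. g \<in> rel_ideal2 n q \<Longrightarrow> lf \<phi> g = 0"
      using separating_functional[OF I_zero I_add I_sc] by metis
    have gen: "g \<in> rel_ideal2 n q" if "g \<in> gens2 n q" for g
      using ring.genideal_self[OF ring_MA[OF submon_words2] gens2_sub, of n q] that
      unfolding rel_ideal2_MA by blast
    have rel: "relator n q a b i j \<in> rel_ideal n q" if "a < n" "b < n" "i < n" "j < n" for a b i j
      using ring.genideal_self[OF ring_MA[OF submon_words] relators_sub, of n q] that
      unfolding rel_ideal_def Free_MA relators_def by blast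
    have "R2inv n q (\<lambda>u v. \<phi> (u, v))" unfolding R2inv_def
    proof (intro conjI ballI)
      fix y assume y: "y \<in> words n"
      show "Rinv n q (\<lambda>u. \<phi> (u, y))" unfolding Rinv_def
      proof (intro ballI allI impI)
        fix u v :: word and a b i j assume *: "u \<in> words n" "v \<in> words n" "a < n" "b < n" "i < n" "j < n"
        have "ftens (relator n q a b i j) 1 \<in> rel_ideal2 n q" using gen rel * by (auto simp: gens2_def)
        then have "Poly_Mapping.single (u, y) 1 * ftens (relator n q a b i j) 1 * Poly_Mapping.single (v, []) 1 \<in> rel_ideal2 n q"
          using * y by (intro I_mult) auto
        then have "lf (\<lambda>w. \<phi> ((u, y) + w + (v, []))) (ftens (relator n q a b i j) 1) = 0"
          using \<phi>(2) lf_context by metis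
        then show "hk q a b (\<phi> (u @ [(a, i), (b, j)] @ v, y)) (\<phi> (u @ [(b, i), (a, j)] @ v, y)) =
          hk q i j (\<phi> (u @ [(a, i), (b, j)] @ v, y)) (\<phi> (u @ [(a, j), (b, i)] @ v, y))"
          using * by (simp add: lf_ftens lf_relator plus_list_def zero_list_def flip: single_one)
      qed
    next
      fix y assume y: "y \<in> words n"
      show "Rinv n q (\<lambda>u. \<phi> (y, u))" unfolding Rinv_def
      proof (intro ballI allI impI)
        fix u v :: word and a b i j assume *: "u \<in> words n" "v \<in> words n" "a < n" "b < n" "i < n" "j < n"
        have "ftens 1 (relator n q a b i j) \<in> rel_ideal2 n q" using gen rel * by (auto simp: gens2_def)
        then have "Poly_Mapping.single (y, u) 1 * ftens 1 (relator n q a b i j) * Poly_Mapping.single ([], v) 1 \<in> rel_ideal2 n q"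
          using * y by (intro I_mult) auto
        then have "lf (\<lambda>w. \<phi> ((y, u) + w + ([], v))) (ftens 1 (relator n q a b i j)) = 0"
          using \<phi>(2) lf_context by metis
        then show "hk q a b (\<phi> (y, u @ [(a, i), (b, j)] @ v)) (\<phi> (y, u @ [(b, i), (a, j)] @ v)) =
          hk q i j (\<phi> (y, u @ [(a, i), (b, j)] @ v)) (\<phi> (y, u @ [(a, j), (b, i)] @ v))"
          using * by (simp add: lf_ftens lf_relator plus_list_def zero_list_def flip: single_one)
      qed
    qed
    then have "lf2 (\<lambda>u v. \<phi> (u, v)) h = 0" using * by blast
    then show False using \<phi>(1) by (simp add: case_prod_beta')
  qed
qed (simp add: R2inv_kills)

section \<open>Comultiplication\<close>

text \<open>A word in the \<open>x\<^sub>i\<^sub>j\<close> is a pair of multi-indices of the same length; these multi-indices are the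
  basis of \<open>V\<^sub>n\<^bsup>\<otimes>e\<^esup>\<close>.\<close>
definition idx :: "nat \<Rightarrow> nat \<Rightarrow> nat list set" where
  "idx n e = {I. length I = e \<and> set I \<subseteq> {..<n}}"

lemma finite_idx [simp]: "finite (idx n e)"
  unfolding idx_def using finite_lists_length_eq[of "{..<n}" e] by (simp add: conj_commute)

lemma idx_0 [simp]: "idx n 0 = {[]}" by (auto simp: idx_def)

lemma sum_idx_append: "(\<Sum>Q\<in>idx n (a + b). g Q) = (\<Sum>P\<in>idx n a. \<Sum>Q\<in>idx n b. g (P @ Q))"
proof -
  have "bij_betw (\<lambda>(P, Q). P @ Q) (idx n a \<times> idx n b) (idx n (a + b))"
    by (rule bij_betw_byWitness[of _ "\<lambda>L. (take a L, drop a L)"])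
       (auto simp: idx_def dest: in_set_takeD in_set_dropD)
  from sum.reindex_bij_betw[OF this, of g] show ?thesis
    by (simp add: sum.cartesian_product case_prod_beta')
qed

lemma sum_idx_1: "(\<Sum>Q\<in>idx n (Suc 0). g Q) = (\<Sum>s<n. g [s])"
proof -
  have "bij_betw (\<lambda>s. [s]) {..<n} (idx n (Suc 0))"
    by (rule bij_betw_byWitness[of _ hd]) (auto simp: idx_def length_Suc_conv)
  from sum.reindex_bij_betw[OF this, of g] show ?thesis by simp
qed

lemma sum_idx_Suc: "(\<Sum>Q\<in>idx n (Suc e). g Q) = (\<Sum>s<n. \<Sum>Q\<in>idx n e. g (s # Q))"
  using sum_idx_append[of g n 1 e] by (simp add: sum_idx_1)

lemma idx_wordI: "I \<in> idx n e \<Longrightarrow> J \<in> idx n e \<Longrightarrow> zip I J \<in> words n"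
  unfolding words_def idx_def by (fastforce dest: set_zip_leftD set_zip_rightD)
lemma word_idx: "w \<in> words n \<Longrightarrow> map fst w \<in> idx n (length w) \<and> map snd w \<in> idx n (length w)"
  unfolding words_def idx_def by auto

text \<open>The composite of \<open>\<chi>\<close> with the comultiplication.\<close>
definition conv :: "nat \<Rightarrow> (word \<Rightarrow> word \<Rightarrow> 'k::field) \<Rightarrow> word \<Rightarrow> 'k" where
  "conv n \<chi> w = (\<Sum>Q\<in>idx n (length w). \<chi> (zip (map fst w) Q) (zip Q (map snd w)))"

lemma comult_word:
  "prod_list (map (\<lambda>(i, j). \<Sum>s<n. ftens (var i s) (var s j)) w)
   = (\<Sum>Q\<in>idx n (length w). Poly_Mapping.single (zip (map fst w) Q, zip Q (map snd w)) (1::'k::field))"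
proof (induction w)
  case Nil
  have "(1 :: 'k falg2) = Poly_Mapping.single ([], []) 1"
    by (simp only: single_one[symmetric] zero_prod_def zero_list_def)
  then show ?case by simp
next
  case (Cons x w)
  obtain i j where x: "x = (i, j)" by force
  have v: "ftens (var i s) (var s j) = Poly_Mapping.single ([(i, s)], [(s, j)]) (1::'k)" for s
    by (simp add: ftens_def var_def)
  show ?case using Cons
    by (simp add: x v sum_idx_Suc sum_product mult_single plus_list_def)
qed

lemma lf2_comult: "lf2 \<chi> (free_comult n f) = lf (conv n \<chi>) f"
  unfolding free_comult_def comult_word conv_def
  by (simp add: lf_sum sum_distrib_left mult_single plus_list_def)
     (simp add: lf_def sum_distrib_left)

lemma keys_comult: assumes "Poly_Mapping.keys f \<subseteq> words n"
  shows "Poly_Mapping.keys (free_comult n f) \<subseteq> words n \<times> words n"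
  unfolding free_comult_def comult_word sum_distrib_left mult_single
proof (intro keys_sum_sub)
  fix w Q assume w: "w \<in> Poly_Mapping.keys f" and Q: "Q \<in> idx n (length w)"
  then have "map fst w \<in> idx n (length w)" "map snd w \<in> idx n (length w)" using assms word_idx by blast+
  then show "Poly_Mapping.keys (Poly_Mapping.single (([], []) + (zip (map fst w) Q, zip Q (map snd w)))
       (Poly_Mapping.lookup f w * 1)) \<subseteq> words n \<times> words n"
    using Q idx_wordI by (auto simp: plus_list_def)
qed

lemma hk_sum: "hk q a b (\<Sum>x\<in>A. f x) (\<Sum>x\<in>A. g x) = (\<Sum>x\<in>A. hk q a b (f x) (g x))"
  by (simp add: hk_def sum.distrib sum_distrib_left)

text \<open>Convolution over the middle index preserves invariance, because the action of \<open>T\<^sub>i\<close> is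
  self-adjoint and can be moved from one factor to the other.\<close>
lemma Rinv_conv:
  assumes "R2inv n q \<chi>" shows "Rinv n q (conv n \<chi>)"
  unfolding Rinv_def
proof (intro ballI allI impI)
  fix u v :: word and a b i j assume *: "u \<in> words n" "v \<in> words n" "a < n" "b < n" "i < n" "j < n"
  let ?I = "map fst u" and ?J = "map snd u" and ?I' = "map fst v" and ?J' = "map snd v"
  define l :: "nat list \<Rightarrow> nat \<Rightarrow> nat \<Rightarrow> nat list \<Rightarrow> nat \<Rightarrow> nat \<Rightarrow> word" where "l P s t P' a b = zip (?I @ a # b # ?I') (P @ s # t # P')" for P s t P' a b
  define r :: "nat list \<Rightarrow> nat \<Rightarrow> nat \<Rightarrow> nat list \<Rightarrow> nat \<Rightarrow> nat \<Rightarrow> word" where "r P s t P' i j = zip (P @ s # t # P') (?J @ i # j # ?J')" for P s t P' i j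
  have exp: "conv n \<chi> (u @ [(a, i), (b, j)] @ v) = (\<Sum>P\<in>idx n (length u). \<Sum>P'\<in>idx n (length v). \<Sum>s<n. \<Sum>t<n.
      \<chi> (l P s t P' a b) (r P s t P' i j))" for a b i j
  proof -
    have "length (u @ [(a, i), (b, j)] @ v) = length u + Suc (Suc (length v))" by simp
    then have "conv n \<chi> (u @ [(a, i), (b, j)] @ v) = (\<Sum>P\<in>idx n (length u). \<Sum>s<n. \<Sum>t<n. \<Sum>P'\<in>idx n (length v).
      \<chi> (l P s t P' a b) (r P s t P' i j))"
      unfolding conv_def by (simp only: sum_idx_append sum_idx_Suc) (simp add: l_def r_def)
    also have "\<dots> = (\<Sum>P\<in>idx n (length u). \<Sum>P'\<in>idx n (length v). \<Sum>s<n. \<Sum>t<n.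
      \<chi> (l P s t P' a b) (r P s t P' i j))"
    proof (rule sum.cong[OF refl])
      fix P
      have "(\<Sum>s<n. \<Sum>t<n. \<Sum>P'\<in>idx n (length v). \<chi> (l P s t P' a b) (r P s t P' i j))
        = (\<Sum>s<n. \<Sum>P'\<in>idx n (length v). \<Sum>t<n. \<chi> (l P s t P' a b) (r P s t P' i j))"
        by (intro sum.cong refl sum.swap)
      also have "\<dots> = (\<Sum>P'\<in>idx n (length v). \<Sum>s<n. \<Sum>t<n. \<chi> (l P s t P' a b) (r P s t P' i j))"
        by (rule sum.swap)
      finally show "(\<Sum>s<n. \<Sum>t<n. \<Sum>P'\<in>idx n (length v). \<chi> (l P s t P' a b) (r P s t P' i j))
        = (\<Sum>P'\<in>idx n (length v). \<Sum>s<n. \<Sum>t<n. \<chi> (l P s t P' a b) (r P s t P' i j))" .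
    qed
    finally show ?thesis .
  qed
  have main: "(\<Sum>s<n. \<Sum>t<n. hk q a b (\<chi> (l P s t P' a b) (r P s t P' i j)) (\<chi> (l P s t P' b a) (r P s t P' i j)))
    = (\<Sum>s<n. \<Sum>t<n. hk q i j (\<chi> (l P s t P' a b) (r P s t P' i j)) (\<chi> (l P s t P' a b) (r P s t P' j i)))"
    if P: "P \<in> idx n (length u)" "P' \<in> idx n (length v)" for P P'
  proof -
    have len: "length P = length u" "length P' = length v" using P by (auto simp: idx_def)
    have lw: "l P s t P' a b = zip ?I P @ [(a, s), (b, t)] @ zip ?I' P'"
      and rw: "r P s t P' i j = zip P ?J @ [(s, i), (t, j)] @ zip P' ?J'" for s t a b i j
      using len by (simp_all add: l_def r_def)
    have W: "zip ?I P \<in> words n" "zip ?I' P' \<in> words n" "zip P ?J \<in> words n" "zip P' ?J' \<in> words n"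
      using * P by (auto intro: idx_wordI dest: word_idx)
    have L: "hk q a b (\<chi> (l P s t P' a b) y) (\<chi> (l P s t P' b a) y)
        = hk q s t (\<chi> (l P s t P' a b) y) (\<chi> (l P t s P' a b) y)" if "s < n" "t < n" "y \<in> words n" for s t y
      using assms that W * unfolding lw R2inv_def Rinv_def by blast
    have R: "hk q s t (\<chi> x (r P s t P' i j)) (\<chi> x (r P t s P' i j))
        = hk q i j (\<chi> x (r P s t P' i j)) (\<chi> x (r P s t P' j i))" if "s < n" "t < n" "x \<in> words n" for s t x
      using assms that W * unfolding rw R2inv_def Rinv_def by blast
    have lW: "l P s t P' a b \<in> words n" and rW: "r P s t P' i j \<in> words n" if "s < n" "t < n" for s t
      unfolding lw rw using W that * by (auto simp: words_append words_Cons)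
    have "(\<Sum>s<n. \<Sum>t<n. hk q a b (\<chi> (l P s t P' a b) (r P s t P' i j)) (\<chi> (l P s t P' b a) (r P s t P' i j)))
      = (\<Sum>s<n. \<Sum>t<n. hk q s t (\<chi> (l P s t P' a b) (r P s t P' i j)) (\<chi> (l P t s P' a b) (r P s t P' i j)))"
      by (intro sum.cong refl L) (auto intro: rW)
    also have "\<dots> = (\<Sum>s<n. \<Sum>t<n. hk q s t (\<chi> (l P s t P' a b) (r P s t P' i j)) (\<chi> (l P s t P' a b) (r P t s P' i j)))"
    proof -
      have "(\<Sum>s<n. \<Sum>t<n. (if s = t then 0 else 1) * \<chi> (l P t s P' a b) (r P s t P' i j))
        = (\<Sum>s<n. \<Sum>t<n. (if s = t then 0 else 1) * \<chi> (l P s t P' a b) (r P t s P' i j))"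
        by (subst sum.swap) (simp add: eq_commute)
      then show ?thesis unfolding hk_coeff sum.distrib by simp
    qed
    also have "\<dots> = (\<Sum>s<n. \<Sum>t<n. hk q i j (\<chi> (l P s t P' a b) (r P s t P' i j)) (\<chi> (l P s t P' a b) (r P s t P' j i)))"
      by (intro sum.cong refl R) (auto intro: lW)
    finally show ?thesis .
  qed
  show "hk q a b (conv n \<chi> (u @ [(a, i), (b, j)] @ v)) (conv n \<chi> (u @ [(b, i), (a, j)] @ v))
      = hk q i j (conv n \<chi> (u @ [(a, i), (b, j)] @ v)) (conv n \<chi> (u @ [(a, j), (b, i)] @ v))"
    unfolding exp hk_sum by (intro sum.cong refl main)
qed

definition eps :: "word \<Rightarrow> 'k::field" where
  "eps w = prod_list (map (\<lambda>(i, j). if i = j then 1 else 0) w)"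

lemma eps_alt: "eps w = (if map fst w = map snd w then 1 else 0)"
  by (induction w) (auto simp: eps_def)

lemma free_counit_lf: "free_counit f = lf eps f" by (simp add: free_counit_def lf_def eps_def)

lemma Rinv_eps: "Rinv n q eps"
  unfolding Rinv_def by (auto simp: hk_def eps_def)

section \<open>Linear operators on tensors and the action of the Hecke algebra\<close>

text \<open>Operators on the tensors of all degrees and all dimensions at once, coordinates being indexed by lists. The
  point of a type is that its ring structure makes the results on rings applicable.\<close>
typedef (overloaded) 'k lop =
  "{f :: (nat list \<Rightarrow> 'k::field) \<Rightarrow> (nat list \<Rightarrow> 'k).
     (\<forall>X Y. f (\<lambda>L. X L + Y L) = (\<lambda>L. f X L + f Y L)) \<and> (\<forall>c X. f (\<lambda>L. c * X L) = (\<lambda>L. c * f X L))}"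
  by (rule exI[of _ "\<lambda>X. X"]) simp

definition linop :: "((nat list \<Rightarrow> 'k::field) \<Rightarrow> (nat list \<Rightarrow> 'k)) \<Rightarrow> bool" where
  "linop f \<longleftrightarrow> (\<forall>X Y. f (\<lambda>L. X L + Y L) = (\<lambda>L. f X L + f Y L)) \<and> (\<forall>c X. f (\<lambda>L. c * X L) = (\<lambda>L. c * f X L))"

abbreviation app :: "'k::field lop \<Rightarrow> (nat list \<Rightarrow> 'k) \<Rightarrow> (nat list \<Rightarrow> 'k)" where "app \<equiv> Rep_lop"

lemma app_Abs: "linop f \<Longrightarrow> app (Abs_lop f) = f"
  by (simp add: Abs_lop_inverse linop_def)
lemma linop_app: "linop (app A)" using Rep_lop[of A] by (simp add: linop_def)
lemma app_add: "app A (\<lambda>L. X L + Y L) = (\<lambda>L. app A X L + app A Y L)"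
  and app_scale: "app A (\<lambda>L. c * X L) = (\<lambda>L. c * app A X L)"
  using linop_app[of A] by (auto simp: linop_def)
lemma lop_eqI: "(\<And>X L. app A X L = app B X L) \<Longrightarrow> A = B"
  by (metis Rep_lop_inverse ext)

instantiation lop :: (field) ring_1
begin
definition "0 = Abs_lop (\<lambda>X L. 0)"
definition "1 = Abs_lop (\<lambda>X. X)"
definition "A + B = Abs_lop (\<lambda>X L. app A X L + app B X L)"
definition "A - B = Abs_lop (\<lambda>X L. app A X L - app B X L)"
definition "- A = Abs_lop (\<lambda>X L. - app A X L)"
definition "A * B = Abs_lop (\<lambda>X. app A (app B X))"

lemma app_lop:
  "app (0 :: 'a lop) X L = 0" "app 1 X = X" "app (A + B) X L = app A X L + app B X L"
  "app (A - B) X L = app A X L - app B X L" "app (- A) X L = - app A X L" "app (A * B) X = app A (app B X)"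
  by (simp_all add: zero_lop_def one_lop_def plus_lop_def minus_lop_def uminus_lop_def times_lop_def
      app_Abs linop_def app_add app_scale algebra_simps)

lemma app_plus: "app (A + B) X = (\<lambda>L. app A X L + app B X L)" by (simp add: fun_eq_iff app_lop)

instance
proof
  show "(0 :: 'a lop) \<noteq> 1"
  proof
    assume "(0 :: 'a lop) = 1"
    then have "app (0 :: 'a lop) (\<lambda>L. 1) [] = app 1 (\<lambda>L. 1) []" by simp
    then show False by (simp add: app_lop)
  qed
qed (auto intro!: lop_eqI simp: app_lop(1,2,4-) app_plus app_add)
end

definition ksc :: "'k::field \<Rightarrow> 'k lop" where "ksc c = Abs_lop (\<lambda>X L. c * X L)"
lemma app_ksc: "app (ksc c) X = (\<lambda>L. c * X L)"
  by (simp add: ksc_def app_Abs linop_def algebra_simps)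

lemma app_sum: "app A (\<lambda>L. \<Sum>i\<in>S. X i L) = (\<lambda>L. \<Sum>i\<in>S. app A (X i) L)"
proof (induction S rule: infinite_finite_induct)
  case (insert x S) then show ?case by (simp add: app_add)
qed (use app_scale[of A 0] in simp_all)

lemma app_hk: "app A (\<lambda>L. hk q a b (X L) (Y L)) = (\<lambda>L. hk q a b (app A X L) (app A Y L))"
  unfolding hk_coeff by (simp add: app_add app_scale)

text \<open>Exchanges the entries at positions \<open>i\<close> and \<open>i + 1\<close>.\<close>
definition swp :: "nat \<Rightarrow> nat list \<Rightarrow> nat list" where
  "swp i L = L[i := L ! Suc i, Suc i := L ! i]"

lemma swp_append [simp]: "swp (length u) (u @ a # b # v) = u @ b # a # v"
  by (simp add: swp_def nth_append list_update_append)
lemma length_swp [simp]: "length (swp i L) = length L" by (simp add: swp_def)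

lemma split_at:
  assumes "Suc i < length L"
  obtains u a b v where "L = u @ a # b # v" "length u = i"
  using assms by (metis Cons_nth_drop_Suc Suc_lessD id_take_nth_drop length_take min.absorb4)

lemma swp_swp: "Suc i < length L \<Longrightarrow> swp i (swp i L) = L"
  by (erule split_at) (metis swp_append)
lemma swp_nth: "Suc i < length L \<Longrightarrow> swp i L ! i = L ! Suc i" "Suc i < length L \<Longrightarrow> swp i L ! Suc i = L ! i"
  by (simp_all add: swp_def)
lemma swp_eq: "Suc i < length L \<Longrightarrow> L ! i = L ! Suc i \<Longrightarrow> swp i L = L"
  unfolding swp_def by (metis list_update_id)
lemma set_swp: "Suc i < length L \<Longrightarrow> set (swp i L) = set L"
  by (erule split_at) (auto simp: insert_commute)
lemma swp_idx: "Suc i < e \<Longrightarrow> length L = e \<Longrightarrow> swp i L \<in> idx n e \<longleftrightarrow> L \<in> idx n e"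
  by (auto simp: idx_def set_swp)

text \<open>The operator \<open>T\<^sub>i\<close> on tensors of degree \<open>e\<close>. On tensors of other degrees it acts as the scalar
  \<open>q\<close>, so that the relations of the Hecke algebra hold as equations between operators.\<close>
definition TT :: "'k::field \<Rightarrow> nat \<Rightarrow> nat \<Rightarrow> 'k lop" where
  "TT q e i = Abs_lop (\<lambda>X L. if length L = e then hk q (L ! i) (L ! Suc i) (X L) (X (swp i L)) else q * X L)"

lemma app_TT: "app (TT q e i) X L = (if length L = e then hk q (L ! i) (L ! Suc i) (X L) (X (swp i L)) else q * X L)"
  unfolding TT_def by (subst app_Abs) (auto simp: linop_def hk_def algebra_simps fun_eq_iff)

lemma TT_cases:
  assumes "\<And>X L. length L = e \<Longrightarrow> app A X L = app B X L" "\<And>X L. length L \<noteq> e \<Longrightarrow> app A X L = app B X L"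
  shows "A = B"
  using assms by (intro lop_eqI) blast

lemma TT_quad:
  assumes "q \<noteq> 0" "Suc i < e"
  shows "TT q e i * TT q e i = 1 + ksc (q - inverse q) * TT q e i"
proof (rule TT_cases[of e])
  fix X :: "nat list \<Rightarrow> 'a" and L :: "nat list" assume "length L = e"
  then obtain u a b v where "L = u @ a # b # v" "length u = i" using split_at assms(2) by metis
  then show "app (TT q e i * TT q e i) X L = app (1 + ksc (q - inverse q) * TT q e i) X L"
    using assms \<open>length L = e\<close> swp_append[of u]
    by (auto simp: app_lop app_TT app_ksc nth_append hk_def field_simps)
qed (use assms in \<open>auto simp: app_lop app_TT app_ksc field_simps\<close>)

lemma hk_braid:
  fixes a b c :: nat and X :: "nat \<Rightarrow> nat \<Rightarrow> nat \<Rightarrow> 'k::field"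
  assumes "q \<noteq> 0"
  shows "hk q a b (hk q b c (hk q a b (X a b c) (X b a c)) (hk q a c (X a c b) (X c a b)))
     (hk q a c (hk q b a (X b a c) (X a b c)) (hk q b c (X b c a) (X c b a)))
   = hk q b c (hk q a b (hk q b c (X a b c) (X a c b)) (hk q a c (X b a c) (X b c a)))
     (hk q a c (hk q c b (X a c b) (X a b c)) (hk q a b (X c a b) (X c b a)))"
proof -
  define h where "h = q - inverse q"
  have qq: "q * (q * x) = x + h * (q * x)" for x using assms by (simp add: h_def algebra_simps)
  note s = hk_def h_def[symmetric] distrib_left qq mult.left_commute[of q h]
  have False if "a < b" "b < c" "c < a \<or> a = c" using that by auto
  moreover have False if "b < a" "c < b" "a < c \<or> a = c" using that by auto
  ultimately show ?thesis
    by (cases a b rule: linorder_cases; cases b c rule: linorder_cases; cases a c rule: linorder_cases)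
       (blast | simp add: s)+
qed

lemma TT_braid:
  assumes "q \<noteq> 0" "Suc (Suc i) < e"
  shows "TT q e i * TT q e (Suc i) * TT q e i = TT q e (Suc i) * TT q e i * TT q e (Suc i)"
proof (rule TT_cases[of e])
  fix X :: "nat list \<Rightarrow> 'a" and L :: "nat list" assume L: "length L = e"
  then obtain u a v' where u: "L = u @ a # v'" "length u = i" using assms(2)
    by (metis Suc_lessD id_take_nth_drop length_take min.absorb4)
  then obtain b c v where v': "v' = b # c # v" using assms(2) L
    by (cases v'; cases "tl v'") auto
  have s1: "swp i (u @ x # y # z # v) = u @ y # x # z # v" for x y z using u swp_append[of u x y] by simp
  have s2: "swp (Suc i) (u @ x # y # z # v) = u @ x # z # y # v" for x y z
    using u swp_append[of "u @ [x]" y z] by simp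
  have n: "(u @ x # y # z # v) ! i = x" "(u @ x # y # z # v) ! Suc i = y" "(u @ x # y # z # v) ! Suc (Suc i) = z" for x y z
    using u by (simp_all add: nth_append)
  have len: "length (u @ x # y # z # v) = e" for x y z using L u v' by simp
  show "app (TT q e i * TT q e (Suc i) * TT q e i) X L = app (TT q e (Suc i) * TT q e i * TT q e (Suc i)) X L"
    unfolding u v' app_lop app_TT
    by (simp only: len n s1 s2 refl if_True) (rule hk_braid[OF assms(1), where X = "\<lambda>a b c. X (u @ a # b # c # v)"])
qed (use assms in \<open>auto simp: app_lop app_TT\<close>)

lemma TT_far:
  assumes "Suc i < j" "Suc j < e"
  shows "TT q e i * TT q e j = TT q e j * TT q e i"
proof (rule TT_cases[of e])
  fix X :: "nat list \<Rightarrow> 'a" and L :: "nat list" assume L: "length L = e"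
  have c: "swp i (swp j L) = swp j (swp i L)" "swp i L ! j = L ! j" "swp i L ! Suc j = L ! Suc j"
    "swp j L ! i = L ! i" "swp j L ! Suc i = L ! Suc i"
    using assms by (simp_all add: swp_def list_update_swap)
  show "app (TT q e i * TT q e j) X L = app (TT q e j * TT q e i) X L"
    using L c by (simp add: app_lop app_TT hk_coeff algebra_simps)
qed (use assms in \<open>auto simp: app_lop app_TT\<close>)

lemma hecke_TT:
  assumes "q \<noteq> 0" "\<forall>m::nat. m > 0 \<longrightarrow> q ^ m \<noteq> 1"
  shows "hecke (TT q e) ksc q e"
proof
  show "ksc (a + b) = ksc a + ksc b" "ksc (a * b) = ksc a * ksc b" "ksc 1 = 1" "ksc a * x = x * ksc a"
    for a b :: 'a and x
    by (auto intro!: lop_eqI simp: app_lop app_ksc app_scale algebra_simps)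
qed (use assms in \<open>auto simp: TT_quad TT_braid intro: TT_far\<close>)

section \<open>Kernels of operators\<close>

text \<open>Basis vectors, and the matrix entry of an operator between two of them.\<close>
definition dl :: "nat list \<Rightarrow> nat list \<Rightarrow> 'k::field" where "dl J L = (if L = J then 1 else 0)"
definition ker :: "'k::field lop \<Rightarrow> nat list \<Rightarrow> nat list \<Rightarrow> 'k" where "ker A I J = app A (dl J) I"

text \<open>\<open>A\<close> preserves \<open>V\<^sub>n\<^bsup>\<otimes>e\<^esup>\<close>, so that products of such operators are products of matrices.\<close>
definition pres :: "nat \<Rightarrow> nat \<Rightarrow> 'k::field lop \<Rightarrow> bool" where
  "pres n e A \<longleftrightarrow> (\<forall>J\<in>idx n e. \<forall>L. L \<notin> idx n e \<longrightarrow> app A (dl J) L = 0)"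

lemma expand_dl:
  assumes "\<And>L. L \<notin> idx n e \<Longrightarrow> X L = 0"
  shows "X = (\<lambda>L. \<Sum>K\<in>idx n e. X K * dl K L)"
proof
  fix L
  have "(\<Sum>K\<in>idx n e. X K * dl K L) = (\<Sum>K\<in>idx n e. if K = L then X K else 0)"
    by (intro sum.cong refl) (auto simp: dl_def)
  then show "X L = (\<Sum>K\<in>idx n e. X K * dl K L)" using assms[of L] by auto
qed

lemma app_expand:
  assumes "\<And>L. L \<notin> idx n e \<Longrightarrow> X L = 0"
  shows "app A X I = (\<Sum>K\<in>idx n e. ker A I K * X K)"
proof -
  have "app A X I = app A (\<lambda>L. \<Sum>K\<in>idx n e. X K * dl K L) I" using expand_dl[of n e X] assms by metis
  then show ?thesis by (simp add: app_sum app_scale ker_def mult.commute)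
qed

lemma ker_mult:
  assumes "pres n e B" "J \<in> idx n e"
  shows "ker (A * B) I J = (\<Sum>K\<in>idx n e. ker A I K * ker B K J)"
proof -
  have "app A (app B (dl J)) I = (\<Sum>K\<in>idx n e. ker A I K * app B (dl J) K)"
    by (rule app_expand) (use assms in \<open>auto simp: pres_def\<close>)
  then show ?thesis by (simp add: ker_def app_lop)
qed

lemma ker_one: "ker 1 I J = (if I = J then 1 else 0)" by (simp add: ker_def app_lop dl_def)

lemma pres_one: "pres n e 1" by (auto simp: pres_def app_lop dl_def)
lemma pres_mult: assumes "pres n e A" "pres n e B" shows "pres n e (A * B)"
proof -
  have "app A (app B (dl J)) L = 0" if "J \<in> idx n e" "L \<notin> idx n e" for J L
  proof -
    have "app A (app B (dl J)) L = (\<Sum>K\<in>idx n e. ker A L K * app B (dl J) K)"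
      by (rule app_expand) (use assms that in \<open>auto simp: pres_def\<close>)
    then show ?thesis using assms that by (simp add: pres_def ker_def)
  qed
  then show ?thesis by (simp add: pres_def app_lop)
qed
lemma pres_diff: "pres n e A \<Longrightarrow> pres n e B \<Longrightarrow> pres n e (A - B)" by (simp add: pres_def app_lop)
lemma pres_ksc: "pres n e (ksc c)" by (auto simp: pres_def app_ksc dl_def)
lemma pres_TT: assumes "Suc i < e" shows "pres n e (TT q e i)"
  unfolding pres_def
proof (intro ballI allI impI)
  fix J L assume J: "J \<in> idx n e" and L: "L \<notin> idx n e"
  have "swp i L \<noteq> J" if "length L = e" using swp_idx[OF assms that] J L by auto
  then show "app (TT q e i) (dl J) L = 0" using J L by (auto simp: app_TT dl_def hk_def)
qed

lemma TT_dl: assumes "Suc i < e" "length J = e"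
  shows "app (TT q e i) (dl J) = (\<lambda>L. hk q (J ! i) (J ! Suc i) (dl J L) (dl (swp i J) L))"
proof
  fix L
  have s: "swp i L = J \<longleftrightarrow> L = swp i J" if "length L = e" using swp_swp assms that by metis
  show "app (TT q e i) (dl J) L = hk q (J ! i) (J ! Suc i) (dl J L) (dl (swp i J) L)"
  proof (cases "length L = e")
    case False
    then have "L \<noteq> J" "L \<noteq> swp i J" using assms by auto
    then show ?thesis using False by (simp add: app_TT dl_def hk_def)
  next
    case True
    then show ?thesis using s assms swp_nth[of i J] swp_eq[of i J] swp_eq[of i L]
      by (auto simp: app_TT dl_def hk_def)
  qed
qed

text \<open>An intertwining relation between operators is an exchange relation for the kernel.\<close>
lemma ker_exchange:
  assumes "TT q e i' * A = A * TT q e i" "Suc i < e" "Suc i' < e" "length I = e" "length J = e"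
  shows "hk q (I ! i') (I ! Suc i') (ker A I J) (ker A (swp i' I) J)
       = hk q (J ! i) (J ! Suc i) (ker A I J) (ker A I (swp i J))"
proof -
  have "app (TT q e i') (app A (dl J)) I = app A (app (TT q e i) (dl J)) I"
    using assms(1) by (metis app_lop(6))
  then show ?thesis using assms by (simp add: app_TT TT_dl app_hk ker_def)
qed

lemma Rinv_zipD:
  assumes "Rinv n q \<phi>" "I \<in> idx n e" "J \<in> idx n e" "Suc i < e"
  shows "hk q (I ! i) (I ! Suc i) (\<phi> (zip I J)) (\<phi> (zip (swp i I) J))
    = hk q (J ! i) (J ! Suc i) (\<phi> (zip I J)) (\<phi> (zip I (swp i J)))"
proof -
  have "Suc i < length I" "Suc i < length J" using assms by (simp_all add: idx_def)
  then obtain u a b v u' c d v' where I: "I = u @ a # b # v" "length u = i"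
    and J: "J = u' @ c # d # v'" "length u' = i" by (metis split_at)
  have "u \<in> idx n i" "u' \<in> idx n i" "v \<in> idx n (e - i - 2)" "v' \<in> idx n (e - i - 2)"
    and ab: "a < n" "b < n" "c < n" "d < n"
    using assms I J by (auto simp: idx_def)
  then have "zip u u' \<in> words n" "zip v v' \<in> words n" by (blast intro: idx_wordI)+
  then have "hk q a b (\<phi> (zip u u' @ [(a, c), (b, d)] @ zip v v')) (\<phi> (zip u u' @ [(b, c), (a, d)] @ zip v v')) =
      hk q c d (\<phi> (zip u u' @ [(a, c), (b, d)] @ zip v v')) (\<phi> (zip u u' @ [(a, d), (b, c)] @ zip v v'))"
    using assms(1) ab unfolding Rinv_def by blast
  then show ?thesis using I J swp_append[of u] swp_append[of u'] by (simp add: nth_append)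
qed

lemma Rinv_zipI:
  assumes "\<And>e i I J. I \<in> idx n e \<Longrightarrow> J \<in> idx n e \<Longrightarrow> Suc i < e \<Longrightarrow>
    hk q (I ! i) (I ! Suc i) (\<phi> (zip I J)) (\<phi> (zip (swp i I) J))
    = hk q (J ! i) (J ! Suc i) (\<phi> (zip I J)) (\<phi> (zip I (swp i J)))"
  shows "Rinv n q \<phi>"
  unfolding Rinv_def
proof (intro ballI allI impI)
  fix u v :: word and a b i j assume *: "u \<in> words n" "v \<in> words n" "a < n" "b < n" "i < n" "j < n"
  define I J where "I = map fst u @ a # b # map fst v" and "J = map snd u @ i # j # map snd v"
  define e where "e = length u + 2 + length v"
  have "I \<in> idx n e" "J \<in> idx n e" using * word_idx[of u n] word_idx[of v n]
    by (auto simp: I_def J_def e_def idx_def)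
  from assms[OF this, of "length u"] show
   "hk q a b (\<phi> (u @ [(a, i), (b, j)] @ v)) (\<phi> (u @ [(b, i), (a, j)] @ v)) =
      hk q i j (\<phi> (u @ [(a, i), (b, j)] @ v)) (\<phi> (u @ [(a, j), (b, i)] @ v))"
    using swp_append[of "map fst u" a b] swp_append[of "map snd u" i j]
    by (simp add: I_def J_def e_def nth_append zip_map_fst_snd)
qed

text \<open>The operator on \<open>V\<^sub>n\<^bsup>\<otimes>e\<^esup>\<close> with matrix coefficients \<open>\<phi>\<close>. It commutes with the Hecke algebra if \<open>\<phi>\<close> is
  invariant.\<close>
definition op :: "nat \<Rightarrow> nat \<Rightarrow> (word \<Rightarrow> 'k::field) \<Rightarrow> 'k lop" where
  "op n e \<phi> = Abs_lop (\<lambda>X L. if L \<in> idx n e then \<Sum>K\<in>idx n e. \<phi> (zip L K) * X K else 0)"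

lemma app_op: "app (op n e \<phi>) X L = (if L \<in> idx n e then \<Sum>K\<in>idx n e. \<phi> (zip L K) * X K else 0)"
  unfolding op_def
  by (subst app_Abs) (auto simp: linop_def fun_eq_iff distrib_left sum.distrib sum_distrib_left ac_simps)

lemma ker_op: "I \<in> idx n e \<Longrightarrow> J \<in> idx n e \<Longrightarrow> ker (op n e \<phi>) I J = \<phi> (zip I J)"
proof -
  assume *: "I \<in> idx n e" "J \<in> idx n e"
  have "(\<Sum>K\<in>idx n e. \<phi> (zip I K) * dl J K) = (\<Sum>K\<in>idx n e. if K = J then \<phi> (zip I K) else 0)"
    by (intro sum.cong refl) (auto simp: dl_def)
  then show ?thesis using * by (simp add: ker_def app_op)
qed
lemma pres_op: "pres n e (op n e \<phi>)" by (simp add: pres_def app_op)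

lemma op_TT:
  assumes "Rinv n q \<phi>" "Suc i < e"
  shows "op n e \<phi> * TT q e i = TT q e i * op n e \<phi>"
proof (rule lop_eqI)
  fix X L
  show "app (op n e \<phi> * TT q e i) X L = app (TT q e i * op n e \<phi>) X L"
  proof (cases "L \<in> idx n e")
    case False
    then show ?thesis using swp_idx[OF assms(2), of L n] by (auto simp: app_lop app_op app_TT hk_def)
  next
    case True
    have len: "length K = e" if "K \<in> idx n e" for K using that by (simp add: idx_def)
    have bij: "bij_betw (swp i) (idx n e) (idx n e)"
      by (rule bij_betw_byWitness[of _ "swp i"]) (use swp_swp swp_idx assms(2) len in auto)
    have "(\<Sum>K\<in>idx n e. \<phi> (zip L K) * hk q (K ! i) (K ! Suc i) (X K) (X (swp i K)))
       = (\<Sum>K\<in>idx n e. \<phi> (zip L K) * ((if K ! i = K ! Suc i then q else if K ! i < K ! Suc i then 0 else q - inverse q) * X K))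
       + (\<Sum>K\<in>idx n e. \<phi> (zip L K) * ((if K ! i = K ! Suc i then 0 else 1) * X (swp i K)))"
      unfolding hk_coeff by (simp add: distrib_left sum.distrib)
    also have "(\<Sum>K\<in>idx n e. \<phi> (zip L K) * ((if K ! i = K ! Suc i then 0 else 1) * X (swp i K)))
      = (\<Sum>K\<in>idx n e. \<phi> (zip L (swp i K)) * ((if K ! i = K ! Suc i then 0 else 1) * X K))"
      by (subst sum.reindex_bij_betw[OF bij, symmetric])
         (intro sum.cong refl, use swp_swp swp_nth assms(2) len in \<open>auto simp: swp_nth\<close>)
    also have "(\<Sum>K\<in>idx n e. \<phi> (zip L K) * ((if K ! i = K ! Suc i then q else if K ! i < K ! Suc i then 0 else q - inverse q) * X K))
       + (\<Sum>K\<in>idx n e. \<phi> (zip L (swp i K)) * ((if K ! i = K ! Suc i then 0 else 1) * X K))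
       = (\<Sum>K\<in>idx n e. hk q (K ! i) (K ! Suc i) (\<phi> (zip L K)) (\<phi> (zip L (swp i K))) * X K)"
      unfolding hk_coeff sum.distrib[symmetric]
      by (intro sum.cong refl) (simp only: distrib_left distrib_right mult.assoc mult.commute mult.left_commute)
    also have "\<dots> = (\<Sum>K\<in>idx n e. hk q (L ! i) (L ! Suc i) (\<phi> (zip L K)) (\<phi> (zip (swp i L) K)) * X K)"
      using Rinv_zipD[OF assms(1) True _ assms(2)] by simp
    also have "\<dots> = hk q (L ! i) (L ! Suc i) (\<Sum>K\<in>idx n e. \<phi> (zip L K) * X K) (\<Sum>K\<in>idx n e. \<phi> (zip (swp i L) K) * X K)"
      unfolding hk_coeff by (simp add: distrib_right distrib_left sum.distrib sum_distrib_left ac_simps)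
    finally show ?thesis
      using True swp_idx[OF assms(2) len[OF True]] len by (simp add: app_lop app_op app_TT)
  qed
qed

section \<open>Cabled braidings\<close>

definition WW :: "'k::field \<Rightarrow> nat \<Rightarrow> nat list \<Rightarrow> 'k lop" where
  "WW q e ws = prod_list (map (TT q e) ws)"

text \<open>\<open>mv b k\<close> moves the strand at position \<open>k\<close> past the next \<open>b\<close> strands, and \<open>bt a b\<close> moves \<open>a\<close>
  strands past \<open>b\<close> strands.\<close>
definition mv :: "nat \<Rightarrow> nat \<Rightarrow> nat list" where "mv b k = rev [k..<k + b]"
definition bt :: "nat \<Rightarrow> nat \<Rightarrow> nat list" where "bt a b = concat (map (mv b) [0..<a])"

lemma WW_append: "WW q e (u @ v) = WW q e u * WW q e v" by (simp add: WW_def)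
lemma WW_Nil [simp]: "WW q e [] = 1" by (simp add: WW_def)
lemma WW_Cons: "WW q e (i # v) = TT q e i * WW q e v" by (simp add: WW_def)

lemma pres_WW: "(\<And>i. i \<in> set ws \<Longrightarrow> Suc i < e) \<Longrightarrow> pres n e (WW q e ws)"
  by (induction ws) (auto simp: WW_Cons pres_one intro!: pres_mult pres_TT)

lemma mv_0 [simp]: "mv 0 k = []" by (simp add: mv_def)
lemma mv_Suc: "mv (Suc b) k = (k + b) # mv b k" by (simp add: mv_def)
lemma set_mv: "set (mv b k) = {k..<k + b}" by (simp add: mv_def)
lemma bt_Suc: "bt (Suc a) b = bt a b @ mv b a" by (simp add: bt_def)
lemma bt_0 [simp]: "bt 0 b = []" by (simp add: bt_def)
lemma set_bt: "i \<in> set (bt a b) \<Longrightarrow> Suc i < a + b" by (auto simp: bt_def set_mv)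

lemma cmt_WW: "(\<And>j. j \<in> set ws \<Longrightarrow> cmt x (TT q e j)) \<Longrightarrow> cmt x (WW q e ws)"
  by (induction ws) (auto simp: WW_Cons intro: cmt_mult)
lemma cmt_TT: "Suc i < j \<or> Suc j < i \<Longrightarrow> Suc i < e \<Longrightarrow> Suc j < e \<Longrightarrow> cmt (TT q e i) (TT q e j)"
  unfolding cmt_def using TT_far by metis

lemma exchange_mult:
  fixes A B :: "'a::ring_1"
  assumes "A * x = y * A" "B * y = z * B"
  shows "(B * A) * x = z * (B * A)"
proof -
  have "(B * A) * x = B * (y * A)" by (simp only: mult.assoc assms(1))
  also have "\<dots> = (z * B) * A" by (simp only: assms(2)[symmetric] mult.assoc)
  finally show ?thesis by (simp only: mult.assoc)
qed

lemma mv_shift: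
  assumes q: "q \<noteq> 0" and "k < j" "j < k + b" "k + b < e"
  shows "WW q e (mv b k) * TT q e j = TT q e (j - 1) * WW q e (mv b k)"
  using assms(2-)
proof (induction b)
  case (Suc b)
  show ?case
  proof (cases "j = k + b")
    case False
    then have "WW q e (mv b k) * TT q e j = TT q e (j - 1) * WW q e (mv b k)" using Suc by simp
    moreover have "cmt (TT q e (k + b)) (TT q e (j - 1))" using False Suc.prems by (intro cmt_TT) auto
    ultimately show ?thesis unfolding mv_Suc WW_Cons cmt_def by (rule exchange_mult)
  next
    case True
    then obtain b' where b': "b = Suc b'" using Suc.prems by (cases b) auto
    have c: "cmt (TT q e j) (WW q e (mv b' k))"
      by (rule cmt_WW, rule cmt_TT) (use True b' Suc.prems in \<open>auto simp: set_mv\<close>)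
    have "TT q e (j - 1) * TT q e j * TT q e (j - 1) = TT q e j * TT q e (j - 1) * TT q e j"
      using TT_braid[OF q, of "j - 1" e] True b' Suc.prems by simp
    then have "TT q e j * TT q e (j - 1) * TT q e j = TT q e (j - 1) * (TT q e j * TT q e (j - 1))"
      by (simp only: mult.assoc)
    from exchange_mult[OF c[unfolded cmt_def, symmetric] this]
    show ?thesis using True b' by (simp add: mv_Suc WW_Cons mult.assoc)
  qed
qed simp

lemma bt_right:
  assumes q: "q \<noteq> 0" and j: "Suc j < b" and e: "a + b \<le> e"
  shows "WW q e (bt a b) * TT q e (a + j) = TT q e j * WW q e (bt a b)"
  using e
proof (induction a)
  case (Suc a)
  have "WW q e (mv b a) * TT q e (Suc a + j) = TT q e (a + j) * WW q e (mv b a)"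
    using mv_shift[OF q, of a "Suc a + j" b e] j Suc.prems by simp
  moreover have "WW q e (bt a b) * TT q e (a + j) = TT q e j * WW q e (bt a b)" using Suc by simp
  ultimately show ?case unfolding bt_Suc WW_append by (rule exchange_mult)
qed simp

lemma mv_mv:
  assumes q: "q \<noteq> 0" and "Suc i + b < e"
  shows "WW q e (mv b i) * WW q e (mv b (Suc i)) * TT q e i = TT q e (i + b) * (WW q e (mv b i) * WW q e (mv b (Suc i)))"
  using assms(2)
proof (induction b)
  case (Suc b)
  let ?m = "WW q e (mv b i)" and ?m' = "WW q e (mv b (Suc i))" and ?t = "TT q e (i + b)" and ?t' = "TT q e (Suc (i + b))"
  have c: "cmt ?t' ?m"
    by (rule cmt_WW, rule cmt_TT) (use Suc.prems in \<open>auto simp: set_mv\<close>)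
  have B: "?t * ?t' * ?t = ?t' * ?t * ?t'" using TT_braid[OF q, of "i + b" e] Suc.prems by simp
  have IH: "?m * ?m' * TT q e i = ?t * (?m * ?m')" using Suc by simp
  have eq: "WW q e (mv (Suc b) i) * WW q e (mv (Suc b) (Suc i)) = ?t * ?t' * (?m * ?m')"
  proof -
    have "?t * ?m * (?t' * ?m') = ?t * (?m * ?t') * ?m'" by (simp only: mult.assoc)
    also have "?m * ?t' = ?t' * ?m" using c by (simp add: cmt_def)
    finally show ?thesis by (simp add: mv_Suc WW_Cons mult.assoc)
  qed
  have "WW q e (mv (Suc b) i) * WW q e (mv (Suc b) (Suc i)) * TT q e i = ?t * ?t' * (?m * ?m' * TT q e i)"
    unfolding eq by (simp add: mult.assoc)
  also have "\<dots> = (?t * ?t' * ?t) * (?m * ?m')" unfolding IH by (simp add: mult.assoc)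
  also have "\<dots> = ?t' * (?t * ?t' * (?m * ?m'))" unfolding B by (simp add: mult.assoc)
  finally show ?case unfolding eq by simp
qed simp

lemma bt_left:
  assumes q: "q \<noteq> 0" and i: "Suc i < a" and e: "a + b \<le> e"
  shows "WW q e (bt a b) * TT q e i = TT q e (b + i) * WW q e (bt a b)"
  using i e
proof (induction a)
  case (Suc a)
  show ?case
  proof (cases "Suc i < a")
    case True
    have c: "cmt (TT q e i) (WW q e (mv b a))"
      by (rule cmt_WW, rule cmt_TT) (use True Suc.prems in \<open>auto simp: set_mv\<close>)
    have "WW q e (bt a b) * TT q e i = TT q e (b + i) * WW q e (bt a b)" using Suc True by simp
    with c show ?thesis unfolding bt_Suc WW_append cmt_def by (intro exchange_mult) simp_all
  next
    case False
    then have a: "a = Suc i" using Suc.prems by simp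
    have c: "cmt (TT q e (b + i)) (WW q e (bt i b))"
    proof (rule cmt_WW)
      fix j assume "j \<in> set (bt i b)"
      then show "cmt (TT q e (b + i)) (TT q e j)" using set_bt[of j i b] Suc.prems by (intro cmt_TT) auto
    qed
    have "WW q e (mv b i) * WW q e (mv b (Suc i)) * TT q e i = TT q e (b + i) * (WW q e (mv b i) * WW q e (mv b (Suc i)))"
      using mv_mv[OF q, of i b e] Suc.prems a by (simp add: add.commute)
    moreover have "WW q e (bt (Suc a) b) = WW q e (bt i b) * (WW q e (mv b i) * WW q e (mv b (Suc i)))"
      by (simp add: a bt_Suc WW_append mult.assoc)
    ultimately show ?thesis using exchange_mult[OF _ c[unfolded cmt_def, symmetric]] by simp
  qed
qed simp

lemma bt_add: "WW q e (bt (a + a') b) = WW q e (bt a b) * WW q e (map ((+) a) (bt a' b))"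
proof -
  have "mv b (a + k) = map ((+) a) (mv b k)" for k
    by (induction b) (auto simp: mv_Suc)
  moreover have "[0..<a + a'] = [0..<a] @ map ((+) a) [0..<a']"
    by (induction a') auto
  ultimately have "bt (a + a') b = bt a b @ map ((+) a) (bt a' b)"
    unfolding bt_def by (simp add: map_concat comp_def)
  then show ?thesis by (simp add: WW_append)
qed

lemma bt_add_right:
  assumes "a + b + b' \<le> e"
  shows "WW q e (bt a (b + b')) = WW q e (map ((+) b) (bt a b')) * WW q e (bt a b)"
  using assms
proof (induction a)
  case (Suc a)
  have m: "mv (b + b') a = mv b' (b + a) @ mv b a"
    by (induction b') (auto simp: mv_Suc)
  have m': "map ((+) b) (mv b' a) = mv b' (b + a)"
    by (induction b') (auto simp: mv_Suc)
  have "cmt (WW q e (bt a b)) (WW q e (mv b' (b + a)))"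
  proof (rule cmt_WW, rule cmt_sym, rule cmt_WW, rule cmt_sym)
    fix i j assume "j \<in> set (mv b' (b + a))" "i \<in> set (bt a b)"
    then show "cmt (TT q e i) (TT q e j)" using set_bt[of i a b] Suc.prems
      by (intro cmt_TT) (auto simp: set_mv)
  qed
  note c = this[unfolded cmt_def]
  have IH: "WW q e (bt a (b + b')) = WW q e (map ((+) b) (bt a b')) * WW q e (bt a b)" using Suc by simp
  let ?x = "WW q e (map ((+) b) (bt a b'))" and ?y = "WW q e (bt a b)" and ?z = "WW q e (mv b' (b + a))"
  have "?x * ?y * (?z * WW q e (mv b a)) = ?x * (?y * ?z) * WW q e (mv b a)" by (simp only: mult.assoc)
  also have "\<dots> = (?x * ?z) * (?y * WW q e (mv b a))" by (simp only: c mult.assoc)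
  finally show ?case unfolding bt_Suc WW_append map_append m m' IH .
qed simp

text \<open>Operators that act only on a segment of the tensor positions.\<close>
lemma app_WW_suffix:
  assumes "\<And>i. i \<in> set ws \<Longrightarrow> Suc i < e" "length L = e"
  shows "app (WW q (e + length S) ws) X (L @ S) = app (WW q e ws) (\<lambda>L. X (L @ S)) L"
  using assms
proof (induction ws arbitrary: X L)
  case (Cons i ws)
  have "Suc i < length L" using Cons.prems(1)[of i] Cons.prems(2) by simp
  then have sw: "swp i (L @ S) = swp i L @ S" "Suc i < length L" by (simp_all add: swp_def nth_append list_update_append)
  show ?case using Cons sw Suc_lessD[OF sw(2)] by (simp add: WW_Cons app_lop app_TT nth_append)
qed (simp add: app_lop)

lemma app_WW_prefix:
  assumes "\<And>i. i \<in> set ws \<Longrightarrow> Suc i < e" "length L = e"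
  shows "app (WW q (length P + e) (map ((+) (length P)) ws)) X (P @ L) = app (WW q e ws) (\<lambda>L. X (P @ L)) L"
  using assms
proof (induction ws arbitrary: X L)
  case (Cons i ws)
  have "Suc i < length L" using Cons.prems(1)[of i] Cons.prems(2) by simp
  then have sw: "swp (length P + i) (P @ L) = P @ swp i L" "Suc i < length L"
    by (simp_all add: swp_def nth_append list_update_append)
  show ?case using Cons sw Suc_lessD[OF sw(2)] by (simp add: WW_Cons app_lop app_TT nth_append)
qed (simp add: app_lop)

lemma app_zero_fun: "app A (\<lambda>L. 0) = (\<lambda>L. 0)" using app_scale[of A 0] by simp

lemma ker_WW_suffix:
  assumes "\<And>i. i \<in> set ws \<Longrightarrow> Suc i < e" "length I = e" "length S = s" "length J = e" "length S' = s"
  shows "ker (WW q (e + s) ws) (I @ S) (J @ S') = (if S = S' then ker (WW q e ws) I J else 0)"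
proof -
  have "(\<lambda>L. dl (J @ S') (L @ S)) = (if S = S' then dl J else (\<lambda>L. 0 :: 'a))"
    using assms by (auto simp: dl_def fun_eq_iff)
  then show ?thesis using app_WW_suffix[OF assms(1,2), where q = q and S = S and X = "dl (J @ S')"] assms
    by (auto simp: ker_def app_zero_fun)
qed

lemma ker_WW_prefix:
  assumes "\<And>i. i \<in> set ws \<Longrightarrow> Suc i < e" "length I = e" "length P = s" "length J = e" "length P' = s"
  shows "ker (WW q (s + e) (map ((+) s) ws)) (P @ I) (P' @ J) = (if P = P' then ker (WW q e ws) I J else 0)"
proof -
  have "(\<lambda>L. dl (P' @ J) (P @ L)) = (if P = P' then dl J else (\<lambda>L. 0 :: 'a))"
    using assms by (auto simp: dl_def fun_eq_iff)
  then show ?thesis using app_WW_prefix[OF assms(1,2), where q = q and P = P and X = "dl (P' @ J)"] assms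
    by (auto simp: ker_def app_zero_fun)
qed

section \<open>The coquasitriangular structure on words\<close>

text \<open>The value of the coquasitriangular form on two words: a matrix coefficient of the braid that moves
  the strands of the first word past those of the second. \<open>rrb\<close> uses the inverse braid.\<close>
definition rr :: "'k::field \<Rightarrow> word \<Rightarrow> word \<Rightarrow> 'k" where
  "rr q u v = ker (WW q (length u + length v) (bt (length u) (length v)))
     (map fst v @ map fst u) (map snd u @ map snd v)"

definition rrb :: "'k::field \<Rightarrow> word \<Rightarrow> word \<Rightarrow> 'k" where
  "rrb q u v = ker (rinv (WW q (length u + length v) (bt (length u) (length v))))
     (map fst u @ map fst v) (map snd v @ map snd u)"

lemma rr_zip: "length I = a \<Longrightarrow> length I' = a \<Longrightarrow> length J = b \<Longrightarrow> length J' = b \<Longrightarrow>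
  rr q (zip I I') (zip J J') = ker (WW q (a + b) (bt a b)) (J @ I) (I' @ J')"
  by (simp add: rr_def)
lemma rrb_zip: "length I = a \<Longrightarrow> length I' = a \<Longrightarrow> length J = b \<Longrightarrow> length J' = b \<Longrightarrow>
  rrb q (zip I I') (zip J J') = ker (rinv (WW q (a + b) (bt a b))) (I @ J) (J' @ I')"
  by (simp add: rrb_def)

lemma idx_append: "I \<in> idx n a \<Longrightarrow> J \<in> idx n b \<Longrightarrow> I @ J \<in> idx n (a + b)" by (auto simp: idx_def)
lemma idx_len: "I \<in> idx n a \<Longrightarrow> length I = a" by (simp add: idx_def)

lemma swp_append_left: "Suc i < length I \<Longrightarrow> swp i (I @ J) = swp i I @ J"
  by (simp add: swp_def nth_append list_update_append)
lemma swp_append_right: "Suc i < length J \<Longrightarrow> length I = b \<Longrightarrow> swp (b + i) (I @ J) = I @ swp i J"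
  by (simp add: swp_def nth_append list_update_append)

lemma words_zip: "w \<in> words n \<Longrightarrow> \<exists>I J. w = zip I J \<and> I \<in> idx n (length w) \<and> J \<in> idx n (length w)"
  using word_idx[of w n] by (metis zip_map_fst_snd)

lemma R2inv_zipI:
  assumes "\<And>a b i I I' J J'. I \<in> idx n a \<Longrightarrow> I' \<in> idx n a \<Longrightarrow> J \<in> idx n b \<Longrightarrow> J' \<in> idx n b \<Longrightarrow> Suc i < a \<Longrightarrow>
     hk q (I ! i) (I ! Suc i) (\<chi> (zip I I') (zip J J')) (\<chi> (zip (swp i I) I') (zip J J'))
     = hk q (I' ! i) (I' ! Suc i) (\<chi> (zip I I') (zip J J')) (\<chi> (zip I (swp i I')) (zip J J'))"
   and "\<And>a b i I I' J J'. I \<in> idx n a \<Longrightarrow> I' \<in> idx n a \<Longrightarrow> J \<in> idx n b \<Longrightarrow> J' \<in> idx n b \<Longrightarrow> Suc i < b \<Longrightarrow>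
     hk q (J ! i) (J ! Suc i) (\<chi> (zip I I') (zip J J')) (\<chi> (zip I I') (zip (swp i J) J'))
     = hk q (J' ! i) (J' ! Suc i) (\<chi> (zip I I') (zip J J')) (\<chi> (zip I I') (zip J (swp i J')))"
  shows "R2inv n q \<chi>"
  unfolding R2inv_def
proof (intro conjI ballI)
  fix v assume "v \<in> words n"
  then obtain J J' where "v = zip J J'" "J \<in> idx n (length v)" "J' \<in> idx n (length v)" using words_zip by blast
  then show "Rinv n q (\<lambda>u. \<chi> u v)" using assms(1) by (intro Rinv_zipI) blast
next
  fix u assume "u \<in> words n"
  then obtain J J' where "u = zip J J'" "J \<in> idx n (length u)" "J' \<in> idx n (length u)" using words_zip by blast
  then show "Rinv n q (\<chi> u)" using assms(2) by (intro Rinv_zipI) blast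
qed

lemma R2inv_rr: assumes q: "q \<noteq> 0" shows "R2inv n q (rr q)"
proof (rule R2inv_zipI)
  fix a b i I I' J J' assume *: "I \<in> idx n a" "I' \<in> idx n a" "J \<in> idx n b" "J' \<in> idx n b" "Suc i < a"
  note len = *(1-4)[THEN idx_len]
  let ?A = "WW q (a + b) (bt a b)"
  have "TT q (a + b) (b + i) * ?A = ?A * TT q (a + b) i" using bt_left[OF q *(5)] by simp
  from ker_exchange[OF this, of "J @ I" "I' @ J'"] show
    "hk q (I ! i) (I ! Suc i) (rr q (zip I I') (zip J J')) (rr q (zip (swp i I) I') (zip J J'))
     = hk q (I' ! i) (I' ! Suc i) (rr q (zip I I') (zip J J')) (rr q (zip I (swp i I')) (zip J J'))"
    using * len by (simp add: rr_zip nth_append swp_append_left swp_append_right)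
next
  fix a b i I I' J J' assume *: "I \<in> idx n a" "I' \<in> idx n a" "J \<in> idx n b" "J' \<in> idx n b" "Suc i < b"
  note len = *(1-4)[THEN idx_len]
  let ?A = "WW q (a + b) (bt a b)"
  have "TT q (a + b) i * ?A = ?A * TT q (a + b) (a + i)" using bt_right[OF q *(5)] by simp
  from ker_exchange[OF this, of "J @ I" "I' @ J'"] show
    "hk q (J ! i) (J ! Suc i) (rr q (zip I I') (zip J J')) (rr q (zip I I') (zip (swp i J) J'))
     = hk q (J' ! i) (J' ! Suc i) (rr q (zip I I') (zip J J')) (rr q (zip I I') (zip J (swp i J')))"
    using * len by (simp add: rr_zip nth_append swp_append_left swp_append_right)
qed

definition tinv :: "'k::field \<Rightarrow> nat \<Rightarrow> nat \<Rightarrow> 'k lop" where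
  "tinv q e i = TT q e i - ksc (q - inverse q)"

lemma TT_inv:
  assumes "q \<noteq> 0" "Suc i < e"
  shows "TT q e i * tinv q e i = 1" "tinv q e i * TT q e i = 1"
proof -
  have "ksc c * x = x * ksc c" for c :: 'a and x by (auto intro!: lop_eqI simp: app_lop app_ksc app_scale)
  then show "TT q e i * tinv q e i = 1" "tinv q e i * TT q e i = 1"
    using TT_quad[OF assms] by (simp_all add: tinv_def algebra_simps)
qed

lemma WW_inv:
  assumes "q \<noteq> 0" "\<And>i. i \<in> set ws \<Longrightarrow> Suc i < e"
  shows "uni (WW q e ws)" "pres n e (rinv (WW q e ws))"
proof -
  have "\<exists>B. WW q e ws * B = 1 \<and> B * WW q e ws = 1 \<and> pres n e B" using assms(2)
  proof (induction ws)
    case Nil then show ?case by (intro exI[of _ 1]) (simp add: pres_one)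
  next
    case (Cons i ws)
    then obtain B where B: "WW q e ws * B = 1" "B * WW q e ws = 1" "pres n e B" by auto
    have i: "Suc i < e" using Cons.prems by simp
    have "TT q e i * WW q e ws * (B * tinv q e i) = TT q e i * (WW q e ws * B) * tinv q e i"
      "B * tinv q e i * (TT q e i * WW q e ws) = B * (tinv q e i * TT q e i) * WW q e ws"
      by (simp_all only: mult.assoc)
    then have "TT q e i * WW q e ws * (B * tinv q e i) = 1" "B * tinv q e i * (TT q e i * WW q e ws) = 1"
      using B TT_inv[OF assms(1) i] by simp_all
    moreover have "pres n e (B * tinv q e i)" unfolding tinv_def
      by (intro pres_mult B pres_diff pres_TT i pres_ksc)
    ultimately show ?case unfolding WW_Cons by blast
  qed
  then obtain B where B: "WW q e ws * B = 1" "B * WW q e ws = 1" "pres n e B" by blast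
  then show u: "uni (WW q e ws)" unfolding uni_def by blast
  have "rinv (WW q e ws) = rinv (WW q e ws) * (WW q e ws * B)" using B by simp
  also have "\<dots> = B" using rinv[OF u] by (simp add: mult.assoc[symmetric])
  finally show "pres n e (rinv (WW q e ws))" using B by simp
qed

lemma rinv_exchange:
  assumes "uni A" "x * A = A * y" shows "y * rinv A = rinv A * x"
proof -
  have "rinv A * (x * A) * rinv A = rinv A * (A * y) * rinv A" using assms by simp
  moreover have "rinv A * (x * A) * rinv A = rinv A * x * (A * rinv A)"
    "rinv A * (A * y) * rinv A = (rinv A * A) * y * rinv A" by (simp_all only: mult.assoc)
  ultimately show ?thesis using rinv[OF assms(1)] by simp
qed

lemma R2inv_rrb: assumes q: "q \<noteq> 0" shows "R2inv n q (rrb q)"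
proof (rule R2inv_zipI)
  fix a b i I I' J J' assume *: "I \<in> idx n a" "I' \<in> idx n a" "J \<in> idx n b" "J' \<in> idx n b" "Suc i < a"
  note len = *(1-4)[THEN idx_len]
  let ?A = "WW q (a + b) (bt a b)"
  have "TT q (a + b) (b + i) * ?A = ?A * TT q (a + b) i" using bt_left[OF q *(5)] by simp
  then have "TT q (a + b) i * rinv ?A = rinv ?A * TT q (a + b) (b + i)"
    by (intro rinv_exchange WW_inv(1)[OF q] set_bt)
  from ker_exchange[OF this, of "I @ J" "J' @ I'"] show
    "hk q (I ! i) (I ! Suc i) (rrb q (zip I I') (zip J J')) (rrb q (zip (swp i I) I') (zip J J'))
     = hk q (I' ! i) (I' ! Suc i) (rrb q (zip I I') (zip J J')) (rrb q (zip I (swp i I')) (zip J J'))"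
    using * len by (simp add: rrb_zip nth_append swp_append_left swp_append_right)
next
  fix a b i I I' J J' assume *: "I \<in> idx n a" "I' \<in> idx n a" "J \<in> idx n b" "J' \<in> idx n b" "Suc i < b"
  note len = *(1-4)[THEN idx_len]
  let ?A = "WW q (a + b) (bt a b)"
  have "TT q (a + b) i * ?A = ?A * TT q (a + b) (a + i)" using bt_right[OF q *(5)] by simp
  then have "TT q (a + b) (a + i) * rinv ?A = rinv ?A * TT q (a + b) i"
    by (intro rinv_exchange WW_inv(1)[OF q] set_bt)
  from ker_exchange[OF this, of "I @ J" "J' @ I'"] show
    "hk q (J ! i) (J ! Suc i) (rrb q (zip I I') (zip J J')) (rrb q (zip I I') (zip (swp i J) J'))
     = hk q (J' ! i) (J' ! Suc i) (rrb q (zip I I') (zip J J')) (rrb q (zip I I') (zip J (swp i J')))"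
    using * len by (simp add: rrb_zip nth_append swp_append_left swp_append_right)
qed

lemma sum_idx_delta: "K \<in> idx n e \<Longrightarrow> (\<Sum>P\<in>idx n e. (if P = K then f P else 0)) = f K"
  "K \<in> idx n e \<Longrightarrow> (\<Sum>P\<in>idx n e. (if K = P then f P else 0)) = f K"
  for f :: "nat list \<Rightarrow> 'k::field" by simp_all

lemma sum_idx_append3:
  "e = a + (b + c) \<Longrightarrow> (\<Sum>L\<in>idx n e. F L) = (\<Sum>A\<in>idx n a. \<Sum>P\<in>idx n b. \<Sum>B\<in>idx n c. F (A @ P @ B))"
  by (simp add: sum_idx_append)

text \<open>The two hexagon identities, on matrix coefficients.\<close>
lemma rr_append_left:
  assumes "I \<in> idx n a" "I' \<in> idx n a" "K \<in> idx n a'" "K' \<in> idx n a'" "J \<in> idx n b" "J' \<in> idx n b"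
  shows "rr q (zip I I' @ zip K K') (zip J J') = (\<Sum>P\<in>idx n b. rr q (zip I I') (zip J P) * rr q (zip K K') (zip P J'))"
proof -
  note len = assms[THEN idx_len]
  let ?e = "a + a' + b"
  have s: "\<And>i. i \<in> set (bt a b) \<Longrightarrow> Suc i < a + b" "\<And>i. i \<in> set (bt a' b) \<Longrightarrow> Suc i < a' + b"
    by (erule set_bt)+
  have "zip I I' @ zip K K' = zip (I @ K) (I' @ K')" using len by simp
  then have "rr q (zip I I' @ zip K K') (zip J J')
      = ker (WW q ?e (bt a b) * WW q ?e (map ((+) a) (bt a' b))) (J @ I @ K) (I' @ K' @ J')"
    using rr_zip[of "I @ K" "a + a'" "I' @ K'" J b J' q] len by (simp add: bt_add del: zip_append)
  also have "\<dots> = (\<Sum>L\<in>idx n ?e. ker (WW q ?e (bt a b)) (J @ I @ K) L * ker (WW q ?e (map ((+) a) (bt a' b))) L (I' @ K' @ J'))"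
  proof (rule ker_mult)
    show "pres n ?e (WW q ?e (map ((+) a) (bt a' b)))" using s(2) by (intro pres_WW) auto
    show "I' @ K' @ J' \<in> idx n ?e" using assms by (auto simp: idx_def)
  qed
  also have "\<dots> = (\<Sum>A\<in>idx n a. \<Sum>P\<in>idx n b. \<Sum>B\<in>idx n a'. ker (WW q ?e (bt a b)) (J @ I @ K) (A @ P @ B)
       * ker (WW q ?e (map ((+) a) (bt a' b))) (A @ P @ B) (I' @ K' @ J'))"
    by (rule sum_idx_append3) simp
  also have "\<dots> = (\<Sum>A\<in>idx n a. \<Sum>P\<in>idx n b. \<Sum>B\<in>idx n a'. (if K = B then rr q (zip I A) (zip J P) else 0)
       * (if A = I' then rr q (zip K K') (zip P J') else 0))"
  proof (intro sum.cong refl)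
    fix A P B assume **: "A \<in> idx n a" "P \<in> idx n b" "B \<in> idx n a'"
    note len' = **[THEN idx_len]
    have "ker (WW q (a + b + a') (bt a b)) ((J @ I) @ K) ((A @ P) @ B) = (if K = B then ker (WW q (a + b) (bt a b)) (J @ I) (A @ P) else 0)"
      by (rule ker_WW_suffix) (use s len len' in auto)
    moreover have "ker (WW q (a + (a' + b)) (map ((+) a) (bt a' b))) (A @ (P @ B)) (I' @ (K' @ J'))
       = (if A = I' then ker (WW q (a' + b) (bt a' b)) (P @ B) (K' @ J') else 0)"
      by (rule ker_WW_prefix) (use s len len' in auto)
    moreover have "a + b + a' = ?e" "a + (a' + b) = ?e" by simp_all
    ultimately show "ker (WW q ?e (bt a b)) (J @ I @ K) (A @ P @ B) * ker (WW q ?e (map ((+) a) (bt a' b))) (A @ P @ B) (I' @ K' @ J')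
      = (if K = B then rr q (zip I A) (zip J P) else 0) * (if A = I' then rr q (zip K K') (zip P J') else 0)"
      using len len' by (auto simp: rr_zip)
  qed
  also have "\<dots> = (\<Sum>A\<in>idx n a. if A = I' then \<Sum>P\<in>idx n b. rr q (zip I A) (zip J P) * rr q (zip K K') (zip P J') else 0)"
  proof (intro sum.cong refl)
    fix A
    have "(\<Sum>B\<in>idx n a'. (if K = B then x else 0) * y) = x * y" for x y :: 'a
      using sum_idx_delta(2)[OF assms(3), of "\<lambda>_. x"] by (simp flip: sum_distrib_right)
    then show "(\<Sum>P\<in>idx n b. \<Sum>B\<in>idx n a'. (if K = B then rr q (zip I A) (zip J P) else 0)
       * (if A = I' then rr q (zip K K') (zip P J') else 0)) = (if A = I' then \<Sum>P\<in>idx n b. rr q (zip I A) (zip J P) * rr q (zip K K') (zip P J') else 0)"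
      by simp
  qed
  also have "\<dots> = (\<Sum>P\<in>idx n b. rr q (zip I I') (zip J P) * rr q (zip K K') (zip P J'))"
    using assms by (simp add: sum_idx_delta)
  finally show ?thesis .
qed

lemma rr_append_right:
  assumes "I \<in> idx n a" "I' \<in> idx n a" "J \<in> idx n b" "J' \<in> idx n b" "K \<in> idx n b'" "K' \<in> idx n b'"
  shows "rr q (zip I I') (zip J J' @ zip K K') = (\<Sum>P\<in>idx n a. rr q (zip I P) (zip K K') * rr q (zip P I') (zip J J'))"
proof -
  note len = assms[THEN idx_len]
  let ?e = "a + b + b'"
  have s: "\<And>i. i \<in> set (bt a b) \<Longrightarrow> Suc i < a + b" "\<And>i. i \<in> set (bt a b') \<Longrightarrow> Suc i < a + b'"
    by (erule set_bt)+
  have "zip J J' @ zip K K' = zip (J @ K) (J' @ K')" using len by simp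
  then have "rr q (zip I I') (zip J J' @ zip K K')
      = ker (WW q ?e (map ((+) b) (bt a b')) * WW q ?e (bt a b)) (J @ K @ I) (I' @ J' @ K')"
    using rr_zip[of I a I' "J @ K" "b + b'" "J' @ K'" q] bt_add_right[of a b b' ?e q] len
    by (simp add: add.assoc del: zip_append)
  also have "\<dots> = (\<Sum>L\<in>idx n ?e. ker (WW q ?e (map ((+) b) (bt a b'))) (J @ K @ I) L * ker (WW q ?e (bt a b)) L (I' @ J' @ K'))"
  proof (rule ker_mult)
    show "pres n ?e (WW q ?e (bt a b))" 
    proof (rule pres_WW)
      fix i assume "i \<in> set (bt a b)"
      then have "Suc i < a + b" by (rule s(1))
      then show "Suc i < ?e" by simp
    qed
    show "I' @ J' @ K' \<in> idx n ?e" using assms by (auto simp: idx_def)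
  qed
  also have "\<dots> = (\<Sum>A\<in>idx n b. \<Sum>P\<in>idx n a. \<Sum>B\<in>idx n b'. ker (WW q ?e (map ((+) b) (bt a b'))) (J @ K @ I) (A @ P @ B)
       * ker (WW q ?e (bt a b)) (A @ P @ B) (I' @ J' @ K'))"
    by (rule sum_idx_append3) simp
  also have "\<dots> = (\<Sum>A\<in>idx n b. \<Sum>P\<in>idx n a. \<Sum>B\<in>idx n b'. (if J = A then rr q (zip I P) (zip K B) else 0)
       * (if B = K' then rr q (zip P I') (zip A J') else 0))"
  proof (intro sum.cong refl)
    fix A P B assume **: "A \<in> idx n b" "P \<in> idx n a" "B \<in> idx n b'"
    note len' = **[THEN idx_len]
    have "ker (WW q (b + (a + b')) (map ((+) b) (bt a b'))) (J @ (K @ I)) (A @ (P @ B))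
       = (if J = A then ker (WW q (a + b') (bt a b')) (K @ I) (P @ B) else 0)"
      by (rule ker_WW_prefix) (use s len len' in auto)
    moreover have "ker (WW q (a + b + b') (bt a b)) ((A @ P) @ B) ((I' @ J') @ K')
       = (if B = K' then ker (WW q (a + b) (bt a b)) (A @ P) (I' @ J') else 0)"
      by (rule ker_WW_suffix) (use s len len' in auto)
    moreover have "b + (a + b') = ?e" by simp
    ultimately show "ker (WW q ?e (map ((+) b) (bt a b'))) (J @ K @ I) (A @ P @ B) * ker (WW q ?e (bt a b)) (A @ P @ B) (I' @ J' @ K')
      = (if J = A then rr q (zip I P) (zip K B) else 0) * (if B = K' then rr q (zip P I') (zip A J') else 0)"
      using len len' by (auto simp: rr_zip)
  qed
  also have "\<dots> = (\<Sum>A\<in>idx n b. if J = A then \<Sum>P\<in>idx n a. rr q (zip I P) (zip K K') * rr q (zip P I') (zip A J') else 0)"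
  proof (intro sum.cong refl)
    fix A
    have "(\<Sum>B\<in>idx n b'. f B * (if B = K' then y else 0)) = f K' * y" for f and y :: 'a
      using sum_idx_delta(1)[OF assms(6), of "\<lambda>B. f B * y"] by (simp add: if_distrib cong: if_cong)
    then show "(\<Sum>P\<in>idx n a. \<Sum>B\<in>idx n b'. (if J = A then rr q (zip I P) (zip K B) else 0)
       * (if B = K' then rr q (zip P I') (zip A J') else 0)) = (if J = A then \<Sum>P\<in>idx n a. rr q (zip I P) (zip K K') * rr q (zip P I') (zip A J') else 0)"
      by simp
  qed
  also have "\<dots> = (\<Sum>P\<in>idx n a. rr q (zip I P) (zip K K') * rr q (zip P I') (zip J J'))"
    using assms by (simp add: sum_idx_delta)
  finally show ?thesis .
qed

lemma rr_letters:
  assumes "s < n" "t < n" "i < n" "j < n"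
  shows "rr q [(s, i)] [(t, j)] = Rcoef q t s i j"
proof -
  have "bt 1 1 = [0]" by (simp add: bt_def mv_def)
  then have "rr q [(s, i)] [(t, j)] = app (TT q 2 0) (dl [i, j]) [t, s]"
    by (simp add: rr_def ker_def WW_def numeral_2_eq_2)
  also have "\<dots> = Rcoef q t s i j"
  proof -
    have "app (TT q 2 0) (dl [i, j]) [t, s] = hk q t s (dl [i, j] [t, s]) (dl [i, j] [s, t])"
      by (simp add: app_TT swp_def)
    then show ?thesis by (cases i j rule: linorder_cases) (auto simp: hk_def dl_def Rcoef_def)
  qed
  finally show ?thesis .
qed

text \<open>\<open>rrb\<close> is the convolution inverse of \<open>rr\<close>.\<close>
lemma rr_rrb:
  assumes q: "q \<noteq> 0" and "I \<in> idx n a" "I' \<in> idx n a" "J \<in> idx n b" "J' \<in> idx n b"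
  shows "(\<Sum>Q\<in>idx n a. \<Sum>P\<in>idx n b. rr q (zip I Q) (zip J P) * rrb q (zip Q I') (zip P J')) = (if I = I' \<and> J = J' then 1 else 0)"
    "(\<Sum>Q\<in>idx n a. \<Sum>P\<in>idx n b. rrb q (zip I Q) (zip J P) * rr q (zip Q I') (zip P J')) = (if I = I' \<and> J = J' then 1 else 0)"
proof -
  note len = assms(2-)[THEN idx_len]
  let ?A = "WW q (a + b) (bt a b)"
  have u: "uni ?A" and p: "pres n (a + b) ?A" "pres n (a + b) (rinv ?A)"
    by (rule WW_inv[OF q set_bt] pres_WW[OF set_bt]; assumption)+
  have "(\<Sum>Q\<in>idx n a. \<Sum>P\<in>idx n b. rr q (zip I Q) (zip J P) * rrb q (zip Q I') (zip P J'))
     = (\<Sum>Q\<in>idx n a. \<Sum>P\<in>idx n b. ker ?A (J @ I) (Q @ P) * ker (rinv ?A) (Q @ P) (J' @ I'))"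
    using len by (intro sum.cong refl) (auto simp: rr_zip rrb_zip dest!: idx_len)
  also have "\<dots> = ker (?A * rinv ?A) (J @ I) (J' @ I')"
  proof -
    have "J' @ I' \<in> idx n (a + b)" using assms by (auto simp: idx_def)
    then show ?thesis by (simp only: ker_mult[OF p(2)] sum_idx_append)
  qed
  also have "\<dots> = (if I = I' \<and> J = J' then 1 else 0)" using rinv[OF u] len by (auto simp: ker_one)
  finally show "(\<Sum>Q\<in>idx n a. \<Sum>P\<in>idx n b. rr q (zip I Q) (zip J P) * rrb q (zip Q I') (zip P J')) = (if I = I' \<and> J = J' then 1 else 0)" .
  have "(\<Sum>Q\<in>idx n a. \<Sum>P\<in>idx n b. rrb q (zip I Q) (zip J P) * rr q (zip Q I') (zip P J'))
     = (\<Sum>Q\<in>idx n a. \<Sum>P\<in>idx n b. ker (rinv ?A) (I @ J) (P @ Q) * ker ?A (P @ Q) (I' @ J'))"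
    using len by (intro sum.cong refl) (auto simp: rr_zip rrb_zip dest!: idx_len)
  also have "\<dots> = (\<Sum>P\<in>idx n b. \<Sum>Q\<in>idx n a. ker (rinv ?A) (I @ J) (P @ Q) * ker ?A (P @ Q) (I' @ J'))"
    by (rule sum.swap)
  also have "\<dots> = ker (rinv ?A * ?A) (I @ J) (I' @ J')"
  proof -
    have "I' @ J' \<in> idx n (a + b)" using assms by (auto simp: idx_def)
    then show ?thesis
      using sum_idx_append[of "\<lambda>L. ker (rinv ?A) (I @ J) L * ker ?A L (I' @ J')" n b a]
      by (simp only: ker_mult[OF p(1)] add.commute[of b a])
  qed
  also have "\<dots> = (if I = I' \<and> J = J' then 1 else 0)" using rinv[OF u] len by (auto simp: ker_one)
  finally show "(\<Sum>Q\<in>idx n a. \<Sum>P\<in>idx n b. rrb q (zip I Q) (zip J P) * rr q (zip Q I') (zip P J')) = (if I = I' \<and> J = J' then 1 else 0)" .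
qed

text \<open>Quasi-commutativity, dually: invariant functionals commute with the cabled braiding.\<close>
lemma rr_quasi:
  assumes \<phi>: "Rinv n q \<phi>" and *: "I \<in> idx n a" "I' \<in> idx n a" "J \<in> idx n b" "J' \<in> idx n b"
  shows "(\<Sum>Q\<in>idx n a. \<Sum>P\<in>idx n b. rr q (zip I Q) (zip J P) * \<phi> (zip Q I' @ zip P J'))
    = (\<Sum>Q\<in>idx n a. \<Sum>P\<in>idx n b. \<phi> (zip J P @ zip I Q) * rr q (zip Q I') (zip P J'))"
proof -
  note len = *[THEN idx_len]
  let ?e = "a + b" let ?A = "WW q ?e (bt a b)" let ?F = "op n ?e \<phi>"
  have "cmt ?F ?A" by (rule cmt_WW) (auto simp: cmt_def intro: op_TT[OF \<phi>] set_bt)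
  then have "ker (?A * ?F) (J @ I) (I' @ J') = ker (?F * ?A) (J @ I) (I' @ J')" by (simp add: cmt_def)
  moreover have JI: "J @ I \<in> idx n ?e" "I' @ J' \<in> idx n ?e" using * by (auto simp: idx_def)
  have "ker (?A * ?F) (J @ I) (I' @ J') = (\<Sum>Q\<in>idx n a. \<Sum>P\<in>idx n b. ker ?A (J @ I) (Q @ P) * ker ?F (Q @ P) (I' @ J'))"
    using ker_mult[OF pres_op JI(2)] by (simp add: sum_idx_append)
  also have "\<dots> = (\<Sum>Q\<in>idx n a. \<Sum>P\<in>idx n b. rr q (zip I Q) (zip J P) * \<phi> (zip Q I' @ zip P J'))"
  proof (intro sum.cong refl)
    fix Q P assume **: "Q \<in> idx n a" "P \<in> idx n b"
    then show "ker ?A (J @ I) (Q @ P) * ker ?F (Q @ P) (I' @ J') = rr q (zip I Q) (zip J P) * \<phi> (zip Q I' @ zip P J')"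
      using len **[THEN idx_len] JI by (simp add: rr_zip ker_op idx_append)
  qed
  moreover have "ker (?F * ?A) (J @ I) (I' @ J') = (\<Sum>P\<in>idx n b. \<Sum>Q\<in>idx n a. ker ?F (J @ I) (P @ Q) * ker ?A (P @ Q) (I' @ J'))"
  proof -
    have "pres n ?e ?A" by (rule pres_WW) (rule set_bt)
    then have "ker (?F * ?A) (J @ I) (I' @ J') = (\<Sum>L\<in>idx n ?e. ker ?F (J @ I) L * ker ?A L (I' @ J'))"
      using JI(2) by (rule ker_mult)
    then show ?thesis
      using sum_idx_append[of "\<lambda>L. ker ?F (J @ I) L * ker ?A L (I' @ J')" n b a] by (simp only: add.commute[of b a])
  qed
  moreover have "\<dots> = (\<Sum>P\<in>idx n b. \<Sum>Q\<in>idx n a. \<phi> (zip J P @ zip I Q) * rr q (zip Q I') (zip P J'))"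
  proof (intro sum.cong refl)
    fix Q P assume **: "P \<in> idx n b" "Q \<in> idx n a"
    then have "P @ Q \<in> idx n ?e" by (auto simp: idx_def)
    then show "ker ?F (J @ I) (P @ Q) * ker ?A (P @ Q) (I' @ J') = \<phi> (zip J P @ zip I Q) * rr q (zip Q I') (zip P J')"
      using len **[THEN idx_len] JI by (simp add: rr_zip ker_op)
  qed
  moreover have "\<dots> = (\<Sum>Q\<in>idx n a. \<Sum>P\<in>idx n b. \<phi> (zip J P @ zip I Q) * rr q (zip Q I') (zip P J'))"
    by (rule sum.swap)
  ultimately show ?thesis by simp
qed

section \<open>Kronecker products\<close>

lemma idx_split: fixes x :: nat assumes "x < a * b" obtains i j where "i < a" "j < b" "x = i * b + j"
proof (rule that)
  have "b > 0" using assms by (cases b) auto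
  then show "x div b < a" "x mod b < b" "x = x div b * b + x mod b"
    using assms by (simp_all add: less_mult_imp_div_less)
qed

lemma idx_bound: fixes i :: nat assumes "i < a" "j < b" shows "i * b + j < a * b"
proof -
  have "i * b + j < Suc i * b" using assms by simp
  also have "\<dots> \<le> a * b" using assms by (intro mult_right_mono) auto
  finally show ?thesis .
qed

lemma idx_inj: fixes i :: nat assumes "j < b" "l < b" shows "i * b + j = k * b + l \<longleftrightarrow> i = k \<and> j = l"
proof
  assume *: "i * b + j = k * b + l"
  have "i = (i * b + j) div b" "j = (i * b + j) mod b" using assms by simp_all
  moreover have "k = (k * b + l) div b" "l = (k * b + l) mod b" using assms by simp_all
  ultimately show "i = k \<and> j = l" using * by simp
qed simp

lemma sum_split: "(\<Sum>y<a * b. f y) = (\<Sum>i<a. \<Sum>j<b. f (i * b + j))" for f :: "nat \<Rightarrow> 'k::comm_monoid_add"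
proof -
  have "bij_betw (\<lambda>(i, j). i * b + j) ({..<a} \<times> {..<b}) {..<a * b}"
  proof (rule bij_betw_byWitness[of _ "\<lambda>x. (x div b, x mod b)"])
    show "\<forall>x\<in>{..<a} \<times> {..<b}. ((case x of (i, j) \<Rightarrow> i * b + j) div b, (case x of (i, j) \<Rightarrow> i * b + j) mod b) = x"
      by auto
    show "\<forall>x\<in>{..<a * b}. (case (x div b, x mod b) of (i, j) \<Rightarrow> i * b + j) = x" by auto
    show "(\<lambda>(i, j). i * b + j) ` ({..<a} \<times> {..<b}) \<subseteq> {..<a * b}" using idx_bound by fastforce
    show "(\<lambda>x. (x div b, x mod b)) ` {..<a * b} \<subseteq> {..<a} \<times> {..<b}" by (auto elim: idx_split)
  qed
  from sum.reindex_bij_betw[OF this, of f] show ?thesis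
    by (simp add: sum.cartesian_product case_prod_beta')
qed

lemma dim_kron [simp]: "dim_row (kron A B) = dim_row A * dim_row B" "dim_col (kron A B) = dim_col A * dim_col B"
  by (simp_all add: kron_def)

lemma kron_index:
  assumes "i < dim_row A" "j < dim_row B" "k < dim_col A" "l < dim_col B"
    "r = dim_row B" "c = dim_col B"
  shows "kron A B $$ (i * r + j, k * c + l) = A $$ (i, k) * B $$ (j, l)"
proof -
  have "i * r + j < dim_row A * r" "k * c + l < dim_col A * c" using assms idx_bound by blast+
  then show ?thesis using assms by (simp add: kron_def)
qed

lemma mat_eq_splitI:
  assumes "dim_row A = a * b" "dim_row B = a * b" "dim_col A = c * d" "dim_col B = c * d"
    and "\<And>i j k l. i < a \<Longrightarrow> j < b \<Longrightarrow> k < c \<Longrightarrow> l < d \<Longrightarrow> A $$ (i * b + j, k * d + l) = B $$ (i * b + j, k * d + l)"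
  shows "A = B"
  by (rule eq_matI) (use assms in \<open>auto elim!: idx_split\<close>)

lemma mult_index:
  "i < dim_row A \<Longrightarrow> j < dim_col B \<Longrightarrow> dim_col A = n \<Longrightarrow> dim_row B = n \<Longrightarrow> (A * B) $$ (i, j) = (\<Sum>k<n. A $$ (i, k) * B $$ (k, j))"
  by (simp add: times_mat_def scalar_prod_def lessThan_atLeast0)

lemma kron_mult:
  fixes A B C D :: "'k::comm_semiring_1 mat"
  assumes "dim_col A = dim_row C" "dim_col B = dim_row D"
  shows "kron A B * kron C D = kron (A * C) (B * D)"
proof (rule mat_eq_splitI[of _ "dim_row A" "dim_row B" _ "dim_col C" "dim_col D"])
  fix i j k l assume *: "i < dim_row A" "j < dim_row B" "k < dim_col C" "l < dim_col D"
  have "(kron A B * kron C D) $$ (i * dim_row B + j, k * dim_col D + l)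
    = (\<Sum>y<dim_row C * dim_row D. kron A B $$ (i * dim_row B + j, y) * kron C D $$ (y, k * dim_col D + l))"
    by (rule mult_index) (use * assms idx_bound in auto)
  also have "\<dots> = (\<Sum>s<dim_row C. \<Sum>t<dim_row D. (A $$ (i, s) * B $$ (j, t)) * (C $$ (s, k) * D $$ (t, l)))"
    unfolding sum_split using * assms by (intro sum.cong refl arg_cong2[of _ _ _ _ "(*)"] kron_index) auto
  also have "\<dots> = (\<Sum>s<dim_row C. A $$ (i, s) * C $$ (s, k)) * (\<Sum>t<dim_row D. B $$ (j, t) * D $$ (t, l))"
    by (simp add: sum_product ac_simps)
  also have "\<dots> = (A * C) $$ (i, k) * (B * D) $$ (j, l)"
    using * assms mult_index[of i A k C] mult_index[of j B l D] by simp
  also have "\<dots> = kron (A * C) (B * D) $$ (i * dim_row B + j, k * dim_col D + l)"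
    using * by (intro kron_index[symmetric]) auto
  finally show "(kron A B * kron C D) $$ (i * dim_row B + j, k * dim_col D + l)
     = kron (A * C) (B * D) $$ (i * dim_row B + j, k * dim_col D + l)" .
qed auto

lemma kron_one: "kron (1\<^sub>m a) (1\<^sub>m b) = (1\<^sub>m (a * b) :: 'k::semiring_1 mat)"
proof (rule mat_eq_splitI[of _ a b _ a b])
  fix i j k l assume *: "i < a" "j < b" "k < a" "l < b"
  then have "(i * b + j = k * b + l) = (i = k \<and> j = l)" by (simp add: idx_inj)
  then show "kron (1\<^sub>m a) (1\<^sub>m b) $$ (i * b + j, k * b + l) = (1\<^sub>m (a * b) :: 'k mat) $$ (i * b + j, k * b + l)"
    using * idx_bound by (subst kron_index) auto
qed auto

lemma kron_assoc: "kron (kron A B) C = kron A (kron B (C :: 'k::semiring_1 mat))"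
proof (rule mat_eq_splitI[of _ "dim_row A * dim_row B" "dim_row C" _ "dim_col A * dim_col B" "dim_col C"])
  fix i j k l assume *: "i < dim_row A * dim_row B" "j < dim_row C" "k < dim_col A * dim_col B" "l < dim_col C"
  from *(1) obtain i1 i2 where i: "i1 < dim_row A" "i2 < dim_row B" "i = i1 * dim_row B + i2" by (rule idx_split)
  from *(3) obtain k1 k2 where k: "k1 < dim_col A" "k2 < dim_col B" "k = k1 * dim_col B + k2" by (rule idx_split)
  have e: "i * dim_row C + j = i1 * (dim_row B * dim_row C) + (i2 * dim_row C + j)"
    "k * dim_col C + l = k1 * (dim_col B * dim_col C) + (k2 * dim_col C + l)"
    using i k by (simp_all add: algebra_simps)
  have "kron (kron A B) C $$ (i * dim_row C + j, k * dim_col C + l) = A $$ (i1, k1) * B $$ (i2, k2) * C $$ (j, l)"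
    using * i k by (subst kron_index) (simp_all add: kron_index)
  moreover have "kron A (kron B C) $$ (i * dim_row C + j, k * dim_col C + l) = A $$ (i1, k1) * (B $$ (i2, k2) * C $$ (j, l))"
    unfolding e using * i k idx_bound by (subst kron_index) (simp_all add: kron_index)
  ultimately show "kron (kron A B) C $$ (i * dim_row C + j, k * dim_col C + l) = kron A (kron B C) $$ (i * dim_row C + j, k * dim_col C + l)"
    by (simp add: mult.assoc)
qed (auto simp: mult.assoc)

lemma kron_unit: "kron (1\<^sub>m 1) A = (A :: 'k::semiring_1 mat)" "kron A (1\<^sub>m 1) = A"
  by (rule eq_matI; simp add: kron_def)+

fun kpow :: "'k::semiring_1 mat \<Rightarrow> nat \<Rightarrow> 'k mat" where
  "kpow A 0 = 1\<^sub>m 1"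
| "kpow A (Suc k) = kron A (kpow A k)"

lemma dim_kpow [simp]: "dim_row (kpow A k) = dim_row A ^ k" "dim_col (kpow A k) = dim_col A ^ k"
  by (induction k) auto

lemma kpow_mult:
  fixes A B :: "'k::comm_semiring_1 mat"
  assumes "dim_col A = dim_row B" shows "kpow A k * kpow B k = kpow (A * B) k"
  by (induction k) (simp_all add: kron_mult assms)

lemma kpow_one: "kpow (1\<^sub>m a) k = (1\<^sub>m (a ^ k) :: 'k::semiring_1 mat)"
  by (induction k) (simp_all add: kron_one)

lemma kpow_add: "kpow A (a + b) = kron (kpow A a) (kpow (A :: 'k::semiring_1 mat) b)"
proof (induction a)
  case 0 show ?case using kron_unit(1)[of "kpow A b"] by simp
qed (simp add: kron_assoc)

section \<open>Comodules in terms of functionals\<close>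

lemma Aq_MA: "Aq n q = MA (words n) Quot rel_ideal n q" by (simp add: Aq_def Free_MA)
lemma Aq2_MA: "Aq2 n q = MA (words n \<times> words n) Quot rel_ideal2 n q" by (simp add: Aq2_def Free2_MA)
lemma cls_MA: "cls n q f = rel_ideal n q +>\<^bsub>MA (words n)\<^esub> f" by (simp add: cls_def Free_MA)

abbreviation wp :: "nat \<Rightarrow> 'k::field falg \<Rightarrow> bool" where "wp n f \<equiv> Poly_Mapping.keys f \<subseteq> words n"

lemma cls_carrier: "wp n f \<Longrightarrow> cls n q f \<in> carrier (Aq n q)"
  unfolding Aq_MA cls_MA by (rule quotient_algebra.quot_carrier[OF quotient_Aq])
lemma cls_eq: "cls n q f = cls n q g \<longleftrightarrow> f - g \<in> rel_ideal n q"
  unfolding cls_MA by (rule quotient_algebra.coset_eq[OF quotient_Aq])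
lemma mem_cls: "f \<in> cls n q g \<longleftrightarrow> f - g \<in> rel_ideal n q"
  unfolding cls_MA by (rule quotient_algebra.coset_mem[OF quotient_Aq])
lemma cls_mult: "wp n f \<Longrightarrow> wp n g \<Longrightarrow> cls n q f \<otimes>\<^bsub>Aq n q\<^esub> cls n q g = cls n q (f * g)"
  unfolding Aq_MA cls_MA by (rule quotient_algebra.quot_mult[OF quotient_Aq])
lemma cls_finsum: "finite A \<Longrightarrow> (\<And>i. i \<in> A \<Longrightarrow> wp n (f i)) \<Longrightarrow> finsum (Aq n q) (\<lambda>i. cls n q (f i)) A = cls n q (\<Sum>i\<in>A. f i)"
  unfolding Aq_MA cls_MA by (rule quotient_algebra.quot_finsum[OF quotient_Aq])

text \<open>Invariant functionals take the same value on all representatives of a class, so any choice will do.\<close>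
definition rep :: "nat \<Rightarrow> 'k::field \<Rightarrow> 'k falg set \<Rightarrow> 'k falg" where
  "rep n q a = (SOME f. wp n f \<and> cls n q f = a)"

lemma rep: assumes "a \<in> carrier (Aq n q)" shows "wp n (rep n q a)" "cls n q (rep n q a) = a"
proof -
  obtain f where "wp n f" "a = cls n q f"
    using assms unfolding Aq_MA cls_MA by (rule quotient_algebra.quot_carrierE[OF quotient_Aq])
  then have "wp n (rep n q a) \<and> cls n q (rep n q a) = a"
    unfolding rep_def by (intro someI[of "\<lambda>f. wp n f \<and> cls n q f = a" f]) simp
  then show "wp n (rep n q a)" "cls n q (rep n q a) = a" by auto
qed

lemma cls_lf: "cls n q f = cls n q g \<Longrightarrow> Rinv n q \<phi> \<Longrightarrow> lf \<phi> f = lf \<phi> g"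
  using Rinv_kills[of n q \<phi> "f - g"] by (simp add: cls_eq lf_diff)

lemma lf_rep_cls: assumes "wp n f" "Rinv n q \<phi>" shows "lf \<phi> (rep n q (cls n q f)) = lf \<phi> f"
  by (rule cls_lf[OF rep(2)[OF cls_carrier[OF assms(1)]] assms(2)])

lemma cls_eqI: assumes "wp n f" "wp n g" "\<And>\<phi>. Rinv n q \<phi> \<Longrightarrow> lf \<phi> f = lf \<phi> g" shows "cls n q f = cls n q g"
  unfolding cls_eq using assms by (subst mem_rel_ideal) (auto simp: keys_diff_sub lf_diff)

lemma wp_mult: "wp n f \<Longrightarrow> wp n g \<Longrightarrow> wp n (f * g)" by (rule keys_mult_sub[OF submon_words])
lemma wp_constI [simp]: "wp n (const a)" by (simp add: const_def)

lemma lf_const_mult: "lf \<phi> (const a * f) = a * lf \<phi> f" "lf \<phi> (f * const a) = a * lf \<phi> f"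
  by (simp_all add: lf_mult const_def plus_list_def)
     (simp add: lf_def sum_distrib_left ac_simps)+

lemma hk_scale: "hk q a b (c * x) (c * y) = c * hk q a b x y" "hk q a b (x * c) (y * c) = hk q a b x y * c"
  by (simp_all add: hk_def algebra_simps)

lemma RinvD:
  "Rinv n q \<phi> \<Longrightarrow> u \<in> words n \<Longrightarrow> v \<in> words n \<Longrightarrow> a < n \<Longrightarrow> b < n \<Longrightarrow> i < n \<Longrightarrow> j < n \<Longrightarrow>
    hk q a b (\<phi> (u @ [(a, i), (b, j)] @ v)) (\<phi> (u @ [(b, i), (a, j)] @ v))
    = hk q i j (\<phi> (u @ [(a, i), (b, j)] @ v)) (\<phi> (u @ [(a, j), (b, i)] @ v))"
  unfolding Rinv_def by blast

lemma Rinv_sum_scale: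
  assumes "\<And>i. i \<in> A \<Longrightarrow> Rinv n q (\<phi> i)" shows "Rinv n q (\<lambda>w. \<Sum>i\<in>A. c i * \<phi> i w)"
  unfolding Rinv_def hk_sum hk_scale
proof (intro ballI allI impI sum.cong refl arg_cong2[of _ _ _ _ "(*)"])
  fix u v :: word and a b i j x
  assume "u \<in> words n" "v \<in> words n" "a < n" "b < n" "i < n" "j < n" "x \<in> A"
  then show "hk q a b (\<phi> x (u @ [(a, i), (b, j)] @ v)) (\<phi> x (u @ [(b, i), (a, j)] @ v))
    = hk q i j (\<phi> x (u @ [(a, i), (b, j)] @ v)) (\<phi> x (u @ [(a, j), (b, i)] @ v))"
    by (intro RinvD[OF assms])
qed

lemma Rinv_scale: assumes "Rinv n q \<phi>" shows "Rinv n q (\<lambda>w. c * \<phi> w)" "Rinv n q (\<lambda>w. \<phi> w * c)"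
  using Rinv_sum_scale[of "{()}" n q "\<lambda>_. \<phi>" "\<lambda>_. c"] assms by (simp_all add: mult.commute)

lemma Rinv_lf: assumes "\<And>v. v \<in> words n \<Longrightarrow> Rinv n q (\<lambda>u. \<chi> u v)" "wp n g" shows "Rinv n q (\<lambda>u. lf (\<chi> u) g)"
  unfolding lf_def by (rule Rinv_sum_scale) (use assms in auto)

lemma R2inv_times: "Rinv n q \<alpha> \<Longrightarrow> Rinv n q \<beta> \<Longrightarrow> R2inv n q (\<lambda>u v. \<alpha> u * \<beta> v)"
  unfolding R2inv_def by (simp add: Rinv_scale)

lemma R2inv_rep:
  assumes "R2inv n q \<chi>" "wp n f" "wp n g"
  shows "lf (\<lambda>u. lf (\<chi> u) (rep n q (cls n q g))) (rep n q (cls n q f)) = lf (\<lambda>u. lf (\<chi> u) g) f"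
proof -
  have 1: "Rinv n q (\<lambda>u. \<chi> u v)" if "v \<in> words n" for v using assms(1) that by (simp add: R2inv_def)
  have 2: "Rinv n q (\<chi> u)" if "u \<in> words n" for u using assms(1) that by (simp add: R2inv_def)
  note r = rep(1)[OF cls_carrier]
  have "lf (\<lambda>u. lf (\<chi> u) (rep n q (cls n q g))) (rep n q (cls n q f)) = lf (\<lambda>u. lf (\<chi> u) (rep n q (cls n q g))) f"
    by (rule lf_rep_cls[OF assms(2) Rinv_lf[OF 1 r[OF assms(3)]]])
  also have "\<dots> = lf (\<lambda>u. lf (\<chi> u) g) f"
    by (rule lf_cong) (use assms(2,3) lf_rep_cls 2 in blast)
  finally show ?thesis .
qed

lemma comult_cls: assumes "wp n f"
  shows "comult n q (cls n q f) = rel_ideal2 n q +>\<^bsub>MA (words n \<times> words n)\<^esub> free_comult n f"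
proof -
  interpret Q: quotient_algebra "words n \<times> words n" "rel_ideal2 n q" by (rule quotient_Aq2)
  have "rel_ideal2 n q +>\<^bsub>MA (words n \<times> words n)\<^esub> free_comult n g
      = rel_ideal2 n q +>\<^bsub>MA (words n \<times> words n)\<^esub> free_comult n f" if "g \<in> cls n q f" for g
  proof -
    have g: "g - f \<in> rel_ideal n q" using that by (simp add: mem_cls)
    then have "wp n (g - f + f)" using rel_ideal_sub assms by (intro keys_add_sub) auto
    then have "wp n g" by simp
    then have "Poly_Mapping.keys (free_comult n g - free_comult n f) \<subseteq> words n \<times> words n"
      using assms by (intro keys_diff_sub keys_comult)
    moreover have "lf2 \<chi> (free_comult n g - free_comult n f) = 0" if "R2inv n q \<chi>" for \<chi>
      using Rinv_kills[OF Rinv_conv[OF that] g] by (simp add: lf_diff lf2_comult)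
    ultimately have "free_comult n g - free_comult n f \<in> rel_ideal2 n q" by (simp add: mem_rel_ideal2)
    then show ?thesis by (simp add: Q.coset_eq)
  qed
  moreover have "f \<in> cls n q f" using quotient_algebra.I_zero[OF quotient_Aq] by (simp add: mem_cls)
  ultimately show ?thesis unfolding comult_def Free2_MA by blast
qed

lemma lf2_ftens: "lf2 \<chi> (ftens f g) = lf (\<lambda>u. lf (\<chi> u) g) f" by (simp add: lf_ftens)

lemma Atens_cls: assumes "wp n f" "wp n g"
  shows "Atens n q (cls n q f) (cls n q g) = rel_ideal2 n q +>\<^bsub>MA (words n \<times> words n)\<^esub> ftens f g"
proof -
  interpret Q: quotient_algebra "words n \<times> words n" "rel_ideal2 n q" by (rule quotient_Aq2)
  have wp: "wp n f'" if "f' \<in> cls n q f" "wp n f" for f' f :: "'a falg"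
    using keys_add_sub[of "f' - f" "words n" f] rel_ideal_sub that by (auto simp: mem_cls)
  have "rel_ideal2 n q +>\<^bsub>MA (words n \<times> words n)\<^esub> ftens f' g'
      = rel_ideal2 n q +>\<^bsub>MA (words n \<times> words n)\<^esub> ftens f g" if fg: "f' \<in> cls n q f" "g' \<in> cls n q g" for f' g'
  proof -
    note w = wp[OF fg(1) assms(1)] wp[OF fg(2) assms(2)]
    have c: "cls n q f' = cls n q f" "cls n q g' = cls n q g" using fg by (simp_all add: cls_eq mem_cls)
    have "Poly_Mapping.keys (ftens f' g' - ftens f g) \<subseteq> words n \<times> words n"
      using assms w by (intro keys_diff_sub keys_ftens)
    moreover have "lf2 \<chi> (ftens f' g' - ftens f g) = 0" if "R2inv n q \<chi>" for \<chi>
      using R2inv_rep[OF that w] R2inv_rep[OF that assms] c by (simp add: lf_diff lf2_ftens)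
    ultimately have "ftens f' g' - ftens f g \<in> rel_ideal2 n q" by (simp add: mem_rel_ideal2)
    then show ?thesis by (simp add: Q.coset_eq)
  qed
  moreover have "f \<in> cls n q f" "g \<in> cls n q g" using quotient_algebra.I_zero[OF quotient_Aq] by (simp_all add: mem_cls)
  ultimately show ?thesis unfolding Atens_def Free2_MA by blast
qed

lemma counit_cls: "counit (cls n q f) = lf eps f"
proof -
  have "free_counit ` cls n q f = {lf eps f}"
  proof
    show "free_counit ` cls n q f \<subseteq> {lf eps f}"
      using cls_lf[OF _ Rinv_eps] by (auto simp: free_counit_lf mem_cls cls_eq)
    have "f \<in> cls n q f" using quotient_algebra.I_zero[OF quotient_Aq] by (simp add: mem_cls)
    then show "{lf eps f} \<subseteq> free_counit ` cls n q f" by (auto simp: free_counit_lf)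
  qed
  then show ?thesis by (simp add: counit_def)
qed

definition ent :: "nat \<Rightarrow> 'k::field \<Rightarrow> 'k coact \<Rightarrow> bool" where
  "ent n q c \<longleftrightarrow> dim_col c = dim_row c \<and> (\<forall>i<dim_row c. \<forall>j<dim_row c. c $$ (i, j) \<in> carrier (Aq n q))"

abbreviation fr :: "nat \<Rightarrow> 'k::field \<Rightarrow> 'k coact \<Rightarrow> nat \<Rightarrow> nat \<Rightarrow> 'k falg" where
  "fr n q c i j \<equiv> rep n q (c $$ (i, j))"

lemma ent_iff: "ent n q c \<longleftrightarrow> square_mat c \<and> elements_mat c \<subseteq> carrier (Aq n q)"
  by (auto simp: ent_def elements_mat_def UN_subset_iff image_subset_iff)

lemma ent_fr: "ent n q c \<Longrightarrow> i < dim_row c \<Longrightarrow> j < dim_row c \<Longrightarrow> wp n (fr n q c i j) \<and> cls n q (fr n q c i j) = c $$ (i, j)"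
  using rep unfolding ent_def by blast

text \<open>Invariant functionals on one or two words separate the elements of \<open>A\<^sub>q(n, n)\<close> and of its tensor
  square, so the comodule axioms may be tested on them.\<close>
lemma is_comodule_iff:
  "is_comodule n q c \<longleftrightarrow> ent n q c \<and> (\<forall>i<dim_row c. \<forall>j<dim_row c.
     (\<forall>\<chi>. R2inv n q \<chi> \<longrightarrow> lf (conv n \<chi>) (fr n q c i j) = (\<Sum>s<dim_row c. lf (\<lambda>u. lf (\<chi> u) (fr n q c s j)) (fr n q c i s)))
     \<and> lf eps (fr n q c i j) = (if i = j then 1 else 0))"
proof -
  interpret Q: quotient_algebra "words n \<times> words n" "rel_ideal2 n q" by (rule quotient_Aq2)
  have e1: "(comult n q (c $$ (i, j)) = finsum (Aq2 n q) (\<lambda>s. Atens n q (c $$ (i, s)) (c $$ (s, j))) {..<dim_row c})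
    = (\<forall>\<chi>. R2inv n q \<chi> \<longrightarrow> lf (conv n \<chi>) (fr n q c i j) = (\<Sum>s<dim_row c. lf (\<lambda>u. lf (\<chi> u) (fr n q c s j)) (fr n q c i s)))"
    and e2: "counit (c $$ (i, j)) = lf eps (fr n q c i j)"
    if c: "ent n q c" and ij: "i < dim_row c" "j < dim_row c" for i j
  proof -
    let ?W = "words n \<times> words n"
    let ?f = "fr n q c"
    have f: "wp n (?f i j)" "cls n q (?f i j) = c $$ (i, j)" if "i < dim_row c" "j < dim_row c" for i j
      using ent_fr[OF c that] by auto
    have k: "Poly_Mapping.keys (ftens (?f i s) (?f s j)) \<subseteq> ?W" if "s < dim_row c" for s
      using f ij that by (intro keys_ftens) auto
    have 1: "comult n q (c $$ (i, j)) = rel_ideal2 n q +>\<^bsub>MA ?W\<^esub> free_comult n (?f i j)"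
      using comult_cls[OF f(1)[OF ij], of q] f(2)[OF ij] by simp
    have 2: "Atens n q (c $$ (i, s)) (c $$ (s, j)) = rel_ideal2 n q +>\<^bsub>MA ?W\<^esub> ftens (?f i s) (?f s j)" if "s < dim_row c" for s
      using Atens_cls[OF f(1)[OF ij(1) that] f(1)[OF that ij(2)], of q] f(2)[OF ij(1) that] f(2)[OF that ij(2)] by simp
    interpret R: ring "Aq2 n q" unfolding Aq2_MA by (rule Q.ring_quot)
    have "finsum (Aq2 n q) (\<lambda>s. Atens n q (c $$ (i, s)) (c $$ (s, j))) {..<dim_row c}
      = finsum (Aq2 n q) (\<lambda>s. rel_ideal2 n q +>\<^bsub>MA ?W\<^esub> ftens (?f i s) (?f s j)) {..<dim_row c}"
      by (rule R.finsum_cong') (use 2 k Q.quot_carrier in \<open>auto simp: Aq2_MA\<close>)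
    also have "\<dots> = rel_ideal2 n q +>\<^bsub>MA ?W\<^esub> (\<Sum>s<dim_row c. ftens (?f i s) (?f s j))"
      unfolding Aq2_MA by (rule Q.quot_finsum) (use k in auto)
    finally have "(comult n q (c $$ (i, j)) = finsum (Aq2 n q) (\<lambda>s. Atens n q (c $$ (i, s)) (c $$ (s, j))) {..<dim_row c})
       \<longleftrightarrow> free_comult n (?f i j) - (\<Sum>s<dim_row c. ftens (?f i s) (?f s j)) \<in> rel_ideal2 n q"
      unfolding 1 by (simp add: Q.coset_eq)
    also have "\<dots> \<longleftrightarrow> (\<forall>\<chi>. R2inv n q \<chi> \<longrightarrow> lf2 \<chi> (free_comult n (?f i j) - (\<Sum>s<dim_row c. ftens (?f i s) (?f s j))) = 0)"
      by (rule mem_rel_ideal2) (intro keys_diff_sub keys_comult keys_sum_sub; use f(1)[OF ij] k in simp)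
    finally show "(comult n q (c $$ (i, j)) = finsum (Aq2 n q) (\<lambda>s. Atens n q (c $$ (i, s)) (c $$ (s, j))) {..<dim_row c})
      = (\<forall>\<chi>. R2inv n q \<chi> \<longrightarrow> lf (conv n \<chi>) (fr n q c i j) = (\<Sum>s<dim_row c. lf (\<lambda>u. lf (\<chi> u) (fr n q c s j)) (fr n q c i s)))"
      by (simp add: lf_diff lf_sum lf2_comult lf2_ftens)
    show "counit (c $$ (i, j)) = lf eps (fr n q c i j)" using counit_cls[of n q "?f i j"] f(2)[OF ij] by simp
  qed
  show ?thesis
  proof (cases "ent n q c")
    case True
    then have "square_mat c" "elements_mat c \<subseteq> carrier (Aq n q)" by (simp_all add: ent_iff)
    moreover have "(comult n q (c $$ (i, j)) = finsum (Aq2 n q) (\<lambda>s. Atens n q (c $$ (i, s)) (c $$ (s, j))) {..<dim_row c} \<and>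
        counit (c $$ (i, j)) = (if i = j then 1 else 0))
      = ((\<forall>\<chi>. R2inv n q \<chi> \<longrightarrow> lf (conv n \<chi>) (fr n q c i j) = (\<Sum>s<dim_row c. lf (\<lambda>u. lf (\<chi> u) (fr n q c s j)) (fr n q c i s)))
     \<and> lf eps (fr n q c i j) = (if i = j then 1 else 0))" if "i < dim_row c" "j < dim_row c" for i j
      by (simp only: e1[OF True that] e2[OF True that])
    ultimately show ?thesis unfolding is_comodule_def by (simp only: True simp_thms cong: imp_cong)
  next
    case False
    then show ?thesis unfolding is_comodule_def ent_iff by blast
  qed
qed

lemma comoduleD:
  assumes "is_comodule n q c" "i < dim_row c" "j < dim_row c"
  shows "wp n (fr n q c i j)" "cls n q (fr n q c i j) = c $$ (i, j)"
    "lf eps (fr n q c i j) = (if i = j then 1 else 0)"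
    "R2inv n q \<chi> \<Longrightarrow> lf (conv n \<chi>) (fr n q c i j) = (\<Sum>s<dim_row c. lf (\<lambda>u. lf (\<chi> u) (fr n q c s j)) (fr n q c i s))"
  using assms ent_fr unfolding is_comodule_iff by blast+

text \<open>A comodule is thus a representation of the invariant functionals under convolution.\<close>
lemma comodule_times:
  assumes "is_comodule n q c" "i < dim_row c" "j < dim_row c" "Rinv n q \<alpha>" "Rinv n q \<beta>"
  shows "lf (conv n (\<lambda>u v. \<alpha> u * \<beta> v)) (fr n q c i j) = (\<Sum>s<dim_row c. lf \<alpha> (fr n q c i s) * lf \<beta> (fr n q c s j))"
  using comoduleD(4)[OF assms(1-3) R2inv_times[OF assms(4,5)]]
  by (simp add: lf_scale) (simp add: lf_def sum_distrib_right mult.assoc)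

text \<open>Comodule maps are the maps that commute with the action of all invariant functionals.\<close>
lemma comodule_maps_iff:
  assumes "ent n q c" "ent n q c'"
  shows "f \<in> comodule_maps n q c c' \<longleftrightarrow> f \<in> carrier_mat (dim_row c') (dim_row c) \<and>
    (\<forall>\<phi>. Rinv n q \<phi> \<longrightarrow> (\<forall>k<dim_row c'. \<forall>i<dim_row c.
      (\<Sum>j<dim_row c. f $$ (k, j) * lf \<phi> (fr n q c j i)) = (\<Sum>l<dim_row c'. lf \<phi> (fr n q c' k l) * f $$ (l, i))))"
proof -
  interpret Q: quotient_algebra "words n" "rel_ideal n q" by (rule quotient_Aq)
  interpret R: ring "Aq n q" unfolding Aq_MA by (rule Q.ring_quot)
  have "(finsum (Aq n q) (\<lambda>j. cls n q (const (f $$ (k, j))) \<otimes>\<^bsub>Aq n q\<^esub> c $$ (j, i)) {..<dim_row c}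
       = finsum (Aq n q) (\<lambda>l. c' $$ (k, l) \<otimes>\<^bsub>Aq n q\<^esub> cls n q (const (f $$ (l, i)))) {..<dim_row c'})
    = (\<forall>\<phi>. Rinv n q \<phi> \<longrightarrow>
      (\<Sum>j<dim_row c. f $$ (k, j) * lf \<phi> (fr n q c j i)) = (\<Sum>l<dim_row c'. lf \<phi> (fr n q c' k l) * f $$ (l, i)))"
    if ki: "k < dim_row c'" "i < dim_row c" for k i
  proof -
    have f: "wp n (fr n q c j i)" "cls n q (fr n q c j i) = c $$ (j, i)" if "j < dim_row c" for j
      using ent_fr[OF assms(1) that ki(2)] by auto
    have f': "wp n (fr n q c' k l)" "cls n q (fr n q c' k l) = c' $$ (k, l)" if "l < dim_row c'" for l
      using ent_fr[OF assms(2) ki(1) that] by auto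
    have 1: "cls n q (const (f $$ (k, j))) \<otimes>\<^bsub>Aq n q\<^esub> c $$ (j, i) = cls n q (const (f $$ (k, j)) * fr n q c j i)" if "j < dim_row c" for j
      using cls_mult[OF wp_constI f(1)[OF that], where q = q] f(2)[OF that] by simp
    have 2: "c' $$ (k, l) \<otimes>\<^bsub>Aq n q\<^esub> cls n q (const (f $$ (l, i))) = cls n q (fr n q c' k l * const (f $$ (l, i)))" if "l < dim_row c'" for l
      using cls_mult[OF f'(1)[OF that] wp_constI, where q = q] f'(2)[OF that] by simp
    have w1: "wp n (const (f $$ (k, j)) * fr n q c j i)" if "j < dim_row c" for j by (intro wp_mult wp_constI f that)
    have w2: "wp n (fr n q c' k l * const (f $$ (l, i)))" if "l < dim_row c'" for l by (intro wp_mult wp_constI f' that)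
    have s1: "finsum (Aq n q) (\<lambda>j. cls n q (const (f $$ (k, j))) \<otimes>\<^bsub>Aq n q\<^esub> c $$ (j, i)) {..<dim_row c}
      = cls n q (\<Sum>j<dim_row c. const (f $$ (k, j)) * fr n q c j i)"
    proof -
      have "finsum (Aq n q) (\<lambda>j. cls n q (const (f $$ (k, j))) \<otimes>\<^bsub>Aq n q\<^esub> c $$ (j, i)) {..<dim_row c}
        = finsum (Aq n q) (\<lambda>j. cls n q (const (f $$ (k, j)) * fr n q c j i)) {..<dim_row c}"
        by (rule R.finsum_cong') (use 1 cls_carrier[OF w1, where q = q] in auto)
      then show ?thesis using cls_finsum[where A = "{..<dim_row c}" and n = n and q = q and f = "\<lambda>j. const (f $$ (k, j)) * fr n q c j i"] w1 by simp
    qed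
    have s2: "finsum (Aq n q) (\<lambda>l. c' $$ (k, l) \<otimes>\<^bsub>Aq n q\<^esub> cls n q (const (f $$ (l, i)))) {..<dim_row c'}
      = cls n q (\<Sum>l<dim_row c'. fr n q c' k l * const (f $$ (l, i)))"
    proof -
      have "finsum (Aq n q) (\<lambda>l. c' $$ (k, l) \<otimes>\<^bsub>Aq n q\<^esub> cls n q (const (f $$ (l, i)))) {..<dim_row c'}
        = finsum (Aq n q) (\<lambda>l. cls n q (fr n q c' k l * const (f $$ (l, i)))) {..<dim_row c'}"
        by (rule R.finsum_cong') (use 2 cls_carrier[OF w2, where q = q] in auto)
      then show ?thesis using cls_finsum[where A = "{..<dim_row c'}" and n = n and q = q and f = "\<lambda>l. fr n q c' k l * const (f $$ (l, i))"] w2 by simp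
    qed
    have W: "wp n (\<Sum>j<dim_row c. const (f $$ (k, j)) * fr n q c j i)" "wp n (\<Sum>l<dim_row c'. fr n q c' k l * const (f $$ (l, i)))"
      using w1 w2 by (intro keys_sum_sub; simp)+
    have "(cls n q (\<Sum>j<dim_row c. const (f $$ (k, j)) * fr n q c j i) = cls n q (\<Sum>l<dim_row c'. fr n q c' k l * const (f $$ (l, i))))
      = (\<forall>\<phi>. Rinv n q \<phi> \<longrightarrow> lf \<phi> (\<Sum>j<dim_row c. const (f $$ (k, j)) * fr n q c j i) = lf \<phi> (\<Sum>l<dim_row c'. fr n q c' k l * const (f $$ (l, i))))"
      using cls_eqI[OF W] cls_lf by blast
    then show ?thesis unfolding s1 s2 by (simp add: lf_sum lf_const_mult mult.commute)
  qed
  then show ?thesis unfolding comodule_maps_def by blast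
qed

section \<open>Bilinear functionals on pairs of comodules\<close>

text \<open>The action on \<open>V \<otimes> W\<close> of a functional on pairs of words, as a matrix.\<close>
definition B2 :: "nat \<Rightarrow> 'k::field \<Rightarrow> 'k coact \<Rightarrow> 'k coact \<Rightarrow> (word \<Rightarrow> word \<Rightarrow> 'k) \<Rightarrow> nat \<Rightarrow> nat \<Rightarrow> nat \<Rightarrow> nat \<Rightarrow> 'k" where
  "B2 n q V W \<chi> k l i j = lf (\<lambda>u. lf (\<chi> u) (fr n q W l j)) (fr n q V k i)"

definition conv2 :: "nat \<Rightarrow> (word \<Rightarrow> word \<Rightarrow> 'k::field) \<Rightarrow> (word \<Rightarrow> word \<Rightarrow> 'k) \<Rightarrow> word \<Rightarrow> word \<Rightarrow> 'k" where
  "conv2 n \<chi> \<chi>' u v = (\<Sum>Q\<in>idx n (length u). \<Sum>P\<in>idx n (length v).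
     \<chi> (zip (map fst u) Q) (zip (map fst v) P) * \<chi>' (zip Q (map snd u)) (zip P (map snd v)))"

lemma zip_words: "u \<in> words n \<Longrightarrow> Q \<in> idx n (length u) \<Longrightarrow> zip (map fst u) Q \<in> words n \<and> zip Q (map snd u) \<in> words n"
  by (auto dest: word_idx intro: idx_wordI)

lemma B2_conv2:
  assumes V: "is_comodule n q V" and W: "is_comodule n q W" and \<chi>: "R2inv n q \<chi>" and \<chi>': "R2inv n q \<chi>'"
    and *: "k < dim_row V" "i < dim_row V" "l < dim_row W" "j < dim_row W"
  shows "B2 n q V W (conv2 n \<chi> \<chi>') k l i j
    = (\<Sum>k'<dim_row V. \<Sum>l'<dim_row W. B2 n q V W \<chi> k l k' l' * B2 n q V W \<chi>' k' l' i j)"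
proof -
  let ?f = "fr n q V" and ?g = "fr n q W"
  have R: "Rinv n q (\<chi> u)" "Rinv n q (\<chi>' u)" if "u \<in> words n" for u using \<chi> \<chi>' that by (simp_all add: R2inv_def)
  define A where "A l' u = lf (\<chi> u) (?g l l')" for l' u
  define B where "B l' u = lf (\<chi>' u) (?g l' j)" for l' u
  have RA: "Rinv n q (A l')" if "l' < dim_row W" for l' unfolding A_def
    by (rule Rinv_lf) (use \<chi> comoduleD(1)[OF W *(3) that] in \<open>auto simp: R2inv_def\<close>)
  have RB: "Rinv n q (B l')" if "l' < dim_row W" for l' unfolding B_def
    by (rule Rinv_lf) (use \<chi>' comoduleD(1)[OF W that *(4)] in \<open>auto simp: R2inv_def\<close>)
  have "lf (conv2 n \<chi> \<chi>' u) (?g l j) = (\<Sum>l'<dim_row W. conv n (\<lambda>u v. A l' u * B l' v) u)" if u: "u \<in> words n" for u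
  proof -
    have "lf (conv2 n \<chi> \<chi>' u) (?g l j)
      = (\<Sum>Q\<in>idx n (length u). lf (conv n (\<lambda>v v'. \<chi> (zip (map fst u) Q) v * \<chi>' (zip Q (map snd u)) v')) (?g l j))"
      unfolding conv2_def[abs_def] conv_def[abs_def] by (rule lf_sum_fun)
    also have "\<dots> = (\<Sum>Q\<in>idx n (length u). \<Sum>l'<dim_row W. A l' (zip (map fst u) Q) * B l' (zip Q (map snd u)))"
      unfolding A_def B_def
      by (intro sum.cong refl comodule_times[OF W *(3,4)] R) (use zip_words[OF u] in auto)
    also have "\<dots> = (\<Sum>l'<dim_row W. conv n (\<lambda>u v. A l' u * B l' v) u)"
      unfolding conv_def by (rule sum.swap)
    finally show ?thesis .
  qed
  then have "B2 n q V W (conv2 n \<chi> \<chi>') k l i j = lf (\<lambda>u. \<Sum>l'<dim_row W. conv n (\<lambda>u v. A l' u * B l' v) u) (?f k i)"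
    unfolding B2_def by (intro lf_cong) (use comoduleD(1)[OF V *(1,2)] in blast)
  also have "\<dots> = (\<Sum>l'<dim_row W. \<Sum>k'<dim_row V. lf (A l') (?f k k') * lf (B l') (?f k' i))"
    unfolding lf_sum_fun by (intro sum.cong refl comodule_times[OF V *(1,2)] RA RB) auto
  also have "\<dots> = (\<Sum>k'<dim_row V. \<Sum>l'<dim_row W. lf (A l') (?f k k') * lf (B l') (?f k' i))" by (rule sum.swap)
  finally show ?thesis by (simp add: B2_def A_def[abs_def] B_def[abs_def])
qed

lemma B2_cong:
  assumes "is_comodule n q V" "is_comodule n q W" "k < dim_row V" "i < dim_row V" "l < dim_row W" "j < dim_row W"
    and "\<And>u v. u \<in> words n \<Longrightarrow> v \<in> words n \<Longrightarrow> \<chi> u v = \<chi>' u v"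
  shows "B2 n q V W \<chi> k l i j = B2 n q V W \<chi>' k l i j"
  unfolding B2_def using comoduleD(1)[OF assms(1,3,4)] comoduleD(1)[OF assms(2,5,6)] assms(7)
  by (intro lf_cong) blast

lemma B2_eps:
  assumes "is_comodule n q V" "is_comodule n q W" "k < dim_row V" "i < dim_row V" "l < dim_row W" "j < dim_row W"
  shows "B2 n q V W (\<lambda>u v. eps u * eps v) k l i j = (if k = i \<and> l = j then 1 else 0)"
proof -
  have "B2 n q V W (\<lambda>u v. eps u * eps v) k l i j = lf eps (fr n q V k i) * lf eps (fr n q W l j)"
    unfolding B2_def lf_scale by (simp add: lf_def sum_distrib_right mult.assoc)
  then show ?thesis using comoduleD(3)[OF assms(1,3,4)] comoduleD(3)[OF assms(2,5,6)] by simp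
qed

lemma tens_dims [simp]: "dim_row (tens_comodule n q V W) = dim_row V * dim_row W" "dim_col (tens_comodule n q V W) = dim_col V * dim_col W"
  by (simp_all add: tens_comodule_def)

lemma tens_index:
  assumes "ent n q V" "ent n q W" "k < dim_row V" "i < dim_row V" "l < dim_row W" "j < dim_row W"
  shows "tens_comodule n q V W $$ (k * dim_row W + l, i * dim_row W + j) = cls n q (fr n q V k i * fr n q W l j)"
proof -
  have "tens_comodule n q V W $$ (k * dim_row W + l, i * dim_row W + j) = V $$ (k, i) \<otimes>\<^bsub>Aq n q\<^esub> W $$ (l, j)"
    unfolding tens_comodule_def using assms idx_bound[of k "dim_row V" l "dim_row W"] idx_bound[of i "dim_row V" j "dim_row W"]
    by (simp add: ent_def)
  moreover have "cls n q (fr n q V k i) = V $$ (k, i)" "cls n q (fr n q W l j) = W $$ (l, j)"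
    "wp n (fr n q V k i)" "wp n (fr n q W l j)" using assms ent_fr by blast+
  ultimately show ?thesis using cls_mult by metis
qed

lemma ent_tens: assumes "ent n q V" "ent n q W" shows "ent n q (tens_comodule n q V W)"
  unfolding ent_def
proof (intro conjI allI impI)
  show "dim_col (tens_comodule n q V W) = dim_row (tens_comodule n q V W)" using assms by (simp add: ent_def)
  fix x y assume xy: "x < dim_row (tens_comodule n q V W)" "y < dim_row (tens_comodule n q V W)"
  from xy(1) obtain k l where x: "k < dim_row V" "l < dim_row W" "x = k * dim_row W + l" by (auto elim: idx_split)
  from xy(2) obtain i j where y: "i < dim_row V" "j < dim_row W" "y = i * dim_row W + j" by (auto elim: idx_split)
  show "tens_comodule n q V W $$ (x, y) \<in> carrier (Aq n q)"
    unfolding x y using tens_index[OF assms x(1) y(1) x(2) y(2)] ent_fr[OF assms(1) x(1) y(1)] ent_fr[OF assms(2) x(2) y(2)]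
    by (simp add: cls_carrier wp_mult)
qed

lemma lf_tens:
  assumes "ent n q V" "ent n q W" "k < dim_row V" "i < dim_row V" "l < dim_row W" "j < dim_row W" "Rinv n q \<phi>"
  shows "lf \<phi> (fr n q (tens_comodule n q V W) (k * dim_row W + l) (i * dim_row W + j)) = B2 n q V W (\<lambda>u v. \<phi> (u @ v)) k l i j"
proof -
  have "wp n (fr n q V k i * fr n q W l j)" using assms ent_fr by (intro wp_mult) blast+
  then show ?thesis unfolding tens_index[OF assms(1-6)] using assms(7)
    by (simp add: lf_rep_cls) (simp add: lf_mult B2_def plus_list_def)
qed

lemma R2inv_append: "Rinv n q \<phi> \<Longrightarrow> R2inv n q (\<lambda>u v. \<phi> (u @ v))" "Rinv n q \<phi> \<Longrightarrow> R2inv n q (\<lambda>u v. \<phi> (v @ u))"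
  unfolding R2inv_def using Rinv_context[of n q \<phi> "[]"] Rinv_context[of n q \<phi> _ "[]"] by auto

section \<open>Existence of the braiding\<close>

text \<open>The braiding given by the coquasitriangular form, followed by the flip of tensor factors.\<close>
definition Rbr :: "nat \<Rightarrow> 'k::field \<Rightarrow> 'k coact \<Rightarrow> 'k coact \<Rightarrow> 'k mat" where
  "Rbr n q V W = mat (dim_row W * dim_row V) (dim_row V * dim_row W) (\<lambda>(x, y).
     B2 n q V W (rr q) (x mod dim_row V) (x div dim_row V) (y div dim_row W) (y mod dim_row W))"

lemma Rbr_dims [simp]: "dim_row (Rbr n q V W) = dim_row W * dim_row V" "dim_col (Rbr n q V W) = dim_row V * dim_row W"
  by (simp_all add: Rbr_def)

lemma Rbr_index:
  assumes "k < dim_row V" "i < dim_row V" "l < dim_row W" "j < dim_row W"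
  shows "Rbr n q V W $$ (l * dim_row V + k, i * dim_row W + j) = B2 n q V W (rr q) k l i j"
  unfolding Rbr_def using assms idx_bound[of l "dim_row W" k "dim_row V"] idx_bound[of i "dim_row V" j "dim_row W"]
  by simp

lemma ent_comodule: "is_comodule n q c \<Longrightarrow> ent n q c" by (simp add: is_comodule_iff)

text \<open>This is the quasi-commutativity of invariant functionals with the cabled braiding.\<close>
lemma Rbr_comodule_map:
  assumes V: "is_comodule n q V" and W: "is_comodule n q W" and q: "q \<noteq> 0"
  shows "Rbr n q V W \<in> comodule_maps n q (tens_comodule n q V W) (tens_comodule n q W V)"
proof -
  note eV = ent_comodule[OF V] and eW = ent_comodule[OF W]
  let ?VW = "tens_comodule n q V W" and ?WV = "tens_comodule n q W V"
  have "(\<Sum>y<dim_row V * dim_row W. Rbr n q V W $$ (x, y) * lf \<phi> (fr n q ?VW y z))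
      = (\<Sum>y<dim_row W * dim_row V. lf \<phi> (fr n q ?WV x y) * Rbr n q V W $$ (y, z))"
    if \<phi>: "Rinv n q \<phi>" and x: "x < dim_row W * dim_row V" and z: "z < dim_row V * dim_row W" for x z \<phi>
  proof -
    from x obtain l k where x: "l < dim_row W" "k < dim_row V" "x = l * dim_row V + k" by (rule idx_split)
    from z obtain i j where z: "i < dim_row V" "j < dim_row W" "z = i * dim_row W + j" by (rule idx_split)
    let ?a = "\<lambda>u v. \<phi> (u @ v)" and ?b = "\<lambda>u v. \<phi> (v @ u)"
    have swap: "lf \<phi> (fr n q ?WV (l * dim_row V + k) (l' * dim_row V + k')) = B2 n q V W ?b k l k' l'"
      if "k' < dim_row V" "l' < dim_row W" for k' l'
    proof -
      have "lf \<phi> (fr n q ?WV (l * dim_row V + k) (l' * dim_row V + k')) = B2 n q W V (\<lambda>u v. \<phi> (u @ v)) l k l' k'"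
        by (rule lf_tens[OF eW eV x(1) that(2) x(2) that(1) \<phi>])
      also have "\<dots> = B2 n q V W ?b k l k' l'" unfolding B2_def by (rule lf_swap)
      finally show ?thesis .
    qed
    have "(\<Sum>y<dim_row V * dim_row W. Rbr n q V W $$ (x, y) * lf \<phi> (fr n q ?VW y z))
      = (\<Sum>k'<dim_row V. \<Sum>l'<dim_row W. B2 n q V W (rr q) k l k' l' * B2 n q V W ?a k' l' i j)"
      unfolding sum_split x(3) z(3)
      using x z by (intro sum.cong refl arg_cong2[of _ _ _ _ "(*)"] Rbr_index lf_tens eV eW \<phi>) auto
    also have "\<dots> = B2 n q V W (conv2 n (rr q) ?a) k l i j"
      by (rule B2_conv2[symmetric]) (use V W x z R2inv_rr[OF q] R2inv_append[OF \<phi>] in auto)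
    also have "\<dots> = B2 n q V W (conv2 n ?b (rr q)) k l i j"
    proof (rule B2_cong[OF V W x(2) z(1) x(1) z(2)])
      fix u v assume uv: "u \<in> words n" "v \<in> words n"
      from rr_quasi[OF \<phi> word_idx[OF uv(1), THEN conjunct1] word_idx[OF uv(1), THEN conjunct2]
          word_idx[OF uv(2), THEN conjunct1] word_idx[OF uv(2), THEN conjunct2]]
      show "conv2 n (rr q) ?a u v = conv2 n ?b (rr q) u v" unfolding conv2_def .
    qed
    also have "\<dots> = (\<Sum>k'<dim_row V. \<Sum>l'<dim_row W. B2 n q V W ?b k l k' l' * B2 n q V W (rr q) k' l' i j)"
      by (rule B2_conv2) (use V W x z R2inv_rr[OF q] R2inv_append[OF \<phi>] in auto)
    also have "\<dots> = (\<Sum>l'<dim_row W. \<Sum>k'<dim_row V. B2 n q V W ?b k l k' l' * B2 n q V W (rr q) k' l' i j)"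
      by (rule sum.swap)
    also have "\<dots> = (\<Sum>y<dim_row W * dim_row V. lf \<phi> (fr n q ?WV x y) * Rbr n q V W $$ (y, z))"
      unfolding sum_split x(3) z(3)
      using x z by (intro sum.cong refl arg_cong2[of _ _ _ _ "(*)"] Rbr_index[symmetric] swap[symmetric]) auto
    finally show ?thesis .
  qed
  then show ?thesis unfolding comodule_maps_iff[OF ent_tens[OF eV eW] ent_tens[OF eW eV]]
    by (auto intro!: carrier_matI)
qed

lemma conv2_inverse:
  assumes q: "q \<noteq> 0" and uv: "u \<in> words n" "v \<in> words n"
  shows "conv2 n (rr q) (rrb q) u v = eps u * eps v" "conv2 n (rrb q) (rr q) u v = eps u * eps v"
  using rr_rrb[OF q word_idx[OF uv(1), THEN conjunct1] word_idx[OF uv(1), THEN conjunct2]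
          word_idx[OF uv(2), THEN conjunct1] word_idx[OF uv(2), THEN conjunct2]]
  unfolding conv2_def eps_alt by auto

text \<open>The inverse comes from the convolution inverse of the coquasitriangular form.\<close>
lemma Rbr_invertible:
  assumes V: "is_comodule n q V" and W: "is_comodule n q W" and q: "q \<noteq> 0"
  shows "invertible_mat (Rbr n q V W)"
proof -
  define B where "B = mat (dim_row V * dim_row W) (dim_row W * dim_row V) (\<lambda>(x, y).
     B2 n q V W (rrb q) (x div dim_row W) (x mod dim_row W) (y mod dim_row V) (y div dim_row V))"
  have B: "B $$ (k * dim_row W + l, j * dim_row V + i) = B2 n q V W (rrb q) k l i j"
    if "k < dim_row V" "i < dim_row V" "l < dim_row W" "j < dim_row W" for i j k l
    unfolding B_def using that idx_bound[of k "dim_row V" l "dim_row W"] idx_bound[of j "dim_row W" i "dim_row V"] by simp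
  have Bd [simp]: "dim_row B = dim_row V * dim_row W" "dim_col B = dim_row W * dim_row V" by (simp_all add: B_def)
  have "Rbr n q V W * B = 1\<^sub>m (dim_row W * dim_row V)"
  proof (rule mat_eq_splitI[of _ "dim_row W" "dim_row V" _ "dim_row W" "dim_row V"])
    fix l k j i assume *: "l < dim_row W" "k < dim_row V" "j < dim_row W" "i < dim_row V"
    have "(Rbr n q V W * B) $$ (l * dim_row V + k, j * dim_row V + i)
      = (\<Sum>y<dim_row V * dim_row W. Rbr n q V W $$ (l * dim_row V + k, y) * B $$ (y, j * dim_row V + i))"
      by (rule mult_index) (use * idx_bound in auto)
    also have "\<dots> = (\<Sum>k'<dim_row V. \<Sum>l'<dim_row W. B2 n q V W (rr q) k l k' l' * B2 n q V W (rrb q) k' l' i j)"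
      unfolding sum_split using * by (intro sum.cong refl arg_cong2[of _ _ _ _ "(*)"] Rbr_index B) auto
    also have "\<dots> = B2 n q V W (conv2 n (rr q) (rrb q)) k l i j"
      by (rule B2_conv2[symmetric]) (use V W * R2inv_rr[OF q] R2inv_rrb[OF q] in auto)
    also have "\<dots> = B2 n q V W (\<lambda>u v. eps u * eps v) k l i j"
      by (rule B2_cong) (use V W * conv2_inverse(1)[OF q] in auto)
    also have "\<dots> = (if k = i \<and> l = j then 1 else 0)" by (rule B2_eps) (use V W * in auto)
    finally show "(Rbr n q V W * B) $$ (l * dim_row V + k, j * dim_row V + i) = 1\<^sub>m (dim_row W * dim_row V) $$ (l * dim_row V + k, j * dim_row V + i)"
      using * idx_bound by (auto simp: idx_inj)
  qed auto
  moreover have "B * Rbr n q V W = 1\<^sub>m (dim_row V * dim_row W)"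
  proof (rule mat_eq_splitI[of _ "dim_row V" "dim_row W" _ "dim_row V" "dim_row W"])
    fix k l i j assume *: "k < dim_row V" "l < dim_row W" "i < dim_row V" "j < dim_row W"
    have "(B * Rbr n q V W) $$ (k * dim_row W + l, i * dim_row W + j)
      = (\<Sum>y<dim_row W * dim_row V. B $$ (k * dim_row W + l, y) * Rbr n q V W $$ (y, i * dim_row W + j))"
      by (rule mult_index) (use * idx_bound in auto)
    also have "\<dots> = (\<Sum>l'<dim_row W. \<Sum>k'<dim_row V. B2 n q V W (rrb q) k l k' l' * B2 n q V W (rr q) k' l' i j)"
      unfolding sum_split using * by (intro sum.cong refl arg_cong2[of _ _ _ _ "(*)"] Rbr_index B) auto
    also have "\<dots> = (\<Sum>k'<dim_row V. \<Sum>l'<dim_row W. B2 n q V W (rrb q) k l k' l' * B2 n q V W (rr q) k' l' i j)"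
      by (rule sum.swap)
    also have "\<dots> = B2 n q V W (conv2 n (rrb q) (rr q)) k l i j"
      by (rule B2_conv2[symmetric]) (use V W * R2inv_rr[OF q] R2inv_rrb[OF q] in auto)
    also have "\<dots> = B2 n q V W (\<lambda>u v. eps u * eps v) k l i j"
      by (rule B2_cong) (use V W * conv2_inverse(2)[OF q] in auto)
    also have "\<dots> = (if k = i \<and> l = j then 1 else 0)" by (rule B2_eps) (use V W * in auto)
    finally show "(B * Rbr n q V W) $$ (k * dim_row W + l, i * dim_row W + j) = 1\<^sub>m (dim_row V * dim_row W) $$ (k * dim_row W + l, i * dim_row W + j)"
      using * idx_bound by (auto simp: idx_inj)
  qed auto
  ultimately show ?thesis unfolding invertible_mat_def inverts_mat_def
    by (auto simp: mult.commute intro!: exI[of _ B])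
qed

lemma comodule_map_lf:
  assumes "is_comodule n q c" "is_comodule n q c'" "f \<in> comodule_maps n q c c'" "Rinv n q \<phi>" "k < dim_row c'" "i < dim_row c"
  shows "(\<Sum>j<dim_row c. f $$ (k, j) * lf \<phi> (fr n q c j i)) = (\<Sum>l<dim_row c'. lf \<phi> (fr n q c' k l) * f $$ (l, i))"
  using assms(3-) comodule_maps_iff[OF ent_comodule[OF assms(1)] ent_comodule[OF assms(2)]] by blast

text \<open>The coquasitriangular form is an invariant functional of each argument, and comodule maps commute with
  the action of invariant functionals.\<close>
lemma Rbr_natural:
  assumes V: "is_comodule n q V" and V': "is_comodule n q V'" and W: "is_comodule n q W" and W': "is_comodule n q W'"
    and f: "f \<in> comodule_maps n q V V'" and g: "g \<in> comodule_maps n q W W'" and q: "q \<noteq> 0"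
  shows "Rbr n q V' W' * kron f g = kron g f * Rbr n q V W"
proof -
  have d: "dim_row f = dim_row V'" "dim_col f = dim_row V" "dim_row g = dim_row W'" "dim_col g = dim_row W"
    using f g by (auto simp: comodule_maps_def)
  show ?thesis
  proof (rule mat_eq_splitI[of _ "dim_row W'" "dim_row V'" _ "dim_row V" "dim_row W"])
    fix l k i j assume *: "l < dim_row W'" "k < dim_row V'" "i < dim_row V" "j < dim_row W"
    have RR: "Rinv n q (rr q u)" "Rinv n q (\<lambda>u. rr q u v)" if "u \<in> words n" "v \<in> words n" for u v
      using R2inv_rr[OF q, of n] that by (simp_all add: R2inv_def)
    define \<alpha> where "\<alpha> t u = lf (rr q u) (fr n q W' l t)" for t u
    define \<beta> where "\<beta> t u = lf (rr q u) (fr n q W t j)" for t u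
    have R\<alpha>: "Rinv n q (\<alpha> t)" if "t < dim_row W'" for t unfolding \<alpha>_def
      by (rule Rinv_lf) (use RR(2) comoduleD(1)[OF W' *(1) that] in auto)
    have R\<beta>: "Rinv n q (\<beta> t)" if "t < dim_row W" for t unfolding \<beta>_def
      by (rule Rinv_lf) (use RR(2) comoduleD(1)[OF W that *(4)] in auto)
    have "(Rbr n q V' W' * kron f g) $$ (l * dim_row V' + k, i * dim_row W + j)
       = (\<Sum>y<dim_row V' * dim_row W'. Rbr n q V' W' $$ (l * dim_row V' + k, y) * kron f g $$ (y, i * dim_row W + j))"
      by (rule mult_index) (use * d idx_bound in auto)
    also have "\<dots> = (\<Sum>s<dim_row V'. \<Sum>t<dim_row W'. lf (\<alpha> t) (fr n q V' k s) * (f $$ (s, i) * g $$ (t, j)))"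
      unfolding sum_split \<alpha>_def B2_def[symmetric] using * d
      by (intro sum.cong refl arg_cong2[of _ _ _ _ "(*)"] Rbr_index kron_index) auto
    also have "\<dots> = (\<Sum>t<dim_row W'. (\<Sum>s<dim_row V'. lf (\<alpha> t) (fr n q V' k s) * f $$ (s, i)) * g $$ (t, j))"
      by (subst sum.swap) (simp add: sum_distrib_right mult.assoc)
    also have "\<dots> = (\<Sum>t<dim_row W'. (\<Sum>s<dim_row V. f $$ (k, s) * lf (\<alpha> t) (fr n q V s i)) * g $$ (t, j))"
      by (intro sum.cong refl) (use comodule_map_lf[OF V V' f R\<alpha> *(2,3)] in simp)
    also have "\<dots> = (\<Sum>s<dim_row V. f $$ (k, s) * (\<Sum>t<dim_row W'. g $$ (t, j) * lf (\<alpha> t) (fr n q V s i)))"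
      by (simp add: sum_distrib_right sum_distrib_left) (subst sum.swap, simp add: ac_simps)
    also have "\<dots> = (\<Sum>s<dim_row V. f $$ (k, s) * (\<Sum>t<dim_row W. g $$ (l, t) * lf (\<beta> t) (fr n q V s i)))"
    proof (rule sum.cong[OF refl], rule arg_cong2[of _ _ _ _ "(*)", OF refl])
      fix s assume s: "s \<in> {..<dim_row V}"
      have "(\<Sum>t<dim_row W'. g $$ (t, j) * lf (\<alpha> t) (fr n q V s i)) = lf (\<lambda>u. \<Sum>t<dim_row W'. g $$ (t, j) * \<alpha> t u) (fr n q V s i)"
        by (simp add: lf_sum_fun lf_scale)
      also have "\<dots> = lf (\<lambda>u. \<Sum>t<dim_row W. g $$ (l, t) * \<beta> t u) (fr n q V s i)"
      proof (rule lf_cong)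
        fix u assume "u \<in> Poly_Mapping.keys (fr n q V s i)"
        then have "u \<in> words n" using comoduleD(1)[OF V _ *(3), of s] s by auto
        then show "(\<Sum>t<dim_row W'. g $$ (t, j) * \<alpha> t u) = (\<Sum>t<dim_row W. g $$ (l, t) * \<beta> t u)"
          using comodule_map_lf[OF W W' g RR(1)[of u "[]"] *(1,4)] by (simp add: \<alpha>_def \<beta>_def mult.commute)
      qed
      finally show "(\<Sum>t<dim_row W'. g $$ (t, j) * lf (\<alpha> t) (fr n q V s i)) = (\<Sum>t<dim_row W. g $$ (l, t) * lf (\<beta> t) (fr n q V s i))"
        by (simp add: lf_sum_fun lf_scale)
    qed
    also have "\<dots> = (\<Sum>t<dim_row W. \<Sum>s<dim_row V. (g $$ (l, t) * f $$ (k, s)) * lf (\<beta> t) (fr n q V s i))"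
      by (subst sum.swap) (simp add: sum_distrib_left ac_simps)
    also have "\<dots> = (\<Sum>y<dim_row W * dim_row V. kron g f $$ (l * dim_row V' + k, y) * Rbr n q V W $$ (y, i * dim_row W + j))"
      unfolding sum_split \<beta>_def B2_def[symmetric] using * d
      by (intro sum.cong refl arg_cong2[of _ _ _ _ "(*)"] Rbr_index[symmetric] kron_index[symmetric]) auto
    also have "\<dots> = (kron g f * Rbr n q V W) $$ (l * dim_row V' + k, i * dim_row W + j)"
      by (rule mult_index[symmetric]) (use * d idx_bound in auto)
    finally show "(Rbr n q V' W' * kron f g) $$ (l * dim_row V' + k, i * dim_row W + j)
      = (kron g f * Rbr n q V W) $$ (l * dim_row V' + k, i * dim_row W + j)" .
  qed (use d in auto)
qed


lemma rr_append_left_words: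
  assumes "u \<in> words n" "u' \<in> words n" "v \<in> words n"
  shows "rr q (u @ u') v = conv n (\<lambda>w w'. rr q u w * rr q u' w') v"
  using rr_append_left[OF word_idx[OF assms(1), THEN conjunct1] word_idx[OF assms(1), THEN conjunct2]
    word_idx[OF assms(2), THEN conjunct1] word_idx[OF assms(2), THEN conjunct2]
    word_idx[OF assms(3), THEN conjunct1] word_idx[OF assms(3), THEN conjunct2], of q]
  unfolding conv_def by (simp add: zip_map_fst_snd)

lemma rr_append_right_words:
  assumes "u \<in> words n" "v \<in> words n" "v' \<in> words n"
  shows "rr q u (v @ v') = conv n (\<lambda>w w'. rr q w v' * rr q w' v) u"
  using rr_append_right[OF word_idx[OF assms(1), THEN conjunct1] word_idx[OF assms(1), THEN conjunct2]
    word_idx[OF assms(2), THEN conjunct1] word_idx[OF assms(2), THEN conjunct2]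
    word_idx[OF assms(3), THEN conjunct1] word_idx[OF assms(3), THEN conjunct2], of q]
  unfolding conv_def by (simp add: zip_map_fst_snd)

lemma sum_delta_mid:
  fixes X Z :: "'k::field" and Y :: "nat \<Rightarrow> 'k"
  assumes "l < n"
  shows "(\<Sum>x<n. (X * (if l = x then 1 else 0)) * (Z * Y x)) = X * (Z * Y l)"
    "(\<Sum>x<n. (X * Y x) * (Z * (if x = l then 1 else 0))) = (X * Y l) * Z"
proof -
  have "(\<Sum>x<n. (X * (if l = x then 1 else 0)) * (Z * Y x)) = (\<Sum>x<n. if x = l then X * (Z * Y x) else 0)"
    "(\<Sum>x<n. (X * Y x) * (Z * (if x = l then 1 else 0))) = (\<Sum>x<n. if x = l then (X * Y x) * Z else 0)"
    by (intro sum.cong refl; simp)+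
  then show "(\<Sum>x<n. (X * (if l = x then 1 else 0)) * (Z * Y x)) = X * (Z * Y l)"
    "(\<Sum>x<n. (X * Y x) * (Z * (if x = l then 1 else 0))) = (X * Y l) * Z" using assms by simp_all
qed

text \<open>Both hexagon identities reflect that moving two groups of strands past a third one can be done one
  group after the other.\<close>
lemma Rbr_hexagon1:
  assumes V: "is_comodule n q V" and W: "is_comodule n q W" and U: "is_comodule n q U" and q: "q \<noteq> 0"
  shows "Rbr n q (tens_comodule n q V W) U = kron (Rbr n q V U) (1\<^sub>m (dim_row W)) * kron (1\<^sub>m (dim_row V)) (Rbr n q W U)"
proof (rule mat_eq_splitI[of _ "dim_row U" "dim_row V * dim_row W" _ "dim_row V * dim_row W" "dim_row U"])
  let ?v = "dim_row V" and ?w = "dim_row W" and ?u = "dim_row U"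
  fix m kl ij m' assume *: "m < ?u" "kl < ?v * ?w" "ij < ?v * ?w" "m' < ?u"
  from *(2) obtain k l where kl: "k < ?v" "l < ?w" "kl = k * ?w + l" by (rule idx_split)
  from *(3) obtain i j where ij: "i < ?v" "j < ?w" "ij = i * ?w + j" by (rule idx_split)
  note eV = ent_comodule[OF V] and eW = ent_comodule[OF W]
  have RR: "Rinv n q (rr q u)" "Rinv n q (\<lambda>u. rr q u v)" if "u \<in> words n" "v \<in> words n" for u v
    using R2inv_rr[OF q, of n] that by (simp_all add: R2inv_def)
  define A where "A p u = lf (rr q u) (fr n q U m p)" for p u
  define B where "B p u = lf (rr q u) (fr n q U p m')" for p u
  define \<alpha> where "\<alpha> u = lf (rr q u) (fr n q U m m')" for u
  have R\<alpha>: "Rinv n q \<alpha>" unfolding \<alpha>_def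
    by (rule Rinv_lf) (use RR(2) comoduleD(1)[OF U *(1,4)] in auto)
  have split: "\<alpha> (u @ u') = (\<Sum>p<?u. A p u * B p u')" if "u \<in> words n" "u' \<in> words n" for u u'
  proof -
    have "\<alpha> (u @ u') = lf (conv n (\<lambda>w w'. rr q u w * rr q u' w')) (fr n q U m m')"
      unfolding \<alpha>_def by (rule lf_cong, rule rr_append_left_words) (use that comoduleD(1)[OF U *(1,4)] in auto)
    also have "\<dots> = (\<Sum>p<?u. A p u * B p u')"
      unfolding A_def B_def by (rule comodule_times[OF U *(1,4)]) (use RR(1)[of _ "[]"] that in auto)
    finally show ?thesis .
  qed
  have "Rbr n q (tens_comodule n q V W) U $$ (m * (?v * ?w) + kl, ij * ?u + m')
    = B2 n q (tens_comodule n q V W) U (rr q) kl m ij m'"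
    using Rbr_index[of kl "tens_comodule n q V W" ij m U m' n q] * by simp
  also have "\<dots> = lf \<alpha> (fr n q (tens_comodule n q V W) (k * ?w + l) (i * ?w + j))"
    by (simp add: B2_def \<alpha>_def[abs_def] kl ij)
  also have "\<dots> = B2 n q V W (\<lambda>u v. \<alpha> (u @ v)) k l i j"
    by (rule lf_tens[OF eV eW kl(1) ij(1) kl(2) ij(2) R\<alpha>])
  also have "\<dots> = B2 n q V W (\<lambda>u v. \<Sum>p<?u. A p u * B p v) k l i j"
    by (rule B2_cong[OF V W kl(1) ij(1) kl(2) ij(2)]) (rule split)
  also have "\<dots> = (\<Sum>p<?u. lf (A p) (fr n q V k i) * lf (B p) (fr n q W l j))"
  proof -
    have "lf (\<lambda>u. A p u * c) y = lf (A p) y * c" for p c y by (simp add: lf_def sum_distrib_right mult.assoc)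
    then show ?thesis unfolding B2_def lf_sum_fun lf_scale by simp
  qed
  also have "\<dots> = (\<Sum>p<?u. B2 n q V U (rr q) k m i p * B2 n q W U (rr q) l p j m')"
    by (simp add: A_def[abs_def] B_def[abs_def] B2_def)
  also have "\<dots> = (\<Sum>p<?u. Rbr n q V U $$ (m * ?v + k, i * ?u + p) * Rbr n q W U $$ (p * ?w + l, j * ?u + m'))"
    using * kl ij by (intro sum.cong refl) (simp add: Rbr_index)
  also have "\<dots> = (\<Sum>i'<?v. if i' = i then \<Sum>p<?u. Rbr n q V U $$ (m * ?v + k, i' * ?u + p) * Rbr n q W U $$ (p * ?w + l, j * ?u + m') else 0)"
    using ij(1) by simp
  also have "\<dots> = (\<Sum>i'<?v. \<Sum>p<?u. \<Sum>l'<?w. (Rbr n q V U $$ (m * ?v + k, i' * ?u + p) * (if l = l' then 1 else 0))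
      * ((if i' = i then 1 else 0) * Rbr n q W U $$ (p * ?w + l', j * ?u + m')))"
    by (intro sum.cong refl) (simp add: sum_delta_mid(1)[OF kl(2)])
  also have "\<dots> = (\<Sum>i'<?v. \<Sum>p<?u. \<Sum>l'<?w. kron (Rbr n q V U) (1\<^sub>m ?w) $$ (m * (?v * ?w) + kl, (i' * ?u + p) * ?w + l')
      * kron (1\<^sub>m ?v) (Rbr n q W U) $$ ((i' * ?u + p) * ?w + l', ij * ?u + m'))"
  proof (intro sum.cong refl)
    fix i' p l' assume **: "i' \<in> {..<?v}" "p \<in> {..<?u}" "l' \<in> {..<?w}"
    have e: "m * (?v * ?w) + kl = (m * ?v + k) * ?w + l" "(i' * ?u + p) * ?w + l' = i' * (?u * ?w) + (p * ?w + l')"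
      "ij * ?u + m' = i * (?w * ?u) + (j * ?u + m')" using kl ij by (simp_all add: algebra_simps)
    have "kron (Rbr n q V U) (1\<^sub>m ?w) $$ (m * (?v * ?w) + kl, (i' * ?u + p) * ?w + l')
       = Rbr n q V U $$ (m * ?v + k, i' * ?u + p) * 1\<^sub>m ?w $$ (l, l')"
      unfolding e(1) by (rule kron_index) (use * ** kl ij idx_bound in auto)
    moreover have "kron (1\<^sub>m ?v) (Rbr n q W U) $$ ((i' * ?u + p) * ?w + l', ij * ?u + m')
       = 1\<^sub>m ?v $$ (i', i) * Rbr n q W U $$ (p * ?w + l', j * ?u + m')"
      unfolding e(2,3) by (rule kron_index) (use * ** kl ij idx_bound in auto)
    ultimately show "(Rbr n q V U $$ (m * ?v + k, i' * ?u + p) * (if l = l' then 1 else 0))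
      * ((if i' = i then 1 else 0) * Rbr n q W U $$ (p * ?w + l', j * ?u + m'))
      = kron (Rbr n q V U) (1\<^sub>m ?w) $$ (m * (?v * ?w) + kl, (i' * ?u + p) * ?w + l')
      * kron (1\<^sub>m ?v) (Rbr n q W U) $$ ((i' * ?u + p) * ?w + l', ij * ?u + m')"
      using kl(2) ij(1) ** by simp
  qed
  also have "\<dots> = (\<Sum>y<(?v * ?u) * ?w. kron (Rbr n q V U) (1\<^sub>m ?w) $$ (m * (?v * ?w) + kl, y)
      * kron (1\<^sub>m ?v) (Rbr n q W U) $$ (y, ij * ?u + m'))"
    by (simp only: sum_split)
  also have "\<dots> = (kron (Rbr n q V U) (1\<^sub>m ?w) * kron (1\<^sub>m ?v) (Rbr n q W U)) $$ (m * (?v * ?w) + kl, ij * ?u + m')"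
  proof (rule mult_index[symmetric])
    show "m * (?v * ?w) + kl < dim_row (kron (Rbr n q V U) (1\<^sub>m ?w))" using idx_bound[OF *(1,2)] by (simp add: mult.assoc)
    show "ij * ?u + m' < dim_col (kron (1\<^sub>m ?v) (Rbr n q W U))" using idx_bound[OF *(3,4)] by (simp add: mult.assoc)
  qed (simp_all add: ac_simps)
  finally show "Rbr n q (tens_comodule n q V W) U $$ (m * (?v * ?w) + kl, ij * ?u + m')
     = (kron (Rbr n q V U) (1\<^sub>m ?w) * kron (1\<^sub>m ?v) (Rbr n q W U)) $$ (m * (?v * ?w) + kl, ij * ?u + m')" .
qed (simp_all add: ac_simps)

lemma Rbr_hexagon2:
  assumes V: "is_comodule n q V" and W: "is_comodule n q W" and U: "is_comodule n q U" and q: "q \<noteq> 0"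
  shows "Rbr n q V (tens_comodule n q W U) = kron (1\<^sub>m (dim_row W)) (Rbr n q V U) * kron (Rbr n q V W) (1\<^sub>m (dim_row U))"
proof (rule mat_eq_splitI[of _ "dim_row W * dim_row U" "dim_row V" _ "dim_row V" "dim_row W * dim_row U"])
  let ?v = "dim_row V" and ?w = "dim_row W" and ?u = "dim_row U"
  fix lm k i jm assume *: "lm < ?w * ?u" "k < ?v" "i < ?v" "jm < ?w * ?u"
  from *(1) obtain l m where lm: "l < ?w" "m < ?u" "lm = l * ?u + m" by (rule idx_split)
  from *(4) obtain j m' where jm: "j < ?w" "m' < ?u" "jm = j * ?u + m'" by (rule idx_split)
  note eU = ent_comodule[OF U] and eW = ent_comodule[OF W]
  have RR: "Rinv n q (rr q u)" "Rinv n q (\<lambda>u. rr q u v)" if "u \<in> words n" "v \<in> words n" for u v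
    using R2inv_rr[OF q, of n] that by (simp_all add: R2inv_def)
  define A where "A u = lf (rr q u) (fr n q U m m')" for u
  define B where "B u = lf (rr q u) (fr n q W l j)" for u
  have RA: "Rinv n q A" unfolding A_def by (rule Rinv_lf) (use RR(2) comoduleD(1)[OF U lm(2) jm(2)] in auto)
  have RB: "Rinv n q B" unfolding B_def by (rule Rinv_lf) (use RR(2) comoduleD(1)[OF W lm(1) jm(1)] in auto)
  have split: "lf (rr q u) (fr n q (tens_comodule n q W U) lm jm) = conv n (\<lambda>u u'. A u * B u') u" if u: "u \<in> words n" for u
  proof -
    have "lf (rr q u) (fr n q (tens_comodule n q W U) lm jm) = B2 n q W U (\<lambda>w w'. rr q u (w @ w')) l m j m'"
      unfolding lm(3) jm(3) by (rule lf_tens[OF eW eU lm(1) jm(1) lm(2) jm(2) RR(1)[OF u words_Nil]])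
    also have "\<dots> = B2 n q W U (\<lambda>w w'. conv n (\<lambda>v v'. rr q v w' * rr q v' w) u) l m j m'"
      by (rule B2_cong[OF W U lm(1) jm(1) lm(2) jm(2)]) (rule rr_append_right_words[OF u])
    also have "\<dots> = conv n (\<lambda>u u'. A u * B u') u"
    proof -
      have "lf (\<lambda>w. c * f w) y = c * lf f y" "lf (\<lambda>w. f w * c) y = lf f y * c" for c f and y :: "'a falg"
        by (simp_all add: lf_def sum_distrib_right sum_distrib_left ac_simps)
      then show ?thesis unfolding B2_def conv_def lf_sum_fun A_def B_def by simp
    qed
    finally show ?thesis .
  qed
  have "Rbr n q V (tens_comodule n q W U) $$ (lm * ?v + k, i * (?w * ?u) + jm)
    = B2 n q V (tens_comodule n q W U) (rr q) k lm i jm"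
    using Rbr_index[of k V i lm "tens_comodule n q W U" jm n q] * by simp
  also have "\<dots> = lf (conv n (\<lambda>u u'. A u * B u')) (fr n q V k i)"
    unfolding B2_def by (rule lf_cong, rule split) (use comoduleD(1)[OF V *(2,3)] in auto)
  also have "\<dots> = (\<Sum>p<?v. lf A (fr n q V k p) * lf B (fr n q V p i))"
    by (rule comodule_times[OF V *(2,3) RA RB])
  also have "\<dots> = (\<Sum>p<?v. Rbr n q V U $$ (m * ?v + k, p * ?u + m') * Rbr n q V W $$ (l * ?v + p, i * ?w + j))"
    using * lm jm by (intro sum.cong refl) (simp add: Rbr_index B2_def A_def[abs_def] B_def[abs_def])
  also have "\<dots> = (\<Sum>l'<?w. if l' = l then \<Sum>p<?v. Rbr n q V U $$ (m * ?v + k, p * ?u + m') * Rbr n q V W $$ (l' * ?v + p, i * ?w + j) else 0)"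
    using lm(1) by simp
  also have "\<dots> = (\<Sum>l'<?w. \<Sum>p<?v. \<Sum>m''<?u. ((if l = l' then 1 else 0) * Rbr n q V U $$ (m * ?v + k, p * ?u + m''))
      * (Rbr n q V W $$ (l' * ?v + p, i * ?w + j) * (if m'' = m' then 1 else 0)))"
    by (intro sum.cong refl) (simp add: sum_delta_mid(2)[OF jm(2)])
  also have "\<dots> = (\<Sum>l'<?w. \<Sum>p<?v. \<Sum>m''<?u. kron (1\<^sub>m ?w) (Rbr n q V U) $$ (lm * ?v + k, (l' * ?v + p) * ?u + m'')
      * kron (Rbr n q V W) (1\<^sub>m ?u) $$ ((l' * ?v + p) * ?u + m'', i * (?w * ?u) + jm))"
  proof (intro sum.cong refl)
    fix l' p m'' assume **: "l' \<in> {..<?w}" "p \<in> {..<?v}" "m'' \<in> {..<?u}"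
    have e: "lm * ?v + k = l * (?u * ?v) + (m * ?v + k)" "(l' * ?v + p) * ?u + m'' = l' * (?v * ?u) + (p * ?u + m'')"
      "i * (?w * ?u) + jm = (i * ?w + j) * ?u + m'" using lm jm by (simp_all add: algebra_simps)
    have "kron (1\<^sub>m ?w) (Rbr n q V U) $$ (lm * ?v + k, (l' * ?v + p) * ?u + m'')
       = 1\<^sub>m ?w $$ (l, l') * Rbr n q V U $$ (m * ?v + k, p * ?u + m'')"
      unfolding e(1,2) by (rule kron_index) (use * ** lm jm idx_bound in auto)
    moreover have "kron (Rbr n q V W) (1\<^sub>m ?u) $$ ((l' * ?v + p) * ?u + m'', i * (?w * ?u) + jm)
       = Rbr n q V W $$ (l' * ?v + p, i * ?w + j) * 1\<^sub>m ?u $$ (m'', m')"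
      unfolding e(3) by (rule kron_index) (use * ** lm jm idx_bound in auto)
    ultimately show "((if l = l' then 1 else 0) * Rbr n q V U $$ (m * ?v + k, p * ?u + m''))
      * (Rbr n q V W $$ (l' * ?v + p, i * ?w + j) * (if m'' = m' then 1 else 0))
      = kron (1\<^sub>m ?w) (Rbr n q V U) $$ (lm * ?v + k, (l' * ?v + p) * ?u + m'')
      * kron (Rbr n q V W) (1\<^sub>m ?u) $$ ((l' * ?v + p) * ?u + m'', i * (?w * ?u) + jm)"
      using lm(1) jm(2) ** by simp
  qed
  also have "\<dots> = (\<Sum>y<(?w * ?v) * ?u. kron (1\<^sub>m ?w) (Rbr n q V U) $$ (lm * ?v + k, y)
      * kron (Rbr n q V W) (1\<^sub>m ?u) $$ (y, i * (?w * ?u) + jm))"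
    by (simp only: sum_split)
  also have "\<dots> = (kron (1\<^sub>m ?w) (Rbr n q V U) * kron (Rbr n q V W) (1\<^sub>m ?u)) $$ (lm * ?v + k, i * (?w * ?u) + jm)"
  proof (rule mult_index[symmetric])
    show "lm * ?v + k < dim_row (kron (1\<^sub>m ?w) (Rbr n q V U))" using idx_bound[OF *(1,2)] by (simp add: mult.assoc)
    show "i * (?w * ?u) + jm < dim_col (kron (Rbr n q V W) (1\<^sub>m ?u))" using idx_bound[OF *(3,4)] by (simp add: mult.assoc)
  qed (simp_all add: ac_simps)
  finally show "Rbr n q V (tens_comodule n q W U) $$ (lm * ?v + k, i * (?w * ?u) + jm)
     = (kron (1\<^sub>m ?w) (Rbr n q V U) * kron (Rbr n q V W) (1\<^sub>m ?u)) $$ (lm * ?v + k, i * (?w * ?u) + jm)" .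
qed (simp_all add: ac_simps)

lemma Rbr_std: assumes q: "q \<noteq> 0" shows "Rbr n q (std_comodule n q) (std_comodule n q) = Rmat n q"
proof (rule mat_eq_splitI[of _ n n _ n n])
  fix t s i j assume *: "t < n" "s < n" "i < n" "j < n"
  have c: "std_comodule n q $$ (a, b) = cls n q (var a b)" if "a < n" "b < n" for a b
    using that by (simp add: std_comodule_def)
  have w: "wp n (var a b)" if "a < n" "b < n" for a b using that by (simp add: var_def words_Cons)
  have "Rbr n q (std_comodule n q) (std_comodule n q) $$ (t * n + s, i * n + j)
    = B2 n q (std_comodule n q) (std_comodule n q) (rr q) s t i j"
    using Rbr_index[of s "std_comodule n q" i t "std_comodule n q" j n q] * by (simp add: std_comodule_def)
  also have "\<dots> = lf (\<lambda>u. lf (rr q u) (var t j)) (var s i)"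
    unfolding B2_def c[OF *(1,4)] c[OF *(2,3)] by (rule R2inv_rep[OF R2inv_rr[OF q] w[OF *(2,3)] w[OF *(1,4)]])
  also have "\<dots> = Rcoef q t s i j" using rr_letters[OF *(2,1,3,4)] by (simp add: var_def)
  also have "\<dots> = Rmat n q $$ (t * n + s, i * n + j)"
    unfolding Rmat_def using * idx_bound[of t n s n] idx_bound[of i n j n] by simp
  finally show "Rbr n q (std_comodule n q) (std_comodule n q) $$ (t * n + s, i * n + j) = Rmat n q $$ (t * n + s, i * n + j)" .
qed (simp_all add: std_comodule_def Rmat_def)

text \<open>The choice in the definition of the braiding therefore has the required properties; only
  these are used below.\<close>
theorem braiding_exists: assumes "q \<noteq> 0" shows "is_braiding n q (braiding n q)"
proof -
  have "is_braiding n q (Rbr n q)" unfolding is_braiding_def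
    by (intro conjI allI impI; (elim conjE)?;
      (rule Rbr_comodule_map Rbr_invertible Rbr_natural Rbr_hexagon1 Rbr_hexagon2 Rbr_std; (assumption | rule assms))+)
  then show ?thesis unfolding braiding_def by (rule someI[of "is_braiding n q"])
qed

section \<open>Multiples of tensor powers of the standard comodule\<close>

text \<open>Lists of digits: they number the basis of \<open>V\<^sub>n\<^bsup>\<otimes>e\<^esup>\<close> compatibly with Kronecker products.\<close>
fun dec :: "nat \<Rightarrow> nat \<Rightarrow> nat \<Rightarrow> nat list" where
  "dec n 0 k = []"
| "dec n (Suc e) k = (k div n ^ e) # dec n e (k mod n ^ e)"

lemma div_idx: "j < b \<Longrightarrow> (i * b + j) div b = i" "j < b \<Longrightarrow> (i * b + j) mod b = j" for i j b :: nat
  by simp_all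

lemma sum_if_const: "(\<Sum>k\<in>A. if P then f k else 0) = (if P then sum f A else 0)"
  for f :: "'a \<Rightarrow> 'k::comm_monoid_add"
  by (cases P) simp_all

lemma dec_Suc: "j < n ^ e \<Longrightarrow> dec n (Suc e) (i * n ^ e + j) = i # dec n e j"
  by (simp only: dec.simps div_idx)

lemma dec_idx: "k < n ^ e \<Longrightarrow> dec n e k \<in> idx n e"
proof (induction e arbitrary: k)
  case (Suc e)
  then have "k < n * n ^ e" by simp
  then obtain i j where ij: "i < n" "j < n ^ e" "k = i * n ^ e + j" by (rule idx_split)
  then have "dec n e j \<in> idx n e" using Suc by simp
  then show ?case unfolding ij(3) dec_Suc[OF ij(2)] using ij(1) by (auto simp: idx_def)
qed simp

lemma sum_dec: "(\<Sum>k<n ^ e. g (dec n e k)) = (\<Sum>K\<in>idx n e. g K)" for g :: "nat list \<Rightarrow> 'k::comm_monoid_add"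
proof (induction e arbitrary: g)
  case (Suc e)
  have "(\<Sum>k<n ^ Suc e. g (dec n (Suc e) k)) = (\<Sum>i<n. \<Sum>j<n ^ e. g (i # dec n e j))"
    unfolding power_Suc sum_split by (intro sum.cong refl) (simp del: dec.simps add: dec_Suc)
  also have "\<dots> = (\<Sum>i<n. \<Sum>K\<in>idx n e. g (i # K))" by (intro sum.cong refl Suc)
  finally show ?case by (simp add: sum_idx_Suc)
qed simp

lemma dec_inj: "k < n ^ e \<Longrightarrow> k' < n ^ e \<Longrightarrow> dec n e k = dec n e k' \<Longrightarrow> k = k'"
proof (induction e arbitrary: k k')
  case (Suc e)
  from Suc.prems(1) have "k < n * n ^ e" by simp
  then obtain i j where ij: "i < n" "j < n ^ e" "k = i * n ^ e + j" by (rule idx_split)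
  from Suc.prems(2) have "k' < n * n ^ e" by simp
  then obtain i' j' where ij': "i' < n" "j' < n ^ e" "k' = i' * n ^ e + j'" by (rule idx_split)
  have "i = i' \<and> dec n e j = dec n e j'"
    using Suc.prems(3) unfolding ij(3) ij'(3) dec_Suc[OF ij(2)] dec_Suc[OF ij'(2)] by simp
  then show ?case using Suc.IH[of j j'] ij ij' by simp
qed simp

lemma dec_append: "i < n ^ a \<Longrightarrow> j < n ^ b \<Longrightarrow> dec n (a + b) (i * n ^ b + j) = dec n a i @ dec n b j"
proof (induction a arbitrary: i)
  case (Suc a)
  from Suc.prems(1) have "i < n * n ^ a" by simp
  then obtain i1 i2 where i: "i1 < n" "i2 < n ^ a" "i = i1 * n ^ a + i2" by (rule idx_split)
  have e: "i * n ^ b + j = i1 * n ^ (a + b) + (i2 * n ^ b + j)" by (simp add: i power_add algebra_simps)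
  have "i2 * n ^ b + j < n ^ (a + b)" using idx_bound[OF i(2) Suc.prems(2)] by (simp add: power_add)
  then have "dec n (Suc (a + b)) (i * n ^ b + j) = i1 # dec n (a + b) (i2 * n ^ b + j)"
    unfolding e by (rule dec_Suc)
  moreover have "dec n (Suc a) i = i1 # dec n a i2" unfolding i(3) by (rule dec_Suc[OF i(2)])
  ultimately show ?case using Suc.IH[OF i(2) Suc.prems(2)] by simp
qed simp

definition sw :: "nat \<Rightarrow> nat \<Rightarrow> nat \<Rightarrow> nat \<Rightarrow> 'k::field falg" where
  "sw n e i j = Poly_Mapping.single (zip (dec n e i) (dec n e j)) 1"

text \<open>The direct sum of \<open>m\<close> copies of \<open>V\<^sub>n\<^sup>\<otimes>\<^sup>e\<close>.\<close>
definition MM :: "nat \<Rightarrow> 'k::field \<Rightarrow> nat \<Rightarrow> nat \<Rightarrow> 'k coact" where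
  "MM n q e m = mat (m * n ^ e) (m * n ^ e) (\<lambda>(x, y).
     if x div n ^ e = y div n ^ e then cls n q (sw n e (x mod n ^ e) (y mod n ^ e)) else cls n q 0)"

lemma MM_dims [simp]: "dim_row (MM n q e m) = m * n ^ e" "dim_col (MM n q e m) = m * n ^ e"
  by (simp_all add: MM_def)

lemma MM_index:
  assumes "a < m" "b < m" "i < n ^ e" "j < n ^ e"
  shows "MM n q e m $$ (a * n ^ e + i, b * n ^ e + j) = cls n q (if a = b then sw n e i j else 0)"
  unfolding MM_def using assms idx_bound[of a m i "n ^ e"] idx_bound[of b m j "n ^ e"]
  by (simp only: index_mat prod.case div_idx if_distrib[of "cls n q"])

lemma wp_sw: "i < n ^ e \<Longrightarrow> j < n ^ e \<Longrightarrow> wp n (sw n e i j :: 'k::field falg)"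
  by (simp add: sw_def idx_wordI[OF dec_idx dec_idx])

lemma length_dec [simp]: "length (dec n e k) = e" by (induction e arbitrary: k) auto

lemma lf_MM:
  assumes "a < m" "b < m" "i < n ^ e" "j < n ^ e" "Rinv n q \<phi>"
  shows "lf \<phi> (fr n q (MM n q e m) (a * n ^ e + i) (b * n ^ e + j)) = (if a = b then \<phi> (zip (dec n e i) (dec n e j)) else 0)"
proof -
  have "wp n (if a = b then sw n e i j else 0 :: 'a falg)" using wp_sw[OF assms(3,4)] by auto
  then show ?thesis unfolding MM_index[OF assms(1-4)] using lf_rep_cls[OF _ assms(5)] by (auto simp: sw_def)
qed

lemma is_comodule_MM: "is_comodule n q (MM n q e m)"
  unfolding is_comodule_iff
proof (intro conjI allI impI)
  show "ent n q (MM n q e m)" unfolding ent_def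
  proof (intro conjI allI impI)
    fix x y assume "x < dim_row (MM n q e m)" "y < dim_row (MM n q e m)"
    then have xy: "x < m * n ^ e" "y < m * n ^ e" by auto
    from xy(1) obtain a i where x: "a < m" "i < n ^ e" "x = a * n ^ e + i" by (rule idx_split)
    from xy(2) obtain b j where y: "b < m" "j < n ^ e" "y = b * n ^ e + j" by (rule idx_split)
    show "MM n q e m $$ (x, y) \<in> carrier (Aq n q)" unfolding x(3) y(3) MM_index[OF x(1) y(1) x(2) y(2)]
      by (rule cls_carrier) (use wp_sw[OF x(2) y(2)] in auto)
  qed simp
next
  fix x y \<chi> assume "x < dim_row (MM n q e m)" "y < dim_row (MM n q e m)" and \<chi>: "R2inv n q \<chi>"
  then have xy: "x < m * n ^ e" "y < m * n ^ e" by auto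
  from xy(1) obtain a i where x: "a < m" "i < n ^ e" "x = a * n ^ e + i" by (rule idx_split)
  from xy(2) obtain b j where y: "b < m" "j < n ^ e" "y = b * n ^ e + j" by (rule idx_split)
  define G :: "nat \<Rightarrow> nat \<Rightarrow> nat \<Rightarrow> nat \<Rightarrow> 'a falg" where "G a b i j = (if a = b then sw n e i j else 0 :: 'a falg)" for a b i j
  have wG: "wp n (G a b i j)" if "i < n ^ e" "j < n ^ e" for a b i j using wp_sw[OF that] by (auto simp: G_def)
  have "(\<Sum>s<dim_row (MM n q e m). lf (\<lambda>u. lf (\<chi> u) (fr n q (MM n q e m) s y)) (fr n q (MM n q e m) x s))
    = (\<Sum>c<m. \<Sum>k<n ^ e. lf (\<lambda>u. lf (\<chi> u) (fr n q (MM n q e m) (c * n ^ e + k) y)) (fr n q (MM n q e m) x (c * n ^ e + k)))"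
    by (simp add: sum_split)
  also have "\<dots> = (\<Sum>c<m. \<Sum>k<n ^ e. lf (\<lambda>u. lf (\<chi> u) (G c b k j)) (G a c i k))"
  proof (intro sum.cong refl)
    fix c k assume c: "c \<in> {..<m}" "k \<in> {..<n ^ e}"
    then have c: "c < m" "k < n ^ e" by auto
    show "lf (\<lambda>u. lf (\<chi> u) (fr n q (MM n q e m) (c * n ^ e + k) y)) (fr n q (MM n q e m) x (c * n ^ e + k))
      = lf (\<lambda>u. lf (\<chi> u) (G c b k j)) (G a c i k)"
      unfolding x(3) y(3) MM_index[OF x(1) c(1) x(2) c(2)] MM_index[OF c(1) y(1) c(2) y(2)] G_def[symmetric]
      by (rule R2inv_rep[OF \<chi> wG[OF x(2) c(2)] wG[OF c(2) y(2)]])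
  qed
  also have "\<dots> = (\<Sum>c<m. if c = a then (if a = b then conv n \<chi> (zip (dec n e i) (dec n e j)) else 0) else 0)"
  proof (rule sum.cong[OF refl])
    fix c
    have "(\<Sum>k<n ^ e. lf (\<lambda>u. lf (\<chi> u) (G c b k j)) (G a c i k))
       = (if c = a \<and> a = b then (\<Sum>k<n ^ e. \<chi> (zip (dec n e i) (dec n e k)) (zip (dec n e k) (dec n e j))) else 0)"
    proof -
      have "lf (\<lambda>u. lf (\<chi> u) (G c b k j)) (G a c i k)
        = (if c = a \<and> a = b then \<chi> (zip (dec n e i) (dec n e k)) (zip (dec n e k) (dec n e j)) else 0)" for k
        by (cases "a = c"; cases "c = b"; simp add: G_def sw_def lf_def)
      note t = this
      show ?thesis unfolding t by (rule sum_if_const)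
    qed
    then show "(\<Sum>k<n ^ e. lf (\<lambda>u. lf (\<chi> u) (G c b k j)) (G a c i k))
       = (if c = a then (if a = b then conv n \<chi> (zip (dec n e i) (dec n e j)) else 0) else 0)"
      using sum_dec[of "\<lambda>K. \<chi> (zip (dec n e i) K) (zip K (dec n e j))" n e] by (auto simp: conv_def)
  qed
  also have "\<dots> = (if a = b then conv n \<chi> (zip (dec n e i) (dec n e j)) else 0)" using x(1) by simp
  also have "\<dots> = lf (conv n \<chi>) (fr n q (MM n q e m) x y)"
    unfolding x(3) y(3) using lf_MM[OF x(1) y(1) x(2) y(2) Rinv_conv[OF \<chi>]] by simp
  finally show "lf (conv n \<chi>) (fr n q (MM n q e m) x y)
    = (\<Sum>s<dim_row (MM n q e m). lf (\<lambda>u. lf (\<chi> u) (fr n q (MM n q e m) s y)) (fr n q (MM n q e m) x s))" by simp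
next
  fix x y assume "x < dim_row (MM n q e m)" "y < dim_row (MM n q e m)"
  then have xy: "x < m * n ^ e" "y < m * n ^ e" by auto
  from xy(1) obtain a i where x: "a < m" "i < n ^ e" "x = a * n ^ e + i" by (rule idx_split)
  from xy(2) obtain b j where y: "b < m" "j < n ^ e" "y = b * n ^ e + j" by (rule idx_split)
  show "lf eps (fr n q (MM n q e m) x y) = (if x = y then 1 else 0)"
    unfolding x(3) y(3) lf_MM[OF x(1) y(1) x(2) y(2) Rinv_eps]
    using dec_inj[OF x(2) y(2)] x y by (auto simp: eps_alt idx_inj)
qed

lemma hecke_pair_MM: "n \<ge> 1 \<Longrightarrow> (n, MM n q e m) \<in> hecke_pairs q e"
proof -
  assume n: "n \<ge> 1"
  have "MM n q e m $$ (x, y) \<in> Aq_deg n q e" if "x < m * n ^ e" "y < m * n ^ e" for x y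
  proof -
    from that(1) obtain a i where x: "a < m" "i < n ^ e" "x = a * n ^ e + i" by (rule idx_split)
    from that(2) obtain b j where y: "b < m" "j < n ^ e" "y = b * n ^ e + j" by (rule idx_split)
    have "wp n (if a = b then sw n e i j else 0 :: 'a falg)" using wp_sw[OF x(2) y(2)] by auto
    moreover have "\<forall>w\<in>Poly_Mapping.keys (if a = b then sw n e i j else 0 :: 'a falg). length w = e"
      by (auto simp: sw_def split: if_splits)
    ultimately show ?thesis unfolding x(3) y(3) MM_index[OF x(1) y(1) x(2) y(2)] Aq_deg_def Free_MA
      by (intro imageI) simp
  qed
  then have "elements_mat (MM n q e m) \<subseteq> Aq_deg n q e" by (auto simp: elements_mat_def)
  then show ?thesis using n is_comodule_MM by (auto simp: hecke_pairs_def)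
qed

lemma ent_MM: "ent n q (MM n q e m)" by (rule ent_comodule[OF is_comodule_MM])

lemma mult_comodule_map:
  assumes "B \<in> carrier_mat m' m"
  shows "kron B (1\<^sub>m (n ^ e)) \<in> comodule_maps n q (MM n q e m) (MM n q e m')"
  unfolding comodule_maps_iff[OF ent_MM ent_MM]
proof (intro conjI allI impI)
  have B: "dim_row B = m'" "dim_col B = m" using assms by auto
  show "kron B (1\<^sub>m (n ^ e)) \<in> carrier_mat (dim_row (MM n q e m')) (dim_row (MM n q e m))"
    using B by (auto intro!: carrier_matI)
  fix \<phi> x y assume \<phi>: "Rinv n q \<phi>" and "x < dim_row (MM n q e m')" "y < dim_row (MM n q e m)"
  then have xy: "x < m' * n ^ e" "y < m * n ^ e" by auto
  from xy(1) obtain a i where x: "a < m'" "i < n ^ e" "x = a * n ^ e + i" by (rule idx_split)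
  from xy(2) obtain b j where y: "b < m" "j < n ^ e" "y = b * n ^ e + j" by (rule idx_split)
  let ?N = "n ^ e"
  have K: "kron B (1\<^sub>m ?N) $$ (c * ?N + k, d * ?N + l) = (if k = l then B $$ (c, d) else 0)"
    if "c < m'" "k < ?N" "d < m" "l < ?N" for c d k l
    using that B by (subst kron_index) auto
  have "(\<Sum>z<dim_row (MM n q e m). kron B (1\<^sub>m ?N) $$ (x, z) * lf \<phi> (fr n q (MM n q e m) z y))
    = (\<Sum>c<m. \<Sum>k<?N. (if i = k then B $$ (a, c) else 0) * (if c = b then \<phi> (zip (dec n e k) (dec n e j)) else 0))"
    unfolding MM_dims sum_split x(3) y(3)
    by (intro sum.cong refl arg_cong2[of _ _ _ _ "(*)"] K lf_MM \<phi>) (use x y in auto)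
  also have "\<dots> = (\<Sum>c<m. \<Sum>k<?N. if k = i then (if c = b then B $$ (a, b) * \<phi> (zip (dec n e i) (dec n e j)) else 0) else 0)"
    by (intro sum.cong refl) auto
  also have "\<dots> = B $$ (a, b) * \<phi> (zip (dec n e i) (dec n e j))" using x(2) y(1) by simp
  also have "\<dots> = (\<Sum>c<m'. \<Sum>k<?N. if k = j then (if c = a then \<phi> (zip (dec n e i) (dec n e j)) * B $$ (a, b) else 0) else 0)"
    using x(1) y(2) by simp
  also have "\<dots> = (\<Sum>c<m'. \<Sum>k<?N. (if a = c then \<phi> (zip (dec n e i) (dec n e k)) else 0) * (if k = j then B $$ (c, b) else 0))"
    by (intro sum.cong refl) auto
  also have "\<dots> = (\<Sum>z<dim_row (MM n q e m'). lf \<phi> (fr n q (MM n q e m') x z) * kron B (1\<^sub>m ?N) $$ (z, y))"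
    unfolding MM_dims sum_split x(3) y(3)
    by (intro sum.cong refl arg_cong2[of _ _ _ _ "(*)"] K[symmetric] lf_MM[symmetric] \<phi>) (use x y in auto)
  finally show "(\<Sum>z<dim_row (MM n q e m). kron B (1\<^sub>m ?N) $$ (x, z) * lf \<phi> (fr n q (MM n q e m) z y))
    = (\<Sum>z<dim_row (MM n q e m'). lf \<phi> (fr n q (MM n q e m') x z) * kron B (1\<^sub>m ?N) $$ (z, y))" .
qed

text \<open>Concatenation of digit lists makes tensor powers strictly associative, so the hexagon identities
  apply to them literally.\<close>
lemma tens_MM: "tens_comodule n q (MM n q a 1) (MM n q b 1) = MM n q (a + b) 1"
proof (rule mat_eq_splitI[of _ "n ^ a" "n ^ b" _ "n ^ a" "n ^ b"])
  fix i k j l assume *: "i < n ^ a" "k < n ^ b" "j < n ^ a" "l < n ^ b"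
  have e: "i * n ^ b + k < n ^ (a + b)" "j * n ^ b + l < n ^ (a + b)"
    using idx_bound[OF *(1,2)] idx_bound[OF *(3,4)] by (simp_all add: power_add)
  have 1: "MM n q a 1 $$ (i, j) = cls n q (sw n a i j)" using MM_index[of 0 1 0 i n a j q] * by simp
  have 2: "MM n q b 1 $$ (k, l) = cls n q (sw n b k l)" using MM_index[of 0 1 0 k n b l q] * by simp
  have 3: "MM n q (a + b) 1 $$ (i * n ^ b + k, j * n ^ b + l) = cls n q (sw n (a + b) (i * n ^ b + k) (j * n ^ b + l))"
    using MM_index[of 0 1 0 "i * n ^ b + k" n "a + b" "j * n ^ b + l" q] e by simp
  have "tens_comodule n q (MM n q a 1) (MM n q b 1) $$ (i * n ^ b + k, j * n ^ b + l)
    = MM n q a 1 $$ (i, j) \<otimes>\<^bsub>Aq n q\<^esub> MM n q b 1 $$ (k, l)"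
    unfolding tens_comodule_def using * e
    by (simp only: MM_dims index_mat prod.case div_idx power_add mult_1)
  also have "\<dots> = cls n q (sw n a i j * sw n b k l)"
    unfolding 1 2 by (rule cls_mult[OF wp_sw[OF *(1,3)] wp_sw[OF *(2,4)]])
  also have "sw n a i j * sw n b k l = (sw n (a + b) (i * n ^ b + k) (j * n ^ b + l) :: 'a falg)"
    using * by (simp add: sw_def mult_single plus_list_def dec_append)
  finally show "tens_comodule n q (MM n q a 1) (MM n q b 1) $$ (i * n ^ b + k, j * n ^ b + l)
    = MM n q (a + b) 1 $$ (i * n ^ b + k, j * n ^ b + l)" using 3 by simp
qed (simp_all add: power_add)

lemma std_MM: "std_comodule n q = MM n q 1 1"
proof (rule eq_matI)
  fix i j assume "i < dim_row (MM n q 1 1)" "j < dim_col (MM n q 1 1)"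
  then have *: "i < n" "j < n" by auto
  have "MM n q 1 1 $$ (i, j) = cls n q (sw n 1 i j)" using MM_index[of 0 1 0 i n 1 j q] * by simp
  moreover have "sw n 1 i j = (var i j :: 'a falg)" by (simp add: sw_def var_def)
  ultimately show "std_comodule n q $$ (i, j) = MM n q 1 1 $$ (i, j)" using * by (simp add: std_comodule_def)
qed (simp_all add: std_comodule_def)

section \<open>Homogeneous comodules are retracts of multiples of tensor powers\<close>

text \<open>Rows are added one at a time. A row that depends on the previous ones needs no change; otherwise
  the residue \<open>r\<close> of the new row has a pivot, which serves to correct the previous solution.\<close>
lemma generalized_inverse:
  fixes g :: "'x \<Rightarrow> 'y \<Rightarrow> 'k::field"
  assumes "finite X" "finite Y"
  obtains Z where "\<And>x y'. x \<in> X \<Longrightarrow> y' \<in> Y \<Longrightarrow> (\<Sum>y\<in>Y. g x y * (\<Sum>x'\<in>X. Z x' y * g x' y')) = g x y'"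
proof -
  have "\<exists>Z. \<forall>x\<in>X. \<forall>y'\<in>Y. (\<Sum>y\<in>Y. g x y * (\<Sum>x'\<in>X. Z x' y * g x' y')) = g x y'"
    using assms(1)
  proof (induction X rule: finite_induct)
    case (insert x0 X)
    then obtain Z where Z: "\<And>x y'. x \<in> X \<Longrightarrow> y' \<in> Y \<Longrightarrow> (\<Sum>y\<in>Y. g x y * (\<Sum>x'\<in>X. Z x' y * g x' y')) = g x y'"
      by blast
    define p where "p y y' = (\<Sum>x'\<in>X. Z x' y * g x' y')" for y y'
    define r where "r y' = g x0 y' - (\<Sum>y\<in>Y. g x0 y * p y y')" for y'
    show ?case
    proof (cases "\<forall>y'\<in>Y. r y' = 0")
      case True
      define Z' where "Z' x y = (if x = x0 then 0 else Z x y)" for x y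
      have "(\<Sum>x'\<in>insert x0 X. Z' x' y * g x' y') = p y y'" for y y'
      proof -
        have "(\<Sum>x'\<in>X. Z' x' y * g x' y') = (\<Sum>x'\<in>X. Z x' y * g x' y')"
          by (intro sum.cong refl) (use insert.hyps in \<open>auto simp: Z'_def\<close>)
        then show ?thesis using insert.hyps by (simp add: p_def Z'_def)
      qed
      then show ?thesis using Z True by (intro exI[of _ Z']) (auto simp: r_def p_def)
    next
      case False
      then obtain y0 where y0: "y0 \<in> Y" "r y0 \<noteq> 0" by blast
      define \<omega> where "\<omega> y = ((if y = y0 then 1 else 0) - p y y0) / r y0" for y
      define Z' where "Z' x y = (if x = x0 then \<omega> y else Z x y - \<omega> y * (\<Sum>y1\<in>Y. g x0 y1 * Z x y1))" for x y
      have sum': "(\<Sum>x'\<in>insert x0 X. Z' x' y * g x' y') = p y y' + \<omega> y * r y'" for y y'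
      proof -
        have "(\<Sum>x'\<in>X. Z' x' y * g x' y') = (\<Sum>x'\<in>X. Z x' y * g x' y' - \<omega> y * ((\<Sum>y1\<in>Y. g x0 y1 * Z x' y1) * g x' y'))"
          by (intro sum.cong refl) (use insert.hyps in \<open>auto simp: Z'_def algebra_simps\<close>)
        also have "\<dots> = p y y' - \<omega> y * (\<Sum>x'\<in>X. (\<Sum>y1\<in>Y. g x0 y1 * Z x' y1) * g x' y')"
          by (simp add: sum_subtractf p_def sum_distrib_left)
        also have "(\<Sum>x'\<in>X. (\<Sum>y1\<in>Y. g x0 y1 * Z x' y1) * g x' y') = (\<Sum>y\<in>Y. g x0 y * p y y')"
          unfolding p_def sum_distrib_left sum_distrib_right by (subst sum.swap) (simp add: ac_simps)
        finally show ?thesis using insert.hyps by (simp add: Z'_def r_def algebra_simps)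
      qed
      have \<omega>: "(\<Sum>y\<in>Y. g x y * \<omega> y) = (g x y0 - (\<Sum>y\<in>Y. g x y * p y y0)) / r y0" for x
      proof -
        have "(\<Sum>y\<in>Y. g x y * \<omega> y) = (\<Sum>y\<in>Y. (if y = y0 then g x y else 0) - g x y * p y y0) / r y0"
          unfolding \<omega>_def sum_divide_distrib by (intro sum.cong refl) (simp add: algebra_simps)
        then show ?thesis using y0(1) assms(2) by (simp add: sum_subtractf)
      qed
      have "(\<Sum>y\<in>Y. g x y * (p y y' + \<omega> y * r y')) = g x y'" if "x \<in> insert x0 X" "y' \<in> Y" for x y'
      proof -
        have "(\<Sum>y\<in>Y. g x y * (p y y' + \<omega> y * r y')) = (\<Sum>y\<in>Y. g x y * p y y') + (\<Sum>y\<in>Y. g x y * \<omega> y) * r y'"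
          by (simp add: distrib_left sum.distrib sum_distrib_right mult.assoc)
        also have "\<dots> = g x y'"
        proof (cases "x = x0")
          case True
          then have "(\<Sum>y\<in>Y. g x y * \<omega> y) = 1" using y0(2) by (simp add: \<omega> r_def)
          then show ?thesis using True by (simp add: r_def)
        next
          case False
          then have "x \<in> X" using that by simp
          then have "(\<Sum>y\<in>Y. g x y * p y y') = g x y'" "(\<Sum>y\<in>Y. g x y * p y y0) = g x y0"
            using Z that(2) y0(1) by (simp_all add: p_def)
          then show ?thesis by (simp add: \<omega>)
        qed
        finally show ?thesis .
      qed
      then show ?thesis by (intro exI[of _ Z']) (simp only: sum', blast)
    qed
  qed simp
  then show ?thesis using that by blast
qed

lemma app_lop_sum: "app (\<Sum>i\<in>A. f i) X L = (\<Sum>i\<in>A. app (f i) X L)"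
  by (induction A rule: infinite_finite_induct) (simp_all add: app_lop)

definition unit_fun :: "nat list \<Rightarrow> nat list \<Rightarrow> word \<Rightarrow> 'k::field" where
  "unit_fun K L w = (if w = zip K L then 1 else 0)"

lemma zip_eq_idx: "I \<in> idx n e \<Longrightarrow> J \<in> idx n e \<Longrightarrow> K \<in> idx n e \<Longrightarrow> L \<in> idx n e \<Longrightarrow> zip I J = zip K L \<longleftrightarrow> I = K \<and> J = L"
  by (metis idx_len map_fst_zip map_snd_zip)

lemma app_op_unit:
  assumes "K \<in> idx n e" "L \<in> idx n e"
  shows "app (op n e (unit_fun K L)) X I = (if I = K then X L else 0)"
proof -
  have "(\<Sum>J\<in>idx n e. unit_fun K L (zip I J) * X J) = (\<Sum>J\<in>idx n e. if J = L then (if I = K then X L else 0) else 0)" if "I \<in> idx n e"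
    by (intro sum.cong refl) (use assms that zip_eq_idx in \<open>auto simp: unit_fun_def\<close>)
  then show ?thesis using assms by (auto simp: app_op)
qed

lemma op_mult_unit:
  assumes "K \<in> idx n e" "L \<in> idx n e"
  shows "op n e s * op n e (unit_fun K L) = (\<Sum>P\<in>idx n e. ksc (s (zip P K)) * op n e (unit_fun P L))"
    "op n e (unit_fun K L) * op n e s = (\<Sum>P\<in>idx n e. ksc (s (zip L P)) * op n e (unit_fun K P))"
proof -
  show "op n e s * op n e (unit_fun K L) = (\<Sum>P\<in>idx n e. ksc (s (zip P K)) * op n e (unit_fun P L))"
  proof (rule lop_eqI)
    fix X I
    have "app (\<Sum>P\<in>idx n e. ksc (s (zip P K)) * op n e (unit_fun P L)) X I = (\<Sum>P\<in>idx n e. if P = I then s (zip I K) * X L else 0)"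
      unfolding app_lop_sum by (intro sum.cong refl) (use assms in \<open>auto simp: app_lop app_ksc app_op_unit\<close>)
    moreover have "(\<Sum>J\<in>idx n e. s (zip I J) * (if J = K then X L else 0)) = (\<Sum>J\<in>idx n e. if J = K then s (zip I K) * X L else 0)"
      by (intro sum.cong refl) auto
    ultimately show "app (op n e s * op n e (unit_fun K L)) X I = app (\<Sum>P\<in>idx n e. ksc (s (zip P K)) * op n e (unit_fun P L)) X I"
      using assms by (auto simp: app_lop app_op[of n e s] app_op_unit)
  qed
  show "op n e (unit_fun K L) * op n e s = (\<Sum>P\<in>idx n e. ksc (s (zip L P)) * op n e (unit_fun K P))"
  proof (rule lop_eqI)
    fix X I
    show "app (op n e (unit_fun K L) * op n e s) X I = app (\<Sum>P\<in>idx n e. ksc (s (zip L P)) * op n e (unit_fun K P)) X I"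
      unfolding app_lop_sum using assms by (auto simp: app_lop app_ksc app_op_unit app_op[of n e s])
  qed
qed

lemma op_eps: "op n e eps = (\<Sum>K\<in>idx n e. op n e (unit_fun K K))"
proof (rule lop_eqI)
  fix X I
  have "(\<Sum>J\<in>idx n e. eps (zip I J) * X J) = X I" if "I \<in> idx n e"
  proof -
    have "(\<Sum>J\<in>idx n e. eps (zip I J) * X J) = (\<Sum>J\<in>idx n e. if J = I then X I else 0)"
      by (intro sum.cong refl) (use that in \<open>auto simp: eps_alt idx_len\<close>)
    then show ?thesis using that by simp
  qed
  moreover have "(\<Sum>K\<in>idx n e. app (op n e (unit_fun K K)) X I) = (\<Sum>K\<in>idx n e. if K = I then X I else 0)"
    by (intro sum.cong refl) (auto simp: app_op_unit)
  ultimately show "app (op n e eps) X I = app (\<Sum>K\<in>idx n e. op n e (unit_fun K K)) X I"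
    unfolding app_lop_sum by (auto simp: app_op)
qed

lemma app_op_eps: "app (op n e eps) X I = (if I \<in> idx n e then X I else 0)"
  unfolding op_eps app_lop_sum by (auto simp: app_op_unit if_distrib cong: if_cong)

text \<open>Averaging is linear over operators that commute with the Hecke algebra. So the averages of the matrix
  units multiply with such an operator like the matrix units themselves, and as functionals they
  are invariant.\<close>
lemma averaged_units:
  fixes q :: "'k::field"
  assumes q: "q \<noteq> 0" "\<forall>m::nat. m > 0 \<longrightarrow> q ^ m \<noteq> 1"
  obtains \<alpha> :: "nat list \<Rightarrow> nat list \<Rightarrow> word \<Rightarrow> 'k" where
    "\<And>K L. K \<in> idx n e \<Longrightarrow> L \<in> idx n e \<Longrightarrow> Rinv n q (\<alpha> K L)"
    "\<And>s K L w. Rinv n q s \<Longrightarrow> K \<in> idx n e \<Longrightarrow> L \<in> idx n e \<Longrightarrow> w \<in> words n \<Longrightarrow> length w = e \<Longrightarrow>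
       conv n (\<lambda>u v. s u * \<alpha> K L v) w = (\<Sum>P\<in>idx n e. s (zip P K) * \<alpha> P L w)"
    "\<And>s K L w. Rinv n q s \<Longrightarrow> K \<in> idx n e \<Longrightarrow> L \<in> idx n e \<Longrightarrow> w \<in> words n \<Longrightarrow> length w = e \<Longrightarrow>
       conv n (\<lambda>u v. \<alpha> K L u * s v) w = (\<Sum>P\<in>idx n e. s (zip L P) * \<alpha> K P w)"
    "\<And>w. w \<in> words n \<Longrightarrow> length w = e \<Longrightarrow> (\<Sum>K\<in>idx n e. \<alpha> K K w) = eps w"
proof -
  interpret hecke "TT q e" ksc q e by (rule hecke_TT[OF q])
  obtain av where av: "\<And>f i. Suc i < e \<Longrightarrow> TT q e i * av f = av f * TT q e i"
    "\<And>s f. (\<And>i. Suc i < e \<Longrightarrow> s * TT q e i = TT q e i * s) \<Longrightarrow> av (s * f) = s * av f"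
    "\<And>s f. (\<And>i. Suc i < e \<Longrightarrow> s * TT q e i = TT q e i * s) \<Longrightarrow> av (f * s) = av f * s"
    "\<And>f g. av (f + g) = av f + av g" "av 1 = 1"
  proof (rule averaging, goal_cases)
    case (1 av)
    show ?case by (rule 1(1)[OF 1(2-6)])
  qed
  have av0: "av 0 = 0" using av(4)[of 0 0] by simp
  have avsum: "av (\<Sum>i\<in>A. f i) = (\<Sum>i\<in>A. av (f i))" for f :: "nat list \<Rightarrow> _" and A
    by (induction A rule: infinite_finite_induct) (simp_all add: av0 av(4))
  have avk: "av (ksc c * f) = ksc c * av f" for c f by (rule av(2)) (rule \<kappa>_central)
  let ?P = "op n e eps :: 'k lop"
  define A where "A K L = av (op n e (unit_fun K L))" for K L
  have opc: "op n e s * TT q e i = TT q e i * op n e s" if "Rinv n q s" "Suc i < e" for s i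
    using op_TT[OF that] .
  have PA: "?P * A K L = A K L" "A K L * ?P = A K L" if "K \<in> idx n e" "L \<in> idx n e" for K L
  proof -
    have "?P * op n e (unit_fun K L) = op n e (unit_fun K L)" "op n e (unit_fun K L) * ?P = op n e (unit_fun K L)"
      using that by (auto intro!: lop_eqI simp: app_lop app_op_eps app_op_unit)
    note u = this
    have "av (?P * op n e (unit_fun K L)) = ?P * A K L" unfolding A_def
      by (rule av(2)) (rule opc[OF Rinv_eps])
    then show "?P * A K L = A K L" unfolding u(1) A_def by (rule sym)
    have "av (op n e (unit_fun K L) * ?P) = A K L * ?P" unfolding A_def
      by (rule av(3)) (rule opc[OF Rinv_eps])
    then show "A K L * ?P = A K L" unfolding u(2) A_def by (rule sym)
  qed
  have presA: "pres n e (A K L)" if "K \<in> idx n e" "L \<in> idx n e" for K L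
  proof -
    have "app (A K L) X I = 0" if "I \<notin> idx n e" for X I
    proof -
      have "app (A K L) X I = app ?P (app (A K L) X) I" 
        unfolding app_lop(6)[symmetric] PA(1)[OF \<open>K \<in> idx n e\<close> \<open>L \<in> idx n e\<close>] ..
      then show ?thesis using that by (simp add: app_op_eps)
    qed
    then show ?thesis by (simp add: pres_def)
  qed
  define \<alpha> where "\<alpha> K L w = (if length w = e then ker (A K L) (map fst w) (map snd w) else 0)" for K L w
  have \<alpha>: "\<alpha> K L (zip I J) = ker (A K L) I J" if "I \<in> idx n e" "J \<in> idx n e" for K L I J
    using that by (simp add: \<alpha>_def idx_len)
  have kersum: "ker (\<Sum>P\<in>S. ksc (c P) * B P) I J = (\<Sum>P\<in>S. c P * ker (B P) I J)" for S :: "nat list set" and c B I J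
    by (simp add: ker_def app_lop_sum app_lop app_ksc)
  show ?thesis
  proof (rule that[of \<alpha>])
    fix K L assume KL: "K \<in> idx n e" "L \<in> idx n e"
    show "Rinv n q (\<alpha> K L)"
    proof (rule Rinv_zipI)
      fix e' i I J assume *: "I \<in> idx n e'" "J \<in> idx n e'" "Suc i < e'"
      show "hk q (I ! i) (I ! Suc i) (\<alpha> K L (zip I J)) (\<alpha> K L (zip (swp i I) J))
        = hk q (J ! i) (J ! Suc i) (\<alpha> K L (zip I J)) (\<alpha> K L (zip I (swp i J)))"
      proof (cases "e' = e")
        case False
        then show ?thesis using * by (simp add: \<alpha>_def idx_len hk_def)
      next
        case True
        have "TT q e i * A K L = A K L * TT q e i" using av(1) * True by (simp add: A_def)
        from ker_exchange[OF this, of I J] show ?thesis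
          using * True swp_idx[of i e I n] swp_idx[of i e J n] by (simp add: \<alpha> idx_len)
      qed
    qed
  next
    fix s K L w assume s: "Rinv n q s" and KL: "K \<in> idx n e" "L \<in> idx n e" and w: "w \<in> words n" "length w = e"
    let ?I = "map fst w" and ?J = "map snd w"
    have IJ: "?I \<in> idx n e" "?J \<in> idx n e" using word_idx[OF w(1)] w(2) by auto
    have "op n e s * A K L = av (op n e s * op n e (unit_fun K L))" unfolding A_def
      by (rule av(2)[symmetric]) (rule opc[OF s])
    then have 1: "op n e s * A K L = (\<Sum>P\<in>idx n e. ksc (s (zip P K)) * A P L)"
      unfolding op_mult_unit(1)[OF KL] avsum avk A_def .
    have "A K L * op n e s = av (op n e (unit_fun K L) * op n e s)" unfolding A_def
      by (rule av(3)[symmetric]) (rule opc[OF s])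
    then have 2: "A K L * op n e s = (\<Sum>P\<in>idx n e. ksc (s (zip L P)) * A K P)"
      unfolding op_mult_unit(2)[OF KL] avsum avk A_def .
    have "conv n (\<lambda>u v. s u * \<alpha> K L v) w = (\<Sum>Q\<in>idx n e. ker (op n e s) ?I Q * ker (A K L) Q ?J)"
      unfolding conv_def w(2) by (intro sum.cong refl) (use IJ in \<open>simp add: \<alpha> ker_op\<close>)
    also have "\<dots> = ker (op n e s * A K L) ?I ?J" by (rule ker_mult[OF presA[OF KL] IJ(2), symmetric])
    finally show "conv n (\<lambda>u v. s u * \<alpha> K L v) w = (\<Sum>P\<in>idx n e. s (zip P K) * \<alpha> P L w)"
      unfolding 1 kersum using w by (simp add: \<alpha>_def)
    have "conv n (\<lambda>u v. \<alpha> K L u * s v) w = (\<Sum>Q\<in>idx n e. ker (A K L) ?I Q * ker (op n e s) Q ?J)"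
      unfolding conv_def w(2) by (intro sum.cong refl) (use IJ in \<open>simp add: \<alpha> ker_op\<close>)
    also have "\<dots> = ker (A K L * op n e s) ?I ?J" by (rule ker_mult[OF pres_op IJ(2), symmetric])
    finally show "conv n (\<lambda>u v. \<alpha> K L u * s v) w = (\<Sum>P\<in>idx n e. s (zip L P) * \<alpha> K P w)"
      unfolding 2 kersum using w by (simp add: \<alpha>_def)
  next
    fix w assume w: "w \<in> words n" "length w = e"
    let ?I = "map fst w" and ?J = "map snd w"
    have IJ: "?I \<in> idx n e" "?J \<in> idx n e" using word_idx[OF w(1)] w(2) by auto
    have "(\<Sum>K\<in>idx n e. A K K) = av (?P * 1)" by (simp add: A_def op_eps avsum)
    also have "\<dots> = ?P" using av(2)[OF opc[OF Rinv_eps], of 1] av(5) by simp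
    finally have "(\<Sum>K\<in>idx n e. ker (A K K) ?I ?J) = ker ?P ?I ?J"
      unfolding ker_def app_lop_sum[symmetric] by simp
    also have "\<dots> = eps w" using IJ by (simp add: ker_op zip_map_fst_snd)
    finally show "(\<Sum>K\<in>idx n e. \<alpha> K K w) = eps w" using w by (simp add: \<alpha>_def)
  qed
qed

text \<open>The entries \<open>\<gamma>\<close> of the averaged matrix units acting on the comodule are the coefficients of comodule maps
  from it to \<open>V\<^sub>n\<^bsup>\<otimes>e\<^esup>\<close> and back. All of them together form a matrix \<open>g\<close>, and a generalized inverse of it turns the
  maps into an inclusion and a retraction: as the matrix units \<open>(K, K)\<close> add up to \<open>1\<close>, so do the
  averages.\<close>
lemma retract:
  fixes q :: "'k::field"
  assumes q: "q \<noteq> 0" "\<forall>m::nat. m > 0 \<longrightarrow> q ^ m \<noteq> 1" and V: "(n, c) \<in> hecke_pairs q e"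
  obtains m \<iota> p where "\<iota> \<in> comodule_maps n q c (MM n q e m)" "p \<in> comodule_maps n q (MM n q e m) c"
    "p * \<iota> = 1\<^sub>m (dim_row c)"
proof -
  let ?v = "dim_row c" and ?N = "n ^ e"
  obtain \<alpha> :: "nat list \<Rightarrow> nat list \<Rightarrow> word \<Rightarrow> 'k" where \<alpha>:
    "\<And>K L. K \<in> idx n e \<Longrightarrow> L \<in> idx n e \<Longrightarrow> Rinv n q (\<alpha> K L)"
    "\<And>s K L w. Rinv n q s \<Longrightarrow> K \<in> idx n e \<Longrightarrow> L \<in> idx n e \<Longrightarrow> w \<in> words n \<Longrightarrow> length w = e \<Longrightarrow>
       conv n (\<lambda>u v. s u * \<alpha> K L v) w = (\<Sum>P\<in>idx n e. s (zip P K) * \<alpha> P L w)"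
    "\<And>s K L w. Rinv n q s \<Longrightarrow> K \<in> idx n e \<Longrightarrow> L \<in> idx n e \<Longrightarrow> w \<in> words n \<Longrightarrow> length w = e \<Longrightarrow>
       conv n (\<lambda>u v. \<alpha> K L u * s v) w = (\<Sum>P\<in>idx n e. s (zip L P) * \<alpha> K P w)"
    "\<And>w. w \<in> words n \<Longrightarrow> length w = e \<Longrightarrow> (\<Sum>K\<in>idx n e. \<alpha> K K w) = eps w"
  proof (rule averaged_units[OF q, of n e], goal_cases)
    case (1 \<alpha>)
    show ?case by (rule 1(1)[OF 1(2-5)])
  qed
  have c: "is_comodule n q c" and el: "elements_mat c \<subseteq> Aq_deg n q e" using V by (auto simp: hecke_pairs_def)
  note ec = ent_comodule[OF c]
  have sq: "dim_col c = ?v" using ec by (simp add: ent_def)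
  have "\<exists>f. wp n f \<and> (\<forall>w\<in>Poly_Mapping.keys f. length w = e) \<and> cls n q f = c $$ (i, j)" if "i < ?v" "j < ?v" for i j
  proof -
    have "c $$ (i, j) \<in> elements_mat c" unfolding elements_mat_def using that sq by force
    then have "c $$ (i, j) \<in> Aq_deg n q e" using el by blast
    then show ?thesis by (auto simp: Aq_deg_def Free_MA)
  qed
  then obtain F where F: "\<And>i j. i < ?v \<Longrightarrow> j < ?v \<Longrightarrow>
      wp n (F i j) \<and> (\<forall>w\<in>Poly_Mapping.keys (F i j). length w = e) \<and> cls n q (F i j) = c $$ (i, j)" by metis
  have frF: "lf \<phi> (fr n q c i j) = lf \<phi> (F i j)" if "i < ?v" "j < ?v" "Rinv n q \<phi>" for i j \<phi>
    using lf_rep_cls[where n = n and f = "F i j" and q = q and \<phi> = \<phi>] F[OF that(1,2)] that(3) by simp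
  define \<gamma> where "\<gamma> i j K L = lf (\<alpha> K L) (F i j)" for i j K L
  have \<gamma>fr: "\<gamma> i j K L = lf (\<alpha> K L) (fr n q c i j)" if "i < ?v" "j < ?v" "K \<in> idx n e" "L \<in> idx n e" for i j K L
    unfolding \<gamma>_def using frF[OF that(1,2) \<alpha>(1)[OF that(3,4)]] by simp
  have lfF: "lf \<phi> (F i j) = lf \<phi>' (F i j)" if "i < ?v" "j < ?v"
      "\<And>w. w \<in> words n \<Longrightarrow> length w = e \<Longrightarrow> \<phi> w = \<phi>' w" for i j \<phi> \<phi>'
    by (rule lf_cong) (use F[OF that(1,2)] that(3) in blast)
  have left: "(\<Sum>i'<?v. lf s (fr n q c i i') * \<gamma> i' j K L) = (\<Sum>P\<in>idx n e. s (zip P K) * \<gamma> i j P L)"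
    if ij: "i < ?v" "j < ?v" and KL: "K \<in> idx n e" "L \<in> idx n e" and s: "Rinv n q s" for i j K L s
  proof -
    have "(\<Sum>i'<?v. lf s (fr n q c i i') * \<gamma> i' j K L) = (\<Sum>i'<?v. lf s (fr n q c i i') * lf (\<alpha> K L) (fr n q c i' j))"
      by (rule sum.cong[OF refl]) (simp add: \<gamma>fr ij KL)
    also have "\<dots> = lf (conv n (\<lambda>u v. s u * \<alpha> K L v)) (fr n q c i j)"
      by (rule comodule_times[OF c ij s \<alpha>(1)[OF KL], symmetric])
    also have "\<dots> = lf (conv n (\<lambda>u v. s u * \<alpha> K L v)) (F i j)"
      by (rule frF[OF ij]) (rule Rinv_conv[OF R2inv_times[OF s \<alpha>(1)[OF KL]]])
    also have "\<dots> = lf (\<lambda>w. \<Sum>P\<in>idx n e. s (zip P K) * \<alpha> P L w) (F i j)"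
      by (rule lfF[OF ij]) (rule \<alpha>(2)[OF s KL])
    also have "\<dots> = (\<Sum>P\<in>idx n e. s (zip P K) * \<gamma> i j P L)" unfolding lf_sum_fun lf_scale \<gamma>_def ..
    finally show ?thesis .
  qed
  have right: "(\<Sum>i'<?v. \<gamma> i i' K L * lf s (fr n q c i' j)) = (\<Sum>P\<in>idx n e. s (zip L P) * \<gamma> i j K P)"
    if ij: "i < ?v" "j < ?v" and KL: "K \<in> idx n e" "L \<in> idx n e" and s: "Rinv n q s" for i j K L s
  proof -
    have "(\<Sum>i'<?v. \<gamma> i i' K L * lf s (fr n q c i' j)) = (\<Sum>i'<?v. lf (\<alpha> K L) (fr n q c i i') * lf s (fr n q c i' j))"
      by (rule sum.cong[OF refl]) (simp add: \<gamma>fr ij KL)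
    also have "\<dots> = lf (conv n (\<lambda>u v. \<alpha> K L u * s v)) (fr n q c i j)"
      by (rule comodule_times[OF c ij \<alpha>(1)[OF KL] s, symmetric])
    also have "\<dots> = lf (conv n (\<lambda>u v. \<alpha> K L u * s v)) (F i j)"
      by (rule frF[OF ij]) (rule Rinv_conv[OF R2inv_times[OF \<alpha>(1)[OF KL] s]])
    also have "\<dots> = lf (\<lambda>w. \<Sum>P\<in>idx n e. s (zip L P) * \<alpha> K P w) (F i j)"
      by (rule lfF[OF ij]) (rule \<alpha>(3)[OF s KL])
    also have "\<dots> = (\<Sum>P\<in>idx n e. s (zip L P) * \<gamma> i j K P)" unfolding lf_sum_fun lf_scale \<gamma>_def ..
    finally show ?thesis .
  qed
  have one: "(\<Sum>K\<in>idx n e. \<gamma> i j K K) = (if i = j then 1 else 0)" if ij: "i < ?v" "j < ?v" for i j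
  proof -
    have "(\<Sum>K\<in>idx n e. \<gamma> i j K K) = lf (\<lambda>w. \<Sum>K\<in>idx n e. \<alpha> K K w) (F i j)" unfolding lf_sum_fun \<gamma>_def ..
    also have "\<dots> = lf eps (F i j)" by (rule lfF[OF ij \<alpha>(4)])
    also have "\<dots> = (if i = j then 1 else 0)" using frF[OF ij Rinv_eps] comoduleD(3)[OF c ij] by simp
    finally show ?thesis .
  qed
  define g where "g x y = \<gamma> (fst y) (fst x) (snd y) (snd x)" for x y
  let ?X = "{..<?v} \<times> idx n e"
  have fin: "finite ?X" by simp
  obtain Z where Z: "\<And>x y'. x \<in> ?X \<Longrightarrow> y' \<in> ?X \<Longrightarrow> (\<Sum>y\<in>?X. g x y * (\<Sum>x'\<in>?X. Z x' y * g x' y')) = g x y'"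
  proof (rule generalized_inverse[OF fin fin, of g], goal_cases)
    case (1 Z)
    show ?case by (rule 1(1)[OF 1(2)])
  qed
  define y where "y a = (a div ?N, dec n e (a mod ?N))" for a
  have y: "y a \<in> ?X" if "a < ?v * ?N" for a
    using that by (elim idx_split) (simp only: y_def div_idx dec_idx mem_Times_iff fst_conv snd_conv lessThan_iff simp_thms)
  have sum_y: "(\<Sum>a<?v * ?N. h (y a)) = (\<Sum>z\<in>?X. h z)" for h :: "nat \<times> nat list \<Rightarrow> 'k"
  proof -
    have "(\<Sum>a<?v * ?N. h (y a)) = (\<Sum>i<?v. \<Sum>j<?N. h (i, dec n e j))"
      unfolding sum_split by (intro sum.cong refl) (simp only: y_def div_idx lessThan_iff)
    then show ?thesis unfolding sum_dec[of "\<lambda>K. h (_, K)"] sum.cartesian_product by (simp add: case_prod_beta')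
  qed
  define m where "m = ?v * ?N"
  \<comment> \<open>The copies are numbered by the pairs \<open>y a = (i, K)\<close>; copy \<open>(i, K)\<close> uses the row \<open>\<gamma> i _ K _\<close>.\<close>
  define \<iota> where "\<iota> = mat (m * ?N) ?v (\<lambda>(x, j). g (j, dec n e (x mod ?N)) (y (x div ?N)))"
  define G where "G a k L = (\<Sum>x\<in>?X. Z x (y a) * g x (k, L))" for a k L
  define p where "p = mat ?v (m * ?N) (\<lambda>(k, x). G (x div ?N) k (dec n e (x mod ?N)))"
  have \<iota>i: "\<iota> $$ (a * ?N + l, j) = g (j, dec n e l) (y a)" if "a < m" "l < ?N" "j < ?v" for a l j
    unfolding \<iota>_def using that idx_bound[OF that(1,2)] by (simp only: index_mat prod.case div_idx)
  have pi: "p $$ (k, a * ?N + l) = G a k (dec n e l)" if "a < m" "l < ?N" "k < ?v" for a l k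
    unfolding p_def using that idx_bound[OF that(1,2)] by (simp only: index_mat prod.case div_idx)
  have ya: "fst (y a) < ?v" "snd (y a) \<in> idx n e" if "a < m" for a using y[of a] that by (auto simp: m_def)
  show ?thesis
  proof (rule that[of \<iota> m p])
    show "\<iota> \<in> comodule_maps n q c (MM n q e m)" unfolding comodule_maps_iff[OF ec ent_MM]
    proof (intro conjI allI impI)
      show "\<iota> \<in> carrier_mat (dim_row (MM n q e m)) ?v" by (simp add: \<iota>_def)
      fix \<phi> x i assume \<phi>: "Rinv n q \<phi>" and "x < dim_row (MM n q e m)" and i: "i < ?v"
      then have "x < m * ?N" by simp
      then obtain a l where x: "a < m" "l < ?N" "x = a * ?N + l" by (rule idx_split)
      have "(\<Sum>j<?v. \<iota> $$ (x, j) * lf \<phi> (fr n q c j i))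
        = (\<Sum>j<?v. \<gamma> (fst (y a)) j (snd (y a)) (dec n e l) * lf \<phi> (fr n q c j i))"
        unfolding x(3) by (rule sum.cong[OF refl]) (simp only: \<iota>i x lessThan_iff g_def fst_conv snd_conv)
      also have "\<dots> = (\<Sum>P\<in>idx n e. \<phi> (zip (dec n e l) P) * \<gamma> (fst (y a)) i (snd (y a)) P)"
        by (rule right[OF ya(1)[OF x(1)] i ya(2)[OF x(1)] dec_idx[OF x(2)] \<phi>])
      also have "\<dots> = (\<Sum>t<?N. \<phi> (zip (dec n e l) (dec n e t)) * g (i, dec n e t) (y a))"
        unfolding sum_dec[symmetric, where e = e and n = n] g_def by simp
      also have "\<dots> = (\<Sum>b<m. if b = a then (\<Sum>t<?N. \<phi> (zip (dec n e l) (dec n e t)) * g (i, dec n e t) (y b)) else 0)"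
        using x(1) by simp
      also have "\<dots> = (\<Sum>b<m. \<Sum>t<?N. (if a = b then \<phi> (zip (dec n e l) (dec n e t)) else 0) * g (i, dec n e t) (y b))"
        by (rule sum.cong[OF refl]) auto
      also have "\<dots> = (\<Sum>z<dim_row (MM n q e m). lf \<phi> (fr n q (MM n q e m) x z) * \<iota> $$ (z, i))"
        unfolding MM_dims sum_split x(3)
        by (intro sum.cong refl arg_cong2[of _ _ _ _ "(*)"] lf_MM[symmetric] \<iota>i[symmetric]) (use x i \<phi> in auto)
      finally show "(\<Sum>j<?v. \<iota> $$ (x, j) * lf \<phi> (fr n q c j i))
        = (\<Sum>z<dim_row (MM n q e m). lf \<phi> (fr n q (MM n q e m) x z) * \<iota> $$ (z, i))" .
    qed
  next
    show "p \<in> comodule_maps n q (MM n q e m) c" unfolding comodule_maps_iff[OF ent_MM ec]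
    proof (intro conjI allI impI)
      show "p \<in> carrier_mat ?v (dim_row (MM n q e m))" by (simp add: p_def)
      fix \<phi> k x assume \<phi>: "Rinv n q \<phi>" and k: "k < ?v" and "x < dim_row (MM n q e m)"
      then have "x < m * ?N" by simp
      then obtain a l where x: "a < m" "l < ?N" "x = a * ?N + l" by (rule idx_split)
      have "(\<Sum>i<?v. lf \<phi> (fr n q c k i) * p $$ (i, x)) = (\<Sum>i<?v. \<Sum>z\<in>?X. Z z (y a) * (lf \<phi> (fr n q c k i) * g z (i, dec n e l)))"
        unfolding x(3) by (rule sum.cong[OF refl]) (simp only: lessThan_iff pi x G_def sum_distrib_left mult.left_commute)
      also have "\<dots> = (\<Sum>z\<in>?X. \<Sum>i<?v. Z z (y a) * (lf \<phi> (fr n q c k i) * g z (i, dec n e l)))" by (rule sum.swap)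
      also have "\<dots> = (\<Sum>z\<in>?X. Z z (y a) * (\<Sum>P\<in>idx n e. \<phi> (zip P (dec n e l)) * g z (k, P)))"
      proof (rule sum.cong[OF refl])
        fix z assume "z \<in> ?X"
        then have z: "fst z < ?v" "snd z \<in> idx n e" by auto
        have "(\<Sum>i<?v. lf \<phi> (fr n q c k i) * g z (i, dec n e l)) = (\<Sum>P\<in>idx n e. \<phi> (zip P (dec n e l)) * g z (k, P))"
          unfolding g_def fst_conv snd_conv by (rule left[OF k z(1) dec_idx[OF x(2)] z(2) \<phi>])
        then show "(\<Sum>i<?v. Z z (y a) * (lf \<phi> (fr n q c k i) * g z (i, dec n e l)))
          = Z z (y a) * (\<Sum>P\<in>idx n e. \<phi> (zip P (dec n e l)) * g z (k, P))"
          unfolding sum_distrib_left[symmetric] by simp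
      qed
      also have "\<dots> = (\<Sum>P\<in>idx n e. G a k P * \<phi> (zip P (dec n e l)))"
        unfolding G_def sum_distrib_left sum_distrib_right by (subst sum.swap) (simp add: ac_simps)
      also have "\<dots> = (\<Sum>t<?N. G a k (dec n e t) * \<phi> (zip (dec n e t) (dec n e l)))"
        by (rule sum_dec[symmetric])
      also have "\<dots> = (\<Sum>b<m. if b = a then (\<Sum>t<?N. G b k (dec n e t) * \<phi> (zip (dec n e t) (dec n e l))) else 0)"
        using x(1) by simp
      also have "\<dots> = (\<Sum>b<m. \<Sum>t<?N. G b k (dec n e t) * (if b = a then \<phi> (zip (dec n e t) (dec n e l)) else 0))"
        by (rule sum.cong[OF refl]) auto
      also have "\<dots> = (\<Sum>z<dim_row (MM n q e m). p $$ (k, z) * lf \<phi> (fr n q (MM n q e m) z x))"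
        unfolding MM_dims sum_split x(3)
        by (intro sum.cong refl arg_cong2[of _ _ _ _ "(*)"] lf_MM[symmetric] pi[symmetric]) (use x k \<phi> in auto)
      finally show "(\<Sum>z<dim_row (MM n q e m). p $$ (k, z) * lf \<phi> (fr n q (MM n q e m) z x))
        = (\<Sum>i<?v. lf \<phi> (fr n q c k i) * p $$ (i, x))" by (rule sym)
    qed
  next
    show "p * \<iota> = 1\<^sub>m ?v"
    proof (rule eq_matI)
      fix k j assume "k < dim_row (1\<^sub>m ?v :: 'k mat)" "j < dim_col (1\<^sub>m ?v :: 'k mat)"
      then have k: "k < ?v" and j: "j < ?v" by auto
      have "(p * \<iota>) $$ (k, j) = (\<Sum>z<m * ?N. p $$ (k, z) * \<iota> $$ (z, j))"
        by (rule mult_index) (use k j in \<open>simp_all add: p_def \<iota>_def\<close>)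
      also have "\<dots> = (\<Sum>a<m. \<Sum>l<?N. G a k (dec n e l) * g (j, dec n e l) (y a))"
        unfolding sum_split by (intro sum.cong refl arg_cong2[of _ _ _ _ "(*)"] pi \<iota>i) (use k j in auto)
      also have "\<dots> = (\<Sum>a<m. \<Sum>L\<in>idx n e. G a k L * g (j, L) (y a))"
        by (rule sum.cong[OF refl]) (rule sum_dec)
      also have "\<dots> = (\<Sum>L\<in>idx n e. \<Sum>a<m. g (j, L) (y a) * (\<Sum>x\<in>?X. Z x (y a) * g x (k, L)))"
        unfolding G_def by (subst sum.swap) (simp only: mult.commute)
      also have "\<dots> = (\<Sum>L\<in>idx n e. \<Sum>z\<in>?X. g (j, L) z * (\<Sum>x\<in>?X. Z x z * g x (k, L)))"
        unfolding m_def by (rule sum.cong[OF refl]) (rule sum_y)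
      also have "\<dots> = (\<Sum>L\<in>idx n e. g (j, L) (k, L))"
        by (rule sum.cong[OF refl]) (rule Z; use j k in simp)
      also have "\<dots> = (if k = j then 1 else 0)" using one[OF k j] by (simp add: g_def)
      finally show "(p * \<iota>) $$ (k, j) = 1\<^sub>m ?v $$ (k, j)" using k j by simp
    qed (simp_all add: p_def \<iota>_def)
  qed
qed

section \<open>Maps compatible with braidings\<close>

lemma mat_assoc: "dim_col A = dim_row B \<Longrightarrow> dim_col B = dim_row C \<Longrightarrow> (A * B) * C = A * (B * C)"
  for A B C :: "'k::semiring_1 mat"
  by (rule assoc_mult_mat[of A "dim_row A" "dim_row B" B "dim_row C" C "dim_col C"]) auto

lemma mult_one: "dim_row A = n \<Longrightarrow> 1\<^sub>m n * A = A" "dim_col A = n \<Longrightarrow> A * 1\<^sub>m n = A"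
  for A :: "'k::semiring_1 mat"
  by (auto intro: left_mult_one_mat' right_mult_one_mat')

abbreviation hp :: "'k::field \<Rightarrow> 'k hpair \<Rightarrow> bool" where "hp q V \<equiv> is_comodule (fst V) q (snd V)"

lemma hecke_hp: "V \<in> hecke_pairs q e \<Longrightarrow> hp q V" by (auto simp: hecke_pairs_def)

lemma braiding_dims:
  assumes "q \<noteq> 0" "is_comodule n q V" "is_comodule n q W"
  shows "dim_row (braiding n q V W) = dim_row W * dim_row V" "dim_col (braiding n q V W) = dim_row V * dim_row W"
    "invertible_mat (braiding n q V W)"
proof -
  have *: "braiding n q V W \<in> comodule_maps n q (tens_comodule n q V W) (tens_comodule n q W V)"
    "invertible_mat (braiding n q V W)"
    using braiding_exists[OF assms(1), of n] assms(2,3) unfolding is_braiding_def by blast+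
  have "braiding n q V W \<in> carrier_mat (dim_row (tens_comodule n q W V)) (dim_row (tens_comodule n q V W))"
    using *(1) unfolding comodule_maps_def by blast
  then show "dim_row (braiding n q V W) = dim_row W * dim_row V" "dim_col (braiding n q V W) = dim_row V * dim_row W"
    by (simp_all add: tens_comodule_def carrier_matD)
  show "invertible_mat (braiding n q V W)" by (rule *(2))
qed

lemma braiding_natural:
  assumes "q \<noteq> 0" "is_comodule n q V" "is_comodule n q V'" "is_comodule n q W" "is_comodule n q W'"
    "f \<in> comodule_maps n q V V'" "g \<in> comodule_maps n q W W'"
  shows "braiding n q V' W' * kron f g = kron g f * braiding n q V W"
  using braiding_exists[OF assms(1), of n] assms(2-) unfolding is_braiding_def by blast

lemma braiding_hexagon:
  assumes "q \<noteq> 0" "is_comodule n q V" "is_comodule n q W" "is_comodule n q U"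
  shows "braiding n q (tens_comodule n q V W) U
          = kron (braiding n q V U) (1\<^sub>m (dim_row W)) * kron (1\<^sub>m (dim_row V)) (braiding n q W U)"
    "braiding n q V (tens_comodule n q W U)
          = kron (1\<^sub>m (dim_row W)) (braiding n q V U) * kron (braiding n q V W) (1\<^sub>m (dim_row U))"
  using braiding_exists[OF assms(1), of n] assms(2-) unfolding is_braiding_def by blast+

lemma braiding_std: "q \<noteq> 0 \<Longrightarrow> braiding n q (std_comodule n q) (std_comodule n q) = Rmat n q"
  using braiding_exists[of q n] unfolding is_braiding_def by blast

lemma RV_dims [simp]:
  assumes "q \<noteq> 0" "hp q V"
  shows "dim_row (RV q V) = vdim V * vdim V" "dim_col (RV q V) = vdim V * vdim V"
  using braiding_dims[OF assms(1) assms(2) assms(2)] by (simp_all add: RV_def vdim_def)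

lemma Tact_carrier:
  assumes "q \<noteq> 0" "hp q V" "i + 1 < d"
  shows "Tact q d V i \<in> carrier_mat (vdim V ^ d) (vdim V ^ d)"
proof -
  have d: "d = i + (2 + (d - 2 - i))" using assms(3) by simp
  have "v ^ d = v ^ i * (v * v * v ^ (d - 2 - i))" for v :: nat
    by (subst d) (simp only: power_add power2_eq_square)
  then show ?thesis using assms by (auto simp: Tact_def intro!: carrier_matI)
qed

text \<open>Maps compatible with the braidings of their source and target. Unlike comodule maps they may relate
  comodules over different \<open>A\<^sub>q(n, n)\<close>, and they suffice for equivariance on tensor powers.\<close>
definition Rmor :: "'k::field \<Rightarrow> 'k hpair \<Rightarrow> 'k hpair \<Rightarrow> 'k mat \<Rightarrow> bool" where
  "Rmor q V W Q \<longleftrightarrow> Q \<in> carrier_mat (vdim W) (vdim V) \<and> kron Q Q * RV q V = RV q W * kron Q Q"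

lemma Rmor_kpow:
  assumes q: "q \<noteq> 0" and V: "hp q V" and W: "hp q W" and Q: "Rmor q V W Q"
  shows "kpow Q d \<in> braid_hom q d V W"
  unfolding braid_hom_def
proof (intro CollectI conjI allI impI)
  have dQ: "dim_row Q = vdim W" "dim_col Q = vdim V" and c: "kron Q Q * RV q V = RV q W * kron Q Q"
    using Q by (auto simp: Rmor_def)
  show "kpow Q d \<in> carrier_mat (vdim W ^ d) (vdim V ^ d)" using dQ by (auto intro!: carrier_matI)
  fix i assume i: "i + 1 < d"
  define r where "r = d - 2 - i"
  have d: "d = i + (2 + r)" using i by (simp add: r_def)
  have "kpow Q d = kron (kpow Q i) (kron (kpow Q 2) (kpow Q r))" unfolding d kpow_add ..
  also have "kpow Q 2 = kron Q Q" by (simp add: numeral_2_eq_2 kron_unit(2)[simplified])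
  finally have k: "kpow Q d = kron (kpow Q i) (kron (kron Q Q) (kpow Q r))" .
  have "kpow Q d * Tact q d V i = kron (kpow Q i) (kron (kron Q Q * RV q V) (kpow Q r))"
    unfolding k Tact_def r_def[symmetric] using dQ q V by (simp add: kron_mult mult_one)
  also have "\<dots> = Tact q d W i * kpow Q d"
    unfolding k Tact_def r_def[symmetric] c using dQ q W by (simp add: kron_mult mult_one)
  finally show "kpow Q d * Tact q d V i = Tact q d W i * kpow Q d" .
qed

lemma comodule_map_Rmor:
  assumes "q \<noteq> 0" "is_comodule n q c" "is_comodule n q c'" "f \<in> comodule_maps n q c c'"
  shows "Rmor q (n, c) (n, c') f"
  using braiding_natural[OF assms(1-3) assms(2,3) assms(4,4)] assms(4)
  by (auto simp: Rmor_def RV_def vdim_def comodule_maps_def)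

section \<open>Relabelling the basis of the standard comodule\<close>

text \<open>The matrix of zeros and ones of a relation between basis vectors.\<close>
definition rel :: "nat \<Rightarrow> nat \<Rightarrow> (nat \<Rightarrow> nat \<Rightarrow> bool) \<Rightarrow> 'k::field mat" where
  "rel a b G = mat a b (\<lambda>(i, j). if G i j then 1 else 0)"

lemma rel_dims [simp]: "dim_row (rel a b G) = a" "dim_col (rel a b G) = b" by (simp_all add: rel_def)
lemma rel_index: "i < a \<Longrightarrow> j < b \<Longrightarrow> rel a b G $$ (i, j) = (if G i j then 1 else 0)" by (simp add: rel_def)

lemma rel_mult:
  assumes "\<And>i k s t. s < b \<Longrightarrow> t < b \<Longrightarrow> G i s \<Longrightarrow> G i t \<Longrightarrow> s = t"
  shows "rel a b G * rel b c H = (rel a c (\<lambda>i k. \<exists>t<b. G i t \<and> H t k) :: 'k::field mat)"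
proof (rule eq_matI)
  fix i k assume "i < dim_row (rel a c (\<lambda>i k. \<exists>t<b. G i t \<and> H t k) :: 'k mat)" "k < dim_col (rel a c (\<lambda>i k. \<exists>t<b. G i t \<and> H t k) :: 'k mat)"
  then have ik: "i < a" "k < c" by auto
  have "(rel a b G * rel b c H :: 'k mat) $$ (i, k) = (\<Sum>t<b. rel a b G $$ (i, t) * rel b c H $$ (t, k))"
    by (rule mult_index) (use ik in auto)
  also have "\<dots> = (\<Sum>t<b. if G i t \<and> H t k then 1 else 0)" by (rule sum.cong) (use ik in \<open>auto simp: rel_index\<close>)
  also have "\<dots> = (if \<exists>t<b. G i t \<and> H t k then 1 else 0)"
  proof (cases "\<exists>t<b. G i t \<and> H t k")
    case True
    then obtain t where t: "t < b" "G i t" "H t k" by blast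
    have "(\<Sum>t<b. if G i t \<and> H t k then 1 else 0) = (\<Sum>s<b. if s = t then 1 else (0::'k))"
      by (rule sum.cong) (use t assms in auto)
    then show ?thesis using True t(1) by simp
  next
    case False
    have "(\<Sum>t<b. if G i t \<and> H t k then 1 else 0) = (\<Sum>s<b. (0::'k))" by (rule sum.cong) (use False in auto)
    then show ?thesis using False by simp
  qed
  finally show "(rel a b G * rel b c H :: 'k mat) $$ (i, k) = rel a c (\<lambda>i k. \<exists>t<b. G i t \<and> H t k) $$ (i, k)"
    using ik by (simp add: rel_index)
qed auto

text \<open>\<open>R\<^sub>n\<close> depends on the order of two indices only, not on the indices themselves. A relation that
  respects the order in both directions is in particular a partial injection, so the case of equal
  indices is respected as well.\<close>
lemma relabel_Rmat:
  assumes G: "\<And>i j i' j'. G i j \<Longrightarrow> G i' j' \<Longrightarrow> i < i' \<longleftrightarrow> j < j'"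
  shows "Rmat n' q * kron (rel n' n G) (rel n' n G) = kron (rel n' n G) (rel n' n G) * Rmat n q"
proof (rule mat_eq_splitI[of _ n' n' _ n n])
  let ?p = "rel n' n G :: 'a mat"
  fix a b i j assume *: "a < n'" "b < n'" "i < n" "j < n"
  have R: "Rmat n q $$ (a * n + b, i * n + j) = Rcoef q a b i j" if "a < n" "b < n" "i < n" "j < n" for n a b i j
    unfolding Rmat_def using that idx_bound[of a n b n] idx_bound[of i n j n]
    by (simp only: index_mat prod.case div_idx)
  have "(Rmat n' q * kron ?p ?p) $$ (a * n' + b, i * n + j)
    = (\<Sum>y<n' * n'. Rmat n' q $$ (a * n' + b, y) * kron ?p ?p $$ (y, i * n + j))"
    by (rule mult_index) (use * idx_bound in \<open>auto simp: Rmat_def\<close>)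
  also have "\<dots> = (\<Sum>s<n'. \<Sum>t<n'. Rcoef q a b s t * (?p $$ (s, i) * ?p $$ (t, j)))"
    unfolding sum_split by (intro sum.cong refl arg_cong2[of _ _ _ _ "(*)"] R kron_index) (use * in auto)
  also have "\<dots> = hk q a b (?p $$ (a, i) * ?p $$ (b, j)) (?p $$ (b, i) * ?p $$ (a, j))"
    by (rule sum_Rcoef_left) (use * in auto)
  also have "\<dots> = hk q i j (?p $$ (a, i) * ?p $$ (b, j)) (?p $$ (a, j) * ?p $$ (b, i))"
    using * G[of a i b j] G[of b j a i] G[of a j b i] G[of b i a j] G[of a i a j] G[of a j a i] G[of b i b j] G[of b j b i]
    by (auto simp: hk_def rel_index)
  also have "\<dots> = (\<Sum>s<n. \<Sum>t<n. Rcoef q i j s t * (?p $$ (a, s) * ?p $$ (b, t)))"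
    by (rule sum_Rcoef_left[symmetric]) (use * in auto)
  also have "\<dots> = (\<Sum>s<n. \<Sum>t<n. kron ?p ?p $$ (a * n' + b, s * n + t) * Rmat n q $$ (s * n + t, i * n + j))"
  proof (rule sum.cong[OF refl], rule sum.cong[OF refl])
    fix s t assume "s \<in> {..<n}" "t \<in> {..<n}"
    then have st: "s < n" "t < n" by auto
    have "kron ?p ?p $$ (a * n' + b, s * n + t) = ?p $$ (a, s) * ?p $$ (b, t)" by (rule kron_index) (use * st in auto)
    then show "Rcoef q i j s t * (?p $$ (a, s) * ?p $$ (b, t)) = kron ?p ?p $$ (a * n' + b, s * n + t) * Rmat n q $$ (s * n + t, i * n + j)"
      unfolding R[OF st *(3,4)] Rcoef_sym[of q s t] by (simp only: mult.commute)
  qed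
  also have "\<dots> = (kron ?p ?p * Rmat n q) $$ (a * n' + b, i * n + j)"
  proof -
    have "(kron ?p ?p * Rmat n q) $$ (a * n' + b, i * n + j)
      = (\<Sum>y<n * n. kron ?p ?p $$ (a * n' + b, y) * Rmat n q $$ (y, i * n + j))"
      by (rule mult_index) (use * idx_bound in \<open>auto simp: Rmat_def\<close>)
    then show ?thesis unfolding sum_split by (rule sym)
  qed
  finally show "(Rmat n' q * kron ?p ?p) $$ (a * n' + b, i * n + j) = (kron ?p ?p * Rmat n q) $$ (a * n' + b, i * n + j)" .
qed (auto simp: Rmat_def)

text \<open>If the braidings of \<open>P\<close> with \<open>C\<close> and of \<open>Q\<close> with \<open>C\<close> are intertwined, the hexagon identity intertwines
  that of \<open>P \<otimes> Q\<close> with \<open>C\<close>.\<close>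
lemma hexagon_step1:
  fixes P Q C :: "'k::field mat"
  assumes e: "r1' * kron P C = kron C P * r1" "r2' * kron Q C = kron C Q * r2"
    and d: "dim_row r1' = dim_row C * dim_row P" "dim_col r1' = dim_row P * dim_row C"
      "dim_row r1 = dim_col C * dim_col P" "dim_col r1 = dim_col P * dim_col C"
      "dim_row r2' = dim_row C * dim_row Q" "dim_col r2' = dim_row Q * dim_row C"
      "dim_row r2 = dim_col C * dim_col Q" "dim_col r2 = dim_col Q * dim_col C"
  shows "(kron r1' (1\<^sub>m (dim_row Q)) * kron (1\<^sub>m (dim_row P)) r2') * kron (kron P Q) C
    = kron C (kron P Q) * (kron r1 (1\<^sub>m (dim_col Q)) * kron (1\<^sub>m (dim_col P)) r2)"
proof -
  have 1: "kron (1\<^sub>m (dim_row P)) r2' * kron (kron P Q) C = kron (kron P C) Q * kron (1\<^sub>m (dim_col P)) r2"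
    unfolding kron_assoc using d e(2) by (simp add: kron_mult mult_one)
  have 2: "kron r1' (1\<^sub>m (dim_row Q)) * kron (kron P C) Q = kron C (kron P Q) * kron r1 (1\<^sub>m (dim_col Q))"
    unfolding kron_assoc[of C P Q, symmetric] using d e(1) by (simp add: kron_mult mult_one)
  have "(kron r1' (1\<^sub>m (dim_row Q)) * kron (1\<^sub>m (dim_row P)) r2') * kron (kron P Q) C
    = kron r1' (1\<^sub>m (dim_row Q)) * (kron (kron P C) Q * kron (1\<^sub>m (dim_col P)) r2)"
    unfolding 1[symmetric] by (rule mat_assoc) (use d in simp_all)
  also have "\<dots> = (kron C (kron P Q) * kron r1 (1\<^sub>m (dim_col Q))) * kron (1\<^sub>m (dim_col P)) r2"
    unfolding 2[symmetric] by (rule mat_assoc[symmetric]) (use d in simp_all)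
  also have "\<dots> = kron C (kron P Q) * (kron r1 (1\<^sub>m (dim_col Q)) * kron (1\<^sub>m (dim_col P)) r2)"
    by (rule mat_assoc) (use d in simp_all)
  finally show ?thesis .
qed

lemma hexagon_step2:
  fixes P Q C :: "'k::field mat"
  assumes e: "r1' * kron C P = kron P C * r1" "r2' * kron C Q = kron Q C * r2"
    and d: "dim_row r1' = dim_row P * dim_row C" "dim_col r1' = dim_row C * dim_row P"
      "dim_row r1 = dim_col P * dim_col C" "dim_col r1 = dim_col C * dim_col P"
      "dim_row r2' = dim_row Q * dim_row C" "dim_col r2' = dim_row C * dim_row Q"
      "dim_row r2 = dim_col Q * dim_col C" "dim_col r2 = dim_col C * dim_col Q"
  shows "(kron (1\<^sub>m (dim_row P)) r2' * kron r1' (1\<^sub>m (dim_row Q))) * kron C (kron P Q)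
    = kron (kron P Q) C * (kron (1\<^sub>m (dim_col P)) r2 * kron r1 (1\<^sub>m (dim_col Q)))"
proof -
  have 1: "kron r1' (1\<^sub>m (dim_row Q)) * kron C (kron P Q) = kron P (kron C Q) * kron r1 (1\<^sub>m (dim_col Q))"
    unfolding kron_assoc[symmetric] using d e(1) by (simp add: kron_mult mult_one)
  have 2: "kron (1\<^sub>m (dim_row P)) r2' * kron P (kron C Q) = kron (kron P Q) C * kron (1\<^sub>m (dim_col P)) r2"
    unfolding kron_assoc using d e(2) by (simp add: kron_mult mult_one)
  have "(kron (1\<^sub>m (dim_row P)) r2' * kron r1' (1\<^sub>m (dim_row Q))) * kron C (kron P Q)
    = kron (1\<^sub>m (dim_row P)) r2' * (kron P (kron C Q) * kron r1 (1\<^sub>m (dim_col Q)))"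
    unfolding 1[symmetric] by (rule mat_assoc) (use d in simp_all)
  also have "\<dots> = (kron (kron P Q) C * kron (1\<^sub>m (dim_col P)) r2) * kron r1 (1\<^sub>m (dim_col Q))"
    unfolding 2[symmetric] by (rule mat_assoc[symmetric]) (use d in simp_all)
  also have "\<dots> = kron (kron P Q) C * (kron (1\<^sub>m (dim_col P)) r2 * kron r1 (1\<^sub>m (dim_col Q)))"
    by (rule mat_assoc) (use d in simp_all)
  finally show ?thesis .
qed

lemma invertible_idempotent:
  fixes R :: "'k::field mat"
  assumes "invertible_mat R" "R * R = R" shows "R = 1\<^sub>m (dim_row R)"
proof -
  obtain B where B: "R * B = 1\<^sub>m (dim_row R)" "B * R = 1\<^sub>m (dim_row B)" and sq: "dim_col R = dim_row R"
    using assms(1) by (auto simp: invertible_mat_def inverts_mat_def)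
  have dB: "dim_row B = dim_row R" using arg_cong[OF B(2), of dim_col] sq by simp
  have "(R * R) * B = R * (R * B)" by (rule mat_assoc) (simp_all add: sq dB)
  then show ?thesis unfolding assms(2) B(1) using sq by (simp add: mult_one)
qed

definition rbr :: "'k::field \<Rightarrow> nat \<Rightarrow> nat \<Rightarrow> nat \<Rightarrow> 'k mat" where
  "rbr q n a b = braiding n q (MM n q a 1) (MM n q b 1)"

lemma rbr_dims [simp]: "q \<noteq> 0 \<Longrightarrow> dim_row (rbr q n a b) = n ^ b * n ^ a" "q \<noteq> 0 \<Longrightarrow> dim_col (rbr q n a b) = n ^ a * n ^ b"
  by (simp_all add: rbr_def braiding_dims is_comodule_MM)

lemma rbr_add:
  assumes "q \<noteq> 0"
  shows "rbr q n (a + b) c = kron (rbr q n a c) (1\<^sub>m (n ^ b)) * kron (1\<^sub>m (n ^ a)) (rbr q n b c)"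
    "rbr q n c (a + b) = kron (1\<^sub>m (n ^ a)) (rbr q n c b) * kron (rbr q n c a) (1\<^sub>m (n ^ b))"
  unfolding rbr_def tens_MM[symmetric, of n q a b]
  using braiding_hexagon(1)[OF assms is_comodule_MM is_comodule_MM is_comodule_MM, of n a 1 b 1 c 1]
    braiding_hexagon(2)[OF assms is_comodule_MM is_comodule_MM is_comodule_MM, of n c 1 a 1 b 1]
  by simp_all

text \<open>With \<open>a = b = 0\<close> the hexagon identity says that the braiding with the trivial comodule is idempotent;
  being invertible, it is the identity.\<close>
lemma rbr_zero: assumes "q \<noteq> 0" shows "rbr q n 0 c = 1\<^sub>m (n ^ c)" "rbr q n c 0 = 1\<^sub>m (n ^ c)"
proof -
  have i: "invertible_mat (rbr q n a b)" for a b unfolding rbr_def by (rule braiding_dims[OF assms is_comodule_MM is_comodule_MM])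
  have "rbr q n 0 c = rbr q n 0 c * rbr q n 0 c" "rbr q n c 0 = rbr q n c 0 * rbr q n c 0"
    using rbr_add(1)[OF assms, where n = n and a = 0 and b = 0 and c = c]
      rbr_add(2)[OF assms, where n = n and a = 0 and b = 0 and c = c]
    by (simp_all only: add_0_left power_0 kron_unit)
  from this[symmetric, THEN invertible_idempotent[OF i]] show "rbr q n 0 c = 1\<^sub>m (n ^ c)" "rbr q n c 0 = 1\<^sub>m (n ^ c)"
    using assms by simp_all
qed

lemma rbr_one: "q \<noteq> 0 \<Longrightarrow> rbr q n 1 1 = Rmat n q"
  unfolding rbr_def std_MM[symmetric] by (rule braiding_std)

text \<open>The hexagon identities reduce the braiding of tensor powers to \<open>R\<^sub>n\<close>.\<close>
lemma relabel_rbr: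
  fixes q :: "'k::field" and n n' :: nat
  assumes q: "q \<noteq> 0" and G: "\<And>i j i' j'. G i j \<Longrightarrow> G i' j' \<Longrightarrow> i < i' \<longleftrightarrow> j < j'"
  defines "p \<equiv> rel n' n G"
  shows "rbr q n' a b * kron (kpow p a) (kpow p b) = kron (kpow p b) (kpow p a) * rbr q n a b"
proof -
  have [simp]: "dim_row p = n'" "dim_col p = n" by (simp_all add: p_def)
  have u: "kron (1\<^sub>m (Suc 0)) A = A" "kron A (1\<^sub>m (Suc 0)) = A" for A :: "'k mat" using kron_unit[of A] by simp_all
  have z: "rbr q n' 0 b * kron (kpow p 0) (kpow p b) = kron (kpow p b) (kpow p 0) * rbr q n 0 b"
    "rbr q n' b 0 * kron (kpow p b) (kpow p 0) = kron (kpow p 0) (kpow p b) * rbr q n b 0" for b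
    using q by (simp_all add: rbr_zero u mult_one)
  have one: "rbr q n' 1 b * kron (kpow p 1) (kpow p b) = kron (kpow p b) (kpow p 1) * rbr q n 1 b" for b
  proof (induction b)
    case 0 show ?case by (rule z)
  next
    case (Suc b)
    have o: "rbr q n' 1 1 * kron (kpow p 1) (kpow p 1) = kron (kpow p 1) (kpow p 1) * rbr q n 1 1"
      unfolding rbr_one[OF q] using relabel_Rmat[OF G, where n = n and n' = n' and q = q] by (simp add: p_def u)
    show ?case using hexagon_step2[OF o Suc] q unfolding plus_1_eq_Suc[symmetric] rbr_add[OF q] kpow_add
      by (simp add: u)
  qed
  show ?thesis
  proof (induction a)
    case 0 show ?case by (rule z)
  next
    case (Suc a)
    show ?case using hexagon_step1[OF one Suc] q unfolding plus_1_eq_Suc[symmetric] rbr_add[OF q] kpow_add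
      by (simp add: u)
  qed
qed

text \<open>The inclusion of one copy into a multiple.\<close>
definition incl :: "nat \<Rightarrow> nat \<Rightarrow> nat \<Rightarrow> 'k::field mat" where
  "incl m N \<alpha> = kron (rel m 1 (\<lambda>i _. i = \<alpha>)) (1\<^sub>m N)"

lemma incl_dims [simp]: "dim_row (incl m N \<alpha>) = m * N" "dim_col (incl m N \<alpha>) = N" by (simp_all add: incl_def)

lemma incl_index: assumes "y < m * N" "k < N" shows "incl m N \<alpha> $$ (y, k) = (if y = \<alpha> * N + k then 1 else 0)"
proof -
  from assms(1) obtain a b where y: "a < m" "b < N" "y = a * N + b" by (rule idx_split)
  have "incl m N \<alpha> $$ (a * N + b, 0 * N + k) = rel m 1 (\<lambda>i _. i = \<alpha>) $$ (a, 0) * 1\<^sub>m N $$ (b, k)"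
    unfolding incl_def by (rule kron_index) (use y assms in auto)
  then show ?thesis using y assms(2) idx_inj[OF y(2) assms(2), of a \<alpha>] by (auto simp: rel_index)
qed

text \<open>The tensor squares of the inclusions of two copies jointly span the tensor square of the multiple.\<close>
lemma cols_eqI:
  fixes X Y :: "'k::field mat"
  assumes d: "dim_col X = (m * N) * (m * N)" "dim_col Y = (m * N) * (m * N)" "dim_row X = dim_row Y"
    and e: "\<And>\<alpha> \<beta>. \<alpha> < m \<Longrightarrow> \<beta> < m \<Longrightarrow> X * kron (incl m N \<alpha>) (incl m N \<beta>) = Y * kron (incl m N \<alpha>) (incl m N \<beta>)"
  shows "X = Y"
proof (rule eq_matI)
  let ?M = "m * N"
  fix i x assume i: "i < dim_row Y" and "x < dim_col Y"
  then have "x < ?M * ?M" using d by simp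
  then obtain y z where yz: "y < ?M" "z < ?M" "x = y * ?M + z" by (rule idx_split)
  from yz(1) obtain \<alpha> k where y: "\<alpha> < m" "k < N" "y = \<alpha> * N + k" by (rule idx_split)
  from yz(2) obtain \<beta> l where z: "\<beta> < m" "l < N" "z = \<beta> * N + l" by (rule idx_split)
  have col: "(Z * kron (incl m N \<alpha>) (incl m N \<beta>)) $$ (i, k * N + l) = Z $$ (i, x)"
    if Z: "dim_col Z = ?M * ?M" "i < dim_row Z" for Z :: "'k mat"
  proof -
    have "(Z * kron (incl m N \<alpha>) (incl m N \<beta>)) $$ (i, k * N + l)
      = (\<Sum>w<?M * ?M. Z $$ (i, w) * kron (incl m N \<alpha>) (incl m N \<beta>) $$ (w, k * N + l))"
      by (rule mult_index) (use Z y z idx_bound in auto)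
    also have "\<dots> = (\<Sum>y'<?M. \<Sum>z'<?M. if z' = z then (if y' = y then Z $$ (i, x) else 0) else 0)"
      unfolding sum_split[of _ ?M ?M]
    proof (rule sum.cong[OF refl], rule sum.cong[OF refl])
      fix y' z' assume "y' \<in> {..<?M}" "z' \<in> {..<?M}"
      then have *: "y' < ?M" "z' < ?M" by auto
      have "kron (incl m N \<alpha>) (incl m N \<beta>) $$ (y' * ?M + z', k * N + l) = incl m N \<alpha> $$ (y', k) * (incl m N \<beta> $$ (z', l) :: 'k)"
        by (rule kron_index) (use * y z in simp_all)
      then show "Z $$ (i, y' * ?M + z') * kron (incl m N \<alpha>) (incl m N \<beta>) $$ (y' * ?M + z', k * N + l)
        = (if z' = z then (if y' = y then Z $$ (i, x) else 0) else 0)"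
        unfolding incl_index[OF *(1) y(2)] incl_index[OF *(2) z(2)] yz(3) y(3)[symmetric] z(3)[symmetric] by simp
    qed
    also have "\<dots> = Z $$ (i, x)" using yz by simp
    finally show ?thesis .
  qed
  show "X $$ (i, x) = Y $$ (i, x)" using col[of X] col[of Y] d i e[OF y(1) z(1)] by simp
qed (use d in auto)

text \<open>Naturality for the inclusions of the copies reduces the claim to one copy in each factor.\<close>
lemma relabel_Rmor:
  fixes q :: "'k::field"
  assumes q: "q \<noteq> 0" and G: "\<And>i j i' j'. G i j \<Longrightarrow> G i' j' \<Longrightarrow> i < i' \<longleftrightarrow> j < j'"
  shows "Rmor q (n, MM n q e m) (n', MM n' q e m) (kron (1\<^sub>m m) (kpow (rel n' n G) e))"
proof -
  define p where "p = (kpow (rel n' n G) e :: 'k mat)"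
  define P where "P = kron (1\<^sub>m m) p"
  have dp: "dim_row p = n' ^ e" "dim_col p = n ^ e" by (simp_all add: p_def)
  have dP: "dim_row P = m * n' ^ e" "dim_col P = m * n ^ e" by (simp_all add: P_def dp)
  let ?R = "\<lambda>n. braiding n q (MM n q e m) (MM n q e m)"
  have dR: "dim_row (?R n) = m * n ^ e * (m * n ^ e)" "dim_col (?R n) = m * n ^ e * (m * n ^ e)" for n
    using braiding_dims[OF q is_comodule_MM[of n q e m] is_comodule_MM[of n q e m]] by simp_all
  have i: "incl m (n ^ e) \<alpha> \<in> comodule_maps n q (MM n q e 1) (MM n q e m)" for \<alpha> n
    unfolding incl_def by (rule mult_comodule_map) (simp add: carrier_matI)
  have nat: "?R n * kron (incl m (n ^ e) \<alpha>) (incl m (n ^ e) \<beta>) = kron (incl m (n ^ e) \<beta>) (incl m (n ^ e) \<alpha>) * rbr q n e e" for n \<alpha> \<beta>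
    unfolding rbr_def by (rule braiding_natural[OF q is_comodule_MM is_comodule_MM is_comodule_MM is_comodule_MM i i])
  have Pi: "P * incl m (n ^ e) \<alpha> = incl m (n' ^ e) \<alpha> * p" for \<alpha>
  proof -
    have "P * incl m (n ^ e) \<alpha> = kron (rel m 1 (\<lambda>i _. i = \<alpha>)) p" unfolding P_def incl_def using dp by (simp add: kron_mult mult_one)
    also have "\<dots> = incl m (n' ^ e) \<alpha> * kron (1\<^sub>m 1) p" unfolding incl_def using dp by (simp add: kron_mult mult_one)
    finally show ?thesis unfolding kron_unit .
  qed
  have PP: "kron P P * kron (incl m (n ^ e) \<alpha>) (incl m (n ^ e) \<beta>) = kron (incl m (n' ^ e) \<alpha>) (incl m (n' ^ e) \<beta>) * kron p p" for \<alpha> \<beta>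
    using dP dp by (simp add: kron_mult Pi)
  have "kron P P * ?R n = ?R n' * kron P P"
  proof (rule cols_eqI[of _ m "n ^ e"])
    fix \<alpha> \<beta>
    let ?i = "kron (incl m (n ^ e) \<alpha>) (incl m (n ^ e) \<beta>) :: 'k mat" and ?i' = "kron (incl m (n' ^ e) \<alpha>) (incl m (n' ^ e) \<beta>) :: 'k mat"
    let ?j = "kron (incl m (n ^ e) \<beta>) (incl m (n ^ e) \<alpha>) :: 'k mat" and ?j' = "kron (incl m (n' ^ e) \<beta>) (incl m (n' ^ e) \<alpha>) :: 'k mat"
    have "(kron P P * ?R n) * ?i = kron P P * (?R n * ?i)" by (rule mat_assoc) (simp_all add: dP dR)
    also have "\<dots> = (kron P P * ?j) * rbr q n e e" unfolding nat by (rule mat_assoc[symmetric]) (simp_all add: dP q)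
    also have "\<dots> = ?j' * (kron p p * rbr q n e e)" unfolding PP by (rule mat_assoc) (simp_all add: dp q)
    also have "kron p p * rbr q n e e = rbr q n' e e * kron p p" unfolding p_def by (rule relabel_rbr[OF q G, symmetric])
    also have "?j' * (rbr q n' e e * kron p p) = (?j' * rbr q n' e e) * kron p p" by (rule mat_assoc[symmetric]) (simp_all add: dp q)
    also have "\<dots> = ?R n' * (?i' * kron p p)" unfolding nat[symmetric] by (rule mat_assoc) (simp_all add: dp dR)
    also have "\<dots> = (?R n' * kron P P) * ?i" unfolding PP[symmetric] by (rule mat_assoc[symmetric]) (simp_all add: dP dR)
    finally show "(kron P P * ?R n) * ?i = (?R n' * kron P P) * ?i" .
  qed (simp_all add: dP dR)
  then show ?thesis using dP unfolding Rmor_def RV_def vdim_def P_def p_def by (auto intro!: carrier_matI)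
qed

section \<open>Equivariant maps\<close>

lemma braid_hom_dims: "f \<in> braid_hom q d V W \<Longrightarrow> f \<in> carrier_mat (vdim W ^ d) (vdim V ^ d)"
  by (simp add: braid_hom_def)

lemma braid_hom_comm: "f \<in> braid_hom q d V W \<Longrightarrow> i + 1 < d \<Longrightarrow> f * Tact q d V i = Tact q d W i * f"
  by (simp add: braid_hom_def)

lemma braid_hom_comp:
  assumes q: "q \<noteq> 0" and hp: "hp q X" "hp q Y" "hp q Z" and f: "f \<in> braid_hom q d X Y" and g: "g \<in> braid_hom q d Y Z"
  shows "g * f \<in> braid_hom q d X Z"
  unfolding braid_hom_def
proof (intro CollectI conjI allI impI)
  note [intro] = braid_hom_dims[OF f] braid_hom_dims[OF g]
  show "g * f \<in> carrier_mat (vdim Z ^ d) (vdim X ^ d)" by (rule mult_carrier_mat) blast+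
  fix i assume i: "i + 1 < d"
  note T = Tact_carrier[OF q hp(1) i] Tact_carrier[OF q hp(2) i] Tact_carrier[OF q hp(3) i]
  have "g * f * Tact q d X i = g * (f * Tact q d X i)" by (rule assoc_mult_mat) (use T in blast)+
  also have "\<dots> = (g * Tact q d Y i) * f" unfolding braid_hom_comm[OF f i]
    by (rule assoc_mult_mat[symmetric]) (use T in blast)+
  also have "\<dots> = Tact q d Z i * (g * f)" unfolding braid_hom_comm[OF g i]
    by (rule assoc_mult_mat) (use T in blast)+
  finally show "g * f * Tact q d X i = Tact q d Z i * (g * f)" .
qed

lemma braid_hom_linear:
  assumes q: "q \<noteq> 0" and hp: "hp q X" "hp q Y" and f: "f \<in> braid_hom q d X Y" and g: "g \<in> braid_hom q d X Y"
  shows "f + g \<in> braid_hom q d X Y" "f - g \<in> braid_hom q d X Y" "a \<cdot>\<^sub>m f \<in> braid_hom q d X Y"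
proof -
  note fg = braid_hom_dims[OF f] braid_hom_dims[OF g]
  note T = Tact_carrier[OF q hp(1)] Tact_carrier[OF q hp(2)]
  note c = braid_hom_comm[OF f] braid_hom_comm[OF g]
  show "f + g \<in> braid_hom q d X Y" unfolding braid_hom_def
  proof (intro CollectI conjI allI impI)
    fix i assume i: "i + 1 < d"
    show "(f + g) * Tact q d X i = Tact q d Y i * (f + g)"
      unfolding add_mult_distrib_mat[OF fg T(1)[OF i]] mult_add_distrib_mat[OF T(2)[OF i] fg] c(1)[OF i] c(2)[OF i] ..
  qed (use fg in auto)
  show "f - g \<in> braid_hom q d X Y" unfolding braid_hom_def
  proof (intro CollectI conjI allI impI)
    fix i assume i: "i + 1 < d"
    show "(f - g) * Tact q d X i = Tact q d Y i * (f - g)"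
      unfolding minus_mult_distrib_mat[OF fg T(1)[OF i]] mult_minus_distrib_mat[OF T(2)[OF i] fg] c(1)[OF i] c(2)[OF i] ..
  qed (use fg in auto)
  show "a \<cdot>\<^sub>m f \<in> braid_hom q d X Y" unfolding braid_hom_def
  proof (intro CollectI conjI allI impI)
    fix i assume i: "i + 1 < d"
    show "(a \<cdot>\<^sub>m f) * Tact q d X i = Tact q d Y i * (a \<cdot>\<^sub>m f)"
      unfolding mult_smult_assoc_mat[OF fg(1) T(1)[OF i]] mult_smult_distrib[OF T(2)[OF i] fg(1)] c(1)[OF i] ..
  qed (use fg in auto)
qed

lemma braid_hom_zero: "q \<noteq> 0 \<Longrightarrow> hp q X \<Longrightarrow> hp q Y \<Longrightarrow> 0\<^sub>m (vdim Y ^ d) (vdim X ^ d) \<in> braid_hom q d X Y"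
  unfolding braid_hom_def using Tact_carrier[of q X _ d] Tact_carrier[of q Y _ d]
  by (auto intro!: trans[OF left_mult_zero_mat right_mult_zero_mat[symmetric]])

lemma braid_hom_one: "q \<noteq> 0 \<Longrightarrow> hp q X \<Longrightarrow> 1\<^sub>m (vdim X ^ d) \<in> braid_hom q d X X"
  unfolding braid_hom_def using Tact_carrier[of q X _ d]
  by (auto intro!: trans[OF left_mult_one_mat right_mult_one_mat[symmetric]])

section \<open>Finite sums of maps through one object\<close>

text \<open>A two-sided ideal of the category of equivariant maps, by the lemmas below.\<close>
inductive_set thru :: "'k::field \<Rightarrow> nat \<Rightarrow> 'k hpair \<Rightarrow> 'k hpair \<Rightarrow> 'k hpair \<Rightarrow> 'k mat set" for q d W X Y where
  zero: "0\<^sub>m (vdim Y ^ d) (vdim X ^ d) \<in> thru q d W X Y"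
| add: "x \<in> thru q d W X Y \<Longrightarrow> \<phi> \<in> braid_hom q d X W \<Longrightarrow> \<psi> \<in> braid_hom q d W Y \<Longrightarrow> x + \<psi> * \<phi> \<in> thru q d W X Y"

lemma thru_hom:
  assumes "q \<noteq> 0" "hp q W" "hp q X" "hp q Y" "x \<in> thru q d W X Y" shows "x \<in> braid_hom q d X Y"
  using assms(5)
proof induction
  case zero show ?case by (rule braid_hom_zero[OF assms(1,3,4)])
next
  case (add x \<phi> \<psi>)
  show ?case by (rule braid_hom_linear(1)[OF assms(1,3,4) add.IH braid_hom_comp[OF assms(1,3,2,4) add.hyps(2,3)]])
qed

lemma thru_add:
  assumes "q \<noteq> 0" "hp q W" "hp q X" "hp q Y" "x \<in> thru q d W X Y" "y \<in> thru q d W X Y"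
  shows "x + y \<in> thru q d W X Y"
  using assms(6)
proof induction
  case zero
  show ?case unfolding right_add_zero_mat[OF braid_hom_dims[OF thru_hom[OF assms(1-5)]]] by (rule assms(5))
next
  case (add y \<phi> \<psi>)
  have "x + (y + \<psi> * \<phi>) = (x + y) + \<psi> * \<phi>"
    by (rule assoc_add_mat[symmetric, OF braid_hom_dims[OF thru_hom[OF assms(1-5)]]
        braid_hom_dims[OF thru_hom[OF assms(1-4) add.hyps(1)]]
        braid_hom_dims[OF braid_hom_comp[OF assms(1,3,2,4) add.hyps(2,3)]]])
  then show ?case using thru.add[OF add.IH add.hyps(2,3)] by simp
qed

lemma thru_left:
  assumes "q \<noteq> 0" "hp q W" "hp q X" "hp q Y" "hp q Z" "x \<in> thru q d W X Y" "g \<in> braid_hom q d Y Z"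
  shows "g * x \<in> thru q d W X Z"
  using assms(6)
proof induction
  case zero
  show ?case unfolding right_mult_zero_mat[OF braid_hom_dims[OF assms(7)]] by (rule thru.zero)
next
  case (add y \<phi> \<psi>)
  note c = braid_hom_dims[OF assms(7)] braid_hom_dims[OF add.hyps(3)] braid_hom_dims[OF add.hyps(2)]
  have "g * (y + \<psi> * \<phi>) = g * y + (g * \<psi>) * \<phi>"
    unfolding assoc_mult_mat[OF c]
    by (rule mult_add_distrib_mat[OF c(1) braid_hom_dims[OF thru_hom[OF assms(1-4) add.hyps(1)]] mult_carrier_mat[OF c(2,3)]])
  then show ?case using thru.add[OF add.IH add.hyps(2) braid_hom_comp[OF assms(1,2,4,5) add.hyps(3) assms(7)]] by simp
qed

lemma thru_right:
  assumes "q \<noteq> 0" "hp q W" "hp q X" "hp q Y" "hp q Z" "x \<in> thru q d W X Y" "g \<in> braid_hom q d Z X"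
  shows "x * g \<in> thru q d W Z Y"
  using assms(6)
proof induction
  case zero
  show ?case unfolding left_mult_zero_mat[OF braid_hom_dims[OF assms(7)]] by (rule thru.zero)
next
  case (add y \<phi> \<psi>)
  note c = braid_hom_dims[OF add.hyps(3)] braid_hom_dims[OF add.hyps(2)] braid_hom_dims[OF assms(7)]
  have "(y + \<psi> * \<phi>) * g = y * g + \<psi> * (\<phi> * g)"
    unfolding assoc_mult_mat[OF c, symmetric]
    by (rule add_mult_distrib_mat[OF braid_hom_dims[OF thru_hom[OF assms(1-4) add.hyps(1)]] mult_carrier_mat[OF c(1,2)] c(3)])
  then show ?case using thru.add[OF add.IH braid_hom_comp[OF assms(1,5,3,2) assms(7) add.hyps(2)] add.hyps(3)] by simp
qed

abbreviation generated :: "'k::field \<Rightarrow> nat \<Rightarrow> 'k hpair \<Rightarrow> 'k hpair \<Rightarrow> bool" where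
  "generated q d W X \<equiv> 1\<^sub>m (vdim X ^ d) \<in> thru q d W X X"

lemma generated_Rmor:
  assumes q: "q \<noteq> 0" and hp: "hp q W" "hp q X" "hp q X'" and g: "generated q d W X'"
    and f: "Rmor q X X' f" and g': "Rmor q X' X g"
  shows "kpow (g * f) d \<in> thru q d W X X"
proof -
  note f' = Rmor_kpow[OF q hp(2,3) f, of d] and g'' = Rmor_kpow[OF q hp(3,2) g', of d]
  have "kpow g d * 1\<^sub>m (vdim X' ^ d) * kpow f d \<in> thru q d W X X"
    by (rule thru_right[OF q hp(1,3,2,2) thru_left[OF q hp(1,3,3,2) g g''] f'])
  moreover have "kpow g d * 1\<^sub>m (vdim X' ^ d) = kpow g d" by (rule right_mult_one_mat[OF braid_hom_dims[OF g'']])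
  moreover have "kpow g d * kpow f d = kpow (g * f) d" by (rule kpow_mult) (use f g' in \<open>auto simp: Rmor_def\<close>)
  ultimately show ?thesis by simp
qed

section \<open>Diagonal projections\<close>

text \<open>The projection onto the basis vectors that satisfy \<open>A\<close>.\<close>
definition Dg :: "nat \<Rightarrow> (nat \<Rightarrow> bool) \<Rightarrow> 'k::field mat" where
  "Dg M A = rel M M (\<lambda>i j. i = j \<and> A i)"

lemma Dg_dims [simp]: "dim_row (Dg M A) = M" "dim_col (Dg M A) = M" by (simp_all add: Dg_def)
lemma Dg_carrier: "Dg M A \<in> carrier_mat M M" by (simp add: carrier_matI)
lemma Dg_index: "i < M \<Longrightarrow> j < M \<Longrightarrow> Dg M A $$ (i, j) = (if i = j \<and> A i then 1 else 0)"
  by (simp add: Dg_def rel_index)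

lemma Dg_mult: "Dg M A * Dg M B = (Dg M (\<lambda>i. A i \<and> B i) :: 'k::field mat)"
proof -
  have "Dg M A * Dg M B = (rel M M (\<lambda>i k. \<exists>t<M. (i = t \<and> A i) \<and> (t = k \<and> B t)) :: 'k mat)"
    unfolding Dg_def by (rule rel_mult) auto
  also have "\<dots> = Dg M (\<lambda>i. A i \<and> B i)" by (rule eq_matI) (auto simp: Dg_index rel_index)
  finally show ?thesis .
qed

lemma Dg_split:
  "Dg M (\<lambda>i. A i \<and> B i) + Dg M (\<lambda>i. A i \<and> \<not> B i) = (Dg M A :: 'k::field mat)"
  "Dg M (\<lambda>i. A i \<and> B i) = (Dg M A - Dg M (\<lambda>i. A i \<and> \<not> B i) :: 'k::field mat)"
  by (rule eq_matI; auto simp: Dg_index)+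

lemma Dg_one: "Dg M (\<lambda>_. True) = 1\<^sub>m M" by (rule eq_matI) (auto simp: Dg_index)

lemma kron_Dg: "kron (Dg a A) (Dg b B) = (Dg (a * b) (\<lambda>i. A (i div b) \<and> B (i mod b)) :: 'k::field mat)"
proof (rule mat_eq_splitI[of _ a b _ a b])
  fix i j k l assume *: "i < a" "j < b" "k < a" "l < b"
  have "kron (Dg a A) (Dg b B) $$ (i * b + j, k * b + l) = Dg a A $$ (i, k) * (Dg b B $$ (j, l) :: 'k)"
    by (rule kron_index) (use * in auto)
  also have "\<dots> = Dg (a * b) (\<lambda>i. A (i div b) \<and> B (i mod b)) $$ (i * b + j, k * b + l)"
    unfolding Dg_index[OF idx_bound[OF *(1,2)] idx_bound[OF *(3,4)]] Dg_index[OF *(1,3)] Dg_index[OF *(2,4)]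
      idx_inj[OF *(2,4)] div_idx(1)[OF *(2)] div_idx(2)[OF *(2)] by auto
  finally show "kron (Dg a A) (Dg b B) $$ (i * b + j, k * b + l)
    = (Dg (a * b) (\<lambda>i. A (i div b) \<and> B (i mod b)) $$ (i * b + j, k * b + l) :: 'k)" .
qed auto

text \<open>\<open>f x\<close> projects onto the basis vectors in which \<open>x\<close> does not occur, where at most \<open>l\<close>
  different letters occur in a basis vector.\<close>
definition missing :: "nat \<Rightarrow> (nat \<Rightarrow> 'k::field mat) \<Rightarrow> bool" where
  "missing l f \<longleftrightarrow> (\<exists>M S. (\<forall>x. f x = Dg M (\<lambda>i. x \<notin> S i)) \<and> (\<forall>i. finite (S i) \<and> card (S i) \<le> l))"

lemma missing_one: "missing 0 (\<lambda>_. 1\<^sub>m N)"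
  unfolding missing_def by (intro exI[of _ N] exI[of _ "\<lambda>_. {}"]) (simp add: Dg_one)

lemma missing_base: "missing 1 (\<lambda>x. Dg n (\<lambda>i. i \<noteq> x))"
  unfolding missing_def by (intro exI[of _ n] exI[of _ "\<lambda>i. {i}"]) (auto intro!: arg_cong[of _ _ "Dg n"])

lemma missing_kron:
  assumes "missing l f" "missing l' g" shows "missing (l + l') (\<lambda>x. kron (f x) (g x))"
proof -
  obtain M S where f: "\<And>x. f x = Dg M (\<lambda>i. x \<notin> S i)" "\<And>i. finite (S i) \<and> card (S i) \<le> l"
    using assms(1) unfolding missing_def by blast
  obtain M' S' where g: "\<And>x. g x = Dg M' (\<lambda>i. x \<notin> S' i)" "\<And>i. finite (S' i) \<and> card (S' i) \<le> l'"
    using assms(2) unfolding missing_def by blast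
  have "finite (S i \<union> S' j) \<and> card (S i \<union> S' j) \<le> l + l'" for i j
    using f(2)[of i] g(2)[of j] card_Un_le[of "S i" "S' j"] by auto
  then show ?thesis unfolding missing_def f(1) g(1) kron_Dg
    by (intro exI[of _ "M * M'"] exI[of _ "\<lambda>i. S (i div M') \<union> S' (i mod M')"]) simp
qed

lemma missing_kpow: "missing l f \<Longrightarrow> missing (k * l) (\<lambda>x. kpow (f x) k)"
  by (induction k) (simp_all add: missing_one[of 1, simplified] missing_kron)

text \<open>The projections \<open>1 - D\<^sub>x\<close> onto the basis vectors in which \<open>x\<close> occurs have product \<open>0\<close> over more letters
  than a basis vector can contain. Expanding the product, \<open>1\<close> lies in the ideal generated by the \<open>D\<^sub>x\<close>.\<close>
lemma generated_missing:
  assumes q: "q \<noteq> 0" and hp: "hp q W" "hp q X"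
    and D: "missing l D" "l < m" "\<And>x. x < m \<Longrightarrow> D x \<in> thru q d W X X"
  shows "generated q d W X"
proof -
  define M where "M = vdim X ^ d"
  obtain M' S where M': "\<And>x. D x = Dg M' (\<lambda>i. x \<notin> S i)" and S: "\<And>i. finite (S i) \<and> card (S i) \<le> l"
    using D(1) unfolding missing_def by blast
  note hom = thru_hom[OF q hp(1,2,2)]
  have "M' = M" using braid_hom_dims[OF hom[OF D(3)[of 0]]] D(2) unfolding M' M_def by (auto simp: carrier_matD dest!: carrier_matD)
  then have DM: "D x = Dg M (\<lambda>i. x \<notin> S i)" for x using M' by simp
  \<comment> \<open>\<open>C k\<close> is the product of the projections \<open>1 - D x\<close> with \<open>x < k\<close>.\<close>
  define C :: "nat \<Rightarrow> 'a mat" where "C k = Dg M (\<lambda>i. {..<k} \<subseteq> S i)" for k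
  have C: "C k \<in> carrier_mat M M" for k unfolding C_def by (rule Dg_carrier)
  have "k \<le> m \<Longrightarrow> C k \<in> braid_hom q d X X \<and> (\<exists>t\<in>thru q d W X X. C k + t = 1\<^sub>m M)" for k
  proof (induction k)
    case 0
    have "C 0 = 1\<^sub>m M" by (simp add: C_def Dg_one)
    then show ?case using braid_hom_one[OF q hp(2), of d] unfolding M_def
      by (intro conjI bexI[OF _ thru.zero]) simp_all
  next
    case (Suc k)
    then obtain t where t: "C k \<in> braid_hom q d X X" "t \<in> thru q d W X X" "C k + t = 1\<^sub>m M" by auto
    define u where "u = C k * D k"
    have u: "u \<in> thru q d W X X" unfolding u_def
      by (rule thru_left[OF q hp(1,2,2,2) D(3) t(1)]) (use Suc.prems in simp)
    have ud: "u = Dg M (\<lambda>i. {..<k} \<subseteq> S i \<and> k \<notin> S i)" unfolding u_def C_def DM by (rule Dg_mult)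
    have uc: "u \<in> carrier_mat M M" unfolding ud by (rule Dg_carrier)
    have tc: "t \<in> carrier_mat M M" using braid_hom_dims[OF hom[OF t(2)]] by (simp add: M_def)
    have C': "{..<Suc k} \<subseteq> S i \<longleftrightarrow> {..<k} \<subseteq> S i \<and> k \<in> S i" for i
      unfolding lessThan_Suc insert_subset by (rule conj_commute)
    have e: "C (Suc k) + u = C k" "C (Suc k) = C k - u"
      unfolding C_def ud C' by (rule Dg_split)+
    have "C (Suc k) + (u + t) = (C (Suc k) + u) + t" by (rule assoc_add_mat[symmetric, OF C uc tc])
    then have "C (Suc k) + (u + t) = 1\<^sub>m M" unfolding e(1) t(3) .
    moreover have "C (Suc k) \<in> braid_hom q d X X" unfolding e(2) by (rule braid_hom_linear(2)[OF q hp(2,2) t(1) hom[OF u]])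
    ultimately show ?case using thru_add[OF q hp(1,2,2) u t(2)] by blast
  qed
  then obtain t where t: "t \<in> thru q d W X X" "C m + t = 1\<^sub>m M" by blast
  have "\<not> {..<m} \<subseteq> S i" for i using card_mono[of "S i" "{..<m}"] S[of i] D(2) by auto
  then have "C m = 0\<^sub>m M M" unfolding C_def by (intro eq_matI) (auto simp: Dg_index)
  moreover have "t \<in> carrier_mat M M" using braid_hom_dims[OF hom[OF t(1)]] by (simp add: M_def)
  ultimately have "t = 1\<^sub>m M" using t(2) by simp
  then show ?thesis using t(1) by (simp add: M_def)
qed

section \<open>A generator\<close>

definition skip :: "nat \<Rightarrow> nat \<Rightarrow> nat" where "skip x i = (if i < x then i else Suc i)"

lemma skip_mono: "skip x i < skip x j \<longleftrightarrow> i < j" by (auto simp: skip_def)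

text \<open>Removing the letter \<open>x\<close> and putting it back is the projection onto the vectors without \<open>x\<close>.\<close>
lemma rel_skip:
  assumes "x < n"
  shows "rel n (n - 1) (\<lambda>i j. i = skip x j) * rel (n - 1) n (\<lambda>i j. j = skip x i) = (Dg n (\<lambda>i. i \<noteq> x) :: 'k::field mat)"
proof -
  have "rel n (n - 1) (\<lambda>i j. i = skip x j) * rel (n - 1) n (\<lambda>i j. j = skip x i)
    = (rel n n (\<lambda>i k. \<exists>t<n - 1. i = skip x t \<and> k = skip x t) :: 'k mat)"
    by (rule rel_mult) (auto simp: skip_def split: if_splits)
  also have "\<dots> = Dg n (\<lambda>i. i \<noteq> x)"
  proof (rule eq_matI)
    fix i k assume "i < dim_row (Dg n (\<lambda>i. i \<noteq> x) :: 'k mat)" "k < dim_col (Dg n (\<lambda>i. i \<noteq> x) :: 'k mat)"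
    then have ik: "i < n" "k < n" by auto
    have "\<exists>t<n - 1. i = skip x t" if "i \<noteq> x"
      by (rule exI[of _ "if i < x then i else i - 1"]) (use that ik assms in \<open>auto simp: skip_def\<close>)
    moreover have "skip x t \<noteq> x" for t by (auto simp: skip_def)
    ultimately have "(\<exists>t<n - 1. i = skip x t \<and> k = skip x t) \<longleftrightarrow> i = k \<and> i \<noteq> x" by metis
    then show "rel n n (\<lambda>i k. \<exists>t<n - 1. i = skip x t \<and> k = skip x t) $$ (i, k) = (Dg n (\<lambda>i. i \<noteq> x) $$ (i, k) :: 'k)"
      by (simp only: rel_index[OF ik] Dg_index[OF ik])
  qed auto
  finally show ?thesis .
qed

lemma rel_incl: assumes "n \<le> n'" shows "rel n n' (=) * rel n' n (=) = (1\<^sub>m n :: 'k::field mat)"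
proof -
  have "rel n n' (=) * rel n' n (=) = (rel n n (\<lambda>i k. \<exists>t<n'. i = t \<and> t = k) :: 'k mat)" by (rule rel_mult) auto
  also have "\<dots> = 1\<^sub>m n" by (rule eq_matI) (use assms in \<open>auto simp: rel_index\<close>)
  finally show ?thesis .
qed

lemma mult_Rmor:
  assumes "q \<noteq> 0" shows "Rmor q (n, MM n q e m) (n, MM n q e m') (kron (rel m' m G) (1\<^sub>m (n ^ e)))"
  by (rule comodule_map_Rmor[OF assms is_comodule_MM is_comodule_MM mult_comodule_map]) (simp add: carrier_matI)

text \<open>A word of \<open>d\<close> blocks of length \<open>e\<close> contains at most \<open>d e\<close> letters and lies in at most \<open>d\<close> copies. The maximum
  matters for \<open>e = 0\<close>, as Hecke pairs require \<open>n \<ge> 1\<close>.\<close>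
definition gen_obj :: "'k::field \<Rightarrow> nat \<Rightarrow> nat \<Rightarrow> 'k hpair" where
  "gen_obj q d e = (max 1 (d * e), MM (max 1 (d * e)) q e d)"

lemma hp_MM: "hp q (n, MM n q e m)" by (simp add: is_comodule_MM)
lemma gen_obj_hecke: "gen_obj q d e \<in> hecke_pairs q e" unfolding gen_obj_def by (rule hecke_pair_MM) simp
lemma hp_gen_obj: "hp q (gen_obj q d e)" by (rule hecke_hp[OF gen_obj_hecke])

text \<open>Induction on \<open>n + m\<close>. If \<open>n\<close> or \<open>m\<close> exceeds that of the generator, every basis vector misses a letter or
  a copy, which can be removed; otherwise the comodule is a retract of the generator.\<close>
lemma generated_MM:
  fixes q :: "'k::field"
  assumes q: "q \<noteq> 0"
  shows "generated q d (gen_obj q d e) (n, MM n q e m)"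
proof (induction "n + m" arbitrary: n m rule: less_induct)
  case less
  let ?W = "gen_obj q d e" and ?X = "(n, MM n q e m)" and ?n0 = "max 1 (d * e)"
  consider "?n0 < n" | "d < m" | "n \<le> ?n0" "m \<le> d" by linarith
  then show ?case
  proof cases
    case 1
    have IH: "generated q d ?W (n - 1, MM (n - 1) q e m)" by (rule less) (use 1 in simp)
    define D :: "nat \<Rightarrow> 'k mat" where "D x = kpow (kron (1\<^sub>m m) (kpow (Dg n (\<lambda>i. i \<noteq> x)) e)) d" for x
    have "missing (d * (0 + e * 1)) D" unfolding D_def
      by (intro missing_kpow missing_kron missing_one missing_base)
    moreover have "d * (0 + e * 1) < n" using 1 by simp
    moreover have "D x \<in> thru q d ?W ?X ?X" if x: "x < n" for x
    proof -
      let ?I = "rel n (n - 1) (\<lambda>i j. i = skip x j) :: 'k mat" and ?S = "rel (n - 1) n (\<lambda>i j. j = skip x i) :: 'k mat"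
      have S: "Rmor q ?X (n - 1, MM (n - 1) q e m) (kron (1\<^sub>m m) (kpow ?S e))"
        by (rule relabel_Rmor[OF q]) (auto simp: skip_mono)
      have I: "Rmor q (n - 1, MM (n - 1) q e m) ?X (kron (1\<^sub>m m) (kpow ?I e))"
        by (rule relabel_Rmor[OF q]) (auto simp: skip_mono)
      have "kron (1\<^sub>m m) (kpow ?I e) * kron (1\<^sub>m m) (kpow ?S e) = kron (1\<^sub>m m) (kpow (Dg n (\<lambda>i. i \<noteq> x)) e)"
        by (simp add: kron_mult mult_one kpow_mult rel_skip[OF x, unfolded One_nat_def])
      then show ?thesis unfolding D_def using generated_Rmor[OF q hp_gen_obj hp_MM hp_MM IH S I] by simp
    qed
    ultimately show ?thesis by (rule generated_missing[OF q hp_gen_obj hp_MM])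
  next
    case 2
    have IH: "generated q d ?W (n, MM n q e (m - 1))" by (rule less) (use 2 in simp)
    define D :: "nat \<Rightarrow> 'k mat" where "D x = kpow (kron (Dg m (\<lambda>i. i \<noteq> x)) (1\<^sub>m (n ^ e))) d" for x
    have "missing (d * (1 + 0)) D" unfolding D_def
      by (intro missing_kpow missing_kron missing_one missing_base)
    moreover have "d * (1 + 0) < m" using 2 by simp
    moreover have "D x \<in> thru q d ?W ?X ?X" if x: "x < m" for x
    proof -
      let ?I = "rel m (m - 1) (\<lambda>i j. i = skip x j) :: 'k mat" and ?S = "rel (m - 1) m (\<lambda>i j. j = skip x i) :: 'k mat"
      have "kron ?I (1\<^sub>m (n ^ e)) * kron ?S (1\<^sub>m (n ^ e)) = kron (Dg m (\<lambda>i. i \<noteq> x)) (1\<^sub>m (n ^ e))"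
        by (simp add: kron_mult mult_one rel_skip[OF x, unfolded One_nat_def])
      then show ?thesis unfolding D_def using generated_Rmor[OF q hp_gen_obj hp_MM hp_MM IH
        mult_Rmor[OF q, of n e m "m - 1" "\<lambda>i j. j = skip x i"] mult_Rmor[OF q, of n e "m - 1" m "\<lambda>i j. i = skip x j"]]
        by simp
    qed
    ultimately show ?thesis by (rule generated_missing[OF q hp_gen_obj hp_MM])
  next
    case 3
    have "generated q d ?W ?W"
    proof -
      note o = braid_hom_one[OF q hp_gen_obj[where q = q and d = d and e = e], where d = d]
      show ?thesis using thru.add[OF thru.zero o o] by simp
    qed
    then have W: "generated q d ?W (?n0, MM ?n0 q e d)" unfolding gen_obj_def .
    have "kron (rel m d (=)) (1\<^sub>m (?n0 ^ e)) * kron (rel d m (=)) (1\<^sub>m (?n0 ^ e)) = (1\<^sub>m (m * ?n0 ^ e) :: 'k mat)"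
      by (simp add: kron_mult mult_one rel_incl[OF 3(2)] kron_one)
    then have "kpow (1\<^sub>m (m * ?n0 ^ e)) d \<in> thru q d ?W (?n0, MM ?n0 q e m) (?n0, MM ?n0 q e m)"
      using generated_Rmor[OF q hp_gen_obj hp_MM hp_MM W mult_Rmor[OF q, of ?n0 e m d "(=)"] mult_Rmor[OF q, of ?n0 e d m "(=)"]] by simp
    then have W': "generated q d ?W (?n0, MM ?n0 q e m)" unfolding kpow_one by (simp add: vdim_def)
    have S: "Rmor q ?X (?n0, MM ?n0 q e m) (kron (1\<^sub>m m) (kpow (rel ?n0 n (=)) e))"
      by (rule relabel_Rmor[OF q]) auto
    have I: "Rmor q (?n0, MM ?n0 q e m) ?X (kron (1\<^sub>m m) (kpow (rel n ?n0 (=)) e))"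
      by (rule relabel_Rmor[OF q]) auto
    have "kron (1\<^sub>m m) (kpow (rel n ?n0 (=)) e) * kron (1\<^sub>m m) (kpow (rel ?n0 n (=)) e) = (1\<^sub>m (m * n ^ e) :: 'k mat)"
      by (simp add: kron_mult mult_one kpow_mult rel_incl[OF 3(1), unfolded One_nat_def] kpow_one kron_one)
    then have "kpow (1\<^sub>m (m * n ^ e)) d \<in> thru q d ?W ?X ?X"
      using generated_Rmor[OF q hp_gen_obj hp_MM hp_MM W' S I] by simp
    then show ?thesis unfolding kpow_one by (simp add: vdim_def)
  qed
qed

theorem generated_hecke:
  fixes q :: "'k::field"
  assumes q: "q \<noteq> 0" "\<forall>m::nat. m > 0 \<longrightarrow> q ^ m \<noteq> 1" and V: "V \<in> hecke_pairs q e"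
  shows "generated q d (gen_obj q d e) V"
proof -
  obtain n c where V': "V = (n, c)" by (cases V)
  note hV = V[unfolded V']
  have c: "is_comodule n q c" using hecke_hp[OF hV] by simp
  obtain m \<iota> p where r: "\<iota> \<in> comodule_maps n q c (MM n q e m)" "p \<in> comodule_maps n q (MM n q e m) c"
    "p * \<iota> = 1\<^sub>m (dim_row c)" by (rule retract[OF q hV])
  have "kpow (p * \<iota>) d \<in> thru q d (gen_obj q d e) (n, c) (n, c)"
    by (rule generated_Rmor[OF q(1) hp_gen_obj _ hp_MM generated_MM[OF q(1)]
        comodule_map_Rmor[OF q(1) c is_comodule_MM r(1)] comodule_map_Rmor[OF q(1) is_comodule_MM c r(2)]]) (simp add: c)
  then show ?thesis unfolding r(3) kpow_one V' by (simp add: vdim_def)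
qed

section \<open>Fitting projections\<close>

text \<open>Gaussian elimination: a vector with a nonzero coordinate at \<open>i\<^sub>0\<close> clears this coordinate in the others.\<close>
lemma linear_dependence:
  fixes f :: "'j \<Rightarrow> 'i \<Rightarrow> 'k::field"
  assumes "finite I" "finite J" "card I < card J"
  obtains c j0 where "j0 \<in> J" "c j0 \<noteq> 0" "\<And>i. i \<in> I \<Longrightarrow> (\<Sum>j\<in>J. c j * f j i) = 0"
proof -
  have "\<exists>c. (\<exists>j\<in>J. c j \<noteq> 0) \<and> (\<forall>i\<in>I. (\<Sum>j\<in>J. c j * f j i) = 0)"
    using assms
  proof (induction I arbitrary: J f rule: finite_induct)
    case empty
    then obtain j where "j \<in> J" by (cases "J = {}") auto
    then show ?case by (intro exI[of _ "\<lambda>_. 1"]) auto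
  next
    case (insert i0 I)
    show ?case
    proof (cases "\<forall>j\<in>J. f j i0 = 0")
      case True
      have "card I < card J" using insert by simp
      from insert.IH[OF insert.prems(1) this, of f] obtain c where
        c: "\<exists>j\<in>J. c j \<noteq> 0" "\<forall>i\<in>I. (\<Sum>j\<in>J. c j * f j i) = 0" by blast
      then show ?thesis using True by (intro exI[of _ c]) auto
    next
      case False
      then obtain p where p: "p \<in> J" "f p i0 \<noteq> 0" by blast
      let ?J = "J - {p}"
      define g where "g j i = f j i - f j i0 / f p i0 * f p i" for j i
      have "card I < card ?J" using insert p by (simp add: card_Diff_singleton)
      from insert.IH[OF finite_Diff[OF insert.prems(1)] this, of g] obtain c where
        c: "\<exists>j\<in>?J. c j \<noteq> 0" "\<forall>i\<in>I. (\<Sum>j\<in>?J. c j * g j i) = 0" by blast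
      define s where "s = (\<Sum>j\<in>?J. c j * (f j i0 / f p i0))"
      define c' where "c' j = (if j = p then - s else c j)" for j
      have "(\<Sum>j\<in>J. c' j * f j i) = (\<Sum>j\<in>?J. c j * g j i)" for i
      proof -
        have "(\<Sum>j\<in>J. c' j * f j i) = c' p * f p i + (\<Sum>j\<in>?J. c' j * f j i)"
          by (rule sum.remove[OF insert.prems(1) p(1)])
        also have "(\<Sum>j\<in>?J. c' j * f j i) = (\<Sum>j\<in>?J. c j * f j i)" by (rule sum.cong) (auto simp: c'_def)
        also have "(\<Sum>j\<in>?J. c j * g j i) = (\<Sum>j\<in>?J. c j * f j i - c j * (f j i0 / f p i0) * f p i)"
          by (rule sum.cong) (simp_all add: g_def algebra_simps)
        then have "(\<Sum>j\<in>?J. c j * f j i) = (\<Sum>j\<in>?J. c j * g j i) + s * f p i"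
          unfolding s_def sum_distrib_right by (simp add: sum_subtractf)
        finally show ?thesis by (simp add: c'_def)
      qed
      moreover have "g j i0 = 0" for j using p by (simp add: g_def)
      moreover have "\<exists>j\<in>J. c' j \<noteq> 0" using c(1) by (auto simp: c'_def)
      ultimately show ?thesis using c(2) by (intro exI[of _ c']) auto
    qed
  qed
  then show ?thesis using that by blast
qed

lemma matrix_dependence:
  fixes A :: "nat \<Rightarrow> 'k::field mat"
  obtains c j0 where "j0 < Suc (N * N)" "c j0 \<noteq> 0"
    "\<And>x y. x < N \<Longrightarrow> y < N \<Longrightarrow> (\<Sum>j<Suc (N * N). c j * A j $$ (x, y)) = 0"
proof (rule linear_dependence[of "{..<N} \<times> {..<N}" "{..<Suc (N * N)}" "\<lambda>j p. A j $$ p"], goal_cases)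
  case (4 c j0)
  show ?case by (rule that[of j0 c]) (use 4 in auto)
qed simp_all

text \<open>The differences of successive members are orthogonal idempotents; if nonzero they would be linearly
  independent, and there are more of them than matrix entries.\<close>
lemma no_idempotent_chain:
  fixes M :: "nat \<Rightarrow> 'k::field mat"
  assumes M: "\<And>i. M i \<in> carrier_mat N N" and idem: "\<And>i j. i \<le> j \<Longrightarrow> M i * M j = M j \<and> M j * M i = M j"
  obtains i where "M i = M (Suc i)"
proof (rule ccontr)
  assume "\<not> thesis"
  then have ne: "M i \<noteq> M (Suc i)" for i using that by blast
  define D where "D i = M i - M (Suc i)" for i
  have D: "D i \<in> carrier_mat N N" for i unfolding D_def by (rule minus_carrier_mat) (rule M)
  have Dxy: "D i $$ (x, y) = M i $$ (x, y) - M (Suc i) $$ (x, y)" if "x < N" "y < N" for i x y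
    unfolding D_def using that M[of "Suc i"] by (intro index_minus_mat) auto
  have zero: "X - X = 0\<^sub>m N N" if "X \<in> carrier_mat N N" for X :: "'k mat" using that by (intro eq_matI) auto
  have e: "D i * D j = (M i * M j - M i * M (Suc j)) - (M (Suc i) * M j - M (Suc i) * M (Suc j))" for i j
    unfolding D_def minus_mult_distrib_mat[OF M M minus_carrier_mat[OF M]] mult_minus_distrib_mat[OF M M M] ..
  have orth: "D i * D j = 0\<^sub>m N N" if "i \<noteq> j" for i j
  proof (cases "i < j")
    case True
    have "D i * D j = D j - D j" using e[of i j] True by (simp add: idem D_def[of j])
    then show ?thesis using zero[OF D] by simp
  next
    case False
    have "D i * D j = (M i - M i) - (M (Suc i) - M (Suc i))" using e[of i j] False that by (simp add: idem)
    then show ?thesis using zero[OF M] zero[of "0\<^sub>m N N"] by simp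
  qed
  have self: "D j * D j = D j" for j
  proof -
    have "D j * D j = D j - (M (Suc j) - M (Suc j))" using e[of j j] by (simp add: idem D_def[of j])
    then show ?thesis unfolding zero[OF M] using D[of j] by (intro eq_matI) auto
  qed
  obtain c p where c: "p < Suc (N * N)" "c p \<noteq> 0"
    "\<And>x y. x < N \<Longrightarrow> y < N \<Longrightarrow> (\<Sum>j<Suc (N * N). c j * D j $$ (x, y)) = 0"
  proof (rule matrix_dependence[of N D], goal_cases)
    case (1 c p)
    show ?case by (rule 1(1)[OF 1(2-4)])
  qed
  have "D p $$ (x, y) = 0" if xy: "x < N" "y < N" for x y
  proof -
    have "(D i * D p) $$ (x, y) = (\<Sum>z<N. D i $$ (x, z) * D p $$ (z, y))" for i
      by (rule mult_index) (use D[of i] D[of p] xy in auto)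
    then have "(\<Sum>j<Suc (N * N). c j * (D j * D p) $$ (x, y)) = (\<Sum>j<Suc (N * N). \<Sum>z<N. c j * D j $$ (x, z) * D p $$ (z, y))"
      by (simp only: sum_distrib_left mult.assoc)
    also have "\<dots> = (\<Sum>z<N. (\<Sum>j<Suc (N * N). c j * D j $$ (x, z)) * D p $$ (z, y))"
      unfolding sum_distrib_right by (rule sum.swap)
    also have "\<dots> = 0" by (rule sum.neutral) (use c(3)[OF xy(1)] in auto)
    finally have "(\<Sum>j<Suc (N * N). c j * (D j * D p) $$ (x, y)) = 0" .
    moreover have "(\<Sum>j<Suc (N * N). c j * (D j * D p) $$ (x, y)) = (\<Sum>j<Suc (N * N). if j = p then c p * D p $$ (x, y) else 0)"
      by (rule sum.cong[OF refl]) (use xy in \<open>auto simp: orth self\<close>)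
    ultimately show ?thesis using c(1,2) by (simp del: sum.lessThan_Suc)
  qed
  then have "M p = M (Suc p)" using M[of p] M[of "Suc p"] Dxy by (intro eq_matI) auto
  then show False using ne by blast
qed

lemma (in monoid) commuting_idempotents:
  assumes u: "\<And>j. u j \<in> carrier G" "\<And>j. u j \<otimes> u j = u j" "\<And>i j. u i \<otimes> u j = u j \<otimes> u i"
    and E: "E 0 = \<one>" "\<And>k. E (Suc k) = E k \<otimes> u k"
  shows "E k \<in> carrier G" "i \<le> j \<Longrightarrow> E i \<otimes> E j = E j \<and> E j \<otimes> E i = E j"
proof -
  have c: "E k \<in> carrier G" for k by (induction k) (simp_all add: E u)
  have uE: "u j \<otimes> E k = E k \<otimes> u j" for j k
  proof (induction k)
    case (Suc k)
    have "u j \<otimes> (E k \<otimes> u k) = E k \<otimes> (u j \<otimes> u k)" using Suc u(1) c by (metis m_assoc)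
    then show ?case using u(1,3) c by (simp add: E m_assoc)
  qed (simp add: E u)
  have "E k \<otimes> E k = E k" for k
  proof (induction k)
    case (Suc k)
    have "(E k \<otimes> u k) \<otimes> (E k \<otimes> u k) = (E k \<otimes> E k) \<otimes> (u k \<otimes> u k)"
      using uE[of k k] u(1) c by (simp add: m_assoc) (metis m_assoc)
    then show ?case by (simp add: E Suc u)
  qed (simp add: E)
  then have *: "E i \<otimes> E (i + l) = E (i + l) \<and> E (i + l) \<otimes> E i = E (i + l)" for i l
  proof (induction l)
    case (Suc l)
    have "E (i + l) \<otimes> u (i + l) \<otimes> E i = E (i + l) \<otimes> E i \<otimes> u (i + l)" using uE u(1) c by (simp add: m_assoc)
    then show ?case using Suc u(1) c by (simp add: E m_assoc[symmetric])
  qed simp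
  show "E k \<in> carrier G" by (rule c)
  show "E i \<otimes> E j = E j \<and> E j \<otimes> E i = E j" if "i \<le> j" using *[of i "j - i"] that by simp
qed

text \<open>The element is \<open>u = a\<^sup>r c\<^sup>r\<close>, which equals \<open>a\<^sup>s c\<^sup>s\<close> for all \<open>s \<ge> r\<close>.\<close>
lemma (in monoid) fitting_element:
  assumes a: "a \<in> carrier G" and c: "c \<in> carrier G" and com: "a \<otimes> c = c \<otimes> a" and r: "a [^] Suc r \<otimes> c = a [^] r"
  obtains u where "u \<in> carrier G"
    "\<And>s. r \<le> s \<Longrightarrow> a [^] s \<otimes> u = a [^] s \<and> u \<otimes> a [^] s = a [^] s \<and>
      (\<exists>v\<in>carrier G. u = a [^] s \<otimes> v \<and> u = v \<otimes> a [^] s)"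
proof -
  have com1: "a [^] i \<otimes> c = c \<otimes> a [^] i" for i :: nat
    by (induction i) (use a c com in \<open>simp_all add: m_assoc\<close>, simp add: m_assoc[symmetric])
  have com2: "a [^] i \<otimes> c [^] j = c [^] j \<otimes> a [^] i" for i j :: nat
  proof (induction j)
    case (Suc j)
    have "a [^] i \<otimes> (c [^] j \<otimes> c) = c [^] j \<otimes> (a [^] i \<otimes> c)" using Suc a c by (metis m_assoc nat_pow_closed)
    then show ?case using a c com1 by (simp add: m_assoc)
  qed (use a in simp)
  have step: "a [^] Suc s \<otimes> c = a [^] s" if "r \<le> s" for s
  proof -
    have "a [^] (s - r) \<otimes> a [^] Suc r = a [^] Suc s" "a [^] (s - r) \<otimes> a [^] r = a [^] s"
      using that a nat_pow_mult[OF a, of "s - r" "Suc r"] nat_pow_mult[OF a, of "s - r" r] by simp_all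
    then show ?thesis using r a c by (metis m_assoc nat_pow_closed)
  qed
  have steps: "a [^] (s + k) \<otimes> c [^] k = a [^] s" if "r \<le> s" for s k
  proof (induction k)
    case (Suc k)
    have "a [^] Suc (s + k) \<otimes> (c [^] k \<otimes> c) = a [^] Suc (s + k) \<otimes> (c \<otimes> c [^] k)"
      using c nat_pow_comm[OF c, of k 1] by simp
    also have "\<dots> = (a [^] Suc (s + k) \<otimes> c) \<otimes> c [^] k" using a c by (simp only: m_assoc nat_pow_closed)
    also have "\<dots> = a [^] s" using step[of "s + k"] that Suc by simp
    finally show ?case by simp
  qed (use a in simp)
  define u where "u = a [^] r \<otimes> c [^] r"
  have us: "u = a [^] s \<otimes> c [^] s" if "r \<le> s" for s
  proof -
    have "c [^] s = c [^] (s - r) \<otimes> c [^] r" using nat_pow_mult[OF c, of "s - r" r] that by simp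
    then have "a [^] s \<otimes> c [^] s = (a [^] (r + (s - r)) \<otimes> c [^] (s - r)) \<otimes> c [^] r"
      using that a c by (simp only: m_assoc nat_pow_closed le_add_diff_inverse)
    then show ?thesis using steps[of r "s - r"] by (simp add: u_def)
  qed
  have uc: "u \<in> carrier G" using a c by (simp add: u_def)
  have 1: "a [^] s \<otimes> u = a [^] s" if "r \<le> s" for s
  proof -
    have "a [^] s \<otimes> u = (a [^] s \<otimes> a [^] s) \<otimes> c [^] s" unfolding us[OF that] using a c by (simp only: m_assoc nat_pow_closed)
    then show ?thesis using steps[OF that, of s] nat_pow_mult[OF a, of s s] by simp
  qed
  have 2: "u \<otimes> a [^] s = a [^] s \<otimes> u" for s :: nat
  proof -
    have "u \<otimes> a [^] s = a [^] r \<otimes> (c [^] r \<otimes> a [^] s)" unfolding u_def using a c by (simp only: m_assoc nat_pow_closed)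
    also have "\<dots> = (a [^] r \<otimes> a [^] s) \<otimes> c [^] r" unfolding com2[symmetric] using a c by (simp only: m_assoc nat_pow_closed)
    also have "\<dots> = a [^] s \<otimes> u" unfolding nat_pow_comm[OF a, of r s] u_def using a c by (simp only: m_assoc nat_pow_closed)
    finally show ?thesis .
  qed
  show ?thesis
  proof (rule that[OF uc])
    fix s assume s: "r \<le> s"
    have "u = c [^] s \<otimes> a [^] s" unfolding us[OF s] by (rule com2)
    then show "a [^] s \<otimes> u = a [^] s \<and> u \<otimes> a [^] s = a [^] s \<and>
      (\<exists>v\<in>carrier G. u = a [^] s \<otimes> v \<and> u = v \<otimes> a [^] s)"
      using 1[OF s] 2[of s] us[OF s] nat_pow_closed[OF c, of s] by (intro conjI bexI[of _ "c [^] s"]) simp_all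
  qed
qed

text \<open>The projection onto the part on which \<open>A\<close> is invertible, along the part on which it is
  nilpotent.\<close>
definition fit :: "nat \<Rightarrow> 'k::field mat \<Rightarrow> 'k mat \<Rightarrow> bool" where
  "fit N A u \<longleftrightarrow> u \<in> carrier_mat N N \<and> (\<exists>r. \<forall>s\<ge>r. A ^\<^sub>m s * u = A ^\<^sub>m s \<and> u * A ^\<^sub>m s = A ^\<^sub>m s \<and>
      (\<exists>v\<in>carrier_mat N N. u = A ^\<^sub>m s * v \<and> u = v * A ^\<^sub>m s))"

text \<open>With the same large exponent \<open>s\<close> on both sides, \<open>u\<close> factors through \<open>A\<^sup>s\<close> and \<open>w\<close> fixes the image of
  \<open>B\<^sup>s\<close>; hence both \<open>f u\<close> and \<open>w f\<close> equal \<open>w f u\<close>.\<close>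
lemma fit_natural:
  fixes A B f :: "'k::field mat"
  assumes A: "A \<in> carrier_mat N N" "fit N A u" and B: "B \<in> carrier_mat M M" "fit M B w"
    and f: "f \<in> carrier_mat M N" "f * A = B * f"
  shows "f * u = w * f"
proof -
  have pow: "f * A ^\<^sub>m s = B ^\<^sub>m s * f" for s
  proof (induction s)
    case 0 show ?case using f(1) A(1) B(1) by simp
  next
    case (Suc s)
    note c = pow_carrier_mat[OF A(1), of s] pow_carrier_mat[OF B(1), of s]
    have "f * (A ^\<^sub>m s * A) = f * A ^\<^sub>m s * A" by (rule assoc_mult_mat[symmetric, OF f(1) c(1) A(1)])
    also have "\<dots> = B ^\<^sub>m s * (f * A)" unfolding Suc by (rule assoc_mult_mat[OF c(2) f(1) A(1)])
    also have "\<dots> = B ^\<^sub>m s * B * f" unfolding f(2) by (rule assoc_mult_mat[symmetric, OF c(2) B(1) f(1)])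
    finally show ?case by simp
  qed
  from A(2) obtain r where r: "\<And>s. s \<ge> r \<Longrightarrow> A ^\<^sub>m s * u = A ^\<^sub>m s \<and> (\<exists>v\<in>carrier_mat N N. u = A ^\<^sub>m s * v)"
    and u: "u \<in> carrier_mat N N" unfolding fit_def by blast
  from B(2) obtain r' where r': "\<And>s. s \<ge> r' \<Longrightarrow> w * B ^\<^sub>m s = B ^\<^sub>m s \<and> (\<exists>v\<in>carrier_mat M M. w = v * B ^\<^sub>m s)"
    and w: "w \<in> carrier_mat M M" unfolding fit_def by blast
  define s where "s = max r r'"
  obtain v where v: "v \<in> carrier_mat N N" "u = A ^\<^sub>m s * v" and Au: "A ^\<^sub>m s * u = A ^\<^sub>m s" using r[of s] by (auto simp: s_def)
  obtain v' where v': "v' \<in> carrier_mat M M" "w = v' * B ^\<^sub>m s" and wB: "w * B ^\<^sub>m s = B ^\<^sub>m s" using r'[of s] by (auto simp: s_def)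
  note As = pow_carrier_mat[OF A(1), of s] and Bs = pow_carrier_mat[OF B(1), of s]
  have fu: "f * u = B ^\<^sub>m s * (f * v)" unfolding v(2) assoc_mult_mat[symmetric, OF f(1) As v(1)] pow by (rule assoc_mult_mat[OF Bs f(1) v(1)])
  have "w * (f * u) = (w * B ^\<^sub>m s) * (f * v)" unfolding fu by (rule assoc_mult_mat[symmetric, OF w Bs mult_carrier_mat[OF f(1) v(1)]])
  then have 1: "w * (f * u) = f * u" unfolding wB fu .
  have wf: "w * f = v' * f * A ^\<^sub>m s" unfolding v'(2) assoc_mult_mat[OF v'(1) Bs f(1)] pow[symmetric]
    by (rule assoc_mult_mat[symmetric, OF v'(1) f(1) As])
  have "w * f * u = v' * f * (A ^\<^sub>m s * u)" unfolding wf by (rule assoc_mult_mat[OF mult_carrier_mat[OF v'(1) f(1)] As u])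
  then have "w * f * u = w * f" unfolding Au wf .
  then show ?thesis using 1 assoc_mult_mat[OF w f(1) u] by simp
qed

lemma fit_idem: assumes "A \<in> carrier_mat N N" "fit N A u" shows "u * u = u"
proof -
  obtain s v where "u * A ^\<^sub>m s = A ^\<^sub>m s" "v \<in> carrier_mat N N" "u = A ^\<^sub>m s * v" "u \<in> carrier_mat N N"
    using assms(2) unfolding fit_def by blast
  then have "u * (A ^\<^sub>m s * v) = A ^\<^sub>m s * v"
    using assoc_mult_mat[of u N N "A ^\<^sub>m s" N v N] pow_carrier_mat[OF assms(1), of s] by simp
  then show ?thesis unfolding \<open>u = A ^\<^sub>m s * v\<close>[symmetric] .
qed

text \<open>Linear combinations of matrices, entry by entry.\<close>
definition lc :: "nat \<Rightarrow> 'j set \<Rightarrow> ('j \<Rightarrow> 'k::field) \<Rightarrow> ('j \<Rightarrow> 'k mat) \<Rightarrow> 'k mat" where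
  "lc N J w B = mat N N (\<lambda>p. \<Sum>j\<in>J. w j * B j $$ p)"

lemma lc_mult:
  fixes A :: "'k::field mat"
  assumes A: "A \<in> carrier_mat N N" and B: "\<And>j. B j \<in> carrier_mat N N"
  shows "A * lc N J w B = lc N J w (\<lambda>j. A * B j)" "lc N J w B * A = lc N J w (\<lambda>j. B j * A)"
proof -
  have AB: "(A * B j) $$ (x, y) = (\<Sum>z<N. A $$ (x, z) * B j $$ (z, y))" "(B j * A) $$ (x, y) = (\<Sum>z<N. B j $$ (x, z) * A $$ (z, y))"
    if "x < N" "y < N" for j x y
    by (rule mult_index; use A B[of j] that in auto)+
  show "A * lc N J w B = lc N J w (\<lambda>j. A * B j)"
  proof (rule eq_matI)
    fix x y assume "x < dim_row (lc N J w (\<lambda>j. A * B j))" "y < dim_col (lc N J w (\<lambda>j. A * B j))"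
    then have xy: "x < N" "y < N" by (auto simp: lc_def)
    have "(A * lc N J w B) $$ (x, y) = (\<Sum>z<N. A $$ (x, z) * (\<Sum>j\<in>J. w j * B j $$ (z, y)))"
      using mult_index[of x A y "lc N J w B" N] A xy by (auto simp: lc_def)
    also have "\<dots> = (\<Sum>j\<in>J. \<Sum>z<N. w j * (A $$ (x, z) * B j $$ (z, y)))"
      unfolding sum_distrib_left by (subst sum.swap) (simp only: mult.left_commute)
    finally show "(A * lc N J w B) $$ (x, y) = lc N J w (\<lambda>j. A * B j) $$ (x, y)"
      using xy by (simp add: lc_def AB sum_distrib_left)
  qed (use A in \<open>auto simp: lc_def\<close>)
  show "lc N J w B * A = lc N J w (\<lambda>j. B j * A)"
  proof (rule eq_matI)
    fix x y assume "x < dim_row (lc N J w (\<lambda>j. B j * A))" "y < dim_col (lc N J w (\<lambda>j. B j * A))"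
    then have xy: "x < N" "y < N" by (auto simp: lc_def)
    have "(lc N J w B * A) $$ (x, y) = (\<Sum>z<N. (\<Sum>j\<in>J. w j * B j $$ (x, z)) * A $$ (z, y))"
      using mult_index[of x "lc N J w B" y A N] A xy by (auto simp: lc_def)
    also have "\<dots> = (\<Sum>j\<in>J. \<Sum>z<N. w j * (B j $$ (x, z) * A $$ (z, y)))"
      unfolding sum_distrib_right by (subst sum.swap) (simp only: mult.assoc)
    finally show "(lc N J w B * A) $$ (x, y) = lc N J w (\<lambda>j. B j * A) $$ (x, y)"
      using xy by (simp add: lc_def AB sum_distrib_left)
  qed (use A in \<open>auto simp: lc_def\<close>)
qed

lemma sum_at: fixes h :: "nat \<Rightarrow> 'k::field" assumes "r < K"
  shows "(\<Sum>j<K. h j) = (\<Sum>j<r. h j) + (h r + (\<Sum>j\<in>{Suc r..<K}. h j))"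
  using sum.atLeastLessThan_concat[of 0 r K h] sum.atLeast_Suc_lessThan[OF assms, of h] assms
  by (simp add: lessThan_atLeast0)

text \<open>The powers of \<open>A\<close> are linearly dependent. If \<open>A\<^sup>r\<close> is the lowest one in a relation, solving for it gives
  \<open>A\<^sup>r = A\<^bsup>r+1\<^esup> C\<close> with a polynomial \<open>C\<close> in \<open>A\<close>.\<close>
lemma fit_exists:
  fixes A :: "'k::field mat"
  assumes A: "A \<in> carrier_mat N N"
  obtains u where "fit N A u"
proof -
  interpret R: ring "ring_mat TYPE('k) N ()" by (rule ring_mat)
  let ?R = "ring_mat TYPE('k) N ()" and ?K = "Suc (N * N)"
  note R = ring_mat_simps
  note Ac = pow_carrier_mat[OF A]
  have pw: "A [^]\<^bsub>?R\<^esub> s = A ^\<^sub>m s" for s :: nat by (rule pow_mat_ring_pow[OF A, symmetric])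
  have aR: "A \<in> carrier ?R" using A by (simp add: R)
  have padd: "A ^\<^sub>m i * A ^\<^sub>m j = A ^\<^sub>m (i + j)" for i j using R.nat_pow_mult[OF aR, of i j] by (simp add: pw R)
  have A1: "A ^\<^sub>m 1 = A" using A by simp
  obtain c p where c: "p < ?K" "c p \<noteq> 0" "\<And>x y. x < N \<Longrightarrow> y < N \<Longrightarrow> (\<Sum>j<?K. c j * (A ^\<^sub>m j) $$ (x, y)) = 0"
  proof (rule matrix_dependence[of N "\<lambda>j. A ^\<^sub>m j"], goal_cases)
    case (1 c p)
    show ?case by (rule 1(1)[OF 1(2-4)])
  qed
  define r where "r = (LEAST j. c j \<noteq> 0)"
  have r: "c r \<noteq> 0" "\<And>j. j < r \<Longrightarrow> c j = 0" unfolding r_def using LeastI[of "\<lambda>j. c j \<noteq> 0", OF c(2)] not_less_Least by blast+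
  have rK: "r < ?K" using Least_le[of "\<lambda>j. c j \<noteq> 0", OF c(2)] c(1) by (simp add: r_def)
  define w where "w j = - c j / c r" for j
  let ?J = "{Suc r..<?K}"
  \<comment> \<open>Solving the relation for its lowest term \<open>c r A\<^sup>r\<close> and dividing the rest by \<open>A\<^bsup>r+1\<^esup>\<close>.\<close>
  define C where "C = lc N ?J w (\<lambda>j. A ^\<^sub>m (j - Suc r))"
  have Cc: "C \<in> carrier_mat N N" by (simp add: C_def lc_def)
  have pA: "A * A ^\<^sub>m i = A ^\<^sub>m i * A" for i
    by (rule trans[OF padd[of 1 i, unfolded A1] padd[of i 1, unfolded A1 add.commute[of i 1], symmetric]])
  have "A * C = C * A" unfolding C_def lc_mult[OF A Ac] pA ..
  moreover have "A ^\<^sub>m Suc r * C = A ^\<^sub>m r"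
  proof (rule eq_matI)
    fix x y assume "x < dim_row (A ^\<^sub>m r)" "y < dim_col (A ^\<^sub>m r)"
    then have xy: "x < N" "y < N" using Ac[of r] by auto
    have "(A ^\<^sub>m Suc r * C) $$ (x, y) = (\<Sum>j\<in>?J. w j * (A ^\<^sub>m (Suc r + (j - Suc r))) $$ (x, y))"
      unfolding C_def lc_mult(1)[OF Ac Ac] padd unfolding lc_def using xy by simp
    also have "\<dots> = (\<Sum>j\<in>?J. w j * (A ^\<^sub>m j) $$ (x, y))" by (rule sum.cong) auto
    also have "c r * \<dots> = - (\<Sum>j\<in>?J. c j * (A ^\<^sub>m j) $$ (x, y))"
      unfolding sum_distrib_left sum_negf[symmetric] using r(1) by (intro sum.cong) (auto simp: w_def)
    also have "(\<Sum>j\<in>?J. c j * (A ^\<^sub>m j) $$ (x, y)) = - (c r * (A ^\<^sub>m r) $$ (x, y))"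
    proof -
      note sum_at[OF rK, of "\<lambda>j. c j * (A ^\<^sub>m j) $$ (x, y)"]
      moreover have "(\<Sum>j<r. c j * (A ^\<^sub>m j) $$ (x, y)) = 0" by (rule sum.neutral) (use r(2) in auto)
      ultimately show ?thesis using c(3)[OF xy] by (simp only: eq_neg_iff_add_eq_0 add_0_left add.commute)
    qed
    finally show "(A ^\<^sub>m Suc r * C) $$ (x, y) = (A ^\<^sub>m r) $$ (x, y)" using r(1) by simp
  qed (use Ac[of "Suc r"] Ac[of r] Cc in auto)
  ultimately have "A \<in> carrier ?R" "C \<in> carrier ?R" "A \<otimes>\<^bsub>?R\<^esub> C = C \<otimes>\<^bsub>?R\<^esub> A"
      "A [^]\<^bsub>?R\<^esub> Suc r \<otimes>\<^bsub>?R\<^esub> C = A [^]\<^bsub>?R\<^esub> r"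
    using A Cc unfolding pw R by auto
  then show ?thesis
  proof (rule R.fitting_element, goal_cases)
    case (1 u)
    have "fit N A u" unfolding fit_def
    proof (intro conjI)
      show "u \<in> carrier_mat N N" using 1(1) by (simp only: R)
      show "\<exists>r. \<forall>s\<ge>r. A ^\<^sub>m s * u = A ^\<^sub>m s \<and> u * A ^\<^sub>m s = A ^\<^sub>m s \<and>
        (\<exists>v\<in>carrier_mat N N. u = A ^\<^sub>m s * v \<and> u = v * A ^\<^sub>m s)"
        by (intro exI[of _ r] allI impI) (rule 1(2)[unfolded pw R])
    qed
    then show ?case by (rule that)
  qed
qed

lemma fit_one_dim:
  assumes "fit 1 (a \<cdot>\<^sub>m 1\<^sub>m 1) u" shows "u = (if a = 0 then 0\<^sub>m 1 1 else 1\<^sub>m 1)"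
proof -
  let ?A = "a \<cdot>\<^sub>m 1\<^sub>m 1"
  have pow: "?A ^\<^sub>m s = a ^ s \<cdot>\<^sub>m 1\<^sub>m 1" for s
  proof (induction s)
    case 0 show ?case by (rule eq_matI) auto
  next
    case (Suc s)
    have "(a ^ s \<cdot>\<^sub>m 1\<^sub>m 1) * ?A = (a ^ Suc s \<cdot>\<^sub>m 1\<^sub>m 1)" by (rule eq_matI) (auto simp: scalar_prod_def)
    then show ?case using Suc by simp
  qed
  obtain r where u: "u \<in> carrier_mat 1 1" and r: "\<And>s. s \<ge> r \<Longrightarrow> ?A ^\<^sub>m s * u = ?A ^\<^sub>m s \<and> (\<exists>v\<in>carrier_mat 1 1. u = ?A ^\<^sub>m s * v)"
    using assms unfolding fit_def by blast
  obtain v where v: "v \<in> carrier_mat 1 1" "u = ?A ^\<^sub>m Suc r * v" and Au: "?A ^\<^sub>m Suc r * u = ?A ^\<^sub>m Suc r" using r[of "Suc r"] by auto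
  show ?thesis
  proof (cases "a = 0")
    case True
    have "u = 0\<^sub>m 1 1" unfolding v(2) pow True using v(1) by (intro eq_matI) (auto simp: scalar_prod_def)
    then show ?thesis using True by simp
  next
    case False
    have "u $$ (0, 0) = 1" using arg_cong[OF Au, of "\<lambda>X. X $$ (0, 0)"] False u unfolding pow by (simp add: scalar_prod_def)
    then have "u = 1\<^sub>m 1" using u by (intro eq_matI) auto
    then show ?thesis using False by simp
  qed
qed

lemma finite_eigenvalues: assumes "A \<in> carrier_mat n n" shows "finite {k::'k::field. eigenvalue A k}"
proof -
  have "char_poly A \<noteq> 0" using degree_monic_char_poly[OF assms] by (metis coeff_0 zero_neq_one)
  then show ?thesis unfolding eigenvalue_root_char_poly[OF assms] by (rule poly_roots_finite)
qed

lemma left_eigenvalue: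
  fixes f T :: "'k::field mat"
  assumes f: "f \<in> carrier_mat 1 N" and T: "T \<in> carrier_mat N N" and e: "f * T = k \<cdot>\<^sub>m f" and nz: "f \<noteq> 0\<^sub>m 1 N"
  shows "eigenvalue (transpose_mat T) k"
proof -
  let ?v = "row f 0"
  have "transpose_mat T *\<^sub>v ?v = k \<cdot>\<^sub>v ?v"
  proof (rule eq_vecI)
    fix i assume "i < dim_vec (k \<cdot>\<^sub>v ?v)"
    then have i: "i < N" using f by simp
    have "(transpose_mat T *\<^sub>v ?v) $ i = col T i \<bullet> ?v" using i T by simp
    also have "\<dots> = ?v \<bullet> col T i" by (rule comm_scalar_prod[of _ N]) (use i f T in \<open>auto intro!: carrier_vecI\<close>)
    also have "\<dots> = (f * T) $$ (0, i)" using i f T by simp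
    also have "\<dots> = (k \<cdot>\<^sub>v ?v) $ i" unfolding e using i f by simp
    finally show "(transpose_mat T *\<^sub>v ?v) $ i = (k \<cdot>\<^sub>v ?v) $ i" .
  qed (use f T in simp)
  moreover have "?v \<noteq> 0\<^sub>v N"
  proof
    assume z: "?v = 0\<^sub>v N"
    have "f = 0\<^sub>m 1 N"
    proof (rule eq_matI)
      fix i j assume "i < dim_row (0\<^sub>m 1 N :: 'k mat)" "j < dim_col (0\<^sub>m 1 N :: 'k mat)"
      then show "f $$ (i, j) = 0\<^sub>m 1 N $$ (i, j)" using arg_cong[OF z, of "\<lambda>v. v $ j"] f by simp
    qed (use f in auto)
    then show False using nz by simp
  qed
  ultimately show ?thesis unfolding eigenvalue_def eigenvector_def using f T by (intro exI[of _ ?v]) auto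
qed

section \<open>The category of formal direct sums\<close>

abbreviation obs :: "'k::field \<Rightarrow> 'k hpair list set" where "obs q \<equiv> lists (\<Union>e. hecke_pairs q e)"

lemma Gamma_sel:
  "Ob (Gamma q d) = obs q" "Cmp (Gamma q d) = block_comp d"
  "Idm (Gamma q d) = (\<lambda>X. mat (length X) (length X) (\<lambda>(j, i).
              if i = j then 1\<^sub>m (vdim (X ! i) ^ d) else 0\<^sub>m (vdim (X ! j) ^ d) (vdim (X ! i) ^ d)))"
  "Add (Gamma q d) = (\<lambda>f g. mat (dim_row f) (dim_col f) (\<lambda>p. f $$ p + g $$ p))"
  "Smul (Gamma q d) = (\<lambda>a f. map_mat ((\<cdot>\<^sub>m) a) f)"
  by (simp_all add: Gamma_def)

lemma Gmor_iff:
  "f \<in> Mor (Gamma q d) X Y \<longleftrightarrow> f \<in> carrier_mat (length Y) (length X) \<and>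
     (\<forall>j<length Y. \<forall>i<length X. f $$ (j, i) \<in> braid_hom q d (X ! i) (Y ! j))"
  by (simp add: Gamma_def)

lemma obs_hp: "X \<in> obs q \<Longrightarrow> i < length X \<Longrightarrow> hp q (X ! i)"
  using nth_mem[of i X] hecke_hp by fastforce

lemma braid_hom_sum:
  fixes q :: "'k::field" and N :: nat
  assumes q: "q \<noteq> 0" and hp: "hp q V" "hp q W" and h: "\<And>j. j < N \<Longrightarrow> h j \<in> braid_hom q d V W"
  shows "mat (vdim W ^ d) (vdim V ^ d) (\<lambda>ab. \<Sum>j<N. h j $$ ab) \<in> braid_hom q d V W"
  using h
proof (induction N)
  case 0
  have "mat (vdim W ^ d) (vdim V ^ d) (\<lambda>ab. \<Sum>j<0. h j $$ ab) = 0\<^sub>m (vdim W ^ d) (vdim V ^ d)"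
    by (rule eq_matI) auto
  then show ?case using braid_hom_zero[OF q hp] by simp
next
  case (Suc N)
  have "mat (vdim W ^ d) (vdim V ^ d) (\<lambda>ab. \<Sum>j<Suc N. h j $$ ab)
    = mat (vdim W ^ d) (vdim V ^ d) (\<lambda>ab. \<Sum>j<N. h j $$ ab) + h N"
    by (rule eq_matI) (use braid_hom_dims[OF Suc.prems[of N]] in auto)
  then show ?case using braid_hom_linear(1)[OF q hp Suc.IH Suc.prems[of N]] Suc.prems by simp
qed

lemma Gmor_id: "q \<noteq> 0 \<Longrightarrow> X \<in> obs q \<Longrightarrow> Idm (Gamma q d) X \<in> Mor (Gamma q d) X X"
  unfolding Gmor_iff Gamma_sel by (auto simp: obs_hp braid_hom_one braid_hom_zero)

lemma Gmor_comp:
  assumes q: "q \<noteq> 0" and ob: "X \<in> obs q" "Y \<in> obs q" "Z \<in> obs q"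
    and f: "f \<in> Mor (Gamma q d) X Y" and g: "g \<in> Mor (Gamma q d) Y Z"
  shows "block_comp d X Y Z g f \<in> Mor (Gamma q d) X Z"
proof -
  have "mat (vdim (Z ! k) ^ d) (vdim (X ! i) ^ d) (\<lambda>ab. \<Sum>j<length Y. (g $$ (k, j) * f $$ (j, i)) $$ ab)
      \<in> braid_hom q d (X ! i) (Z ! k)" if "k < length Z" "i < length X" for k i
    by (rule braid_hom_sum[OF q obs_hp[OF ob(1) that(2)] obs_hp[OF ob(3) that(1)]],
        rule braid_hom_comp[OF q obs_hp[OF ob(1) that(2)] obs_hp[OF ob(2)] obs_hp[OF ob(3) that(1)]])
      (use f g that in \<open>auto simp: Gmor_iff\<close>)
  then show ?thesis unfolding Gmor_iff block_comp_def by auto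
qed

lemma Gmor_add:
  assumes "q \<noteq> 0" "X \<in> obs q" "Y \<in> obs q" "f \<in> Mor (Gamma q d) X Y" "g \<in> Mor (Gamma q d) X Y"
  shows "Add (Gamma q d) f g \<in> Mor (Gamma q d) X Y"
  unfolding Gmor_iff Gamma_sel
proof (intro conjI allI impI)
  note fg = assms(4,5)[unfolded Gmor_iff]
  show "mat (dim_row f) (dim_col f) (\<lambda>p. f $$ p + g $$ p) \<in> carrier_mat (length Y) (length X)" using fg by auto
  fix j i assume ji: "j < length Y" "i < length X"
  have "f $$ (j, i) + g $$ (j, i) \<in> braid_hom q d (X ! i) (Y ! j)"
    by (rule braid_hom_linear(1)[OF assms(1) obs_hp[OF assms(2) ji(2)] obs_hp[OF assms(3) ji(1)]]) (use fg ji in auto)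
  then show "mat (dim_row f) (dim_col f) (\<lambda>p. f $$ p + g $$ p) $$ (j, i) \<in> braid_hom q d (X ! i) (Y ! j)"
    using fg ji by auto
qed

lemma Gmor_smul:
  assumes "q \<noteq> 0" "X \<in> obs q" "Y \<in> obs q" "f \<in> Mor (Gamma q d) X Y"
  shows "Smul (Gamma q d) a f \<in> Mor (Gamma q d) X Y"
  unfolding Gmor_iff Gamma_sel
proof (intro conjI allI impI)
  note f = assms(4)[unfolded Gmor_iff]
  show "map_mat ((\<cdot>\<^sub>m) a) f \<in> carrier_mat (length Y) (length X)" using f by auto
  fix j i assume ji: "j < length Y" "i < length X"
  have "a \<cdot>\<^sub>m (f $$ (j, i)) \<in> braid_hom q d (X ! i) (Y ! j)"
    by (rule braid_hom_linear(3)[OF assms(1) obs_hp[OF assms(2) ji(2)] obs_hp[OF assms(3) ji(1)]]) (use f ji in auto)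
  then show "map_mat ((\<cdot>\<^sub>m) a) f $$ (j, i) \<in> braid_hom q d (X ! i) (Y ! j)" using f ji by auto
qed

section \<open>The functor of tensor powers\<close>

definition triv :: "'k::field \<Rightarrow> nat \<Rightarrow> 'k hpair" where "triv q w = (1, MM 1 q 0 w)"

lemma vdim_triv [simp]: "vdim (triv q w) = w" by (simp add: triv_def vdim_def)
lemma triv_hecke: "triv q w \<in> hecke_pairs q 0" unfolding triv_def by (rule hecke_pair_MM) simp

text \<open>\<open>V\<^bsup>\<otimes>d\<^esup>\<close> as a vector space is an object of \<open>\<Gamma>\<^sup>1\<^sub>q\<V>\<close>, carried by the trivial coaction.\<close>
definition trivs :: "'k::field \<Rightarrow> nat \<Rightarrow> 'k hpair list \<Rightarrow> 'k hpair list" where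
  "trivs q d = map (\<lambda>V. triv q (vdim V ^ d))"

lemma trivs_obs: "trivs q d X \<in> obs q"
  unfolding trivs_def in_lists_conv_set set_map
  by (rule ballI, erule imageE, hypsubst, rule UN_I[OF UNIV_I], rule triv_hecke)

lemma length_trivs [simp]: "length (trivs q d X) = length X" by (simp add: trivs_def)
lemma vdim_trivs [simp]: "i < length X \<Longrightarrow> vdim (trivs q d X ! i) = vdim (X ! i) ^ d" by (simp add: trivs_def)

lemma braid_hom_1: "braid_hom q 1 V W = carrier_mat (vdim W) (vdim V)" by (auto simp: braid_hom_def)

lemma Gmor1_iff: "f \<in> Mor (Gamma q 1) X Y \<longleftrightarrow> f \<in> carrier_mat (length Y) (length X) \<and>
     (\<forall>j<length Y. \<forall>i<length X. f $$ (j, i) \<in> carrier_mat (vdim (Y ! j)) (vdim (X ! i)))"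
  unfolding Gmor_iff braid_hom_1 ..

lemma Gmor_trivs: "f \<in> Mor (Gamma q d) X Y \<Longrightarrow> f \<in> Mor (Gamma q 1) (trivs q d X) (trivs q d Y)"
  unfolding Gmor1_iff
proof (intro conjI allI impI)
  assume f: "f \<in> Mor (Gamma q d) X Y"
  then show "f \<in> carrier_mat (length (trivs q d Y)) (length (trivs q d X))" by (simp add: Gmor_iff)
  fix j i assume "j < length (trivs q d Y)" "i < length (trivs q d X)"
  then have ji: "j < length Y" "i < length X" by simp_all
  then have "f $$ (j, i) \<in> braid_hom q d (X ! i) (Y ! j)" using f by (simp add: Gmor_iff)
  from braid_hom_dims[OF this] show "f $$ (j, i) \<in> carrier_mat (vdim (trivs q d Y ! j)) (vdim (trivs q d X ! i))"
    using ji by simp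
qed

lemma block_comp_trivs: "block_comp 1 (trivs q d X) (trivs q d Y) (trivs q d Z) g f = block_comp d X Y Z g f"
  unfolding block_comp_def by (rule cong_mat) (auto simp del: One_nat_def)

definition tensor_power :: "'k::field \<Rightarrow> nat \<Rightarrow> ('k hpair list, 'k mat mat, 'k hpair list, 'k mat mat) fctr" where
  "tensor_power q d = \<lparr>FOb = (\<lambda>X\<in>obs q. trivs q d X),
     FMor = (\<lambda>X Y f. if X \<in> obs q \<and> Y \<in> obs q \<and> f \<in> Mor (Gamma q d) X Y then f else undefined)\<rparr>"

lemma tensor_power_sel:
  "X \<in> obs q \<Longrightarrow> FOb (tensor_power q d) X = trivs q d X"
  "X \<in> obs q \<Longrightarrow> Y \<in> obs q \<Longrightarrow> f \<in> Mor (Gamma q d) X Y \<Longrightarrow> FMor (tensor_power q d) X Y f = f"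
  by (simp_all add: tensor_power_def)

lemma tensor_power_ob: assumes q: "q \<noteq> 0" shows "tensor_power q d \<in> Ob (P_tilde q d)"
proof -
  note s = tensor_power_sel
  have id: "Idm (Gamma q d) X = Idm (Gamma q 1) (trivs q d X)" for X
    unfolding Gamma_sel by (rule cong_mat) (auto simp del: One_nat_def)
  have "is_functor (Gamma q d) (Gamma q 1) (tensor_power q d)"
    unfolding is_functor_def Gamma_sel(1,2)
  proof (intro conjI ballI)
    fix X assume X: "X \<in> obs q"
    show "FOb (tensor_power q d) X \<in> obs q" unfolding s(1)[OF X] by (rule trivs_obs)
    show "FMor (tensor_power q d) X X (Idm (Gamma q d) X) = Idm (Gamma q 1) (FOb (tensor_power q d) X)"
      unfolding s(2)[OF X X Gmor_id[OF q X]] s(1)[OF X] by (rule id)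
    fix Y f assume Y: "Y \<in> obs q" and f: "f \<in> Mor (Gamma q d) X Y"
    show "FMor (tensor_power q d) X Y f \<in> Mor (Gamma q 1) (FOb (tensor_power q d) X) (FOb (tensor_power q d) Y)"
      unfolding s(2)[OF X Y f] s(1)[OF X] s(1)[OF Y] by (rule Gmor_trivs[OF f])
    fix Z g assume Z: "Z \<in> obs q" and g: "g \<in> Mor (Gamma q d) Y Z"
    show "FMor (tensor_power q d) X Z (block_comp d X Y Z g f)
      = block_comp 1 (FOb (tensor_power q d) X) (FOb (tensor_power q d) Y) (FOb (tensor_power q d) Z)
          (FMor (tensor_power q d) Y Z g) (FMor (tensor_power q d) X Y f)"
      unfolding s(2)[OF X Y f] s(2)[OF Y Z g] s(2)[OF X Z Gmor_comp[OF q X Y Z f g]] s(1)[OF X] s(1)[OF Y] s(1)[OF Z]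
      by (rule block_comp_trivs[symmetric])
  qed
  moreover have "FMor (tensor_power q d) X Y (Add (Gamma q d) f g)
      = Add (Gamma q 1) (FMor (tensor_power q d) X Y f) (FMor (tensor_power q d) X Y g)"
    "FMor (tensor_power q d) X Y (Smul (Gamma q d) a f) = Smul (Gamma q 1) a (FMor (tensor_power q d) X Y f)"
    if XY: "X \<in> obs q" "Y \<in> obs q" and f: "f \<in> Mor (Gamma q d) X Y" and g: "g \<in> Mor (Gamma q d) X Y" for X Y f g a
    unfolding s(2)[OF XY f] s(2)[OF XY g] s(2)[OF XY Gmor_add[OF q XY f g]] s(2)[OF XY Gmor_smul[OF q XY f]]
    by (simp_all add: Gamma_sel)
  ultimately have "is_linear_functor (Gamma q d) (Gamma q 1) (tensor_power q d)"
    unfolding is_linear_functor_def Gamma_sel(1) by blast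
  moreover have "extensional_functor (Gamma q d) (tensor_power q d)"
    unfolding extensional_functor_def Gamma_sel(1) by (auto simp: tensor_power_def)
  ultimately show ?thesis by (simp add: P_tilde_def linear_functor_cat_def)
qed

section \<open>One-dimensional Hecke pairs\<close>

text \<open>The one-dimensional comodule over \<open>A\<^sub>q(1, 1)\<close> with coaction \<open>x\<^sub>1\<^sub>1\<^sup>j\<close>.\<close>
definition line :: "'k::field \<Rightarrow> nat \<Rightarrow> 'k hpair" where "line q j = (1, MM 1 q j 1)"

lemma vdim_line [simp]: "vdim (line q j) = 1" by (simp add: line_def vdim_def)
lemma line_hecke: "line q j \<in> hecke_pairs q j" unfolding line_def by (rule hecke_pair_MM) simp

text \<open>By the hexagon identities the braiding is multiplicative in both degrees, and \<open>R\<^sub>1 = q\<close>.\<close>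
lemma rbr_line:
  fixes q :: "'k::field" assumes q: "q \<noteq> 0" shows "rbr q 1 a b = q ^ (a * b) \<cdot>\<^sub>m 1\<^sub>m 1"
proof -
  have m: "(x \<cdot>\<^sub>m 1\<^sub>m 1) * (y \<cdot>\<^sub>m 1\<^sub>m 1) = ((x * y) \<cdot>\<^sub>m 1\<^sub>m 1 :: 'k mat)" for x y
    by (rule eq_matI) (auto simp: scalar_prod_def)
  have o: "(1 :: 'k) \<cdot>\<^sub>m 1\<^sub>m 1 = 1\<^sub>m 1" by (rule eq_matI) auto
  have a: "rbr q 1 (a + b) c = rbr q 1 a c * rbr q 1 b c" "rbr q 1 c (a + b) = rbr q 1 c b * rbr q 1 c a" for a b c
    using rbr_add(1)[OF q, where n = 1 and a = a and b = b and c = c] rbr_add(2)[OF q, where n = 1 and a = a and b = b and c = c]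
    by (simp_all only: power_one kron_unit)
  have 1: "rbr q 1 1 b = q ^ b \<cdot>\<^sub>m 1\<^sub>m 1" for b
  proof (induction b)
    case 0 show ?case unfolding rbr_zero[OF q] by (simp only: power_one power_0 o)
  next
    case (Suc b)
    have "rbr q 1 1 1 = q \<cdot>\<^sub>m 1\<^sub>m 1" unfolding rbr_one[OF q] by (rule eq_matI) (auto simp: Rmat_def Rcoef_def)
    then have "rbr q 1 1 (1 + b) = q ^ (1 + b) \<cdot>\<^sub>m 1\<^sub>m 1"
      unfolding a(2) Suc by (simp only: m power_add power_one_right mult.commute)
    then show ?case by simp
  qed
  show ?thesis
  proof (induction a)
    case 0 show ?case unfolding rbr_zero[OF q] mult_0 by (simp only: power_one power_0 o)
  next
    case (Suc a)
    have "rbr q 1 (1 + a) b = (q ^ b * q ^ (a * b)) \<cdot>\<^sub>m 1\<^sub>m 1" unfolding a(1) 1 Suc by (rule m)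
    then show ?case by (simp only: plus_1_eq_Suc mult_Suc power_add)
  qed
qed

lemma Tact_line: assumes "q \<noteq> 0" shows "Tact q d (line q j) i = q ^ (j * j) \<cdot>\<^sub>m 1\<^sub>m 1"
proof -
  have "RV q (line q j) = q ^ (j * j) \<cdot>\<^sub>m 1\<^sub>m 1" using rbr_line[OF assms, of j j] by (simp add: RV_def line_def rbr_def)
  then show ?thesis unfolding Tact_def vdim_line by (simp only: power_one kron_unit)
qed

lemma inj_square_power:
  assumes "q \<noteq> 0" "\<forall>m::nat. m > 0 \<longrightarrow> q ^ m \<noteq> 1" shows "inj (\<lambda>j::nat. (q::'k::field) ^ (j * j))"
proof (rule linorder_injI)
  fix i j :: nat assume ij: "i < j"
  then have l: "i * i < j * j" by (intro mult_strict_mono) auto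
  have "q ^ (j * j) = q ^ (i * i) * q ^ (j * j - i * i)" using l by (simp add: power_add[symmetric])
  moreover have "q ^ (j * j - i * i) \<noteq> 1" using assms(2) l by simp
  ultimately show "q ^ (i * i) \<noteq> q ^ (j * j)" using assms(1) by auto
qed

lemma hom_line_zero:
  assumes q: "q \<noteq> 0" and d: "d \<ge> 2" and V: "hp q V" and f: "f \<in> braid_hom q d V (line q j)"
    and ev: "\<not> eigenvalue (transpose_mat (Tact q d V 0)) (q ^ (j * j))"
  shows "f = 0\<^sub>m 1 (vdim V ^ d)"
proof (rule ccontr)
  assume nz: "f \<noteq> 0\<^sub>m 1 (vdim V ^ d)"
  have fc: "f \<in> carrier_mat 1 (vdim V ^ d)" using braid_hom_dims[OF f] by simp
  have "f * Tact q d V 0 = (q ^ (j * j) \<cdot>\<^sub>m 1\<^sub>m 1) * f" using braid_hom_comm[OF f, of 0] d Tact_line[OF q] by simp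
  also have "\<dots> = q ^ (j * j) \<cdot>\<^sub>m f" using mult_smult_assoc_mat[of "1\<^sub>m 1" 1 1 f "vdim V ^ d"] fc by simp
  finally show False using left_eigenvalue[OF fc Tact_carrier[OF q V] _ nz] d ev by simp
qed

text \<open>Choose \<open>j\<close> such that \<open>q\<^bsup>j\<^sup>2\<^esup>\<close> is not an eigenvalue of \<open>T\<^sub>1\<close> on any summand of the proposed generator: no map from
  it to the \<open>j\<close>-th line is nonzero, but the functor of tensor powers is nonzero on this line.\<close>
theorem not_finitely_generated:
  fixes q :: "'k::field"
  assumes q: "q \<noteq> 0" "\<forall>m::nat. m > 0 \<longrightarrow> q ^ m \<noteq> 1" and d: "d \<ge> 2"
  shows "\<not> finitely_generated_P_tilde q d"
proof
  assume fg: "finitely_generated_P_tilde q d"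
  from fg[unfolded finitely_generated_P_tilde_def Gamma_sel(1)] obtain W where W: "W \<in> obs q"
    and gen: "\<forall>F\<in>Ob (P_tilde q d). \<forall>U\<in>obs q. \<forall>u\<in>vectors (FOb F U).
      \<exists>N f v. (\<forall>r<N. f r \<in> Mor (Gamma q d) W U \<and> v r \<in> vectors (FOb F W)) \<and>
          u = sum_vectors (FOb F U) (\<lambda>r. apply_blocks (FOb F W) (FOb F U) (FMor F W U (f r)) (v r)) N"
    by (elim bexE)
  \<comment> \<open>The eigenvalues to be avoided.\<close>
  define B where "B = (\<Union>i<length W. {k. eigenvalue (transpose_mat (Tact q d (W ! i) 0)) k})"
  have "finite {k. eigenvalue (transpose_mat (Tact q d (W ! i) 0)) k}" if "i < length W" for i
    by (rule finite_eigenvalues[OF transpose_carrier_mat[THEN iffD2, OF Tact_carrier[OF q(1) obs_hp[OF W that]]]]) (use d in simp)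
  then have "finite B" unfolding B_def by auto
  moreover have "infinite (range (\<lambda>j::nat. q ^ (j * j)))" by (rule range_inj_infinite[OF inj_square_power[OF q]])
  ultimately obtain j where j: "q ^ (j * j) \<notin> B" by (meson finite_subset image_subsetI)
  define U where "U = [line q j]"
  have U: "U \<in> obs q" using line_hecke[of q j] by (auto simp: U_def)
  let ?F = "tensor_power q d"
  define u :: "'k vec vec" where "u = vec 1 (\<lambda>_. vec 1 (\<lambda>_. 1))"
  have FU: "FOb ?F U = [triv q 1]" unfolding tensor_power_sel(1)[OF U] by (simp add: U_def trivs_def)
  have "u \<in> vectors (FOb ?F U)" unfolding FU by (auto simp: u_def vectors_def)
  from gen[THEN bspec, OF tensor_power_ob[OF q(1)], THEN bspec, OF U, THEN bspec, OF this] obtain N f v where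
    f: "\<forall>r<N. f r \<in> Mor (Gamma q d) W U \<and> v r \<in> vectors (FOb ?F W)" and
    u: "u = sum_vectors (FOb ?F U) (\<lambda>r. apply_blocks (FOb ?F W) (FOb ?F U) (FMor ?F W U (f r)) (v r)) N"
    by (elim exE conjE)
  have z: "apply_blocks (FOb ?F W) (FOb ?F U) (FMor ?F W U (f r)) (v r) $ 0 $ 0 = 0" if r: "r < N" for r
  proof -
    have fr: "f r \<in> Mor (Gamma q d) W U" and vr: "v r \<in> vectors (trivs q d W)"
      using f[rule_format, OF r] tensor_power_sel(1)[OF W, of d] by auto
    have "(f r $$ (0, i) *\<^sub>v v r $ i) $ 0 = 0" if i: "i < length W" for i
    proof -
      have "f r $$ (0, i) \<in> braid_hom q d (W ! i) (line q j)" using fr i by (auto simp: Gmor_iff U_def)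
      then have "f r $$ (0, i) = 0\<^sub>m 1 (vdim (W ! i) ^ d)"
        by (rule hom_line_zero[OF q(1) d obs_hp[OF W i]]) (use j i in \<open>auto simp: B_def\<close>)
      moreover have "v r $ i \<in> carrier_vec (vdim (W ! i) ^ d)" using vr i by (auto simp: vectors_def)
      ultimately show ?thesis by (simp add: scalar_prod_def)
    qed
    then show ?thesis unfolding tensor_power_sel(2)[OF W U fr] FU tensor_power_sel(1)[OF W] by (simp add: apply_blocks_def)
  qed
  have "u $ 0 $ 0 = (\<Sum>r<N. apply_blocks (FOb ?F W) (FOb ?F U) (FMor ?F W U (f r)) (v r) $ 0 $ 0)"
    unfolding u unfolding FU by (simp add: sum_vectors_def)
  then show False using z by (simp add: u_def)
qed

section \<open>A chain of idempotent endomorphisms of the functor of tensor powers\<close>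

lemma commutes_shift:
  fixes f T T' :: "'k::field mat"
  assumes f: "f \<in> carrier_mat M N" and T: "T \<in> carrier_mat N N" "T' \<in> carrier_mat M M" and e: "f * T = T' * f"
  shows "f * (T - a \<cdot>\<^sub>m 1\<^sub>m N) = (T' - a \<cdot>\<^sub>m 1\<^sub>m M) * f"
proof -
  have o: "a \<cdot>\<^sub>m 1\<^sub>m N \<in> carrier_mat N N" "a \<cdot>\<^sub>m 1\<^sub>m M \<in> carrier_mat M M" by auto
  have "f * (a \<cdot>\<^sub>m 1\<^sub>m N) = a \<cdot>\<^sub>m f" using mult_smult_distrib[OF f one_carrier_mat, of a] f by simp
  moreover have "(a \<cdot>\<^sub>m 1\<^sub>m M) * f = a \<cdot>\<^sub>m f" using mult_smult_assoc_mat[OF one_carrier_mat f, of a] f by simp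
  ultimately show ?thesis unfolding mult_minus_distrib_mat[OF f T(1) o(1)] minus_mult_distrib_mat[OF T(2) o(2) f] e by simp
qed

definition shift :: "'k::field \<Rightarrow> nat \<Rightarrow> 'k hpair \<Rightarrow> nat \<Rightarrow> 'k mat" where
  "shift q d V j = Tact q d V 0 - q ^ (j * j) \<cdot>\<^sub>m 1\<^sub>m (vdim V ^ d)"

text \<open>Any two choices agree, by naturality for the identity.\<close>
definition uproj :: "'k::field \<Rightarrow> nat \<Rightarrow> 'k hpair \<Rightarrow> nat \<Rightarrow> 'k mat" where
  "uproj q d V j = (SOME u. fit (vdim V ^ d) (shift q d V j) u)"

primrec chain :: "'k::field \<Rightarrow> nat \<Rightarrow> 'k hpair \<Rightarrow> nat \<Rightarrow> 'k mat" where
  "chain q d V 0 = 1\<^sub>m (vdim V ^ d)"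
| "chain q d V (Suc k) = chain q d V k * uproj q d V k"

context
  fixes q :: "'k::field" and d :: nat
  assumes q: "q \<noteq> 0" and d: "d \<ge> 2"
begin

lemma T0_carrier: "hp q V \<Longrightarrow> Tact q d V 0 \<in> carrier_mat (vdim V ^ d) (vdim V ^ d)"
  by (rule Tact_carrier[OF q]) (use d in auto)

lemma shift_carrier: "hp q V \<Longrightarrow> shift q d V j \<in> carrier_mat (vdim V ^ d) (vdim V ^ d)"
  unfolding shift_def by (rule minus_carrier_mat) simp

lemma uproj_fit: assumes "hp q V" shows "fit (vdim V ^ d) (shift q d V j) (uproj q d V j)"
proof -
  obtain u where "fit (vdim V ^ d) (shift q d V j) u" by (rule fit_exists[OF shift_carrier[OF assms]])
  then show ?thesis unfolding uproj_def by (rule someI)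
qed

lemma uproj_carrier: "hp q V \<Longrightarrow> uproj q d V j \<in> carrier_mat (vdim V ^ d) (vdim V ^ d)"
  using uproj_fit by (simp add: fit_def)

lemma uproj_natural:
  assumes hp: "hp q V" "hp q W" and f: "f \<in> carrier_mat (vdim W ^ d) (vdim V ^ d)" "f * Tact q d V 0 = Tact q d W 0 * f"
  shows "f * uproj q d V j = uproj q d W j * f"
proof -
  have "f * shift q d V j = shift q d W j * f" unfolding shift_def
    by (rule commutes_shift[OF f(1) T0_carrier[OF hp(1)] T0_carrier[OF hp(2)] f(2)])
  then show ?thesis
    by (rule fit_natural[OF shift_carrier[OF hp(1)] uproj_fit[OF hp(1)] shift_carrier[OF hp(2)] uproj_fit[OF hp(2)] f(1)])
qed

text \<open>Naturality for \<open>T\<^sub>1\<close> itself gives that projections commute with \<open>T\<^sub>1\<close>, hence with each other.\<close>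
lemma uproj_commute: assumes "hp q V" shows "uproj q d V i * uproj q d V j = uproj q d V j * uproj q d V i"
  by (rule uproj_natural[OF assms assms uproj_carrier[OF assms]])
    (rule uproj_natural[OF assms assms T0_carrier[OF assms] refl, symmetric])

lemma chain_facts:
  assumes V: "hp q V"
  shows "chain q d V k \<in> carrier_mat (vdim V ^ d) (vdim V ^ d)"
    "i \<le> j \<Longrightarrow> chain q d V i * chain q d V j = chain q d V j \<and> chain q d V j * chain q d V i = chain q d V j"
proof -
  interpret R: ring "ring_mat TYPE('k) (vdim V ^ d) ()" by (rule ring_mat)
  note c = R.commuting_idempotents[of "uproj q d V" "chain q d V", unfolded ring_mat_simps,
    OF uproj_carrier[OF V] fit_idem[OF shift_carrier[OF V] uproj_fit[OF V]] uproj_commute[OF V] chain.simps]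
  show "chain q d V k \<in> carrier_mat (vdim V ^ d) (vdim V ^ d)" by (rule c(1))
  show "chain q d V i * chain q d V j = chain q d V j \<and> chain q d V j * chain q d V i = chain q d V j" if "i \<le> j"
    by (rule c(2)[OF that])
qed

lemma chain_natural:
  assumes hp: "hp q V" "hp q W" and f: "f \<in> braid_hom q d V W"
  shows "f * chain q d V k = chain q d W k * f"
proof (induction k)
  case 0 show ?case using braid_hom_dims[OF f] by simp
next
  case (Suc k)
  note c = braid_hom_dims[OF f] chain_facts(1)[OF hp(1), of k] chain_facts(1)[OF hp(2), of k]
    uproj_carrier[OF hp(1), of k] uproj_carrier[OF hp(2), of k]
  have u: "f * uproj q d V k = uproj q d W k * f"
    by (rule uproj_natural[OF hp c(1) braid_hom_comm[OF f]]) (use d in simp)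
  have "f * (chain q d V k * uproj q d V k) = (f * chain q d V k) * uproj q d V k"
    by (rule assoc_mult_mat[symmetric, OF c(1,2,4)])
  also have "\<dots> = chain q d W k * (f * uproj q d V k)" unfolding Suc by (rule assoc_mult_mat[OF c(3,1,4)])
  also have "\<dots> = chain q d W k * uproj q d W k * f" unfolding u by (rule assoc_mult_mat[symmetric, OF c(3,5,1)])
  finally show ?case by simp
qed

text \<open>On the \<open>j\<close>-th line \<open>T\<^sub>1 - q\<^bsup>i\<^sup>2\<^esup>\<close> is zero for \<open>i = j\<close> and invertible otherwise.\<close>
lemma chain_line:
  assumes g: "\<forall>m::nat. m > 0 \<longrightarrow> q ^ m \<noteq> 1"
  shows "chain q d (line q j) j = 1\<^sub>m 1" "chain q d (line q j) (Suc j) = 0\<^sub>m 1 1"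
proof -
  have hp: "hp q (line q j)" by (rule hecke_hp[OF line_hecke])
  have "shift q d (line q j) i = (q ^ (j * j) - q ^ (i * i)) \<cdot>\<^sub>m 1\<^sub>m 1" for i
    unfolding shift_def Tact_line[OF q] vdim_line power_one by (rule eq_matI) (auto simp: algebra_simps)
  then have "fit 1 ((q ^ (j * j) - q ^ (i * i)) \<cdot>\<^sub>m 1\<^sub>m 1) (uproj q d (line q j) i)" for i
    using uproj_fit[OF hp, of i] by simp
  from fit_one_dim[OF this] have u: "uproj q d (line q j) i = (if i = j then 0\<^sub>m 1 1 else 1\<^sub>m 1)" for i
    using injD[OF inj_square_power[OF q g], of i j] by auto
  have "k \<le> j \<Longrightarrow> chain q d (line q j) k = 1\<^sub>m 1" for k
    by (induction k) (simp_all add: u)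
  then show "chain q d (line q j) j = 1\<^sub>m 1" by simp
  then show "chain q d (line q j) (Suc j) = 0\<^sub>m 1 1" by (simp add: u)
qed

end

text \<open>The endomorphism of a formal direct sum that acts by \<open>D\<close> on each summand.\<close>
definition diag :: "nat \<Rightarrow> ('k::field hpair \<Rightarrow> 'k mat) \<Rightarrow> 'k hpair list \<Rightarrow> 'k mat mat" where
  "diag d D X = mat (length X) (length X) (\<lambda>(j, i). if i = j then D (X ! i) else 0\<^sub>m (vdim (X ! j) ^ d) (vdim (X ! i) ^ d))"

lemma block_comp_diag_left:
  fixes f :: "'k::field mat mat"
  assumes D: "\<And>k. k < length Y \<Longrightarrow> D (Y ! k) \<in> carrier_mat (vdim (Y ! k) ^ d) (vdim (Y ! k) ^ d)"
    and f: "\<And>k i. k < length Y \<Longrightarrow> i < length X \<Longrightarrow> f $$ (k, i) \<in> carrier_mat (vdim (Y ! k) ^ d) (vdim (X ! i) ^ d)"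
  shows "block_comp d X Y Y (diag d D Y) f = mat (length Y) (length X) (\<lambda>(k, i). D (Y ! k) * f $$ (k, i))"
  unfolding block_comp_def
proof (rule cong_mat[OF refl refl], unfold prod.case)
  fix k i assume k: "k < length Y" and i: "i < length X"
  show "mat (vdim (Y ! k) ^ d) (vdim (X ! i) ^ d) (\<lambda>ab. \<Sum>j<length Y. (diag d D Y $$ (k, j) * f $$ (j, i)) $$ ab)
    = D (Y ! k) * f $$ (k, i)"
  proof (rule eq_matI)
    fix a b assume "a < dim_row (D (Y ! k) * f $$ (k, i))" "b < dim_col (D (Y ! k) * f $$ (k, i))"
    then have ab: "a < vdim (Y ! k) ^ d" "b < vdim (X ! i) ^ d" using D[OF k] f[OF k i] by auto
    have "(diag d D Y $$ (k, j) * f $$ (j, i)) $$ (a, b) = (if j = k then (D (Y ! k) * f $$ (k, i)) $$ (a, b) else 0)"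
      if j: "j < length Y" for j
    proof (cases "j = k")
      case True then show ?thesis using k by (simp add: diag_def)
    next
      case False
      then have "diag d D Y $$ (k, j) = 0\<^sub>m (vdim (Y ! k) ^ d) (vdim (Y ! j) ^ d)" using k j by (simp add: diag_def)
      then show ?thesis using False left_mult_zero_mat[OF f[OF j i]] ab by simp
    qed
    then have "(\<Sum>j<length Y. (diag d D Y $$ (k, j) * f $$ (j, i)) $$ (a, b))
      = (\<Sum>j<length Y. if j = k then (D (Y ! k) * f $$ (k, i)) $$ (a, b) else 0)" by (intro sum.cong) auto
    then show "mat (vdim (Y ! k) ^ d) (vdim (X ! i) ^ d) (\<lambda>ab. \<Sum>j<length Y. (diag d D Y $$ (k, j) * f $$ (j, i)) $$ ab) $$ (a, b)
      = (D (Y ! k) * f $$ (k, i)) $$ (a, b)" using ab k by simp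
  qed (use D[OF k] f[OF k i] in auto)
qed

lemma block_comp_diag_right:
  fixes f :: "'k::field mat mat"
  assumes D: "\<And>k. k < length X \<Longrightarrow> D (X ! k) \<in> carrier_mat (vdim (X ! k) ^ d) (vdim (X ! k) ^ d)"
    and f: "\<And>k i. k < length Y \<Longrightarrow> i < length X \<Longrightarrow> f $$ (k, i) \<in> carrier_mat (vdim (Y ! k) ^ d) (vdim (X ! i) ^ d)"
  shows "block_comp d X X Y f (diag d D X) = mat (length Y) (length X) (\<lambda>(k, i). f $$ (k, i) * D (X ! i))"
  unfolding block_comp_def
proof (rule cong_mat[OF refl refl], unfold prod.case)
  fix k i assume k: "k < length Y" and i: "i < length X"
  show "mat (vdim (Y ! k) ^ d) (vdim (X ! i) ^ d) (\<lambda>ab. \<Sum>j<length X. (f $$ (k, j) * diag d D X $$ (j, i)) $$ ab)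
    = f $$ (k, i) * D (X ! i)"
  proof (rule eq_matI)
    fix a b assume "a < dim_row (f $$ (k, i) * D (X ! i))" "b < dim_col (f $$ (k, i) * D (X ! i))"
    then have ab: "a < vdim (Y ! k) ^ d" "b < vdim (X ! i) ^ d" using D[OF i] f[OF k i] by auto
    have "(f $$ (k, j) * diag d D X $$ (j, i)) $$ (a, b) = (if j = i then (f $$ (k, i) * D (X ! i)) $$ (a, b) else 0)"
      if j: "j < length X" for j
    proof (cases "j = i")
      case True then show ?thesis using i by (simp add: diag_def)
    next
      case False
      then have "diag d D X $$ (j, i) = 0\<^sub>m (vdim (X ! j) ^ d) (vdim (X ! i) ^ d)" using i j by (simp add: diag_def)
      then show ?thesis using False right_mult_zero_mat[OF f[OF k j]] ab by simp
    qed
    then have "(\<Sum>j<length X. (f $$ (k, j) * diag d D X $$ (j, i)) $$ (a, b))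
      = (\<Sum>j<length X. if j = i then (f $$ (k, i) * D (X ! i)) $$ (a, b) else 0)" by (intro sum.cong) auto
    then show "mat (vdim (Y ! k) ^ d) (vdim (X ! i) ^ d) (\<lambda>ab. \<Sum>j<length X. (f $$ (k, j) * diag d D X $$ (j, i)) $$ ab) $$ (a, b)
      = (f $$ (k, i) * D (X ! i)) $$ (a, b)" using ab i by simp
  qed (use D[OF i] f[OF k i] in auto)
qed

definition chain_trans :: "'k::field \<Rightarrow> nat \<Rightarrow> nat \<Rightarrow> 'k hpair list \<Rightarrow> 'k mat mat" where
  "chain_trans q d k = (\<lambda>X\<in>obs q. diag d (\<lambda>V. chain q d V k) X)"

lemma functor_cat_sel:
  "Mor (linear_functor_cat C D) F G = {\<eta> \<in> extensional (Ob C). nat_trans C D F G \<eta>}"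
  "Idm (linear_functor_cat C D) F = (\<lambda>X\<in>Ob C. Idm D (FOb F X))"
  "Cmp (linear_functor_cat C D) F G H \<theta> \<eta> = (\<lambda>X\<in>Ob C. Cmp D (FOb F X) (FOb G X) (FOb H X) (\<theta> X) (\<eta> X))"
  by (simp_all add: linear_functor_cat_def)

lemma Gmor_entry_dims:
  "f \<in> Mor (Gamma q d) X Y \<Longrightarrow> k < length Y \<Longrightarrow> i < length X \<Longrightarrow> f $$ (k, i) \<in> carrier_mat (vdim (Y ! k) ^ d) (vdim (X ! i) ^ d)"
  unfolding Gmor_iff by (rule braid_hom_dims) blast

lemma chain_trans_mor:
  fixes q :: "'k::field"
  assumes q: "q \<noteq> 0" and d: "d \<ge> 2"
  shows "chain_trans q d k \<in> Mor (P_tilde q d) (tensor_power q d) (tensor_power q d)"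
  unfolding P_tilde_def functor_cat_sel nat_trans_def Gamma_sel(1,2)
proof (intro CollectI conjI ballI)
  show "chain_trans q d k \<in> extensional (obs q)" by (simp add: chain_trans_def)
  fix X assume X: "X \<in> obs q"
  have cX: "chain_trans q d k X = diag d (\<lambda>V. chain q d V k) X" if "X \<in> obs q" for X using that by (simp add: chain_trans_def)
  have D: "chain q d (X ! i) k \<in> carrier_mat (vdim (X ! i) ^ d) (vdim (X ! i) ^ d)" if "X \<in> obs q" "i < length X" for X i
    by (rule chain_facts(1)[OF q d obs_hp[OF that]])
  show "chain_trans q d k X \<in> Mor (Gamma q 1) (FOb (tensor_power q d) X) (FOb (tensor_power q d) X)"
    unfolding tensor_power_sel(1)[OF X] cX[OF X] Gmor1_iff by (auto simp: diag_def D[OF X])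
  fix Y f assume Y: "Y \<in> obs q" and f: "f \<in> Mor (Gamma q d) X Y"
  have "chain q d (Y ! j) k * f $$ (j, i) = f $$ (j, i) * chain q d (X ! i) k" if "j < length Y" "i < length X" for j i
    by (rule chain_natural[OF q d obs_hp[OF X that(2)] obs_hp[OF Y that(1)], symmetric]) (use f that in \<open>simp add: Gmor_iff\<close>)
  then have "mat (length Y) (length X) (\<lambda>(j, i). chain q d (Y ! j) k * f $$ (j, i))
    = mat (length Y) (length X) (\<lambda>(j, i). f $$ (j, i) * chain q d (X ! i) k)" by (intro cong_mat) auto
  moreover have "block_comp d X Y Y (diag d (\<lambda>V. chain q d V k) Y) f
      = mat (length Y) (length X) (\<lambda>(j, i). chain q d (Y ! j) k * f $$ (j, i))"
    by (rule block_comp_diag_left[where D = "\<lambda>V. chain q d V k"], erule D[OF Y], erule (1) Gmor_entry_dims[OF f])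
  moreover have "block_comp d X X Y f (diag d (\<lambda>V. chain q d V k) X)
      = mat (length Y) (length X) (\<lambda>(j, i). f $$ (j, i) * chain q d (X ! i) k)"
    by (rule block_comp_diag_right[where D = "\<lambda>V. chain q d V k"], erule D[OF X], erule (1) Gmor_entry_dims[OF f])
  ultimately show "block_comp 1 (FOb (tensor_power q d) X) (FOb (tensor_power q d) Y) (FOb (tensor_power q d) Y)
      (chain_trans q d k Y) (FMor (tensor_power q d) X Y f)
    = block_comp 1 (FOb (tensor_power q d) X) (FOb (tensor_power q d) X) (FOb (tensor_power q d) Y)
      (FMor (tensor_power q d) X Y f) (chain_trans q d k X)"
    unfolding tensor_power_sel(1)[OF X] tensor_power_sel(1)[OF Y] tensor_power_sel(2)[OF X Y f] block_comp_trivs cX[OF X] cX[OF Y]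
    by (simp only:)
qed

lemma chain_trans_comp:
  fixes q :: "'k::field"
  assumes q: "q \<noteq> 0" and d: "d \<ge> 2" and m: "\<And>V. hp q V \<Longrightarrow> chain q d V i * chain q d V j = chain q d V k"
  shows "Cmp (P_tilde q d) (tensor_power q d) (tensor_power q d) (tensor_power q d) (chain_trans q d i) (chain_trans q d j)
    = chain_trans q d k"
  unfolding P_tilde_def functor_cat_sel Gamma_sel(1,2)
proof (rule ext)
  fix X
  show "(\<lambda>X\<in>obs q. block_comp 1 (FOb (tensor_power q d) X) (FOb (tensor_power q d) X) (FOb (tensor_power q d) X)
      (chain_trans q d i X) (chain_trans q d j X)) X = chain_trans q d k X"
  proof (cases "X \<in> obs q")
    case X: True
    have D: "chain q d (X ! l) k \<in> carrier_mat (vdim (X ! l) ^ d) (vdim (X ! l) ^ d)" if "l < length X" for l k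
      by (rule chain_facts(1)[OF q d obs_hp[OF X that]])
    have "block_comp d X X X (diag d (\<lambda>V. chain q d V i) X) (diag d (\<lambda>V. chain q d V j) X)
      = mat (length X) (length X) (\<lambda>(a, b). chain q d (X ! a) i * diag d (\<lambda>V. chain q d V j) X $$ (a, b))"
      by (rule block_comp_diag_left[where D = "\<lambda>V. chain q d V i", OF D]) (auto simp: diag_def D)
    also have "\<dots> = diag d (\<lambda>V. chain q d V k) X" unfolding diag_def[of d "\<lambda>V. chain q d V k"]
    proof (rule cong_mat[OF refl refl], unfold prod.case)
      fix a b assume ab: "a < length X" "b < length X"
      show "chain q d (X ! a) i * diag d (\<lambda>V. chain q d V j) X $$ (a, b)
        = (if b = a then chain q d (X ! b) k else 0\<^sub>m (vdim (X ! a) ^ d) (vdim (X ! b) ^ d))"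
        using ab m[OF obs_hp[OF X ab(1)]] right_mult_zero_mat[OF D[OF ab(1), of i], of "vdim (X ! b) ^ d"]
        by (simp add: diag_def)
    qed
    finally show ?thesis using X by (simp only: restrict_apply' tensor_power_sel(1) block_comp_trivs chain_trans_def)
  qed (simp add: chain_trans_def)
qed

section \<open>Endomorphisms of homogeneous polynomial functors\<close>

text \<open>As \<open>1\<^sub>V\<close> is a sum of maps through the generator, naturality expresses \<open>y\<^sub>V = y\<^sub>V H(1\<^sub>V)\<close> through the value
  of \<open>y\<close> at the generator.\<close>
lemma endomorphism_determined:
  fixes q :: "'k::field"
  assumes q: "q \<noteq> 0" "\<forall>m::nat. m > 0 \<longrightarrow> q ^ m \<noteq> 1"
    and H: "H \<in> Ob (P_hom q d e)" and y: "y \<in> Mor (P_hom q d e) H H" "y' \<in> Mor (P_hom q d e) H H"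
    and eq: "y (gen_obj q d e) = y' (gen_obj q d e)"
  shows "y = y'"
proof -
  let ?W = "gen_obj q d e" and ?O = "hecke_pairs q e"
  have lin: "is_linear_functor (Gamma_hom q d e) Vect H" using H by (simp add: P_hom_def linear_functor_cat_def)
  note L = lin[unfolded is_linear_functor_def is_functor_def Gamma_hom_def Vect_def, simplified]
  have mor: "FMor H X Y f \<in> carrier_mat (FOb H Y) (FOb H X)" if "X \<in> ?O" "Y \<in> ?O" "f \<in> braid_hom q d X Y" for X Y f
    using L that by simp
  have one: "FMor H X X (1\<^sub>m (vdim X ^ d)) = 1\<^sub>m (FOb H X)" if "X \<in> ?O" for X using L that by simp
  have comp: "FMor H X Z (g * f) = FMor H Y Z g * FMor H X Y f"
    if "X \<in> ?O" "Y \<in> ?O" "Z \<in> ?O" "f \<in> braid_hom q d X Y" "g \<in> braid_hom q d Y Z" for X Y Z f g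
    using L that by simp
  have hadd: "FMor H X Y (f + g) = FMor H X Y f + FMor H X Y g"
    if "X \<in> ?O" "Y \<in> ?O" "f \<in> braid_hom q d X Y" "g \<in> braid_hom q d X Y" for X Y f g using L that by simp
  have smul: "FMor H X Y (a \<cdot>\<^sub>m f) = a \<cdot>\<^sub>m FMor H X Y f"
    if "X \<in> ?O" "Y \<in> ?O" "f \<in> braid_hom q d X Y" for X Y f a using L that by simp
  have nat: "\<eta> X \<in> carrier_mat (FOb H X) (FOb H X)" "\<eta> Y * FMor H X Y f = FMor H X Y f * \<eta> X"
    if "\<eta> \<in> Mor (P_hom q d e) H H" "X \<in> ?O" "Y \<in> ?O" "f \<in> braid_hom q d X Y" for \<eta> X Y f
    using that by (simp_all add: P_hom_def functor_cat_sel nat_trans_def Gamma_hom_def Vect_def)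
  have W: "?W \<in> ?O" by (rule gen_obj_hecke)
  have V: "y V = y' V" if V: "V \<in> ?O" for V
  proof -
    note hV = hecke_hp[OF V]
    note o = braid_hom_one[OF q(1) hV, of d]
    have c: "y V \<in> carrier_mat (FOb H V) (FOb H V)" "y' V \<in> carrier_mat (FOb H V) (FOb H V)"
      using nat(1)[OF y(1) V V o] nat(1)[OF y(2) V V o] .
    have "y V * FMor H V V x = y' V * FMor H V V x" if "x \<in> thru q d ?W V V" for x
      using that
    proof induction
      case zero
      let ?z = "0\<^sub>m (vdim V ^ d) (vdim V ^ d) :: 'k mat"
      have z: "?z \<in> braid_hom q d V V" by (rule braid_hom_zero[OF q(1) hV hV])
      have "FMor H V V ?z = 0 \<cdot>\<^sub>m FMor H V V ?z" using smul[OF V V z, of 0] by simp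
      also have "\<dots> = 0\<^sub>m (FOb H V) (FOb H V)" using mor[OF V V z] by (intro eq_matI) auto
      finally have "FMor H V V ?z = 0\<^sub>m (FOb H V) (FOb H V)" .
      then show ?case using c by simp
    next
      case (add x \<phi> \<psi>)
      have hW: "hp q ?W" by (rule hp_gen_obj)
      have xh: "x \<in> braid_hom q d V V" by (rule thru_hom[OF q(1) hW hV hV add.hyps(1)])
      have e: "FMor H V V (x + \<psi> * \<phi>) = FMor H V V x + FMor H ?W V \<psi> * FMor H V ?W \<phi>"
        using hadd[OF V V xh
            braid_hom_comp[OF q(1) hV hW hV add.hyps(2,3)]]
          comp[OF V W V add.hyps(2,3)] by simp
      note C = mor[OF V V xh] mor[OF W V add.hyps(3)] mor[OF V W add.hyps(2)]
      have s: "\<eta> V * FMor H V V (x + \<psi> * \<phi>) = \<eta> V * FMor H V V x + FMor H ?W V \<psi> * \<eta> ?W * FMor H V ?W \<phi>"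
        if \<eta>: "\<eta> \<in> Mor (P_hom q d e) H H" for \<eta>
      proof -
        have \<eta>c: "\<eta> V \<in> carrier_mat (FOb H V) (FOb H V)" by (rule nat(1)[OF \<eta> V V o])
        have "\<eta> V * FMor H V V (x + \<psi> * \<phi>) = \<eta> V * FMor H V V x + \<eta> V * (FMor H ?W V \<psi> * FMor H V ?W \<phi>)"
          unfolding e by (rule mult_add_distrib_mat[OF \<eta>c C(1) mult_carrier_mat[OF C(2,3)]])
        also have "\<eta> V * (FMor H ?W V \<psi> * FMor H V ?W \<phi>) = \<eta> V * FMor H ?W V \<psi> * FMor H V ?W \<phi>"
          by (rule assoc_mult_mat[symmetric, OF \<eta>c C(2,3)])
        finally show ?thesis unfolding nat(2)[OF \<eta> W V add.hyps(3)] .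
      qed
      show ?case unfolding s[OF y(1)] s[OF y(2)] add.IH eq ..
    qed
    from this[OF generated_hecke[OF q V]] show ?thesis unfolding one[OF V] using c by simp
  qed
  show ?thesis
  proof (rule extensionalityI)
    show "y \<in> extensional ?O" "y' \<in> extensional ?O" using y by (simp_all add: P_hom_def functor_cat_sel Gamma_hom_def)
  qed (rule V)
qed

section \<open>No equivalence\<close>

text \<open>Functors preserve products of endomorphisms, and an equivalence is faithful on the chain: if two successive members had the same image then, after composition with the
  isomorphism \<open>h\<close> between the functor and its image under both functors, they would agree on a line, where one is \<open>1\<close> and
  the other is \<open>0\<close>. Then \<open>h\<close> would vanish there.\<close>
theorem not_equivalent:
  fixes q :: "'k::field"
  assumes q: "q \<noteq> 0" "\<forall>m::nat. m > 0 \<longrightarrow> q ^ m \<noteq> 1" and d: "d \<ge> 2"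
  shows "\<not> equivalent_cats (P_tilde q d) (P_hom q d e)"
proof
  let ?C = "P_tilde q d" and ?D = "P_hom q d e" and ?F = "tensor_power q d" and ?x = "chain_trans q d"
  assume "equivalent_cats ?C ?D"
  then obtain \<Phi> \<Psi> \<eta> where \<Phi>: "is_functor ?C ?D \<Phi>" and \<eta>: "nat_iso ?C ?C (comp_functor \<Psi> \<Phi>) id_functor \<eta>"
    unfolding equivalent_cats_def by (elim exE conjE)
  note F = tensor_power_ob[OF q(1), of d] and x = chain_trans_mor[OF q(1) d]
  define H where "H = FOb \<Phi> ?F"
  define F' where "F' = FOb \<Psi> H"
  define y where "y k = FMor \<Phi> ?F ?F (?x k)" for k
  have H: "H \<in> Ob ?D" using \<Phi>[unfolded is_functor_def, THEN conjunct1] F by (simp add: H_def)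
  have y: "y k \<in> Mor ?D H H" for k
    using \<Phi>[unfolded is_functor_def, THEN conjunct2, THEN conjunct1, rule_format, OF F F x] by (simp add: H_def y_def)
  have yc: "Cmp ?D H H H (y i) (y j) = FMor \<Phi> ?F ?F (Cmp ?C ?F ?F ?F (?x i) (?x j))" for i j
    using \<Phi>[unfolded is_functor_def, THEN conjunct2, THEN conjunct2, THEN conjunct2, rule_format, OF F F F x x]
    by (simp add: H_def y_def)
  let ?W = "gen_obj q d e"
  have W: "?W \<in> Ob (Gamma_hom q d e)" using gen_obj_hecke[of q d e] by (simp add: Gamma_hom_def)
  have cW: "Cmp ?D H H H (y i) (y j) ?W = y i ?W * y j ?W" for i j
    using W by (simp add: P_hom_def functor_cat_sel Vect_def)
  have yW: "y k ?W \<in> carrier_mat (FOb H ?W) (FOb H ?W)" for k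
    using y[of k] W by (simp add: P_hom_def functor_cat_sel nat_trans_def Vect_def)
  have yi: "y i ?W * y j ?W = y j ?W \<and> y j ?W * y i ?W = y j ?W" if "i \<le> j" for i j
  proof
    have "Cmp ?C ?F ?F ?F (?x i) (?x j) = ?x j" "Cmp ?C ?F ?F ?F (?x j) (?x i) = ?x j"
      by (rule chain_trans_comp[OF q(1) d]; use chain_facts(2)[OF q(1) d _ that] in blast)+
    then show "y i ?W * y j ?W = y j ?W" "y j ?W * y i ?W = y j ?W"
      unfolding cW[symmetric] yc by (simp_all add: y_def)
  qed
  have "\<exists>k. y k ?W = y (Suc k) ?W"
    by (rule no_idempotent_chain[of "\<lambda>k. y k ?W" "FOb H ?W"], rule yW, erule yi, rule exI, assumption)
  then obtain k where k: "y k ?W = y (Suc k) ?W" by (rule exE)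
  have yk: "y k = y (Suc k)" by (rule endomorphism_determined[OF q H y y k])
  define U where "U = [line q k]"
  have U: "U \<in> obs q" using line_hecke[of q k] by (auto simp: U_def)
  define h where "h = \<eta> ?F"
  have iso: "iso_in ?C F' ?F h" and nat: "Cmp ?C F' ?F ?F (?x j) h = Cmp ?C F' F' ?F h (FMor \<Psi> H H (y j))" for j
    using \<eta> F x[of j] unfolding nat_iso_def nat_trans_def
    by (simp_all add: comp_functor_def id_functor_def H_def F'_def h_def y_def)
  have e: "Cmp ?C F' ?F ?F (?x k) h = Cmp ?C F' ?F ?F (?x (Suc k)) h" unfolding nat yk ..
  obtain g where h: "h \<in> Mor ?C F' ?F" and g: "g \<in> Mor ?C ?F F'" and hg: "Cmp ?C ?F F' ?F h g = Idm ?C ?F"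
    using iso[unfolded iso_in_def] by (elim conjE bexE)
  let ?X = "FOb F' U" and ?Y = "trivs q d U"
  have Y: "length ?Y = 1" "vdim (?Y ! 0) = 1" by (simp_all add: U_def)
  have FU: "FOb ?F U = ?Y" by (rule tensor_power_sel(1)[OF U])
  have hU: "h U \<in> Mor (Gamma q 1) ?X ?Y"
    using h U unfolding P_tilde_def functor_cat_sel nat_trans_def Gamma_sel(1) FU[symmetric] by blast
  have gU: "g U \<in> Mor (Gamma q 1) ?Y ?X"
    using g U unfolding P_tilde_def functor_cat_sel nat_trans_def Gamma_sel(1) FU[symmetric] by blast
  have hY: "\<forall>j<length ?Y. \<forall>i<length ?X. h U $$ (j, i) \<in> carrier_mat (vdim (?Y ! j)) (vdim (?X ! i))"
    using hU unfolding Gmor1_iff by (rule conjunct2)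
  have gY: "\<forall>j<length ?X. \<forall>i<length ?Y. g U $$ (j, i) \<in> carrier_mat (vdim (?X ! j)) (vdim (?Y ! i))"
    using gU unfolding Gmor1_iff by (rule conjunct2)
  have x0: "?x k U = mat 1 1 (\<lambda>_. 1\<^sub>m 1)" "?x (Suc k) U = mat 1 1 (\<lambda>_. 0\<^sub>m 1 1)"
    using U chain_line[OF q(1) d q(2), of k]
    by (auto simp: chain_trans_def diag_def U_def intro!: cong_mat simp del: chain.simps)
  have eU: "block_comp 1 ?X ?Y ?Y (?x k U) (h U) = block_comp 1 ?X ?Y ?Y (?x (Suc k) U) (h U)"
    using fun_cong[OF e, of U] U unfolding P_tilde_def functor_cat_sel Gamma_sel(1,2) by (simp add: FU)
  have h0: "h U $$ (0, l) = 0\<^sub>m 1 (vdim (?X ! l))" if l: "l < length ?X" for l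
  proof -
    have hc: "h U $$ (0, l) \<in> carrier_mat 1 (vdim (?X ! l))" using hY[rule_format, of 0 l] l unfolding Y by simp
    have b: "block_comp 1 ?X ?Y ?Y (mat 1 1 (\<lambda>_. E)) (h U) $$ (0, l) $$ (0, b) = (E * h U $$ (0, l)) $$ (0, b)"
      if "b < vdim (?X ! l)" for E b
      using that l by (simp add: block_comp_def Y del: length_trivs vdim_trivs)
    have "h U $$ (0, l) $$ (0, b) = 0" if b': "b < vdim (?X ! l)" for b
      using arg_cong[OF eU, of "\<lambda>M. M $$ (0, l) $$ (0, b)"] hc b' unfolding x0 b[OF b']
        left_mult_one_mat[OF hc] left_mult_zero_mat[OF hc] by simp
    then show ?thesis using hc by (intro eq_matI) auto
  qed
  have "block_comp 1 ?Y ?X ?Y (h U) (g U) = Idm (Gamma q 1) ?Y"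
    using fun_cong[OF hg, of U] U unfolding P_tilde_def functor_cat_sel Gamma_sel(1,2) by (simp add: FU)
  moreover have "block_comp 1 ?Y ?X ?Y (h U) (g U) $$ (0, 0) $$ (0, 0) = 0"
  proof -
    have "(h U $$ (0, l) * g U $$ (l, 0)) $$ (0, 0) = 0" if l: "l < length ?X" for l
    proof -
      have "g U $$ (l, 0) \<in> carrier_mat (vdim (?X ! l)) 1" using gY[rule_format, of l 0] l unfolding Y by simp
      then show ?thesis unfolding h0[OF l] using left_mult_zero_mat by fastforce
    qed
    then show ?thesis by (simp add: block_comp_def Y del: length_trivs vdim_trivs)
  qed
  moreover have "Idm (Gamma q 1) ?Y $$ (0, 0) $$ (0, 0) = 1" by (simp add: Gamma_sel Y del: length_trivs vdim_trivs)
  ultimately show False by simp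
qed

theorem proposition7p3:
  fixes q :: "'k::field" and d :: nat
  assumes "q \<noteq> 0"
    and "\<forall>m::nat. m > 0 \<longrightarrow> q ^ m \<noteq> 1"
    and "d \<ge> 2"
  shows "\<not> finitely_generated_P_tilde q d \<and>
         (\<forall>e. \<not> equivalent_cats (P_tilde q d) (P_hom q d e))"
  using not_finitely_generated[OF assms] not_equivalent[OF assms] by blast

end
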